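(* There is an $O(n^5)$ time algorithm which, given a trigraph $T\in\mathcal F$ on $n$ vertices with no balanced skew-partition, outputs an end $X$ of $T$ together with the block of decomposition $T_X$, if $T$ has an end.
   Context: Trigraphs: finite $V(T)$ with $\theta:\binom{V(T)}{2}\to\{-1,0,1\}$; $u,v$ strongly adjacent if $\theta(uv)=1$, strongly antiadjacent if $-1$, a switchable pair if $0$; adjacent (neighbours) if $\theta\in\{0,1\}$, antiadjacent (antineighbours) if $\theta\in\{-1,0\}$. Complement $\overline T$: $-\theta$; $T|X$: induced trigraph. Strongly complete/anticomplete: strongly adjacent/antiadjacent to every vertex of a set. Full realization: graph on $V(T)$ of adjacent pairs. $X$ connected: full realization of $T|X$ connected; anticonnected: complement of graph on $X$ of strongly adjacent pairs connected; components = maximal connected subsets. Path: distinct $p_1,\dots,p_k$, consecutive adjacent, non-consecutive antiadjacent (length $k-1$, interior = inner vertices). Hole: $h_1,\dots,h_k$, $k\ge4$, $h_i,h_j$ adjacent iff $|i-j|\in\{1,k-1\}$, else antiadjacent. Antipath/antihole: complement is a path/hole in $\overline T$. Berge: no odd hole, no odd antihole. Skew-partition: partition $(A,B)$ of $V(T)$, $A$ not connected, $B$ not anticonnected; balanced if no path of odd length $>1$ with ends in $B$ and interior in $A$ and no antipath of odd length $>1$ with ends in $A$ and interior in $B$. $\mathcal F$: Berge trigraphs such that each component of the graph $\Sigma(T)$ of switchable pairs has at most two edges and each vertex $v$ of $\Sigma(T)$-degree two with $\Sigma(T)$-neighbours $x,y$ is either strongly complete to $V(T)\setminus\{v,x,y\}$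 with $x,y$ strongly adjacent, or strongly anticomplete to $V(T)\setminus\{v,x,y\}$ with $x,y$ strongly antiadjacent. $2$-join: partition $(X_1,X_2)$ with disjoint $A_1,B_1,C_1,A_2,B_2,C_2$ (split), $X_i=A_i\cup B_i\cup C_i$, $A_i,B_i\neq\emptyset$, no switchable pair between $X_1,X_2$, $A_1$ strongly complete to $A_2$, $B_1$ strongly complete to $B_2$, all other pairs between $X_1,X_2$ strongly antiadjacent, $|X_i|\ge3$, and if $|A_i|=|B_i|=1$ the full realization of $T|X_i$ is not a path of length two between the vertices of $A_i$ and $B_i$; proper if each component of $T|X_i$ meets $A_i$ and $B_i$. (Proper) complement $2$-join: (proper) $2$-join of $\overline T$, same split. In a Berge trigraph, for a proper $2$-join all paths from $A_i$ to $B_i$ with interior in $C_i$ ($i=1,2$) have the same length parity, called odd/even accordingly; complement $2$-joins have the parity of the $2$-join of $\overline T$. Proper homogeneous pair: disjoint nonempty $A,B\subseteq V(T)$ such that, letting $A_1$ ($A_2$) be the set of vertices of $V(T)\setminus(A\cup B)$ strongly complete (strongly anticomplete) to $A$ and $B_1,B_2$ likewise for $B$: $|A|>1$, $|B|>1$; $A_1\cup A_2=B_1\cup B_2=V(T)\setminus(A\cup B)$; every vertex of $A$ has a neighbour and an antineighbour in $B$ and vice versa; and $A_1\cap B_1,A_1\cap B_2,A_2\cap B_1,A_2\cap B_2$ are nonempty. Proper fragment: $X\subseteq V(T)$ such that $(X,V(T)\setminus X)$ is a proper $2$-join or proper complement $2$-join of $T$, or $X=A\cup B$ for a proper homogeneous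 pair $(A,B)$. An end of $T$ is a proper fragment $X$ such that no proper subset of $X$ is a proper fragment of $T$. Blocks $T_X$, adding new marker vertices with all unspecified new pairs strongly antiadjacent. For $X=X_1$ of a $2$-join with split $(A_1,B_1,C_1,A_2,B_2,C_2)$, start from $T|X_1$: odd $2$-join: add $a,b$, $a$ strongly complete to $A_1$, $b$ strongly complete to $B_1$, $ab$ switchable; even $2$-join: add $a,b,c$, $a$ strongly complete to $A_1$, $b$ strongly complete to $B_1$, $ac,cb$ switchable; odd complement $2$-join: add $a,b$, $a$ strongly complete to $B_1\cup C_1$, $b$ strongly complete to $A_1\cup C_1$, $ab$ switchable; even complement $2$-join: add $a,b,c$, $a$ strongly complete to $B_1\cup C_1$, $b$ strongly complete to $A_1\cup C_1$, $c$ strongly complete to $X_1$, $ac,cb$ switchable, $ab$ strongly adjacent. For $X=A\cup B$ of a proper homogeneous pair: start from $T|(A\cup B)$, add $c$ strongly complete to $A$ and $d$ strongly complete to $B$ with $cd$ switchable. *)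

theory Defs
  imports Complex_Main "HOL-Library.Landau_Symbols"
begin

section \<open>Trigraphs\<close>

text \<open>Only the values of \<open>theta\<close> on two-element subsets of \<open>verts\<close> are meaningful.\<close>

record 'a trigraph =
  verts :: "'a set"
  theta :: "'a set \<Rightarrow> int"

definition trigraph :: "'a trigraph \<Rightarrow> bool" where
  "trigraph T \<longleftrightarrow> finite (verts T) \<and>
     (\<forall>e. e \<subseteq> verts T \<and> card e = 2 \<longrightarrow> theta T e \<in> {-1, 0, 1})"

definition same_trigraph :: "'a trigraph \<Rightarrow> 'a trigraph \<Rightarrow> bool" where
  "same_trigraph T T' \<longleftrightarrow> verts T = verts T' \<and>
     (\<forall>e. e \<subseteq> verts T \<and> card e = 2 \<longrightarrow> theta T e = theta T' e)"

definition strongly_adj :: "'a trigraph \<Rightarrow> 'a \<Rightarrow> 'a \<Rightarrow> bool" where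
  "strongly_adj T u v \<longleftrightarrow> u \<in> verts T \<and> v \<in> verts T \<and> u \<noteq> v \<and> theta T {u, v} = 1"

definition strongly_antiadj :: "'a trigraph \<Rightarrow> 'a \<Rightarrow> 'a \<Rightarrow> bool" where
  "strongly_antiadj T u v \<longleftrightarrow> u \<in> verts T \<and> v \<in> verts T \<and> u \<noteq> v \<and> theta T {u, v} = -1"

definition switchable :: "'a trigraph \<Rightarrow> 'a \<Rightarrow> 'a \<Rightarrow> bool" where
  "switchable T u v \<longleftrightarrow> u \<in> verts T \<and> v \<in> verts T \<and> u \<noteq> v \<and> theta T {u, v} = 0"

definition adj :: "'a trigraph \<Rightarrow> 'a \<Rightarrow> 'a \<Rightarrow> bool" where
  "adj T u v \<longleftrightarrow> u \<in> verts T \<and> v \<in> verts T \<and> u \<noteq> v \<and> theta T {u, v} \<in> {0, 1}"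

definition antiadj :: "'a trigraph \<Rightarrow> 'a \<Rightarrow> 'a \<Rightarrow> bool" where
  "antiadj T u v \<longleftrightarrow> u \<in> verts T \<and> v \<in> verts T \<and> u \<noteq> v \<and> theta T {u, v} \<in> {-1, 0}"

definition strongly_complete :: "'a trigraph \<Rightarrow> 'a \<Rightarrow> 'a set \<Rightarrow> bool" where
  "strongly_complete T v S \<longleftrightarrow> (\<forall>u\<in>S. strongly_adj T v u)"

definition strongly_anticomplete :: "'a trigraph \<Rightarrow> 'a \<Rightarrow> 'a set \<Rightarrow> bool" where
  "strongly_anticomplete T v S \<longleftrightarrow> (\<forall>u\<in>S. strongly_antiadj T v u)"

definition co :: "'a trigraph \<Rightarrow> 'a trigraph" where
  "co T = \<lparr> verts = verts T, theta = (\<lambda>e. - theta T e) \<rparr>"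

definition induced :: "'a trigraph \<Rightarrow> 'a set \<Rightarrow> 'a trigraph" where
  "induced T X = \<lparr> verts = X, theta = theta T \<rparr>"

text \<open>Graphs are given by a vertex set and a symmetric edge relation. The empty graph counts
  as connected, so both sides of a skew-partition are nonempty; components are nonempty.\<close>

definition graph_connected :: "'a set \<Rightarrow> ('a \<Rightarrow> 'a \<Rightarrow> bool) \<Rightarrow> bool" where
  "graph_connected X E \<longleftrightarrow>
     (\<forall>u\<in>X. \<forall>v\<in>X. (u, v) \<in> {(x, y). x \<in> X \<and> y \<in> X \<and> E x y}\<^sup>*)"

definition graph_component :: "'a set \<Rightarrow> ('a \<Rightarrow> 'a \<Rightarrow> bool) \<Rightarrow> 'a set \<Rightarrow> bool" where
  "graph_component X E C \<longleftrightarrow> C \<noteq> {} \<and> C \<subseteq> X \<and> graph_connected C E \<and>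
     (\<forall>D. C \<subset> D \<and> D \<subseteq> X \<longrightarrow> \<not> graph_connected D E)"

definition connected_in :: "'a trigraph \<Rightarrow> 'a set \<Rightarrow> bool" where
  "connected_in T X \<longleftrightarrow> graph_connected X (adj (induced T X))"

definition anticonnected_in :: "'a trigraph \<Rightarrow> 'a set \<Rightarrow> bool" where
  "anticonnected_in T X \<longleftrightarrow> graph_connected X (\<lambda>u v. u \<noteq> v \<and> \<not> strongly_adj T u v)"

definition component :: "'a trigraph \<Rightarrow> 'a set \<Rightarrow> bool" where
  "component T C \<longleftrightarrow> C \<noteq> {} \<and> C \<subseteq> verts T \<and> connected_in T C \<and>
     (\<forall>D. C \<subset> D \<and> D \<subseteq> verts T \<longrightarrow> \<not> connected_in T D)"

section \<open>Paths, holes, Berge trigraphs\<close>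

definition path :: "'a trigraph \<Rightarrow> 'a list \<Rightarrow> bool" where
  "path T p \<longleftrightarrow> p \<noteq> [] \<and> distinct p \<and> set p \<subseteq> verts T \<and>
     (\<forall>i j. i < j \<and> j < length p \<longrightarrow>
        (if j = Suc i then adj T (p ! i) (p ! j) else antiadj T (p ! i) (p ! j)))"

definition path_length :: "'a list \<Rightarrow> nat" where
  "path_length p = length p - 1"

definition path_interior :: "'a list \<Rightarrow> 'a set" where
  "path_interior p = set (butlast (tl p))"

definition antipath :: "'a trigraph \<Rightarrow> 'a list \<Rightarrow> bool" where
  "antipath T p \<longleftrightarrow> path (co T) p"

text \<open>A switchable pair is both adjacent and antiadjacent, so it may occur between consecutive
  as well as between non-consecutive vertices of a path or hole.\<close>

definition hole :: "'a trigraph \<Rightarrow> 'a list \<Rightarrow> bool" where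
  "hole T h \<longleftrightarrow> length h \<ge> 4 \<and> distinct h \<and> set h \<subseteq> verts T \<and>
     (\<forall>i j. i < j \<and> j < length h \<longrightarrow>
        (if j - i = 1 \<or> j - i = length h - 1
         then adj T (h ! i) (h ! j) else antiadj T (h ! i) (h ! j)))"

definition antihole :: "'a trigraph \<Rightarrow> 'a list \<Rightarrow> bool" where
  "antihole T h \<longleftrightarrow> hole (co T) h"

definition Berge :: "'a trigraph \<Rightarrow> bool" where
  "Berge T \<longleftrightarrow> \<not> (\<exists>h. hole T h \<and> odd (length h)) \<and> \<not> (\<exists>h. antihole T h \<and> odd (length h))"

definition class_F :: "'a trigraph set" where
  "class_F = {T. trigraph T \<and> Berge T \<and>
     (\<forall>C. graph_component (verts T) (switchable T) C \<longrightarrow>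
        card {{u, v} | u v. u \<in> C \<and> v \<in> C \<and> switchable T u v} \<le> 2) \<and>
     (\<forall>v\<in>verts T. \<forall>x y. x \<noteq> y \<and> {u. switchable T v u} = {x, y} \<longrightarrow>
        (strongly_complete T v (verts T - {v, x, y}) \<and> strongly_adj T x y) \<or>
        (strongly_anticomplete T v (verts T - {v, x, y}) \<and> strongly_antiadj T x y))}"

section \<open>Skew-partitions\<close>

definition skew_partition :: "'a trigraph \<Rightarrow> 'a set \<Rightarrow> 'a set \<Rightarrow> bool" where
  "skew_partition T A B \<longleftrightarrow> A \<union> B = verts T \<and> A \<inter> B = {} \<and>
     \<not> connected_in T A \<and> \<not> anticonnected_in T B"

definition balanced_skew_partition :: "'a trigraph \<Rightarrow> 'a set \<Rightarrow> 'a set \<Rightarrow> bool" where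
  "balanced_skew_partition T A B \<longleftrightarrow> skew_partition T A B \<and>
     \<not> (\<exists>p. path T p \<and> odd (path_length p) \<and> path_length p > 1 \<and>
          hd p \<in> B \<and> last p \<in> B \<and> path_interior p \<subseteq> A) \<and>
     \<not> (\<exists>p. antipath T p \<and> odd (path_length p) \<and> path_length p > 1 \<and>
          hd p \<in> A \<and> last p \<in> A \<and> path_interior p \<subseteq> B)"

section \<open>2-joins and homogeneous pairs\<close>

definition realization_is_path2 :: "'a trigraph \<Rightarrow> 'a \<Rightarrow> 'a \<Rightarrow> bool" where
  "realization_is_path2 T a b \<longleftrightarrow> a \<noteq> b \<and>
     (\<exists>c. c \<noteq> a \<and> c \<noteq> b \<and> verts T = {a, c, b} \<and> adj T a c \<and> adj T c b \<and> \<not> adj T a b)"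

definition two_join_side :: "'a trigraph \<Rightarrow> 'a set \<Rightarrow> 'a set \<Rightarrow> 'a set \<Rightarrow> bool" where
  "two_join_side T A B C \<longleftrightarrow> A \<noteq> {} \<and> B \<noteq> {} \<and>
     A \<inter> B = {} \<and> A \<inter> C = {} \<and> B \<inter> C = {} \<and> card (A \<union> B \<union> C) \<ge> 3 \<and>
     (\<forall>a b. A = {a} \<and> B = {b} \<longrightarrow> \<not> realization_is_path2 (induced T (A \<union> B \<union> C)) a b)"

definition two_join ::
  "'a trigraph \<Rightarrow> 'a set \<Rightarrow> 'a set \<Rightarrow> 'a set \<Rightarrow> 'a set \<Rightarrow> 'a set \<Rightarrow> 'a set \<Rightarrow> bool" where
  "two_join T A1 B1 C1 A2 B2 C2 \<longleftrightarrow>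
     (let X1 = A1 \<union> B1 \<union> C1; X2 = A2 \<union> B2 \<union> C2 in
       X1 \<union> X2 = verts T \<and> X1 \<inter> X2 = {} \<and>
       two_join_side T A1 B1 C1 \<and> two_join_side T A2 B2 C2 \<and>
       (\<forall>u\<in>X1. \<forall>v\<in>X2.
          if (u \<in> A1 \<and> v \<in> A2) \<or> (u \<in> B1 \<and> v \<in> B2)
          then strongly_adj T u v else strongly_antiadj T u v))"

definition proper_two_join ::
  "'a trigraph \<Rightarrow> 'a set \<Rightarrow> 'a set \<Rightarrow> 'a set \<Rightarrow> 'a set \<Rightarrow> 'a set \<Rightarrow> 'a set \<Rightarrow> bool" where
  "proper_two_join T A1 B1 C1 A2 B2 C2 \<longleftrightarrow> two_join T A1 B1 C1 A2 B2 C2 \<and>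
     (\<forall>K. component (induced T (A1 \<union> B1 \<union> C1)) K \<longrightarrow> K \<inter> A1 \<noteq> {} \<and> K \<inter> B1 \<noteq> {}) \<and>
     (\<forall>K. component (induced T (A2 \<union> B2 \<union> C2)) K \<longrightarrow> K \<inter> A2 \<noteq> {} \<and> K \<inter> B2 \<noteq> {})"

definition join_path :: "'a trigraph \<Rightarrow> 'a set \<Rightarrow> 'a set \<Rightarrow> 'a set \<Rightarrow> 'a list \<Rightarrow> bool" where
  "join_path T A B C p \<longleftrightarrow> path T p \<and> hd p \<in> A \<and> last p \<in> B \<and> path_interior p \<subseteq> C"

definition odd_two_join ::
  "'a trigraph \<Rightarrow> 'a set \<Rightarrow> 'a set \<Rightarrow> 'a set \<Rightarrow> 'a set \<Rightarrow> 'a set \<Rightarrow> 'a set \<Rightarrow> bool" where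
  "odd_two_join T A1 B1 C1 A2 B2 C2 \<longleftrightarrow> proper_two_join T A1 B1 C1 A2 B2 C2 \<and>
     (\<forall>p. join_path T A1 B1 C1 p \<or> join_path T A2 B2 C2 p \<longrightarrow> odd (path_length p))"

definition even_two_join ::
  "'a trigraph \<Rightarrow> 'a set \<Rightarrow> 'a set \<Rightarrow> 'a set \<Rightarrow> 'a set \<Rightarrow> 'a set \<Rightarrow> 'a set \<Rightarrow> bool" where
  "even_two_join T A1 B1 C1 A2 B2 C2 \<longleftrightarrow> proper_two_join T A1 B1 C1 A2 B2 C2 \<and>
     (\<forall>p. join_path T A1 B1 C1 p \<or> join_path T A2 B2 C2 p \<longrightarrow> even (path_length p))"

definition proper_homogeneous_pair :: "'a trigraph \<Rightarrow> 'a set \<Rightarrow> 'a set \<Rightarrow> bool" where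
  "proper_homogeneous_pair T A B \<longleftrightarrow>
     (let R = verts T - (A \<union> B);
          A1 = {v\<in>R. strongly_complete T v A}; A2 = {v\<in>R. strongly_anticomplete T v A};
          B1 = {v\<in>R. strongly_complete T v B}; B2 = {v\<in>R. strongly_anticomplete T v B}
      in A \<subseteq> verts T \<and> B \<subseteq> verts T \<and> A \<inter> B = {} \<and> A \<noteq> {} \<and> B \<noteq> {} \<and>
         card A > 1 \<and> card B > 1 \<and>
         A1 \<union> A2 = R \<and> B1 \<union> B2 = R \<and>
         (\<forall>a\<in>A. (\<exists>b\<in>B. adj T a b) \<and> (\<exists>b\<in>B. antiadj T a b)) \<and>
         (\<forall>b\<in>B. (\<exists>a\<in>A. adj T b a) \<and> (\<exists>a\<in>A. antiadj T b a)) \<and>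
         A1 \<inter> B1 \<noteq> {} \<and> A1 \<inter> B2 \<noteq> {} \<and> A2 \<inter> B1 \<noteq> {} \<and> A2 \<inter> B2 \<noteq> {})"

section \<open>Ends and blocks of decomposition\<close>

definition proper_fragment :: "'a trigraph \<Rightarrow> 'a set \<Rightarrow> bool" where
  "proper_fragment T X \<longleftrightarrow> X \<subseteq> verts T \<and>
     ((\<exists>A1 B1 C1 A2 B2 C2. X = A1 \<union> B1 \<union> C1 \<and>
         (proper_two_join T A1 B1 C1 A2 B2 C2 \<or> proper_two_join (co T) A1 B1 C1 A2 B2 C2)) \<or>
      (\<exists>A B. X = A \<union> B \<and> proper_homogeneous_pair T A B))"

definition is_end :: "'a trigraph \<Rightarrow> 'a set \<Rightarrow> bool" where
  "is_end T X \<longleftrightarrow> proper_fragment T X \<and> (\<forall>Y. Y \<subset> X \<longrightarrow> \<not> proper_fragment T Y)"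

text \<open>\<open>add_markers T X M S W\<close> is \<open>T|X\<close> with the new vertices \<open>M\<close> added; among the pairs
  containing a new vertex, those in \<open>S\<close> are strongly adjacent, those in \<open>W\<close> are switchable, and
  all others are strongly antiadjacent.\<close>

definition add_markers ::
  "'a trigraph \<Rightarrow> 'a set \<Rightarrow> 'a set \<Rightarrow> 'a set set \<Rightarrow> 'a set set \<Rightarrow> 'a trigraph" where
  "add_markers T X M S W = \<lparr> verts = X \<union> M,
     theta = (\<lambda>e. if e \<subseteq> X then theta T e else if e \<in> S then 1 else if e \<in> W then 0 else -1) \<rparr>"

definition star :: "'a \<Rightarrow> 'a set \<Rightarrow> 'a set set" where
  "star v S = (\<lambda>u. {v, u}) ` S"

text \<open>The block depends on the choice of the new vertices and on the decomposition exhibiting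
  \<open>X\<close> as a proper fragment, hence a relation rather than a function of \<open>X\<close>.\<close>

inductive block :: "'a trigraph \<Rightarrow> 'a set \<Rightarrow> 'a trigraph \<Rightarrow> bool" for T where
  odd_join:
    "\<lbrakk>odd_two_join T A1 B1 C1 A2 B2 C2; X = A1 \<union> B1 \<union> C1;
      distinct [a, b]; {a, b} \<inter> verts T = {};
      same_trigraph T' (add_markers T X {a, b} (star a A1 \<union> star b B1) {{a, b}})\<rbrakk>
     \<Longrightarrow> block T X T'"
| even_join:
    "\<lbrakk>even_two_join T A1 B1 C1 A2 B2 C2; X = A1 \<union> B1 \<union> C1;
      distinct [a, b, c]; {a, b, c} \<inter> verts T = {};
      same_trigraph T'
        (add_markers T X {a, b, c} (star a A1 \<union> star b B1) {{a, c}, {c, b}})\<rbrakk>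
     \<Longrightarrow> block T X T'"
| odd_co_join:
    "\<lbrakk>odd_two_join (co T) A1 B1 C1 A2 B2 C2; X = A1 \<union> B1 \<union> C1;
      distinct [a, b]; {a, b} \<inter> verts T = {};
      same_trigraph T'
        (add_markers T X {a, b} (star a (B1 \<union> C1) \<union> star b (A1 \<union> C1)) {{a, b}})\<rbrakk>
     \<Longrightarrow> block T X T'"
| even_co_join:
    "\<lbrakk>even_two_join (co T) A1 B1 C1 A2 B2 C2; X = A1 \<union> B1 \<union> C1;
      distinct [a, b, c]; {a, b, c} \<inter> verts T = {};
      same_trigraph T'
        (add_markers T X {a, b, c}
           (star a (B1 \<union> C1) \<union> star b (A1 \<union> C1) \<union> star c X \<union> {{a, b}}) {{a, c}, {c, b}})\<rbrakk>
     \<Longrightarrow> block T X T'"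
| homogeneous_pair:
    "\<lbrakk>proper_homogeneous_pair T A B; X = A \<union> B;
      distinct [c, d]; {c, d} \<inter> verts T = {};
      same_trigraph T' (add_markers T X {c, d} (star c A \<union> star d B) {{c, d}})\<rbrakk>
     \<Longrightarrow> block T X T'"

section \<open>Model of computation\<close>

text \<open>A word RAM, programmed by while-programs over finitely many named arrays of words. Words
  are the numbers below \<open>W\<close>, and arithmetic is modulo \<open>W\<close>, except that subtraction truncates at
  zero. Every node of an evaluated expression and every executed command costs one time unit.\<close>

datatype exp =
    Const nat
  | Cell string exp
  | Plus exp exp
  | Minus exp exp
  | Times exp exp
  | Div exp exp

datatype com =
    Skip
  | Assign string exp exp
  | Seq com com
  | If exp com com
  | While exp com

type_synonym state = "string \<Rightarrow> nat \<Rightarrow> nat"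

fun val :: "nat \<Rightarrow> exp \<Rightarrow> state \<Rightarrow> nat" where
  "val W (Const c) s = c mod W"
| "val W (Cell x i) s = s x (val W i s)"
| "val W (Plus e f) s = (val W e s + val W f s) mod W"
| "val W (Minus e f) s = val W e s - val W f s"
| "val W (Times e f) s = (val W e s * val W f s) mod W"
| "val W (Div e f) s = val W e s div val W f s"

fun cost :: "exp \<Rightarrow> nat" where
  "cost (Const c) = 1"
| "cost (Cell x i) = cost i + 1"
| "cost (Plus e f) = cost e + cost f + 1"
| "cost (Minus e f) = cost e + cost f + 1"
| "cost (Times e f) = cost e + cost f + 1"
| "cost (Div e f) = cost e + cost f + 1"

text \<open>\<open>exec W c s t s'\<close>: started in \<open>s\<close>, the program \<open>c\<close> halts in \<open>s'\<close> after \<open>t\<close> time units.\<close>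

inductive exec :: "nat \<Rightarrow> com \<Rightarrow> state \<Rightarrow> nat \<Rightarrow> state \<Rightarrow> bool" for W where
  Skip: "exec W Skip s 1 s"
| Assign: "exec W (Assign x i e) s (cost i + cost e + 1)
             (s(x := (s x)(val W i s := val W e s)))"
| Seq: "\<lbrakk>exec W c s t s'; exec W d s' t' s''\<rbrakk> \<Longrightarrow> exec W (Seq c d) s (t + t' + 1) s''"
| IfTrue: "\<lbrakk>val W b s \<noteq> 0; exec W c s t s'\<rbrakk> \<Longrightarrow> exec W (If b c d) s (cost b + t + 1) s'"
| IfFalse: "\<lbrakk>val W b s = 0; exec W d s t s'\<rbrakk> \<Longrightarrow> exec W (If b c d) s (cost b + t + 1) s'"
| WhileFalse: "val W b s = 0 \<Longrightarrow> exec W (While b c) s (cost b + 1) s"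
| WhileTrue: "\<lbrakk>val W b s \<noteq> 0; exec W c s t s'; exec W (While b c) s' t' s''\<rbrakk>
    \<Longrightarrow> exec W (While b c) s (cost b + t + t' + 1) s''"

inductive_cases exec_SkipE: "exec W Skip s t s'"
inductive_cases exec_AssignE: "exec W (Assign x i e) s t s'"
inductive_cases exec_SeqE: "exec W (Seq c d) s t s'"
inductive_cases exec_IfE: "exec W (If b c d) s t s'"
inductive_cases exec_WhileE: "exec W (While b c) s t s'"

lemma exec_deterministic:
  "exec W c s t s' \<Longrightarrow> exec W c s u s'' \<Longrightarrow> t = u \<and> s' = s''"
proof (induction arbitrary: u s'' rule: exec.induct)
  case (Skip s)
  then show ?case by (elim exec_SkipE) simp
next
  case (Assign x i e s)
  then show ?case by (elim exec_AssignE) simp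
next
  case (Seq c s t s' d t' s1)
  from Seq.prems obtain v w r where "exec W c s v r" "exec W d r w s''" "u = v + w + 1"
    by (elim exec_SeqE) simp
  with Seq.IH show ?case by metis
next
  case (IfTrue b s c t s' d)
  from IfTrue.prems IfTrue.hyps obtain v where "exec W c s v s''" "u = cost b + v + 1"
    by (elim exec_IfE) simp_all
  with IfTrue.IH show ?case by metis
next
  case (IfFalse b s d t s' c)
  from IfFalse.prems IfFalse.hyps obtain v where "exec W d s v s''" "u = cost b + v + 1"
    by (elim exec_IfE) simp_all
  with IfFalse.IH show ?case by metis
next
  case (WhileFalse b s c)
  from WhileFalse.prems show ?case
    by (rule exec_WhileE) (use WhileFalse.hyps in simp_all)
next
  case (WhileTrue b s c t s' t' s1)
  from WhileTrue.prems obtain v w r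
    where "exec W c s v r" "exec W (While b c) r w s''" "u = cost b + v + w + 1"
    by (rule exec_WhileE) (use WhileTrue.hyps in simp_all)
  with WhileTrue.IH show ?case by metis
qed

text \<open>Input: a trigraph with vertices \<open>0, \<dots>, n - 1\<close>, as its \<open>n \<times> n\<close> matrix stored row by row.
  The value of \<open>theta\<close> is stored increased by one; diagonal entries are zero.\<close>

definition input_state :: "nat \<Rightarrow> nat trigraph \<Rightarrow> state" where
  "input_state n T = (\<lambda>x k.
     if x = ''n'' \<and> k = 0 then n
     else if x = ''theta'' \<and> k < n * n \<and> k div n \<noteq> k mod n
       then nat (theta T {k div n, k mod n} + 1)
     else 0)"

text \<open>Output: \<open>X\<close> as an array of flags, and a trigraph whose vertices are among
  \<open>0, \<dots>, n + 2\<close>, as an array of flags together with an \<open>(n + 3) \<times> (n + 3)\<close> matrix, of which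
  the part above the diagonal is read.\<close>

definition output_set :: "nat \<Rightarrow> state \<Rightarrow> nat set" where
  "output_set n s = {i. i < n \<and> s ''X'' i \<noteq> 0}"

definition output_trigraph :: "nat \<Rightarrow> state \<Rightarrow> nat trigraph" where
  "output_trigraph n s =
     \<lparr> verts = {i. i < n + 3 \<and> s ''block_verts'' i \<noteq> 0},
       theta = (\<lambda>e. int (s ''block_theta'' (Min e * (n + 3) + Max e)) - 1) \<rparr>"

end

theory Submission
  imports Defs
begin

text \<open>For a trigraph of the class \<open>F\<close> without balanced skew-partition, a 2-join or homogeneous pair that
  satisfies the adjacency conditions and is not too small is automatically proper, because a defect of
  properness produces a balanced skew-partition. Hence fragments can be generated as closures: starting
  with a few vertices, a vertex is added whenever the adjacency conditions forbid it to stay outside.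
  A spanning tree has an edge across every 2-join, so a tree edge \<open>a1 a2\<close>, a vertex \<open>b2\<close> of \<open>B2\<close> and one
  further vertex \<open>c\<close> generate a 2-join whose side is minimal; a vertex complete to \<open>A\<close> and anticomplete
  to \<open>B\<close> with two vertices of \<open>B\<close> generate a minimal homogeneous pair. Over \<open>T\<close> and its complement these
  are at most \<open>5n\<^sup>3\<close> seeds. Each closure takes time \<open>O(n\<^sup>2)\<close> with a worklist, and a fragment of minimum
  size among the closures is an end. The parity of a 2-join is that of a shortest walk from \<open>A1\<close> to \<open>B1\<close>
  inside \<open>X\<close>.\<close>

section \<open>Trigraphs, complementation and connectivity\<close>

section \<open>Trigraph basics\<close>

text \<open>Guessing a vertex in each of A1, B1, A2, B2 would give n^4 starts and, with quadratic
  closures, time n^6. Two savings lead to n^5. The pair a1, a2 only has to be an edge across the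
  join, so the n - 1 tree edges suffice for it. And no vertex of B1 is guessed: in a minimal side
  some closure of a1 with one more vertex c is already everything. The labels need no guess either,
  because a2 and b2 show whether an inside vertex belongs to A1, B1 or C1. Two trigraphs and two
  directions of the tree edge make \<open>4 * n^3\<close> seeds; the homogeneous pairs add another
  n^3. Only inclusion-minimal fragments are shown to be closures, whereas every accepted closure is
  shown to be a fragment. A fragment of minimum size is inclusion-minimal, so the smallest accepted
  closure has minimum size among all fragments, and this makes it an end. Every skew-partition is
  shown to be balanced by the same device: one further vertex would complete a forbidden odd path or
  antipath to an odd hole or antihole.\<close>

lemma strongly_adj_sym: "strongly_adj T u v \<longleftrightarrow> strongly_adj T v u"
  by (auto simp: strongly_adj_def insert_commute)

lemma strongly_antiadj_sym: "strongly_antiadj T u v \<longleftrightarrow> strongly_antiadj T v u"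
  by (auto simp: strongly_antiadj_def insert_commute)

lemma switchable_sym: "switchable T u v \<longleftrightarrow> switchable T v u"
  by (auto simp: switchable_def insert_commute)

lemma adj_sym: "adj T u v \<longleftrightarrow> adj T v u"
  by (auto simp: adj_def insert_commute)

lemma antiadj_sym: "antiadj T u v \<longleftrightarrow> antiadj T v u"
  by (auto simp: antiadj_def insert_commute)

lemma theta_cases:
  assumes "trigraph T" "u \<in> verts T" "v \<in> verts T" "u \<noteq> v"
  shows "theta T {u, v} \<in> {-1, 0, 1}"
proof -
  have "{u, v} \<subseteq> verts T \<and> card {u, v} = 2" using assms by simp
  thus ?thesis using assms(1) unfolding trigraph_def by (elim conjE allE[of _ "{u, v}"]) simp
qed

lemma pair_cases:
  assumes "trigraph T" "u \<in> verts T" "v \<in> verts T" "u \<noteq> v"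
  obtains "strongly_adj T u v" | "switchable T u v" | "strongly_antiadj T u v"
  using theta_cases[OF assms] assms
  by (auto simp: strongly_adj_def strongly_antiadj_def switchable_def)

lemma strongly_adj_not:
  "strongly_adj T u v \<Longrightarrow> \<not> antiadj T u v" "strongly_adj T u v \<Longrightarrow> \<not> strongly_antiadj T u v"
  "strongly_adj T u v \<Longrightarrow> \<not> switchable T u v"
  by (auto simp: strongly_adj_def antiadj_def strongly_antiadj_def switchable_def)

lemma strongly_antiadj_not:
  "strongly_antiadj T u v \<Longrightarrow> \<not> adj T u v" "strongly_antiadj T u v \<Longrightarrow> \<not> strongly_adj T u v"
  "strongly_antiadj T u v \<Longrightarrow> \<not> switchable T u v"
  by (auto simp: strongly_adj_def adj_def strongly_antiadj_def switchable_def)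

lemma strongly_adj_imp_adj: "strongly_adj T u v \<Longrightarrow> adj T u v"
  by (auto simp: strongly_adj_def adj_def)

lemma strongly_antiadj_imp_antiadj: "strongly_antiadj T u v \<Longrightarrow> antiadj T u v"
  by (auto simp: strongly_antiadj_def antiadj_def)

lemma switchable_imp: "switchable T u v \<Longrightarrow> adj T u v" "switchable T u v \<Longrightarrow> antiadj T u v"
  by (auto simp: switchable_def adj_def antiadj_def)

lemma not_adj_iff:
  assumes "trigraph T" "u \<in> verts T" "v \<in> verts T" "u \<noteq> v"
  shows "\<not> adj T u v \<longleftrightarrow> strongly_antiadj T u v"
  using theta_cases[OF assms] assms by (auto simp: strongly_antiadj_def adj_def)

lemma not_antiadj_iff:
  assumes "trigraph T" "u \<in> verts T" "v \<in> verts T" "u \<noteq> v"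
  shows "\<not> antiadj T u v \<longleftrightarrow> strongly_adj T u v"
  using theta_cases[OF assms] assms by (auto simp: strongly_adj_def antiadj_def)

lemma strongly_adj_antiadj_False:
  "strongly_adj T u v \<Longrightarrow> antiadj T u v \<Longrightarrow> False"
  "strongly_adj T u v \<Longrightarrow> antiadj T v u \<Longrightarrow> False"
  using strongly_adj_not(1) antiadj_sym by metis+

lemma strongly_antiadj_adj_False:
  "strongly_antiadj T u v \<Longrightarrow> adj T u v \<Longrightarrow> False"
  "strongly_antiadj T u v \<Longrightarrow> adj T v u \<Longrightarrow> False"
  using strongly_antiadj_not(1) adj_sym by metis+

lemma verts_co [simp]: "verts (co T) = verts T"
  by (simp add: co_def)

lemma co_co [simp]: "co (co T) = (T :: 'a trigraph)"
  by (simp add: co_def)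

lemma theta_co [simp]: "theta (co T) e = - theta T e"
  by (simp add: co_def)

lemma co_rel [simp]:
  "strongly_adj (co T) u v = strongly_antiadj T u v"
  "strongly_antiadj (co T) u v = strongly_adj T u v"
  "switchable (co T) u v = switchable T u v"
  "adj (co T) u v = antiadj T u v"
  "antiadj (co T) u v = adj T u v"
  by (auto simp: strongly_adj_def strongly_antiadj_def switchable_def adj_def antiadj_def)

lemma trigraph_co [simp]: "trigraph (co T) = trigraph T"
proof -
  have "- theta T e \<in> {-1, 0, 1} \<longleftrightarrow> theta T e \<in> {-1, 0, 1}" for e by auto
  thus ?thesis by (simp only: trigraph_def verts_co theta_co)
qed

lemma Berge_co [simp]: "Berge (co T) = Berge T"
  by (auto simp: Berge_def antihole_def)

definition set_complete :: "'a trigraph \<Rightarrow> 'a set \<Rightarrow> 'a set \<Rightarrow> bool" where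
  "set_complete T X Y \<longleftrightarrow> (\<forall>x\<in>X. \<forall>y\<in>Y. strongly_adj T x y)"

definition set_anticomplete :: "'a trigraph \<Rightarrow> 'a set \<Rightarrow> 'a set \<Rightarrow> bool" where
  "set_anticomplete T X Y \<longleftrightarrow> (\<forall>x\<in>X. \<forall>y\<in>Y. strongly_antiadj T x y)"

lemma set_completeD: "set_complete T X Y \<Longrightarrow> x \<in> X \<Longrightarrow> y \<in> Y \<Longrightarrow> strongly_adj T x y"
  by (auto simp: set_complete_def)

lemma set_anticompleteD: "set_anticomplete T X Y \<Longrightarrow> x \<in> X \<Longrightarrow> y \<in> Y \<Longrightarrow> strongly_antiadj T x y"
  by (auto simp: set_anticomplete_def)

lemma set_complete_co [simp]: "set_complete (co T) X Y = set_anticomplete T X Y"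
  "set_anticomplete (co T) X Y = set_complete T X Y"
  by (auto simp: set_complete_def set_anticomplete_def)

lemma set_complete_sym: "set_complete T X Y \<longleftrightarrow> set_complete T Y X"
  unfolding set_complete_def using strongly_adj_sym by metis

lemma set_anticomplete_sym: "set_anticomplete T X Y \<longleftrightarrow> set_anticomplete T Y X"
  unfolding set_anticomplete_def using strongly_antiadj_sym by metis

section \<open>Connectivity\<close>

text \<open>Connectivity is used in the form of cuts throughout: a walk from inside U to outside has
  a step that leaves U.\<close>

lemma graph_connected_cut:
  assumes "graph_connected X E" "U \<subseteq> X" "U \<noteq> {}" "U \<noteq> X"
  obtains u v where "u \<in> U" "v \<in> X - U" "E u v"
proof -
  obtain u where u: "u \<in> U" using assms by auto
  obtain v where v: "v \<in> X - U" using assms by auto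
  have "(u, v) \<in> {(x, y). x \<in> X \<and> y \<in> X \<and> E x y}\<^sup>*"
    using assms(1) u v assms(2) unfolding graph_connected_def by blast
  hence "v \<in> U \<or> (\<exists>u v. u \<in> U \<and> v \<in> X - U \<and> E u v)"
    by (induction rule: rtrancl_induct) (use u in auto)
  thus thesis using v that by auto
qed

text \<open>If v is not reached from u, the set reached from u is a cut that no edge leaves.\<close>

lemma graph_connectedI:
  assumes "\<And>U. U \<subseteq> X \<Longrightarrow> U \<noteq> {} \<Longrightarrow> U \<noteq> X \<Longrightarrow> \<exists>u\<in>U. \<exists>v\<in>X - U. E u v"
  shows "graph_connected X E"
  unfolding graph_connected_def
proof (intro ballI, rule ccontr)
  fix u v assume uv: "u \<in> X" "v \<in> X" "(u, v) \<notin> {(x, y). x \<in> X \<and> y \<in> X \<and> E x y}\<^sup>*"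
  define U where "U = {w\<in>X. (u, w) \<in> {(x, y). x \<in> X \<and> y \<in> X \<and> E x y}\<^sup>*}"
  have "\<exists>u\<in>U. \<exists>v\<in>X - U. E u v" by (rule assms) (use uv in \<open>auto simp: U_def\<close>)
  then obtain x y where xy: "x \<in> U" "y \<in> X - U" "E x y" by auto
  hence "(u, y) \<in> {(x, y). x \<in> X \<and> y \<in> X \<and> E x y}\<^sup>*"
    unfolding U_def by (auto intro: rtrancl_into_rtrancl)
  thus False using xy by (auto simp: U_def)
qed

text \<open>Maximality comes from cuts: a connected proper superset would have an edge leaving the
  reached set, whose far end would then be reached as well.\<close>

lemma graph_component_reach:
  assumes v: "v \<in> X" and sym: "\<And>x y. E x y \<Longrightarrow> E y x"
  shows "graph_component X E {u. (v, u) \<in> {(x, y). x \<in> X \<and> y \<in> X \<and> E x y}\<^sup>*}"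
proof -
  let ?E = "{(x, y). x \<in> X \<and> y \<in> X \<and> E x y}"
  define C where "C = {u. (v, u) \<in> ?E\<^sup>*}"
  have CV: "C \<subseteq> X"
  proof
    fix u assume "u \<in> C"
    hence "(v, u) \<in> ?E\<^sup>*" by (simp add: C_def)
    thus "u \<in> X" by (induction rule: rtrancl_induct) (use v in auto)
  qed
  have vC: "v \<in> C" by (simp add: C_def)
  have step: "y \<in> C" if "x \<in> C" "y \<in> X" "E x y" for x y
  proof -
    have "(x, y) \<in> ?E" using that CV by auto
    moreover have "(v, x) \<in> ?E\<^sup>*" using that(1) by (simp add: C_def)
    ultimately have "(v, y) \<in> ?E\<^sup>*" by (rule rtrancl_into_rtrancl[rotated])
    thus ?thesis by (simp add: C_def)
  qed
  have conn: "graph_connected C E"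
  proof (rule graph_connectedI)
    fix U assume U: "U \<subseteq> C" "U \<noteq> {}" "U \<noteq> C"
    show "\<exists>u\<in>U. \<exists>w\<in>C - U. E u w"
    proof (rule ccontr)
      assume no: "\<not> ?thesis"
      have cl: "x \<in> U \<longleftrightarrow> y \<in> U" if "x \<in> C" "y \<in> C" "E x y" for x y
        using no that sym by (metis DiffI)
      have keep: "u \<in> C \<and> (u \<in> U \<longleftrightarrow> v \<in> U)" if "(v, u) \<in> ?E\<^sup>*" for u
        using that
      proof (induction rule: rtrancl_induct)
        case (step y z)
        hence yz: "z \<in> X" "E y z" "y \<in> C" by auto
        from \<open>\<And>x y. x \<in> C \<Longrightarrow> y \<in> X \<Longrightarrow> E x y \<Longrightarrow> y \<in> C\<close>[OF yz(3,1,2)] have "z \<in> C" .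
        thus ?case using step.IH cl[OF yz(3) _ yz(2)] by simp
      qed (simp add: vC)
      have "u \<in> U \<longleftrightarrow> v \<in> U" if "u \<in> C" for u
      proof -
        have "(v, u) \<in> ?E\<^sup>*" using that by (simp add: C_def)
        thus ?thesis by (rule conjunct2[OF keep])
      qed
      thus False using U by blast
    qed
  qed
  have "graph_component X E C"
    unfolding graph_component_def
  proof (intro conjI allI impI notI)
    show "C = {} \<Longrightarrow> False" using vC by simp
    show "C \<subseteq> X" "graph_connected C E" by (rule CV conn)+
    fix D assume D: "C \<subset> D \<and> D \<subseteq> X" "graph_connected D E"
    obtain u w where "u \<in> C" "w \<in> D - C" "E u w"
      using graph_connected_cut[OF D(2), of C] D(1) vC by blast
    thus False using step[of u w] D(1) by blast
  qed
  thus ?thesis by (simp add: C_def)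
qed

text \<open>If an edge left K, then K together with its far end would still be connected, against
  maximality.\<close>

lemma graph_component_isolated:
  assumes K: "graph_component X E K" and sym: "\<And>x y. E x y \<Longrightarrow> E y x"
    and k: "k \<in> K" "x \<in> X - K"
  shows "\<not> E k x"
proof
  assume e: "E k x"
  have gc: "graph_connected K E" and KX: "K \<subseteq> X" using K by (simp_all add: graph_component_def)
  have "graph_connected (insert x K) E"
  proof (rule graph_connectedI)
    fix U assume U: "U \<subseteq> insert x K" "U \<noteq> {}" "U \<noteq> insert x K"
    show "\<exists>u\<in>U. \<exists>v\<in>insert x K - U. E u v"
    proof (cases "U \<inter> K = {} \<or> K \<subseteq> U")
      case True
      show ?thesis
      proof (cases "x \<in> U")
        case xU: True
        hence "U \<inter> K = {}" using True U by blast
        thus ?thesis using xU k sym[OF e] by blast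
      next
        case False
        hence "K \<subseteq> U" using True U by blast
        thus ?thesis using False k e by blast
      qed
    next
      case False
      then obtain u v where "u \<in> U \<inter> K" "v \<in> K - (U \<inter> K)" "E u v"
        using graph_connected_cut[OF gc, of "U \<inter> K"] by blast
      thus ?thesis by blast
    qed
  qed
  moreover have "K \<subset> insert x K" "insert x K \<subseteq> X" using k KX by auto
  ultimately show False using K unfolding graph_component_def by blast
qed

lemma adj_induced [simp]: "adj (induced T X) u v \<longleftrightarrow> u \<in> X \<and> v \<in> X \<and> u \<noteq> v \<and> theta T {u, v} \<in> {0, 1}"
  by (simp add: adj_def induced_def)

lemma verts_induced [simp]: "verts (induced T X) = X"
  by (simp add: induced_def)

lemma induced_induced [simp]: "induced (induced T X) Y = induced T Y"
  by (simp add: induced_def)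

lemma connected_in_induced [simp]: "connected_in (induced T X) Y = connected_in T Y"
  by (simp add: connected_in_def)

lemma component_induced:
  assumes "X \<subseteq> verts T"
  shows "component (induced T X) K = graph_component X (adj T) K"
proof -
  have "connected_in T D = graph_connected D (adj T)" if D: "D \<subseteq> X" for D
  proof -
    have "{(x, y). x \<in> D \<and> y \<in> D \<and> adj (induced T D) x y} = {(x, y). x \<in> D \<and> y \<in> D \<and> adj T x y}"
      using D assms by (auto simp: adj_def induced_def)
    thus ?thesis unfolding connected_in_def graph_connected_def by simp
  qed
  thus ?thesis unfolding component_def graph_component_def by auto
qed

section \<open>Attachment conditions under which a skew-partition is balanced, and cutsets that
  satisfy them\<close>

section \<open>A criterion for balanced skew-partitions\<close>

text \<open>\<open>attach_ok T Z S\<close> excludes the odd paths with ends in \<open>Z\<close> and interior in \<open>S\<close> as well as the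
  odd antipaths with ends in \<open>S\<close> and interior in \<open>Z\<close>: the vertex \<open>w\<close> would complete them to an odd
  hole or antihole.\<close>

definition attach_ok :: "'a trigraph \<Rightarrow> 'a set \<Rightarrow> 'a set \<Rightarrow> bool" where
  "attach_ok T Z S \<longleftrightarrow> (\<exists>Z'\<subseteq>Z. set_complete T (Z - Z') S \<and>
     (\<forall>y\<in>Z - Z'. set_complete T {y} Z' \<or> set_anticomplete T {y} Z') \<and>
     ((\<forall>x\<in>Z'. \<forall>y\<in>Z'. x = y) \<or> set_anticomplete T Z' S \<or>
      (\<exists>w\<in>verts T. set_complete T {w} Z' \<and> set_anticomplete T {w} S)))"

text \<open>An even number of at least four vertices means odd length greater than 1. For antipaths
  the notion is read in the complement, with Z and S exchanged.\<close>

definition odd_link :: "'a trigraph \<Rightarrow> 'a set \<Rightarrow> 'a set \<Rightarrow> 'a list \<Rightarrow> bool" where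
  "odd_link T Z S p \<longleftrightarrow> path T p \<and> even (length p) \<and> length p \<ge> 4 \<and> p ! 0 \<in> Z \<and>
     p ! (length p - 1) \<in> Z \<and> (\<forall>i. 0 < i \<and> i < length p - 1 \<longrightarrow> p ! i \<in> S)"

lemma path_nth_adj: "path T p \<Longrightarrow> Suc i < length p \<Longrightarrow> adj T (p ! i) (p ! Suc i)"
  unfolding path_def by (metis lessI)

lemma path_nth_antiadj: "path T p \<Longrightarrow> Suc i < j \<Longrightarrow> j < length p \<Longrightarrow> antiadj T (p ! i) (p ! j)"
  unfolding path_def by (metis Suc_lessD nat_neq_iff)

lemma path_close_hole:
  assumes p: "path T p" "length p \<ge> 3" and w: "w \<in> verts T" "w \<notin> set p"
    and ends: "adj T (p ! 0) w" "adj T (p ! (length p - 1)) w"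
    and int: "\<And>i. 0 < i \<Longrightarrow> i < length p - 1 \<Longrightarrow> antiadj T (p ! i) w"
  shows "hole T (p @ [w])"
  unfolding hole_def
proof (intro conjI allI impI)
  show "4 \<le> length (p @ [w])" using p by simp
  show "distinct (p @ [w])" using p w by (auto simp: path_def)
  show "set (p @ [w]) \<subseteq> verts T" using p w by (auto simp: path_def)
  fix i j assume ij: "i < j \<and> j < length (p @ [w])"
  show "if j - i = 1 \<or> j - i = length (p @ [w]) - 1 then adj T ((p @ [w]) ! i) ((p @ [w]) ! j)
        else antiadj T ((p @ [w]) ! i) ((p @ [w]) ! j)"
  proof (cases "j = length p")
    case False
    hence j: "j < length p" using ij by auto
    show ?thesis
    proof (cases "j = Suc i")
      case True
      thus ?thesis using path_nth_adj[OF p(1), of i] j by (simp add: nth_append)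
    next
      case f: False
      hence "antiadj T (p ! i) (p ! j)" using path_nth_antiadj[OF p(1), of i j] ij j by simp
      moreover have "j - i \<noteq> 1" "j - i \<noteq> length p" using f ij j by auto
      ultimately show ?thesis using ij j by (simp add: nth_append)
    qed
  next
    case True
    consider "i = 0" | "i = length p - 1" "i > 0" | "0 < i" "i < length p - 1" using ij True by force
    thus ?thesis
    proof cases
      case 1 thus ?thesis using True ends p by (auto simp: nth_append)
    next
      case 2 thus ?thesis using True ends p by (auto simp: nth_append)
    next
      case 3
      hence "j - i \<noteq> 1" "j - i \<noteq> length p" using True by auto
      moreover have "i < length p" using 3 by simp
      ultimately show ?thesis using 3 True int[OF 3] by (simp add: nth_append)
    qed
  qed
qed

text \<open>Both ends lie in Z': an end in \<open>Z - Z'\<close> would be strongly adjacent to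
  interior vertices that are not next to it on the path. So Z' has two distinct members, and one of
  them has a neighbour in S. This leaves the alternative with w, which closes the path to a hole
  with an odd number of vertices.\<close>

lemma attach_ok_no_link:
  assumes "attach_ok T Z S" and B: "Berge T"
  shows "\<not> odd_link T Z S p"
proof
  assume L: "odd_link T Z S p"
  from assms(1)[unfolded attach_ok_def] obtain Z' where Z': "Z' \<subseteq> Z" "set_complete T (Z - Z') S"
    "(\<forall>x\<in>Z'. \<forall>y\<in>Z'. x = y) \<or> set_anticomplete T Z' S \<or>
      (\<exists>w\<in>verts T. set_complete T {w} Z' \<and> set_anticomplete T {w} S)"
    by (elim exE conjE) (rule that)
  let ?k = "length p"
  have p: "path T p" "?k \<ge> 4" "even ?k" using L by (auto simp: odd_link_def)
  have inS: "p ! i \<in> S" if "0 < i" "i < ?k - 1" for i using L that by (auto simp: odd_link_def)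
  have e0: "p ! 0 \<in> Z'"
  proof (rule ccontr)
    assume "p ! 0 \<notin> Z'"
    moreover have "antiadj T (p ! 0) (p ! 2)" using path_nth_antiadj[OF p(1), of 0 2] p by simp
    moreover have "p ! 2 \<in> S" using inS[of 2] p by simp
    moreover have "p ! 0 \<in> Z" using L by (simp add: odd_link_def)
    ultimately show False using set_completeD[OF Z'(2)] strongly_adj_antiadj_False by (metis DiffI)
  qed
  have e1: "p ! (?k - 1) \<in> Z'"
  proof (rule ccontr)
    assume "p ! (?k - 1) \<notin> Z'"
    moreover have "antiadj T (p ! 1) (p ! (?k - 1))" using path_nth_antiadj[OF p(1), of 1 "?k - 1"] p by simp
    moreover have "p ! 1 \<in> S" using inS[of 1] p by simp
    moreover have "p ! (?k - 1) \<in> Z" using L by (simp add: odd_link_def)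
    ultimately show False using set_completeD[OF Z'(2)] strongly_adj_antiadj_False by (metis DiffI)
  qed
  have ne: "p ! 0 \<noteq> p ! (?k - 1)" using p by (auto simp: path_def nth_eq_iff_index_eq)
  have "adj T (p ! 0) (p ! 1)" using path_nth_adj[OF p(1), of 0] p by simp
  moreover have "p ! 1 \<in> S" using inS[of 1] p by simp
  ultimately have "\<not> set_anticomplete T Z' S"
    using e0 set_anticompleteD strongly_antiadj_adj_False by metis
  then obtain w where w: "w \<in> verts T" "set_complete T {w} Z'" "set_anticomplete T {w} S"
    using Z'(3) e0 e1 ne by blast
  have wi: "strongly_antiadj T w (p ! i)" if "0 < i" "i < ?k - 1" for i
    using set_anticompleteD[OF w(3) _ inS[OF that]] by simp
  have we: "strongly_adj T w (p ! 0)" "strongly_adj T w (p ! (?k - 1))"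
    using set_completeD[OF w(2)] e0 e1 by simp_all
  have "w \<notin> set p"
  proof
    assume "w \<in> set p"
    then obtain i where "i < ?k" "w = p ! i" by (auto simp: in_set_conv_nth)
    moreover have "i = 0 \<or> i = ?k - 1 \<or> (0 < i \<and> i < ?k - 1)" using \<open>i < ?k\<close> by linarith
    ultimately show False using we wi by (metis strongly_adj_def strongly_antiadj_def)
  qed
  moreover have "adj T (p ! 0) w" "adj T (p ! (?k - 1)) w"
    using we strongly_adj_imp_adj strongly_adj_sym by metis+
  moreover have "antiadj T (p ! i) w" if "0 < i" "i < ?k - 1" for i
    using wi[OF that] strongly_antiadj_imp_antiadj strongly_antiadj_sym by metis
  ultimately have "hole T (p @ [w])" using p(1,2) w(1) by (intro path_close_hole) auto
  moreover have "odd (length (p @ [w]))" using p by simp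
  ultimately show False using B unfolding Berge_def by blast
qed

text \<open>The first and the last interior vertex are antiadjacent to ends in S, so they lie in Z'.
  The induction below puts the whole interior into Z'; then w is complete to the interior and
  anticomplete to the ends, and closes the antipath to an odd antihole.\<close>

lemma attach_ok_no_antilink:
  assumes "attach_ok T Z S" and B: "Berge T"
  shows "\<not> odd_link (co T) S Z p"
proof
  assume L: "odd_link (co T) S Z p"
  from assms(1)[unfolded attach_ok_def] obtain Z' where Z': "Z' \<subseteq> Z" "set_complete T (Z - Z') S"
    "\<forall>y\<in>Z - Z'. set_complete T {y} Z' \<or> set_anticomplete T {y} Z'"
    "(\<forall>x\<in>Z'. \<forall>y\<in>Z'. x = y) \<or> set_anticomplete T Z' S \<or>
      (\<exists>w\<in>verts T. set_complete T {w} Z' \<and> set_anticomplete T {w} S)"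
    by (elim exE conjE) (rule that)
  let ?k = "length p"
  have p: "path (co T) p" "?k \<ge> 4" "even ?k" using L by (auto simp: odd_link_def)
  have inZ: "p ! i \<in> Z" if "0 < i" "i < ?k - 1" for i using L that by (auto simp: odd_link_def)
  have eS: "p ! 0 \<in> S" "p ! (?k - 1) \<in> S" using L by (auto simp: odd_link_def)
  have A: "antiadj T (p ! i) (p ! Suc i)" if "Suc i < ?k" for i
    using path_nth_adj[OF p(1) that] by simp
  have D: "adj T (p ! i) (p ! j)" if "Suc i < j" "j < ?k" for i j
    using path_nth_antiadj[OF p(1) that] by simp
  have z1: "p ! 1 \<in> Z'"
  proof (rule ccontr)
    assume "p ! 1 \<notin> Z'"
    hence "strongly_adj T (p ! 1) (p ! 0)" using inZ[of 1] set_completeD[OF Z'(2)] eS p(2) by simp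
    moreover have "antiadj T (p ! 0) (p ! 1)" using A[of 0] p(2) by simp
    ultimately show False by (rule strongly_adj_antiadj_False)
  qed
  have z2: "p ! (?k - 2) \<in> Z'"
  proof (rule ccontr)
    assume "p ! (?k - 2) \<notin> Z'"
    hence "strongly_adj T (p ! (?k - 2)) (p ! (?k - 1))"
      using inZ[of "?k - 2"] set_completeD[OF Z'(2)] eS p(2) by simp
    moreover have "antiadj T (p ! (?k - 2)) (p ! (?k - 1))"
    proof -
      have "Suc (?k - 2) = ?k - 1" using p(2) by simp
      thus ?thesis using A[of "?k - 2"] p(2) by simp
    qed
    ultimately show False by (rule strongly_adj_antiadj_False)
  qed
  have ne: "p ! 1 \<noteq> p ! (?k - 2)" using p by (auto simp: path_def nth_eq_iff_index_eq)
  have inZ': "p ! i \<in> Z'" if i: "0 < i" "i < ?k - 1" for i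
    using i
  proof (induction i)
    case (Suc j)
    show ?case
    proof (cases "j = 0")
      case True thus ?thesis using z1 by simp
    next
      case False
      hence pj: "p ! j \<in> Z'" using Suc by simp
      show ?thesis
      proof (rule ccontr)
        assume n: "p ! Suc j \<notin> Z'"
        \<comment> \<open>The predecessor lies in Z' and is an antineighbour, so a first interior
          vertex outside Z' would be anticomplete to Z'. On an antipath it is adjacent to every
          vertex that is not next to it, so both \<open>p ! 1\<close> and
          \<open>p ! (?k - 2)\<close> have to be next to it or equal to it.\<close>
        have "\<not> set_complete T {p ! Suc j} Z'"
          using A[of j] pj Suc.prems set_completeD[of T "{p ! Suc j}" Z' "p ! Suc j" "p ! j"]
            strongly_adj_antiadj_False(2)[of T "p ! Suc j" "p ! j"] by auto
        hence an: "set_anticomplete T {p ! Suc j} Z'"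
          using bspec[OF Z'(3), of "p ! Suc j"] n inZ[of "Suc j"] Suc.prems by auto
        have j2: "j = 1"
        proof (rule ccontr)
          assume "j \<noteq> 1"
          hence "adj T (p ! 1) (p ! Suc j)" using False Suc.prems by (intro D) auto
          thus False using set_anticompleteD[OF an] z1 strongly_antiadj_adj_False by (metis singletonI)
        qed
        have "Suc (Suc j) \<ge> ?k - 2"
        proof (rule ccontr)
          assume "\<not> Suc (Suc j) \<ge> ?k - 2"
          hence "adj T (p ! Suc j) (p ! (?k - 2))" by (intro D) auto
          thus False using set_anticompleteD[OF an] z2 strongly_antiadj_adj_False by (metis singletonI)
        qed
        \<comment> \<open>Being even, \<open>?k\<close> is 4, and then the vertex in question is
          \<open>p ! (?k - 2)\<close> itself, which lies in Z'.\<close>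
        hence "?k \<le> 5" using j2 by simp
        hence "?k = 4" using p(2,3) by presburger
        thus False using n z2 j2 by (simp add: numeral_2_eq_2)
      qed
    qed
  qed simp
  have "adj T (p ! 0) (p ! (?k - 2))" using D[of 0 "?k - 2"] p by simp
  hence "\<not> set_anticomplete T Z' S"
    using z2 eS set_anticompleteD strongly_antiadj_adj_False by metis
  then obtain w where w: "w \<in> verts T" "set_complete T {w} Z'" "set_anticomplete T {w} S"
    using Z'(4) z1 z2 ne by blast
  have wi: "strongly_adj T w (p ! i)" if "0 < i" "i < ?k - 1" for i
    using set_completeD[OF w(2) _ inZ'[OF that]] by simp
  have we: "strongly_antiadj T w (p ! 0)" "strongly_antiadj T w (p ! (?k - 1))"
    using set_anticompleteD[OF w(3)] eS by simp_all
  have "w \<notin> set p"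
  proof
    assume "w \<in> set p"
    then obtain i where "i < ?k" "w = p ! i" by (auto simp: in_set_conv_nth)
    moreover have "i = 0 \<or> i = ?k - 1 \<or> (0 < i \<and> i < ?k - 1)" using \<open>i < ?k\<close> by linarith
    ultimately show False using we wi by (metis strongly_adj_def strongly_antiadj_def)
  qed
  moreover have "antiadj T (p ! 0) w" "antiadj T (p ! (?k - 1)) w"
    using we strongly_antiadj_imp_antiadj strongly_antiadj_sym by metis+
  moreover have "adj T (p ! i) w" if "0 < i" "i < ?k - 1" for i
    using wi[OF that] strongly_adj_imp_adj strongly_adj_sym by metis
  ultimately have "hole (co T) (p @ [w])" using p(1,2) w(1) by (intro path_close_hole) auto
  moreover have "odd (length (p @ [w]))" using p by simp
  ultimately show False using B unfolding Berge_def antihole_def by blast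
qed

lemma path_interior_nth: "0 < i \<Longrightarrow> i < length p - 1 \<Longrightarrow> p ! i \<in> path_interior p"
proof -
  assume i: "0 < i" "i < length p - 1"
  hence "butlast (tl p) ! (i - 1) = p ! i" by (simp add: nth_butlast nth_tl)
  moreover have "i - 1 < length (butlast (tl p))" using i by simp
  ultimately show ?thesis unfolding path_interior_def by (metis nth_mem)
qed

lemma path_interior_eq: "path_interior p = {p ! i | i. 0 < i \<and> i < length p - 1}"
proof -
  have "x \<in> {p ! i | i. 0 < i \<and> i < length p - 1}" if x: "x \<in> path_interior p" for x
  proof -
    obtain j where "j < length (butlast (tl p))" "butlast (tl p) ! j = x"
      using x unfolding path_interior_def by (metis in_set_conv_nth)
    hence "j < length p - 2" "p ! Suc j = x" by (auto simp: nth_butlast nth_tl)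
    thus ?thesis by (intro CollectI exI[of _ "Suc j"]) auto
  qed
  thus ?thesis using path_interior_nth by blast
qed

text \<open>The ends are antiadjacent, so they cannot lie on different sides of a complete pair;
  consecutive interior vertices are adjacent, so the interior cannot change sides of an anticomplete
  pair. In the complement the two pairs exchange roles, which covers antipaths.\<close>

lemma link_sides:
  assumes p: "path T p" "odd (path_length p)" "path_length p > 1"
    and ends: "hd p \<in> P \<union> Q" "last p \<in> P \<union> Q" and int: "path_interior p \<subseteq> K \<union> R"
    and KR: "set_anticomplete T K R" and PQ: "set_complete T P Q"
  obtains Z S where "Z \<in> {P, Q}" "S \<in> {K, R}" "odd_link T Z S p"
proof -
  let ?k = "length p"
  have k: "even ?k" "?k \<ge> 4"
  proof -
    show "even ?k" using p(2) unfolding path_length_def by (cases ?k) auto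
    thus "?k \<ge> 4" using p(2,3) unfolding path_length_def by presburger
  qed
  have hl: "hd p = p ! 0" "last p = p ! (?k - 1)" using p(1) by (auto simp: path_def hd_conv_nth last_conv_nth)
  have i: "p ! i \<in> K \<union> R" if "0 < i" "i < ?k - 1" for i using path_interior_nth[OF that] int by auto
  have aa: "antiadj T (p ! 0) (p ! (?k - 1))" using path_nth_antiadj[OF p(1), of 0 "?k - 1"] k by simp
  obtain Z where Z: "Z \<in> {P, Q}" "p ! 0 \<in> Z" "p ! (?k - 1) \<in> Z"
    using ends PQ aa unfolding hl set_complete_def
    by (metis Un_iff antiadj_sym insertCI strongly_adj_not(1))
  have "p ! 1 \<in> K \<union> R" using i[of 1] k(2) by simp
  then obtain S where S: "S \<in> {K, R}" "p ! 1 \<in> S" by blast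
  have "p ! j \<in> S" if "0 < j" "j < ?k - 1" for j
    using that
  proof (induction j)
    case (Suc j)
    show ?case
    proof (cases "j = 0")
      case False
      hence pj: "p ! j \<in> S" using Suc by simp
      have ad: "adj T (p ! j) (p ! Suc j)" using Suc.prems path_nth_adj[OF p(1), of j] by simp
      have "p ! Suc j \<in> K \<union> R" using i[of "Suc j"] Suc.prems by simp
      thus ?thesis using pj S(1) set_anticompleteD[OF KR] strongly_antiadj_adj_False ad
        by (metis Un_iff insertE singletonD)
    qed (use S in simp)
  qed simp
  hence "odd_link T Z S p" unfolding odd_link_def using p(1) k Z(2,3) by simp
  thus thesis using that[OF Z(1) S(1)] by simp
qed

text \<open>By \<open>link_sides\<close> each forbidden path or antipath uses only one of P, Q and
  one of K, R. Hence the four attachment conditions settle both halves of balancedness.\<close>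

lemma balanced_skew_partitionI:
  assumes B: "Berge T" "trigraph T"
    and V: "verts T = (K \<union> R) \<union> (P \<union> Q)" "(K \<union> R) \<inter> (P \<union> Q) = {}" "K \<inter> R = {}" "P \<inter> Q = {}"
    and ne: "K \<noteq> {}" "R \<noteq> {}" "P \<noteq> {}" "Q \<noteq> {}"
    and KR: "set_anticomplete T K R" and PQ: "set_complete T P Q"
    and ok: "attach_ok T P K" "attach_ok T P R" "attach_ok T Q K" "attach_ok T Q R"
  shows "balanced_skew_partition T (K \<union> R) (P \<union> Q)"
  unfolding balanced_skew_partition_def skew_partition_def
proof (intro conjI notI)
  show "(K \<union> R) \<union> (P \<union> Q) = verts T" "(K \<union> R) \<inter> (P \<union> Q) = {}" using V by auto
next
  assume "connected_in T (K \<union> R)"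
  hence "graph_connected (K \<union> R) (adj (induced T (K \<union> R)))" by (simp add: connected_in_def)
  moreover have "K \<subseteq> K \<union> R" "K \<noteq> K \<union> R" using V ne by auto
  ultimately obtain u v where "u \<in> K" "v \<in> (K \<union> R) - K" "adj (induced T (K \<union> R)) u v"
    using graph_connected_cut ne(1) by metis
  thus False using KR by (auto simp: set_anticomplete_def strongly_antiadj_def)
next
  assume ac: "anticonnected_in T (P \<union> Q)"
  have "P \<subseteq> P \<union> Q" "P \<noteq> P \<union> Q" using V ne by auto
  with graph_connected_cut[OF ac[unfolded anticonnected_in_def] _ ne(3)]
  obtain u v where uv: "u \<in> P" "v \<in> (P \<union> Q) - P" "u \<noteq> v \<and> \<not> strongly_adj T u v" by blast
  hence "v \<in> Q" by blast
  thus False using set_completeD[OF PQ uv(1)] uv(3) by simp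
next
  assume "\<exists>p. path T p \<and> odd (path_length p) \<and> 1 < path_length p \<and> hd p \<in> P \<union> Q \<and> last p \<in> P \<union> Q \<and>
        path_interior p \<subseteq> K \<union> R"
  then obtain p where p: "path T p" "odd (path_length p)" "1 < path_length p" "hd p \<in> P \<union> Q"
    "last p \<in> P \<union> Q" "path_interior p \<subseteq> K \<union> R" by (elim exE conjE) (rule that)
  obtain Z S where "Z \<in> {P, Q}" "S \<in> {K, R}" "odd_link T Z S p"
    by (rule link_sides[OF p KR PQ])
  thus False using ok attach_ok_no_link[OF _ B(1)] by (metis insertE singletonD)
next
  assume "\<exists>p. antipath T p \<and> odd (path_length p) \<and> 1 < path_length p \<and> hd p \<in> K \<union> R \<and> last p \<in> K \<union> R \<and>
        path_interior p \<subseteq> P \<union> Q"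
  then obtain p where p: "path (co T) p" "odd (path_length p)" "1 < path_length p" "hd p \<in> K \<union> R"
    "last p \<in> K \<union> R" "path_interior p \<subseteq> P \<union> Q" unfolding antipath_def by (elim exE conjE) (rule that)
  have c: "set_anticomplete (co T) P Q" "set_complete (co T) K R" using KR PQ by simp_all
  obtain Z S where "Z \<in> {K, R}" "S \<in> {P, Q}" "odd_link (co T) Z S p"
    by (rule link_sides[OF p c])
  thus False using ok attach_ok_no_antilink[OF _ B(1)] by (metis insertE singletonD)
qed

lemma set_completeI: "(\<And>x y. x \<in> X \<Longrightarrow> y \<in> Y \<Longrightarrow> strongly_adj T x y) \<Longrightarrow> set_complete T X Y"
  by (auto simp: set_complete_def)

lemma set_anticompleteI: "(\<And>x y. x \<in> X \<Longrightarrow> y \<in> Y \<Longrightarrow> strongly_antiadj T x y) \<Longrightarrow> set_anticomplete T X Y"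
  by (auto simp: set_anticomplete_def)

lemma set_complete_empty [simp]: "set_complete T {} Y" "set_complete T X {}"
  "set_anticomplete T {} Y" "set_anticomplete T X {}"
  by (auto simp: set_complete_def set_anticomplete_def)

lemma set_complete_subset: "set_complete T X Y \<Longrightarrow> X' \<subseteq> X \<Longrightarrow> Y' \<subseteq> Y \<Longrightarrow> set_complete T X' Y'"
  by (auto simp: set_complete_def)

lemma set_anticomplete_subset:
  "set_anticomplete T X Y \<Longrightarrow> X' \<subseteq> X \<Longrightarrow> Y' \<subseteq> Y \<Longrightarrow> set_anticomplete T X' Y'"
  by (auto simp: set_anticomplete_def)

lemma attach_ok_singleton: "attach_ok T {p} S"
  unfolding attach_ok_def by (rule exI[of _ "{p}"]) simp

lemma attach_ok_complete: "set_complete T Z S \<Longrightarrow> attach_ok T Z S"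
  unfolding attach_ok_def by (rule exI[of _ "{}"]) simp

lemma attach_ok_anticomplete: "set_anticomplete T Z S \<Longrightarrow> attach_ok T Z S"
  unfolding attach_ok_def by (rule exI[of _ Z]) simp

lemma attach_ok_vertex:
  "w \<in> verts T \<Longrightarrow> set_complete T {w} Z \<Longrightarrow> set_anticomplete T {w} S \<Longrightarrow> attach_ok T Z S"
  unfolding attach_ok_def by (rule exI[of _ Z]) auto

text \<open>A vertex of A' sees all of A and nothing of C, a vertex of A sees all of A' and nothing
  of R. Each half of the cutset supplies the vertex w for the other half.\<close>

lemma cross_cutset_balanced:
  assumes "Berge T" "trigraph T"
    and "verts T = (C \<union> R) \<union> (A \<union> A')" "(C \<union> R) \<inter> (A \<union> A') = {}" "C \<inter> R = {}" "A \<inter> A' = {}"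
    and ne: "C \<noteq> {}" "R \<noteq> {}" "A \<noteq> {}" "A' \<noteq> {}"
    and "set_anticomplete T C R" and AA: "set_complete T A A'"
    and AR: "set_anticomplete T A R" and CA: "set_anticomplete T C A'"
  shows "balanced_skew_partition T (C \<union> R) (A \<union> A')"
proof (rule balanced_skew_partitionI[OF assms(1-12)])
  obtain a a' where a: "a \<in> A" "a' \<in> A'" using ne by blast
  have V: "a \<in> verts T" "a' \<in> verts T" using a assms(3) by auto
  show "attach_ok T A C"
    using V(2) AA CA a by (intro attach_ok_vertex[of a'])
      (auto simp: set_complete_def set_anticomplete_def strongly_adj_sym strongly_antiadj_sym)
  show "attach_ok T A R" using AR by (rule attach_ok_anticomplete)
  show "attach_ok T A' C" using CA by (intro attach_ok_anticomplete) (simp add: set_anticomplete_sym)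
  show "attach_ok T A' R"
    using V(1) AA AR a by (intro attach_ok_vertex[of a]) (auto intro: set_complete_subset set_anticomplete_subset)
qed

text \<open>\<open>p\<close> together with the common neighbourhood \<open>Q\<close> of \<open>K\<close> cuts off \<open>K\<close>.\<close>

lemma twin_cutset_balanced:
  assumes "Berge T" "trigraph T"
    and V: "K \<subseteq> verts T" "Q \<subseteq> verts T" "p \<in> verts T" "p \<notin> K" "p \<notin> Q" "K \<inter> Q = {}"
    and R: "R = verts T - (K \<union> Q \<union> {p})"
    and ne: "K \<noteq> {}" "Q \<noteq> {}" "R \<noteq> {}"
    and KQ: "set_complete T K Q" and pQ: "set_complete T {p} Q" and KR: "set_anticomplete T K R"
  shows "balanced_skew_partition T (K \<union> R) ({p} \<union> Q)"
proof (rule balanced_skew_partitionI)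
  obtain k where k: "k \<in> K" using ne by blast
  show "attach_ok T {p} K" "attach_ok T {p} R" by (rule attach_ok_singleton)+
  show "attach_ok T Q K" using KQ by (intro attach_ok_complete) (simp add: set_complete_sym)
  show "attach_ok T Q R"
    using k V KQ KR by (intro attach_ok_vertex[of k]) (auto intro: set_complete_subset set_anticomplete_subset)
qed (use assms in auto)

text \<open>A half with one vertex contains neither both ends of a path nor the two or more interior
  vertices of an antipath of odd length greater than 1.\<close>

lemma edge_cutset_balanced:
  assumes "Berge T" "trigraph T"
    and V: "verts T = (K \<union> R) \<union> {p, q}" "p \<notin> K \<union> R" "q \<notin> K \<union> R" "K \<inter> R = {}"
    and ne: "K \<noteq> {}" "R \<noteq> {}" and pq: "strongly_adj T p q" and KR: "set_anticomplete T K R"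
  shows "balanced_skew_partition T (K \<union> R) ({p} \<union> {q})"
proof (rule balanced_skew_partitionI)
  show "attach_ok T {p} K" "attach_ok T {p} R" "attach_ok T {q} K" "attach_ok T {q} R"
    by (rule attach_ok_singleton)+
  show "{p} \<inter> {q} = {}" using pq by (auto simp: strongly_adj_def)
qed (use assms in \<open>auto simp: set_complete_def\<close>)

section \<open>Homogeneous pairs and the class F: properness without testing it\<close>

section \<open>Homogeneous pairs\<close>

text \<open>Booleans as indices make complementation a negation of both indices and the exchange of
  A and B an exchange of the indices.\<close>

definition outer_class :: "'a trigraph \<Rightarrow> 'a set \<Rightarrow> 'a set \<Rightarrow> bool \<Rightarrow> bool \<Rightarrow> 'a set" where
  "outer_class T A B x y = {v \<in> verts T - (A \<union> B).
     (if x then set_complete T {v} A else set_anticomplete T {v} A) \<and>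
     (if y then set_complete T {v} B else set_anticomplete T {v} B)}"

text \<open>The conditions that concern the outside only. The sizes and the mixed adjacencies
  between A and B are recovered by \<open>closed_pair_proper\<close>.\<close>

definition closed_pair :: "'a trigraph \<Rightarrow> 'a set \<Rightarrow> 'a set \<Rightarrow> bool" where
  "closed_pair T A B \<longleftrightarrow> A \<subseteq> verts T \<and> B \<subseteq> verts T \<and> A \<inter> B = {} \<and>
     (\<forall>v\<in>verts T - (A \<union> B). \<exists>x y. v \<in> outer_class T A B x y) \<and> (\<forall>x y. outer_class T A B x y \<noteq> {})"

lemma outer_class_swap: "outer_class T B A y x = outer_class T A B x y"
  unfolding outer_class_def by (intro Collect_cong) (simp add: Un_commute conj_commute)

lemma outer_class_co: "outer_class (co T) A B x y = outer_class T A B (\<not> x) (\<not> y)"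
  unfolding outer_class_def by (cases x; cases y) simp_all

lemma closed_pairD:
  assumes "closed_pair T A B"
  shows "A \<subseteq> verts T" "B \<subseteq> verts T" "A \<inter> B = {}" "outer_class T A B x y \<noteq> {}"
    and "v \<in> verts T - (A \<union> B) \<Longrightarrow> \<exists>x y. v \<in> outer_class T A B x y"
  using assms by (simp_all add: closed_pair_def)

lemma closed_pairI:
  assumes "A \<subseteq> verts T" "B \<subseteq> verts T" "A \<inter> B = {}" "\<And>x y. outer_class T A B x y \<noteq> {}"
    and "\<And>v. v \<in> verts T - (A \<union> B) \<Longrightarrow> \<exists>x y. v \<in> outer_class T A B x y"
  shows "closed_pair T A B"
  using assms by (simp add: closed_pair_def)

lemma closed_pair_swap:
  assumes "closed_pair T A B"
  shows "closed_pair T B A"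
proof (rule closed_pairI)
  show "B \<subseteq> verts T" "A \<subseteq> verts T" using closed_pairD[OF assms] by simp_all
  show "B \<inter> A = {}" using closed_pairD(3)[OF assms] by blast
  show "outer_class T B A x y \<noteq> {}" for x y
    using closed_pairD(4)[OF assms, of y x] outer_class_swap[of T B A x y] by simp
  fix v assume "v \<in> verts T - (B \<union> A)"
  hence "v \<in> verts T - (A \<union> B)" by blast
  from closed_pairD(5)[OF assms this] obtain x y where "v \<in> outer_class T A B x y" by auto
  hence "v \<in> outer_class T B A y x" using outer_class_swap[of T B A y x] by simp
  thus "\<exists>x y. v \<in> outer_class T B A x y" by auto
qed

lemma closed_pair_co:
  assumes "closed_pair T A B"
  shows "closed_pair (co T) A B"
proof (rule closed_pairI)
  show "A \<subseteq> verts (co T)" "B \<subseteq> verts (co T)" "A \<inter> B = {}" using closed_pairD[OF assms] by simp_all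
  show "outer_class (co T) A B x y \<noteq> {}" for x y
    unfolding outer_class_co by (rule closed_pairD(4)[OF assms])
  fix v assume "v \<in> verts (co T) - (A \<union> B)"
  hence "v \<in> verts T - (A \<union> B)" by simp
  from closed_pairD(5)[OF assms this] obtain x y where "v \<in> outer_class T A B x y" by auto
  hence "v \<in> outer_class (co T) A B (\<not> x) (\<not> y)" by (simp add: outer_class_co)
  thus "\<exists>x y. v \<in> outer_class (co T) A B x y" by auto
qed

lemma balanced_skew_partition_co:
  assumes "balanced_skew_partition (co T) A B" "trigraph T"
  shows "balanced_skew_partition T B A"
proof -
  have *: "connected_in (co T) X = anticonnected_in T X" if X: "X \<subseteq> verts T" for X
  proof -
    have "{(x, y). x \<in> X \<and> y \<in> X \<and> adj (induced (co T) X) x y} =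
      {(x, y). x \<in> X \<and> y \<in> X \<and> x \<noteq> y \<and> \<not> strongly_adj T x y}"
      using X theta_cases[OF assms(2)] by (fastforce simp: strongly_adj_def)
    thus ?thesis unfolding connected_in_def anticonnected_in_def graph_connected_def by simp
  qed
  have **: "anticonnected_in (co T) X = connected_in T X" if X: "X \<subseteq> verts T" for X
  proof -
    have "{(x, y). x \<in> X \<and> y \<in> X \<and> adj (induced T X) x y} =
      {(x, y). x \<in> X \<and> y \<in> X \<and> x \<noteq> y \<and> \<not> strongly_adj (co T) x y}"
      using X theta_cases[OF assms(2)] by (fastforce simp: strongly_antiadj_def)
    thus ?thesis unfolding connected_in_def anticonnected_in_def graph_connected_def by simp
  qed
  have s: "A \<subseteq> verts T" "B \<subseteq> verts T"
    using assms(1) by (auto simp: balanced_skew_partition_def skew_partition_def)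
  show ?thesis
    using assms(1) *[OF s(1)] **[OF s(2)]
    unfolding balanced_skew_partition_def skew_partition_def antipath_def
    by (auto simp: Un_commute Int_commute)
qed

text \<open>The two classes complete to A are complete to a, and so is B by assumption. Together
  with a they separate the rest of A from the two classes anticomplete to A.\<close>

lemma closed_pair_complete_balanced:
  assumes B: "Berge T" "trigraph T" and cp: "closed_pair T A B" and a: "a \<in> A"
    and aB: "set_complete T {a} B" and A: "A \<noteq> {a}"
  shows "\<exists>X Y. balanced_skew_partition T X Y"
proof -
  let ?O = "outer_class T A B"
  define P11 P10 P01 P00 where P: "P11 = ?O True True" "P10 = ?O True False" "P01 = ?O False True" "P00 = ?O False False"
  define Q where "Q = P11 \<union> P10 \<union> B"
  define R where "R = P01 \<union> P00"
  note sub = closed_pairD(1-3)[OF cp]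
  have ne: "P11 \<noteq> {}" "P10 \<noteq> {}" "P01 \<noteq> {}" "P00 \<noteq> {}" unfolding P by (rule closed_pairD(4)[OF cp])+
  have Os: "P11 \<subseteq> verts T - (A \<union> B)" "P10 \<subseteq> verts T - (A \<union> B)" "P01 \<subseteq> verts T - (A \<union> B)" "P00 \<subseteq> verts T - (A \<union> B)"
    unfolding P by (auto simp: outer_class_def)
  have OA: "set_complete T (P11 \<union> P10) A" "set_anticomplete T (P01 \<union> P00) A"
    "set_complete T (P11 \<union> P01) B" "set_anticomplete T (P10 \<union> P00) B"
    unfolding P by (auto simp: outer_class_def set_complete_def set_anticomplete_def)
  have cov: "verts T - (A \<union> B) \<subseteq> P11 \<union> P10 \<union> (P01 \<union> P00)"
  proof
    fix v assume v: "v \<in> verts T - (A \<union> B)"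
    from closed_pairD(5)[OF cp v] obtain x y where "v \<in> ?O x y" by auto
    thus "v \<in> P11 \<union> P10 \<union> (P01 \<union> P00)" unfolding P by (cases x; cases y) simp_all
  qed
  have dis: "(P11 \<union> P10) \<inter> (P01 \<union> P00) = {}"
  proof -
    have False if "v \<in> P11 \<union> P10" "v \<in> P01 \<union> P00" for v
      using set_completeD[OF OA(1) that(1) a] set_anticompleteD[OF OA(2) that(2) a]
        strongly_adj_not(2) by metis
    thus ?thesis by blast
  qed
  have "balanced_skew_partition T ((A - {a}) \<union> R) ({a} \<union> Q)"
  proof (rule balanced_skew_partitionI[OF B])
    show "verts T = A - {a} \<union> R \<union> ({a} \<union> Q)"
      using cov Os sub a unfolding Q_def R_def by blast
    show "(A - {a} \<union> R) \<inter> ({a} \<union> Q) = {}"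
      using Os sub a dis unfolding Q_def R_def by blast
    show "(A - {a}) \<inter> R = {}" using Os unfolding R_def by blast
    show "{a} \<inter> Q = {}" using Os a sub unfolding Q_def by blast
    show "A - {a} \<noteq> {}" using a A by blast
    show "R \<noteq> {}" "Q \<noteq> {}" "{a} \<noteq> {}" using ne unfolding R_def Q_def by simp_all
    have R': "set_anticomplete T A R" using OA(2) unfolding R_def by (simp only: set_anticomplete_sym)
    show "set_anticomplete T (A - {a}) R" using R' by (rule set_anticomplete_subset) auto
    have "strongly_adj T a q" if "q \<in> P11 \<union> P10" for q
      using set_completeD[OF OA(1) that a] strongly_adj_sym by metis
    moreover have "strongly_adj T a q" if "q \<in> B" for q
      using set_completeD[OF aB _ that] by simp
    ultimately show aQ: "set_complete T {a} Q" unfolding Q_def by (intro set_completeI) blast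
    show "attach_ok T {a} (A - {a})" "attach_ok T {a} R" by (rule attach_ok_singleton)+
    have "set_anticomplete T {a} R" using R' by (rule set_anticomplete_subset) (use a in auto)
    thus "attach_ok T Q R" using aQ sub a by (intro attach_ok_vertex[of a]) auto
    \<comment> \<open>Inside Q only B may attach to \<open>A - {a}\<close> in a mixed way. A vertex
      complete to B and anticomplete to A completes any odd path or antipath between B and
      \<open>A - {a}\<close>.\<close>
    obtain w where w: "w \<in> P01" using ne by blast
    show "attach_ok T Q (A - {a})"
      unfolding attach_ok_def
    proof (intro exI[of _ B] conjI ballI)
      show "B \<subseteq> Q" by (auto simp: Q_def)
      show "set_complete T (Q - B) (A - {a})"
        using OA(1) by (rule set_complete_subset) (auto simp: Q_def)
      show "set_complete T {y} B \<or> set_anticomplete T {y} B" if "y \<in> Q - B" for y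
        using OA(3,4) that set_complete_subset[OF OA(3), of "{y}" B]
          set_anticomplete_subset[OF OA(4), of "{y}" B] by (auto simp: Q_def)
      have "\<exists>w\<in>verts T. set_complete T {w} B \<and> set_anticomplete T {w} (A - {a})"
        using w Os(3) set_complete_subset[OF OA(3), of "{w}" B]
          set_anticomplete_subset[OF OA(2), of "{w}" "A - {a}"] by (intro bexI[of _ w]) auto
      thus "(\<forall>x\<in>B. \<forall>y\<in>B. x = y) \<or> set_anticomplete T B (A - {a}) \<or>
        (\<exists>w\<in>verts T. set_complete T {w} B \<and> set_anticomplete T {w} (A - {a}))" by simp
    qed
  qed
  thus ?thesis by (intro exI)
qed

section \<open>The class \<open>F\<close>\<close>

lemma class_FD:
  assumes "T \<in> class_F"
  shows "trigraph T" "Berge T" "finite (verts T)"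
  using assms by (auto simp: class_F_def trigraph_def)

lemma class_F_co: "T \<in> class_F \<Longrightarrow> co T \<in> class_F"
proof -
  assume T: "T \<in> class_F"
  have s: "switchable (co T) = switchable T" by (intro ext) simp
  have c: "strongly_complete (co T) v S = strongly_anticomplete T v S"
    "strongly_anticomplete (co T) v S = strongly_complete T v S" for v S
    by (auto simp: strongly_complete_def strongly_anticomplete_def)
  show ?thesis using T unfolding class_F_def mem_Collect_eq s c verts_co trigraph_co Berge_co co_rel
    by (simp only: disj_commute) (elim conjE, intro conjI TrueI)
qed

text \<open>All switchable pairs at v lie in a single component of the graph of switchable pairs,
  which has at most two edges.\<close>

lemma class_F_degree:
  assumes T: "T \<in> class_F" and v: "v \<in> verts T"
  shows "card {u. switchable T v u} \<le> 2"
proof -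
  define C where "C = {u. (v, u) \<in> {(x, y). x \<in> verts T \<and> y \<in> verts T \<and> switchable T x y}\<^sup>*}"
  have fin: "finite (verts T)" using T by (rule class_FD)
  have comp: "graph_component (verts T) (switchable T) C"
    unfolding C_def by (rule graph_component_reach[OF v]) (metis switchable_sym)
  hence CV: "C \<subseteq> verts T" by (simp add: graph_component_def)
  have vC: "v \<in> C" by (simp add: C_def)
  have step: "y \<in> C" if "x \<in> C" "switchable T x y" for x y
    using that unfolding C_def by (auto simp: switchable_def intro: rtrancl_into_rtrancl)
  from comp have E: "card {{u, w} | u w. u \<in> C \<and> w \<in> C \<and> switchable T u w} \<le> 2"
    using T unfolding class_F_def by blast
  let ?D = "{u. switchable T v u}"
  have finC: "finite {{u, w} | u w. u \<in> C \<and> w \<in> C \<and> switchable T u w}"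
    by (rule finite_subset[of _ "Pow (verts T)"]) (use CV fin in auto)
  have "inj_on (\<lambda>u. {v, u}) ?D" by (auto simp: inj_on_def doubleton_eq_iff)
  hence "card ?D = card ((\<lambda>u. {v, u}) ` ?D)" by (simp add: card_image)
  also have "\<dots> \<le> card {{u, w} | u w. u \<in> C \<and> w \<in> C \<and> switchable T u w}"
    by (rule card_mono[OF finC]) (use vC step in blast)
  finally show ?thesis using E by simp
qed

text \<open>A vertex with two switchable neighbours is strongly complete or strongly anticomplete to
  all others, so it cannot have both a strong neighbour and a strong antineighbour. In this form the
  second condition of the class enters the structural arguments.\<close>

lemma class_F_two_switchable:
  assumes T: "T \<in> class_F" and s: "switchable T v x" "switchable T v y" "x \<noteq> y"
    and z: "strongly_adj T v z"
  shows "\<not> strongly_antiadj T v z'"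
proof
  assume z': "strongly_antiadj T v z'"
  have v: "v \<in> verts T" using z by (simp add: strongly_adj_def)
  have fin: "finite {u. switchable T v u}"
    by (rule finite_subset[OF _ class_FD(3)[OF T]]) (auto simp: switchable_def)
  have "{u. switchable T v u} = {x, y}"
    using card_seteq[OF fin, of "{x, y}"] class_F_degree[OF T v] s by simp
  hence "(strongly_complete T v (verts T - {v, x, y}) \<and> strongly_adj T x y) \<or>
        (strongly_anticomplete T v (verts T - {v, x, y}) \<and> strongly_antiadj T x y)"
    using T v s(3) unfolding class_F_def by blast
  moreover have "z \<in> verts T - {v, x, y}" using z s
    by (auto simp: strongly_adj_def switchable_def)
  moreover have "z' \<in> verts T - {v, x, y}" using z' s
    by (auto simp: strongly_antiadj_def switchable_def)
  ultimately show False using z z' strongly_adj_not(2) strongly_antiadj_not(2)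
    unfolding strongly_complete_def strongly_anticomplete_def by metis
qed

text \<open>A vertex of A that is complete or anticomplete to B yields a balanced skew-partition of
  T or of its complement, unless it is all of A. So the mixed adjacencies follow as soon as A has
  two vertices, and the work lies in excluding smaller A.\<close>

lemma closed_pair_side:
  assumes T: "T \<in> class_F" and nb: "\<nexists>X Y. balanced_skew_partition T X Y"
    and cp: "closed_pair T A B" and c: "card (A \<union> B) \<ge> 3"
  shows "card A > 1 \<and> (\<forall>a\<in>A. (\<exists>b\<in>B. adj T a b) \<and> (\<exists>b\<in>B. antiadj T a b))"
proof -
  note F = class_FD[OF T]
  note F' = class_FD[OF class_F_co[OF T]]
  have nb': "\<nexists>X Y. balanced_skew_partition (co T) X Y"
    using nb balanced_skew_partition_co[OF _ F(1)] by blast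
  have sub: "A \<subseteq> verts T" "B \<subseteq> verts T" "A \<inter> B = {}" using cp by (simp_all add: closed_pair_def)
  hence fin: "finite A" "finite B" using F(3) finite_subset by blast+
  have nA: "\<not> set_complete T {a} B" "\<not> set_anticomplete T {a} B" if "a \<in> A" "A \<noteq> {a}" for a
    using closed_pair_complete_balanced[OF F(2,1) cp that(1) _ that(2)] nb
      closed_pair_complete_balanced[OF F'(2,1) closed_pair_co[OF cp] that(1) _ that(2)] nb' by auto
  have nB: "\<not> set_complete T {b} A" "\<not> set_anticomplete T {b} A" if "b \<in> B" "B \<noteq> {b}" for b
    using closed_pair_complete_balanced[OF F(2,1) closed_pair_swap[OF cp] that(1) _ that(2)] nb
      closed_pair_complete_balanced[OF F'(2,1) closed_pair_co[OF closed_pair_swap[OF cp]] that(1) _ that(2)] nb'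
    by auto
  have cu: "card (A \<union> B) = card A + card B" using fin sub by (simp add: card_Un_disjoint)
  have two: "card A > 1"
  proof (rule ccontr)
    assume "\<not> card A > 1"
    then consider "card A = 0" | "card A = 1" by linarith
    thus False
    proof cases
      case 1
      hence "A = {}" "card B \<ge> 3" using fin c cu by auto
      moreover obtain b where "b \<in> B" using \<open>card B \<ge> 3\<close> by fastforce
      moreover have "B \<noteq> {b}" using \<open>card B \<ge> 3\<close> by auto
      \<comment> \<open>Every b is vacuously complete to the empty A.\<close>
      ultimately show False using nB(1)[of b] by simp
    next
      case 2
      then obtain a where a: "A = {a}" by (auto simp: card_1_singleton_iff)
      have "card B \<ge> 2" using c cu 2 by simp
      then obtain x y where xy: "x \<in> B" "y \<in> B" "x \<noteq> y"
        by (metis (no_types, lifting) card_2_iff' obtain_subset_with_card_n subset_iff)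
      \<comment> \<open>A vertex of B that is strongly related to the only vertex a would be
        complete or anticomplete to A. So a is switchable with both x and y, while the outer classes
        provide a strong neighbour and a strong antineighbour of a.\<close>
      have sw: "switchable T a b" if b: "b \<in> B" for b
      proof -
        have Bb: "B \<noteq> {b}" using xy by blast
        have "a \<noteq> b" "a \<in> verts T" "b \<in> verts T" using a b sub by auto
        thus ?thesis
        proof (cases rule: pair_cases[OF F(1), of a b])
          case 4
          hence "strongly_adj T b a" by (simp only: strongly_adj_sym)
          hence "set_complete T {b} A" using a by (simp add: set_complete_def)
          thus ?thesis using nB(1)[OF b Bb] by simp
        next
          case 6
          hence "strongly_antiadj T b a" by (simp only: strongly_antiadj_sym)
          hence "set_anticomplete T {b} A" using a by (simp add: set_anticomplete_def)
          thus ?thesis using nB(2)[OF b Bb] by simp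
        qed simp
      qed
      obtain u where "u \<in> outer_class T A B True False" using closed_pairD(4)[OF cp] by (metis ex_in_conv)
      hence "strongly_adj T u a" using a by (simp add: outer_class_def set_complete_def)
      hence u: "strongly_adj T a u" by (simp only: strongly_adj_sym)
      obtain w where "w \<in> outer_class T A B False True" using closed_pairD(4)[OF cp] by (metis ex_in_conv)
      hence "strongly_antiadj T w a" using a by (simp add: outer_class_def set_anticomplete_def)
      hence w: "strongly_antiadj T a w" by (simp only: strongly_antiadj_sym)
      show False using class_F_two_switchable[OF T sw[OF xy(1)] sw[OF xy(2)] xy(3) u] w by blast
    qed
  qed
  moreover have "(\<exists>b\<in>B. adj T a b) \<and> (\<exists>b\<in>B. antiadj T a b)" if a: "a \<in> A" for a
  proof -
    have "A \<noteq> {a}" using two by auto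
    note n = nA[OF a this]
    have v: "a \<in> verts T" "b \<in> verts T" "a \<noteq> b" if "b \<in> B" for b using that a sub by auto
    obtain b where "b \<in> B" "\<not> strongly_adj T a b" using n(1) by (auto simp: set_complete_def)
    hence "b \<in> B" "antiadj T a b" using not_antiadj_iff[OF F(1) v] by auto
    moreover obtain b' where "b' \<in> B" "\<not> strongly_antiadj T a b'" using n(2) by (auto simp: set_anticomplete_def)
    hence "b' \<in> B" "adj T a b'" using not_adj_iff[OF F(1) v] by auto
    ultimately show ?thesis by blast
  qed
  ultimately show ?thesis by blast
qed

text \<open>Three vertices in both sets together exclude all degenerate pairs, so candidates are
  tested for this number instead of for the sizes of A and B.\<close>

lemma closed_pair_proper:
  assumes T: "T \<in> class_F" and nb: "\<nexists>X Y. balanced_skew_partition T X Y"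
    and cp: "closed_pair T A B" and c: "card (A \<union> B) \<ge> 3"
  shows "proper_homogeneous_pair T A B"
proof -
  note 1 = closed_pair_side[OF T nb cp c]
  have c': "card (B \<union> A) \<ge> 3" using c by (simp add: Un_commute)
  note 2 = closed_pair_side[OF T nb closed_pair_swap[OF cp] c']
  define R where "R = verts T - (A \<union> B)"
  have sc: "strongly_complete T v S = set_complete T {v} S"
    "strongly_anticomplete T v S = set_anticomplete T {v} S" for v S
    by (auto simp: strongly_complete_def strongly_anticomplete_def set_complete_def set_anticomplete_def)
  have ne: "outer_class T A B x y \<noteq> {}" for x y using cp by (simp add: closed_pair_def)
  have cov: "\<exists>x y. v \<in> outer_class T A B x y" if "v \<in> R" for v
    using cp that by (simp add: closed_pair_def R_def)
  have "{v \<in> R. set_complete T {v} A} \<union> {v \<in> R. set_anticomplete T {v} A} = R"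
    using cov by (fastforce simp: outer_class_def split: if_splits)
  moreover have "{v \<in> R. set_complete T {v} B} \<union> {v \<in> R. set_anticomplete T {v} B} = R"
    using cov by (fastforce simp: outer_class_def split: if_splits)
  moreover have "{v \<in> R. set_complete T {v} A} \<inter> {v \<in> R. set_complete T {v} B} \<noteq> {}"
    using ne[of True True] by (auto simp: outer_class_def R_def)
  moreover have "{v \<in> R. set_complete T {v} A} \<inter> {v \<in> R. set_anticomplete T {v} B} \<noteq> {}"
    using ne[of True False] by (auto simp: outer_class_def R_def)
  moreover have "{v \<in> R. set_anticomplete T {v} A} \<inter> {v \<in> R. set_complete T {v} B} \<noteq> {}"
    using ne[of False True] by (auto simp: outer_class_def R_def)
  moreover have "{v \<in> R. set_anticomplete T {v} A} \<inter> {v \<in> R. set_anticomplete T {v} B} \<noteq> {}"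
    using ne[of False False] by (auto simp: outer_class_def R_def)
  moreover have "A \<subseteq> verts T" "B \<subseteq> verts T" "A \<inter> B = {}" "A \<noteq> {}" "B \<noteq> {}"
    using cp 1 2 by (auto simp: closed_pair_def)
  ultimately show ?thesis
    unfolding proper_homogeneous_pair_def Let_def sc R_def[symmetric] using 1 2 by simp
qed

section \<open>2-joins: properness, parity, and generation of a minimal side by closures\<close>

section \<open>2-joins without size conditions\<close>

text \<open>The part of a 2-join that a closure guarantees. Sizes are counted separately, and the
  condition on components follows from \<open>prejoin_components\<close>.\<close>

definition prejoin ::
  "'a trigraph \<Rightarrow> 'a set \<Rightarrow> 'a set \<Rightarrow> 'a set \<Rightarrow> 'a set \<Rightarrow> 'a set \<Rightarrow> 'a set \<Rightarrow> bool" where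
  "prejoin T A1 B1 C1 A2 B2 C2 \<longleftrightarrow>
     verts T = (A1 \<union> B1 \<union> C1) \<union> (A2 \<union> B2 \<union> C2) \<and> (A1 \<union> B1 \<union> C1) \<inter> (A2 \<union> B2 \<union> C2) = {} \<and>
     A1 \<inter> B1 = {} \<and> A1 \<inter> C1 = {} \<and> B1 \<inter> C1 = {} \<and>
     A2 \<inter> B2 = {} \<and> A2 \<inter> C2 = {} \<and> B2 \<inter> C2 = {} \<and>
     A1 \<noteq> {} \<and> B1 \<noteq> {} \<and> A2 \<noteq> {} \<and> B2 \<noteq> {} \<and>
     set_complete T A1 A2 \<and> set_complete T B1 B2 \<and>
     set_anticomplete T A1 (B2 \<union> C2) \<and> set_anticomplete T B1 (A2 \<union> C2) \<and>
     set_anticomplete T C1 (A2 \<union> B2 \<union> C2)"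

lemma prejoinD:
  assumes "prejoin T A1 B1 C1 A2 B2 C2"
  shows "verts T = (A1 \<union> B1 \<union> C1) \<union> (A2 \<union> B2 \<union> C2)" "(A1 \<union> B1 \<union> C1) \<inter> (A2 \<union> B2 \<union> C2) = {}"
    "A1 \<inter> B1 = {}" "A1 \<inter> C1 = {}" "B1 \<inter> C1 = {}" "A2 \<inter> B2 = {}" "A2 \<inter> C2 = {}" "B2 \<inter> C2 = {}"
    "A1 \<noteq> {}" "B1 \<noteq> {}" "A2 \<noteq> {}" "B2 \<noteq> {}" "set_complete T A1 A2" "set_complete T B1 B2"
    "set_anticomplete T A1 (B2 \<union> C2)" "set_anticomplete T B1 (A2 \<union> C2)"
    "set_anticomplete T C1 (A2 \<union> B2 \<union> C2)"
  using assms by (simp_all only: prejoin_def simp_thms)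

lemma prejoin_swap: "prejoin T A1 B1 C1 A2 B2 C2 \<Longrightarrow> prejoin T B1 A1 C1 B2 A2 C2"
  unfolding prejoin_def by (simp add: Un_ac Int_ac)

lemma prejoin_flip:
  assumes J: "prejoin T A1 B1 C1 A2 B2 C2"
  shows "prejoin T A2 B2 C2 A1 B1 C1"
proof -
  note D = prejoinD[OF J]
  have "set_complete T A2 A1" "set_complete T B2 B1" using D(13,14) set_complete_sym by metis+
  moreover have "set_anticomplete T A2 (B1 \<union> C1)" "set_anticomplete T B2 (A1 \<union> C1)"
    "set_anticomplete T C2 (A1 \<union> B1 \<union> C1)"
    using D(15,16,17) strongly_antiadj_sym unfolding set_anticomplete_def by (metis UnCI UnE)+
  ultimately show ?thesis using D(1-12) unfolding prejoin_def by (simp add: Un_ac Int_ac)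
qed

lemma two_join_iff_prejoin:
  "two_join T A1 B1 C1 A2 B2 C2 \<longleftrightarrow>
     prejoin T A1 B1 C1 A2 B2 C2 \<and> two_join_side T A1 B1 C1 \<and> two_join_side T A2 B2 C2"
proof
  assume L: "two_join T A1 B1 C1 A2 B2 C2"
  hence s: "two_join_side T A1 B1 C1" "two_join_side T A2 B2 C2"
    and V: "(A1 \<union> B1 \<union> C1) \<union> (A2 \<union> B2 \<union> C2) = verts T" "(A1 \<union> B1 \<union> C1) \<inter> (A2 \<union> B2 \<union> C2) = {}"
    and P: "\<And>u v. u \<in> A1 \<union> B1 \<union> C1 \<Longrightarrow> v \<in> A2 \<union> B2 \<union> C2 \<Longrightarrow>
      if (u \<in> A1 \<and> v \<in> A2) \<or> (u \<in> B1 \<and> v \<in> B2) then strongly_adj T u v else strongly_antiadj T u v"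
    unfolding two_join_def Let_def by simp_all
  have d: "A1 \<inter> B1 = {}" "A1 \<inter> C1 = {}" "B1 \<inter> C1 = {}" "A2 \<inter> B2 = {}" "A2 \<inter> C2 = {}" "B2 \<inter> C2 = {}"
    "A1 \<noteq> {}" "B1 \<noteq> {}" "A2 \<noteq> {}" "B2 \<noteq> {}" using s by (simp_all add: two_join_side_def)
  have "set_complete T A1 A2" "set_complete T B1 B2"
    using P by (auto simp: set_complete_def)
  moreover have "set_anticomplete T A1 (B2 \<union> C2)"
    using P d by (intro set_anticompleteI) (smt (verit) UnCI UnE disjoint_iff)
  moreover have "set_anticomplete T B1 (A2 \<union> C2)"
    using P d by (intro set_anticompleteI) (smt (verit) UnCI UnE disjoint_iff)
  moreover have "set_anticomplete T C1 (A2 \<union> B2 \<union> C2)"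
    using P d by (intro set_anticompleteI) (smt (verit) UnCI UnE disjoint_iff)
  ultimately show "prejoin T A1 B1 C1 A2 B2 C2 \<and> two_join_side T A1 B1 C1 \<and> two_join_side T A2 B2 C2"
    using V d s by (simp add: prejoin_def)
next
  assume R: "prejoin T A1 B1 C1 A2 B2 C2 \<and> two_join_side T A1 B1 C1 \<and> two_join_side T A2 B2 C2"
  note D = prejoinD[OF conjunct1[OF R]]
  have "if (u \<in> A1 \<and> v \<in> A2) \<or> (u \<in> B1 \<and> v \<in> B2) then strongly_adj T u v else strongly_antiadj T u v"
    if u: "u \<in> A1 \<union> B1 \<union> C1" and v: "v \<in> A2 \<union> B2 \<union> C2" for u v
  proof -
    consider "u \<in> A1" | "u \<in> B1" | "u \<in> C1" using u by blast
    thus ?thesis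
    proof cases
      case 1
      hence "u \<notin> B1" using D(3) by blast
      thus ?thesis using 1 v set_completeD[OF D(13) 1, of v] set_anticompleteD[OF D(15) 1, of v] by auto
    next
      case 2
      hence "u \<notin> A1" using D(3) by blast
      thus ?thesis using 2 v set_completeD[OF D(14) 2, of v] set_anticompleteD[OF D(16) 2, of v] by auto
    next
      case 3
      hence "u \<notin> A1" "u \<notin> B1" using D(4,5) by blast+
      thus ?thesis using set_anticompleteD[OF D(17) 3 v] by simp
    qed
  qed
  thus "two_join T A1 B1 C1 A2 B2 C2"
    using R D(1,2) unfolding two_join_def Let_def by simp
qed

text \<open>Connectivity of the full realization in terms of cuts: a search that does not reach
  every vertex yields a violating U directly.\<close>

definition linked :: "'a trigraph \<Rightarrow> bool" where
  "linked T \<longleftrightarrow> (\<forall>U. U \<subseteq> verts T \<and> U \<noteq> {} \<and> U \<noteq> verts T \<longrightarrow> (\<exists>u\<in>U. \<exists>v\<in>verts T - U. adj T u v))"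

lemma not_adj_anticomplete:
  assumes "trigraph T" "X \<subseteq> verts T" "Y \<subseteq> verts T" "X \<inter> Y = {}"
    and "\<And>x y. x \<in> X \<Longrightarrow> y \<in> Y \<Longrightarrow> \<not> adj T x y"
  shows "set_anticomplete T X Y"
proof (rule set_anticompleteI)
  fix x y assume xy: "x \<in> X" "y \<in> Y"
  hence "x \<in> verts T" "y \<in> verts T" "x \<noteq> y" using assms by auto
  thus "strongly_antiadj T x y" using not_adj_iff[OF assms(1)] assms(5)[OF xy] by blast
qed

lemma linkedD:
  assumes "linked T" "trigraph T" "U \<subseteq> verts T" "U \<noteq> {}" "U \<noteq> verts T"
  shows "\<not> set_anticomplete T U (verts T - U)"
proof
  assume a: "set_anticomplete T U (verts T - U)"
  obtain u v where "u \<in> U" "v \<in> verts T - U" "adj T u v" using assms unfolding linked_def by blast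
  thus False using set_anticompleteD[OF a] strongly_antiadj_adj_False(1) by metis
qed

lemma set_anticomplete_Un [simp]:
  "set_anticomplete T (X \<union> Y) Z \<longleftrightarrow> set_anticomplete T X Z \<and> set_anticomplete T Y Z"
  "set_anticomplete T Z (X \<union> Y) \<longleftrightarrow> set_anticomplete T Z X \<and> set_anticomplete T Z Y"
  by (auto simp: set_anticomplete_def)

lemma set_complete_Un [simp]:
  "set_complete T (X \<union> Y) Z \<longleftrightarrow> set_complete T X Z \<and> set_complete T Y Z"
  "set_complete T Z (X \<union> Y) \<longleftrightarrow> set_complete T Z X \<and> set_complete T Z Y"
  by (auto simp: set_complete_def)

text \<open>A component K that misses B1 meets A1 because T is connected. Whether K has vertices in
  C1, is a proper part of A1 or is all of A1, some part of the side can then be cut off by vertices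
  with common neighbours, which is a balanced skew-partition.\<close>

lemma prejoin_component_meets:
  assumes B: "Berge T" "trigraph T" and fin: "finite (verts T)" and nb: "\<nexists>X Y. balanced_skew_partition T X Y"
    and L: "linked T" and J: "prejoin T A1 B1 C1 A2 B2 C2" and c: "card (A1 \<union> B1 \<union> C1) \<ge> 3"
    and K: "component (induced T (A1 \<union> B1 \<union> C1)) K"
  shows "K \<inter> B1 \<noteq> {}"
proof
  assume KB: "K \<inter> B1 = {}"
  let ?X = "A1 \<union> B1 \<union> C1"
  note D = prejoinD[OF J]
  have XV: "?X \<subseteq> verts T" using D(1) by blast
  have gK: "graph_component ?X (adj T) K" using K component_induced[OF XV] by simp
  hence KX: "K \<subseteq> ?X" "K \<noteq> {}" by (simp_all add: graph_component_def)
  have Kn: "set_anticomplete T K (?X - K)"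
  proof (rule not_adj_anticomplete[OF B(2)])
    show "K \<subseteq> verts T" "?X - K \<subseteq> verts T" "K \<inter> (?X - K) = {}" using XV KX by blast+
    show "\<not> adj T x y" if "x \<in> K" "y \<in> ?X - K" for x y
      using graph_component_isolated[OF gK _ that] adj_sym by metis
  qed
  obtain b1 where b1: "b1 \<in> B1" using D(10) by blast
  have AC: "set_anticomplete T A1 B2" "set_anticomplete T A1 C2" "set_anticomplete T B1 A2" "set_anticomplete T B1 C2"
    "set_anticomplete T C1 A2" "set_anticomplete T C1 B2" "set_anticomplete T C1 C2" using D(15-17) by simp_all
  have KA: "K \<inter> A1 \<noteq> {}"
  proof
    assume "K \<inter> A1 = {}"
    hence KC: "K \<subseteq> C1" using KX KB by blast
    have "set_anticomplete T K (A2 \<union> B2 \<union> C2)" using set_anticomplete_subset[OF D(17) KC] by blast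
    hence "set_anticomplete T K ((?X - K) \<union> (A2 \<union> B2 \<union> C2))" using Kn by simp
    moreover have "verts T - K = (?X - K) \<union> (A2 \<union> B2 \<union> C2)" using D(1,2) KX by blast
    ultimately have "set_anticomplete T K (verts T - K)" by simp
    moreover have "K \<subseteq> verts T" "K \<noteq> verts T" using XV KX D(1,2,11) by blast+
    ultimately show False using linkedD[OF L B(2)] KX(2) by blast
  qed
  show False
  proof (cases "K \<inter> C1 = {}")
    case False
    \<comment> \<open>The vertices of K in C1 have neighbours only in \<open>K \<inter> A1\<close>
      and among themselves, so \<open>K \<inter> A1\<close> together with A2 cuts them off.\<close>
    define R where "R = (?X - K) \<union> B2 \<union> C2"
    have "balanced_skew_partition T ((K \<inter> C1) \<union> R) ((K \<inter> A1) \<union> A2)"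
    proof (rule cross_cutset_balanced[OF B])
      show "verts T = K \<inter> C1 \<union> R \<union> (K \<inter> A1 \<union> A2)" using D(1) KX KB unfolding R_def by blast
      show "(K \<inter> C1 \<union> R) \<inter> (K \<inter> A1 \<union> A2) = {}" "K \<inter> C1 \<inter> R = {}" "K \<inter> A1 \<inter> A2 = {}"
        using D(2-8) unfolding R_def by blast+
      show "R \<noteq> {}" using b1 KB unfolding R_def by blast
      show "set_complete T (K \<inter> A1) A2" using D(13) by (rule set_complete_subset) auto
      show "set_anticomplete T (K \<inter> C1) R" "set_anticomplete T (K \<inter> A1) R"
        unfolding R_def using AC Kn
        by (auto intro: set_anticomplete_subset)
      show "set_anticomplete T (K \<inter> C1) A2" using AC(5) by (rule set_anticomplete_subset) auto
    qed (use False KA D(11) in blast)+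
    thus False using nb by blast
  next
    case True
    hence KA1: "K \<subseteq> A1" using KX KB by blast
    \<comment> \<open>A part K' of A1 whose only possible neighbour in the rest of the side is p is
      cut off by p and A2.\<close>
    have twin: False if "p \<in> A1" "K' \<subseteq> A1" "K' \<noteq> {}" "p \<notin> K'"
      "set_anticomplete T K' (?X - K' - {p})" for p K'
    proof -
      define R where "R = verts T - (K' \<union> A2 \<union> {p})"
      have R: "R \<subseteq> (?X - K' - {p}) \<union> (B2 \<union> C2)"
        unfolding R_def using D(1) by blast
      have "balanced_skew_partition T (K' \<union> R) ({p} \<union> A2)"
      proof (rule twin_cutset_balanced[OF B])
        show "K' \<subseteq> verts T" "A2 \<subseteq> verts T" "p \<in> verts T" "p \<notin> K'" "p \<notin> A2" "K' \<inter> A2 = {}"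
          using that(1,2,4) D(1,2) by blast+
        have "b1 \<in> R" unfolding R_def using b1 that(1,2) D(1,2,3) by blast
        thus "R \<noteq> {}" by blast
        show "set_complete T K' A2" "set_complete T {p} A2"
          using set_complete_subset[OF D(13)] that(1,2) by simp_all
        have "set_anticomplete T K' (B2 \<union> C2)"
          by (rule set_anticomplete_subset[OF D(15) that(2) subset_refl])
        hence "set_anticomplete T K' ((?X - K' - {p}) \<union> (B2 \<union> C2))" using that(5) by simp
        thus "set_anticomplete T K' R" by (rule set_anticomplete_subset[OF _ subset_refl R])
      qed (fact that(3) D(11) R_def)+
      thus False using nb by blast
    qed
    show False
    proof (cases "K = A1")
      case False
      then obtain p where p: "p \<in> A1" "p \<notin> K" using KA1 by blast
      show False by (rule twin[OF p(1) KA1 KX(2) p(2)]) (rule set_anticomplete_subset[OF Kn], auto)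
    next
      case KA: True
      show False
      proof (cases "\<exists>a. A1 = {a}")
        case False
        obtain p where p: "p \<in> A1" using D(9) by blast
        have "set_anticomplete T (A1 - {p}) (?X - (A1 - {p}) - {p})"
          using Kn unfolding KA by (rule set_anticomplete_subset) (use p in blast)+
        moreover have "A1 - {p} \<noteq> {}" using False p by blast
        ultimately show False using twin[OF p, of "A1 - {p}"] by simp
      next
        case True
        then obtain a where a: "A1 = {a}" by blast
        \<comment> \<open>A single vertex a has nothing to be cut off from it. But a is isolated
          within its side, so the cut can be made at the other end, around B1.\<close>
        have aX: "set_anticomplete T {a} (B1 \<union> C1)"
          using Kn unfolding KA a by (rule set_anticomplete_subset) (use D(3,4) a in blast)+
        hence Xa: "set_anticomplete T (B1 \<union> C1) {a}" by (simp only: set_anticomplete_sym)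
        show False
        proof (cases "C1 = {}")
          case False
          have "balanced_skew_partition T (C1 \<union> (A1 \<union> A2 \<union> C2)) (B1 \<union> B2)"
          proof (rule cross_cutset_balanced[OF B])
            show "verts T = C1 \<union> (A1 \<union> A2 \<union> C2) \<union> (B1 \<union> B2)" using D(1) by blast
            show "(C1 \<union> (A1 \<union> A2 \<union> C2)) \<inter> (B1 \<union> B2) = {}" "C1 \<inter> (A1 \<union> A2 \<union> C2) = {}" "B1 \<inter> B2 = {}"
              using D(2-8) by blast+
            show "set_anticomplete T C1 (A1 \<union> A2 \<union> C2)" "set_anticomplete T B1 (A1 \<union> A2 \<union> C2)"
              unfolding a using AC Xa by (auto simp: set_anticomplete_def)
          qed (use False D(9,10,12,14) AC(6) in simp_all)
          thus False using nb by blast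
        next
          case True
          have "card B1 \<ge> 2"
            using c a True card_Un_le[of "{a}" B1] by simp
          then obtain p q where pq: "p \<in> B1" "q \<in> B1" "p \<noteq> q"
            by (metis (no_types, lifting) card_2_iff' obtain_subset_with_card_n subset_iff)
          define R where "R = verts T - ((B1 - {p}) \<union> B2 \<union> {p})"
          have R: "R \<subseteq> {a} \<union> A2 \<union> C2" unfolding R_def using D(1) a True pq(1) by blast
          have "balanced_skew_partition T ((B1 - {p}) \<union> R) ({p} \<union> B2)"
          proof (rule twin_cutset_balanced[OF B])
            show "B1 - {p} \<subseteq> verts T" "B2 \<subseteq> verts T" "p \<in> verts T" "p \<notin> B1 - {p}" "p \<notin> B2" "(B1 - {p}) \<inter> B2 = {}"
              using D(1,2) pq by blast+
            show "set_complete T (B1 - {p}) B2" "set_complete T {p} B2"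
              using set_complete_subset[OF D(14)] pq(1) by simp_all
            have "set_anticomplete T B1 ({a} \<union> A2 \<union> C2)" using AC Xa by (auto simp: set_anticomplete_def)
            thus "set_anticomplete T (B1 - {p}) R" by (rule set_anticomplete_subset[OF _ _ R]) auto
            have "a \<in> A1" using a by simp
            hence "a \<in> verts T" "a \<notin> B1" "a \<notin> B2" using D(1) D(2) D(3) by blast+
            hence "a \<in> R" unfolding R_def using pq(1) by blast
            thus "R \<noteq> {}" by blast
            show "B1 - {p} \<noteq> {}" using pq by blast
          qed (fact D(12) R_def)+
          thus False using nb by blast
        qed
      qed
    qed
  qed
qed

lemma prejoin_components:
  assumes B: "Berge T" "trigraph T" and fin: "finite (verts T)" and nb: "\<nexists>X Y. balanced_skew_partition T X Y"
    and L: "linked T" and J: "prejoin T A1 B1 C1 A2 B2 C2" and c: "card (A1 \<union> B1 \<union> C1) \<ge> 3"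
    and K: "component (induced T (A1 \<union> B1 \<union> C1)) K"
  shows "K \<inter> A1 \<noteq> {} \<and> K \<inter> B1 \<noteq> {}"
proof -
  have eq: "B1 \<union> A1 \<union> C1 = A1 \<union> B1 \<union> C1" by blast
  show ?thesis
    using prejoin_component_meets[OF B fin nb L J c K]
      prejoin_component_meets[OF B fin nb L prejoin_swap[OF J], unfolded eq, OF c K] by blast
qed

section \<open>Parity of 2-joins\<close>

text \<open>One path followed by the reverse of the other is a hole: the two sides touch only at the
  seams between A1 and A2 and between B1 and B2. Its length is even because T is Berge.\<close>

lemma join_path_parity:
  assumes B: "Berge T" and J: "prejoin T A1 B1 C1 A2 B2 C2"
    and p: "join_path T A1 B1 C1 p" and q: "join_path T A2 B2 C2 q"
  shows "even (path_length p) = even (path_length q)"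
proof -
  note D = prejoinD[OF J]
  let ?r = "rev q"
  have pp: "path T p" "p \<noteq> []" "distinct p" "set p \<subseteq> verts T" using p by (auto simp: join_path_def path_def)
  have qq: "path T q" "q \<noteq> []" "distinct q" "set q \<subseteq> verts T" using q by (auto simp: join_path_def path_def)
  have p0: "p ! 0 \<in> A1" "p ! (length p - 1) \<in> B1"
    using p pp(2) by (auto simp: join_path_def hd_conv_nth last_conv_nth)
  have q0: "q ! 0 \<in> A2" "q ! (length q - 1) \<in> B2"
    using q qq(2) by (auto simp: join_path_def hd_conv_nth last_conv_nth)
  have pC: "p ! i \<in> C1" if "0 < i" "i < length p - 1" for i
    using p path_interior_nth[OF that] by (auto simp: join_path_def)
  have qC: "q ! i \<in> C2" if "0 < i" "i < length q - 1" for i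
    using q path_interior_nth[OF that] by (auto simp: join_path_def)
  have lp: "length p \<ge> 2"
  proof (rule ccontr)
    assume "\<not> length p \<ge> 2"
    hence "length p - 1 = 0" by simp
    thus False using p0 D(3) by auto
  qed
  have lq: "length q \<ge> 2"
  proof (rule ccontr)
    assume "\<not> length q \<ge> 2"
    hence "length q - 1 = 0" by simp
    thus False using q0 D(6) by auto
  qed
  have pX: "p ! i \<in> A1 \<union> B1 \<union> C1" if "i < length p" for i
  proof -
    have "i = 0 \<or> i = length p - 1 \<or> (0 < i \<and> i < length p - 1)" using that by linarith
    thus ?thesis using p0 pC by blast
  qed
  have qX: "q ! i \<in> A2 \<union> B2 \<union> C2" if "i < length q" for i
  proof -
    have "i = 0 \<or> i = length q - 1 \<or> (0 < i \<and> i < length q - 1)" using that by linarith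
    thus ?thesis using q0 qC by blast
  qed
  have disj: "set p \<inter> set q = {}"
  proof -
    have "set p \<subseteq> A1 \<union> B1 \<union> C1" "set q \<subseteq> A2 \<union> B2 \<union> C2" using pX qX by (metis in_set_conv_nth subsetI)+
    thus ?thesis using D(2) by blast
  qed
  have cross: "if (i = 0 \<and> k = 0) \<or> (i = length p - 1 \<and> k = length q - 1) then adj T (p ! i) (q ! k)
     else antiadj T (p ! i) (q ! k)" if i: "i < length p" and k: "k < length q" for i k
  proof -
    consider "i = 0" | "i = length p - 1" "i \<noteq> 0" | "0 < i" "i < length p - 1" using i by linarith
    thus ?thesis
    proof cases
      case 1
      show ?thesis
      proof (cases "k = 0")
        case True thus ?thesis using 1 set_completeD[OF D(13) p0(1) q0(1)] strongly_adj_imp_adj by auto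
      next
        case False
        hence "q ! k \<in> B2 \<union> C2" using q0(2) qC[of k] k False by (cases "k = length q - 1") simp_all
        hence "antiadj T (p ! 0) (q ! k)"
          by (intro strongly_antiadj_imp_antiadj set_anticompleteD[OF D(15) p0(1)])
        thus ?thesis using 1 False lp by auto
      qed
    next
      case 2
      show ?thesis
      proof (cases "k = length q - 1")
        case True thus ?thesis using 2 set_completeD[OF D(14) p0(2) q0(2)] strongly_adj_imp_adj by auto
      next
        case False
        hence "q ! k \<in> A2 \<union> C2" using q0(1) qC[of k] k False by (cases "k = 0") simp_all
        hence "antiadj T (p ! (length p - 1)) (q ! k)"
          by (intro strongly_antiadj_imp_antiadj set_anticompleteD[OF D(16) p0(2)])
        thus ?thesis using 2 False by auto
      qed
    next
      case 3
      thus ?thesis using set_anticompleteD[OF D(17) pC[OF 3] qX[OF k]] strongly_antiadj_imp_antiadj by auto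
    qed
  qed
  have "hole T (p @ ?r)"
    unfolding hole_def
  proof (intro conjI allI impI)
    show "4 \<le> length (p @ ?r)" using lp lq by simp
    show "distinct (p @ ?r)" using pp qq disj by auto
    show "set (p @ ?r) \<subseteq> verts T" using pp qq by auto
    fix i j assume ij: "i < j \<and> j < length (p @ ?r)"
    let ?n = "length p" let ?m = "length q"
    consider "j < ?n" | "i < ?n" "?n \<le> j" | "?n \<le> i" using ij by linarith
    thus "if j - i = 1 \<or> j - i = length (p @ ?r) - 1 then adj T ((p @ ?r) ! i) ((p @ ?r) ! j)
      else antiadj T ((p @ ?r) ! i) ((p @ ?r) ! j)"
    proof cases
      case 1
      hence "j - i \<noteq> length (p @ ?r) - 1" using lq ij by simp
      moreover have "if j = Suc i then adj T (p ! i) (p ! j) else antiadj T (p ! i) (p ! j)"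
        using pp(1) ij 1 unfolding path_def by blast
      ultimately show ?thesis using ij 1 by (auto simp: nth_append split: if_splits)
    next
      case 2
      \<comment> \<open>The position in q of the vertex at place j of the cycle; the last vertex of
        q follows p directly.\<close>
      define k where "k = ?m - Suc (j - ?n)"
      have k: "k < ?m" and rk: "?r ! (j - ?n) = q ! k" using 2 ij lq by (auto simp: rev_nth k_def)
      have "j - i = 1 \<longleftrightarrow> i = ?n - 1 \<and> k = ?m - 1" using 2 ij lp lq unfolding k_def by auto
      moreover have "j - i = length (p @ ?r) - 1 \<longleftrightarrow> i = 0 \<and> k = 0" using 2 ij lp lq unfolding k_def by auto
      ultimately show ?thesis using cross[OF 2(1) k] 2 rk by (auto simp: nth_append split: if_splits)
    next
      case 3
      define k l where kl: "k = ?m - Suc (i - ?n)" "l = ?m - Suc (j - ?n)"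
      have lk: "l < k" "k < ?m" using 3 ij unfolding kl by auto
      have r: "?r ! (i - ?n) = q ! k" "?r ! (j - ?n) = q ! l" using 3 ij by (auto simp: rev_nth kl)
      have "j - i \<noteq> length (p @ ?r) - 1"
      proof -
        have "j - i < ?m" using ij 3 unfolding length_append length_rev by linarith
        thus ?thesis using lp by simp
      qed
      moreover have "j - i = 1 \<longleftrightarrow> k = Suc l" using 3 ij unfolding kl by auto
      moreover have "if k = Suc l then adj T (q ! l) (q ! k) else antiadj T (q ! l) (q ! k)"
        using qq(1) lk unfolding path_def by blast
      ultimately show ?thesis using 3 ij r adj_sym[of T "q ! l" "q ! k"] antiadj_sym[of T "q ! l" "q ! k"]
        by (auto simp: nth_append split: if_splits)
    qed
  qed
  hence "even (length (p @ ?r))" using B unfolding Berge_def by blast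
  thus ?thesis using lp lq unfolding path_length_def by auto
qed

lemma proper_two_join_prejoin:
  assumes "proper_two_join T A1 B1 C1 A2 B2 C2"
  shows "prejoin T A1 B1 C1 A2 B2 C2" "two_join_side T A1 B1 C1" "two_join_side T A2 B2 C2"
    "\<And>K. component (induced T (A1 \<union> B1 \<union> C1)) K \<Longrightarrow> K \<inter> A1 \<noteq> {} \<and> K \<inter> B1 \<noteq> {}"
    "\<And>K. component (induced T (A2 \<union> B2 \<union> C2)) K \<Longrightarrow> K \<inter> A2 \<noteq> {} \<and> K \<inter> B2 \<noteq> {}"
  using assms by (simp_all add: proper_two_join_def two_join_iff_prejoin)

lemma component_containing:
  assumes "X \<subseteq> verts T" "x \<in> X"
  obtains K where "component (induced T X) K" "x \<in> K" "K \<subseteq> X" "graph_connected K (adj T)"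
proof -
  let ?K = "{u. (x, u) \<in> {(x, y). x \<in> X \<and> y \<in> X \<and> adj T x y}\<^sup>*}"
  have g: "graph_component X (adj T) ?K"
    by (rule graph_component_reach[OF assms(2)]) (metis adj_sym)
  show thesis
  proof (rule that)
    show "component (induced T X) ?K" using g by (simp only: component_induced[OF assms(1)])
    show "x \<in> ?K" by simp
    show "?K \<subseteq> X" "graph_connected ?K (adj T)" using g by (simp_all only: graph_component_def)
  qed
qed

text \<open>Every component of either side meets A1 or A2, and A1 is complete to A2. Hence seeds for
  2-joins may be rejected when there is no spanning tree.\<close>

lemma proper_two_join_linked:
  assumes J: "proper_two_join T A1 B1 C1 A2 B2 C2"
  shows "linked T"
  unfolding linked_def
proof (intro allI impI, rule ccontr)
  note P = proper_two_join_prejoin[OF J]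
  note D = prejoinD[OF P(1)]
  fix U assume U: "U \<subseteq> verts T \<and> U \<noteq> {} \<and> U \<noteq> verts T"
    and no: "\<not> (\<exists>u\<in>U. \<exists>v\<in>verts T - U. adj T u v)"
  have same: "x \<in> U \<longleftrightarrow> y \<in> U" if "adj T x y" for x y
  proof -
    have "x \<in> verts T" "y \<in> verts T" using that by (simp_all add: adj_def)
    thus ?thesis using no that adj_sym[of T x y] by blast
  qed
  have conn: "x \<in> U \<longleftrightarrow> y \<in> U" if gc: "graph_connected K (adj T)" "x \<in> K" "y \<in> K" for K x y
  proof (rule ccontr)
    assume "\<not> ?thesis"
    hence "K \<inter> U \<noteq> {}" "K \<inter> U \<noteq> K" using gc by blast+
    then obtain u v where "u \<in> K \<inter> U" "v \<in> K - K \<inter> U" "adj T u v"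
      using graph_connected_cut[OF gc(1), of "K \<inter> U"] by (metis Int_lower1)
    thus False using same[of u v] by blast
  qed
  obtain a1 where a1: "a1 \<in> A1" using D(9) by blast
  obtain a2 where a2: "a2 \<in> A2" using D(11) by blast
  have A2: "a \<in> U \<longleftrightarrow> a1 \<in> U" if "a \<in> A2" for a
    using same[OF strongly_adj_imp_adj[OF set_completeD[OF D(13) a1 that]]] by simp
  have A1: "a \<in> U \<longleftrightarrow> a1 \<in> U" if "a \<in> A1" for a
    using same[OF strongly_adj_imp_adj[OF set_completeD[OF D(13) that a2]]] A2[OF a2] by simp
  have "x \<in> U \<longleftrightarrow> a1 \<in> U" if x: "x \<in> verts T" for x
  proof (cases "x \<in> A1 \<union> B1 \<union> C1")
    case True
    have "A1 \<union> B1 \<union> C1 \<subseteq> verts T" using D(1) by blast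
    then obtain K where K: "component (induced T (A1 \<union> B1 \<union> C1)) K" "x \<in> K" "graph_connected K (adj T)"
      using component_containing[OF _ True] by metis
    obtain a where "a \<in> K" "a \<in> A1" using P(4)[OF K(1)] by blast
    thus ?thesis using conn[OF K(3,2), of a] A1[of a] by simp
  next
    case False
    hence X: "x \<in> A2 \<union> B2 \<union> C2" using x D(1) by blast
    have "A2 \<union> B2 \<union> C2 \<subseteq> verts T" using D(1) by blast
    then obtain K where K: "component (induced T (A2 \<union> B2 \<union> C2)) K" "x \<in> K" "graph_connected K (adj T)"
      using component_containing[OF _ X] by metis
    obtain a where "a \<in> K" "a \<in> A2" using P(5)[OF K(1)] by blast
    thus ?thesis using conn[OF K(3,2), of a] A2[of a] by simp
  qed
  thus False using U by blast
qed

text \<open>The walk is shortest among all walks from A to B, not only among those from a to b: a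
  chord would shorten it, and an interior vertex in A or B could replace an end. Thus a layered
  search that ignores chords finds the parity.\<close>

lemma shortest_walk_join_path:
  assumes T: "trigraph T" and X: "A \<union> B \<union> C \<subseteq> verts T"
    and E: "E = {(x, y). x \<in> A \<union> B \<union> C \<and> y \<in> A \<union> B \<union> C \<and> adj T x y}"
    and ab: "a \<in> A" "b \<in> B" "(a, b) \<in> E ^^ k"
    and least: "\<And>j a b. j < k \<Longrightarrow> a \<in> A \<Longrightarrow> b \<in> B \<Longrightarrow> (a, b) \<notin> E ^^ j"
  shows "\<exists>p. join_path T A B C p \<and> path_length p = k \<and> length p = Suc k"
proof -
  obtain f where f: "f 0 = a" "f k = b" "\<And>i. i < k \<Longrightarrow> (f i, f (Suc i)) \<in> E"
    using ab(3) unfolding relpow_fun_conv by blast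
  have seg: "(f i, f j) \<in> E ^^ (j - i)" if "i \<le> j" "j \<le> k" for i j
    unfolding relpow_fun_conv
    by (rule exI[of _ "\<lambda>m. f (i + m)"]) (use that f(3) in auto)
  \<comment> \<open>A walk of m steps may replace the segment from \<open>f i\<close> to
    \<open>f j\<close>.\<close>
  have short: "m \<ge> j - i" if "i \<le> j" "j \<le> k" "(f i, f j) \<in> E ^^ m" for i j m
  proof (rule ccontr)
    assume "\<not> m \<ge> j - i"
    have "(a, f i) \<in> E ^^ i" using seg[of 0 i] that f(1) by simp
    hence "(a, f j) \<in> E ^^ i O E ^^ m" using that(3) by (rule relcompI)
    moreover have "(f j, b) \<in> E ^^ (k - j)" using seg[of j k] that f(2) by simp
    ultimately have "(a, b) \<in> (E ^^ i O E ^^ m) O E ^^ (k - j)" by (rule relcompI)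
    hence "(a, b) \<in> E ^^ (i + m + (k - j))" by (simp only: relpow_add)
    moreover have "i + m + (k - j) < k" using \<open>\<not> m \<ge> j - i\<close> that(1,2) by linarith
    ultimately show False using least[OF _ ab(1,2)] by blast
  qed
  have fX: "f i \<in> A \<union> B \<union> C" if "i \<le> k" for i
  proof (cases "i = k")
    case True thus ?thesis using f(2) ab(2) by blast
  next
    case False
    hence "(f i, f (Suc i)) \<in> E" using that f(3) by simp
    thus ?thesis unfolding E by blast
  qed
  have dist: "f i \<noteq> f j" if "i < j" "j \<le> k" for i j
    using short[of i j 0] that by auto
  define p where "p = map f [0..<Suc k]"
  have len: "length p = Suc k" by (simp add: p_def)
  have nth: "p ! i = f i" if "i \<le> k" for i using that by (simp add: p_def nth_map del: upt_Suc)
  have "path T p"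
    unfolding path_def
  proof (intro conjI allI impI)
    show "p \<noteq> []" using len by auto
    show "distinct p" unfolding distinct_conv_nth len
      using dist nth by (metis less_Suc_eq_le linorder_neqE_nat)
    show "set p \<subseteq> verts T"
    proof
      fix x assume "x \<in> set p"
      then obtain i where "i < Suc k" "x = p ! i" unfolding in_set_conv_nth len by blast
      hence "i \<le> k" "x = f i" using nth[of i] by simp_all
      thus "x \<in> verts T" using fX[of i] X by blast
    qed
    fix i j assume ij: "i < j \<and> j < length p"
    hence jk: "i < j" "j \<le> k" using len by auto
    have v: "f i \<in> verts T" "f j \<in> verts T" using fX[of i] fX[of j] jk X by auto
    show "if j = Suc i then adj T (p ! i) (p ! j) else antiadj T (p ! i) (p ! j)"
    proof (cases "j = Suc i")
      case True
      hence "(f i, f j) \<in> E" using f(3)[of i] jk by simp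
      thus ?thesis using True jk nth unfolding E by auto
    next
      case False
      have "\<not> adj T (f i) (f j)"
      proof
        assume "adj T (f i) (f j)"
        hence "(f i, f j) \<in> E ^^ 1" using fX[of i] fX[of j] jk unfolding E by simp
        thus False using short[of i j 1] jk False by simp
      qed
      hence "strongly_antiadj T (f i) (f j)" using not_adj_iff[OF T v dist[OF jk]] by simp
      thus ?thesis using False jk nth strongly_antiadj_imp_antiadj by simp
    qed
  qed
  moreover have "hd p \<in> A" "last p \<in> B"
  proof -
    have "p \<noteq> []" using len by auto
    thus "hd p \<in> A" "last p \<in> B" using len nth[of 0] nth[of k] f ab by (simp_all add: hd_conv_nth last_conv_nth)
  qed
  moreover have "path_interior p \<subseteq> C"
  proof
    fix x assume "x \<in> path_interior p"
    then obtain i where i: "0 < i" "i < k" "x = f i" using nth len by (auto simp: path_interior_eq)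
    have "(f i, b) \<in> E ^^ (k - i)" "(a, f i) \<in> E ^^ i" using seg[of i k] seg[of 0 i] i f by auto
    hence "f i \<notin> A" "f i \<notin> B" using least[of "k - i" "f i" b] least[of i a "f i"] i ab by auto
    thus "x \<in> C" using fX[of i] i by auto
  qed
  ultimately show ?thesis using len by (intro exI[of _ p]) (simp add: join_path_def path_length_def)
qed

lemma walk_exists:
  assumes X: "A \<union> B \<union> C \<subseteq> verts T" and A: "A \<noteq> {}"
    and E: "E = {(x, y). x \<in> A \<union> B \<union> C \<and> y \<in> A \<union> B \<union> C \<and> adj T x y}"
    and comp: "\<And>K. component (induced T (A \<union> B \<union> C)) K \<Longrightarrow> K \<inter> A \<noteq> {} \<and> K \<inter> B \<noteq> {}"
  shows "\<exists>k. \<exists>a\<in>A. \<exists>b\<in>B. (a, b) \<in> E ^^ k"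
proof -
  obtain a where a: "a \<in> A" using A by blast
  hence aX: "a \<in> A \<union> B \<union> C" by blast
  obtain K where K: "component (induced T (A \<union> B \<union> C)) K" "a \<in> K" "K \<subseteq> A \<union> B \<union> C" "graph_connected K (adj T)"
    by (rule component_containing[OF X aX])
  obtain b where b: "b \<in> K" "b \<in> B" using comp[OF K(1)] by blast
  have "(a, b) \<in> {(x, y). x \<in> K \<and> y \<in> K \<and> adj T x y}\<^sup>*" using K b unfolding graph_connected_def by blast
  moreover have "{(x, y). x \<in> K \<and> y \<in> K \<and> adj T x y} \<subseteq> E" unfolding E using K(3) by blast
  ultimately have "(a, b) \<in> E\<^sup>*" using rtrancl_mono by blast
  then obtain k where "(a, b) \<in> E ^^ k" by (auto simp: rtrancl_power)
  thus ?thesis using a b by blast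
qed

lemma least_walk_join_path:
  assumes T: "trigraph T" and X: "A \<union> B \<union> C \<subseteq> verts T" and A: "A \<noteq> {}"
    and E: "E = {(x, y). x \<in> A \<union> B \<union> C \<and> y \<in> A \<union> B \<union> C \<and> adj T x y}"
    and comp: "\<And>K. component (induced T (A \<union> B \<union> C)) K \<Longrightarrow> K \<inter> A \<noteq> {} \<and> K \<inter> B \<noteq> {}"
  obtains k p where "join_path T A B C p" "path_length p = k" "length p = Suc k"
    "\<And>j a b. j < k \<Longrightarrow> a \<in> A \<Longrightarrow> b \<in> B \<Longrightarrow> (a, b) \<notin> E ^^ j" "\<exists>a\<in>A. \<exists>b\<in>B. (a, b) \<in> E ^^ k"
proof -
  let ?P = "\<lambda>k. \<exists>a\<in>A. \<exists>b\<in>B. (a, b) \<in> E ^^ k"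
  obtain k where k: "?P k" "\<And>j. j < k \<Longrightarrow> \<not> ?P j"
    using walk_exists[OF X A E comp] exists_least_iff[of ?P] by blast
  then obtain a b where ab: "a \<in> A" "b \<in> B" "(a, b) \<in> E ^^ k" by blast
  have l: "(a, b) \<notin> E ^^ j" if "j < k" "a \<in> A" "b \<in> B" for j a b using k(2) that by blast
  from shortest_walk_join_path[OF T X E ab l] obtain p where
    "join_path T A B C p" "path_length p = k" "length p = Suc k" by blast
  from that[OF this l k(1)] show thesis .
qed

text \<open>A path q on the second side, which exists because components meet both ends, transfers
  the parity of p to all paths of the first side, and p transfers it to those of the second.\<close>

lemma two_join_parity:
  assumes B: "Berge T" "trigraph T" and J: "proper_two_join T A1 B1 C1 A2 B2 C2"
    and p: "join_path T A1 B1 C1 p"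
  shows "even (path_length p) \<Longrightarrow> even_two_join T A1 B1 C1 A2 B2 C2"
    "odd (path_length p) \<Longrightarrow> odd_two_join T A1 B1 C1 A2 B2 C2"
proof -
  note P = proper_two_join_prejoin[OF J]
  note D = prejoinD[OF P(1)]
  have X: "A2 \<union> B2 \<union> C2 \<subseteq> verts T" using D(1) by blast
  obtain q where q: "join_path T A2 B2 C2 q"
    by (rule least_walk_join_path[OF B(2) X D(11) refl P(5)])
  have e: "even (path_length r) = even (path_length p)"
    if "join_path T A1 B1 C1 r \<or> join_path T A2 B2 C2 r" for r
    using that join_path_parity[OF B(1) P(1)] p q by blast
  show "even (path_length p) \<Longrightarrow> even_two_join T A1 B1 C1 A2 B2 C2"
    using e J unfolding even_two_join_def by blast
  show "odd (path_length p) \<Longrightarrow> odd_two_join T A1 B1 C1 A2 B2 C2"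
    using e J unfolding odd_two_join_def by blast
qed

lemma path_pair: "adj T a b \<Longrightarrow> path T [a, b]"
  by (auto simp: path_def adj_def less_Suc_eq nth_Cons')

lemma path_triple:
  assumes "adj T a c" "adj T c b" "antiadj T a b"
  shows "path T [a, c, b]"
proof -
  have "if j = Suc i then adj T ([a, c, b] ! i) ([a, c, b] ! j) else antiadj T ([a, c, b] ! i) ([a, c, b] ! j)"
    if "i < j \<and> j < length [a, c, b]" for i j
  proof -
    have "i = 0 \<and> j = 1 \<or> i = 0 \<and> j = 2 \<or> i = 1 \<and> j = 2" using that by auto
    thus ?thesis using assms by auto
  qed
  moreover have "distinct [a, c, b]" "set [a, c, b] \<subseteq> verts T"
    using assms by (auto simp: adj_def antiadj_def)
  ultimately show ?thesis unfolding path_def by blast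
qed

text \<open>A side of three vertices with nonempty C1 is forced to be the very path that a 2-join
  must not have. If c misses a or b, or if a and b are strongly adjacent, then a strongly adjacent
  pair cuts off c; if a and b are switchable, there are paths of both parities.\<close>

lemma prejoin_three:
  assumes B: "Berge T" "trigraph T" and nb: "\<nexists>X Y. balanced_skew_partition T X Y"
    and J: "prejoin T A1 B1 C1 A2 B2 C2" and c3: "card (A1 \<union> B1 \<union> C1) = 3" and c: "c \<in> C1"
    and q: "join_path T A2 B2 C2 q"
  obtains a b where "A1 = {a}" "B1 = {b}" "C1 = {c}" "adj T a c" "adj T c b" "strongly_antiadj T a b"
proof -
  note D = prejoinD[OF J]
  obtain a b where ab: "a \<in> A1" "b \<in> B1" using D(9,10) by blast
  have ne: "a \<noteq> b" "a \<noteq> c" "b \<noteq> c" using ab c D(3,4,5) by blast+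
  have fin: "finite (A1 \<union> B1 \<union> C1)" using c3 by (intro card_ge_0_finite) simp
  have "{a, b, c} = A1 \<union> B1 \<union> C1"
    by (rule card_subset_eq[OF fin]) (use ab c ne c3 in auto)
  hence sub: "A1 \<subseteq> {a, b, c}" "B1 \<subseteq> {a, b, c}" "C1 \<subseteq> {a, b, c}" by blast+
  have s: "A1 = {a}" "B1 = {b}" "C1 = {c}"
    using sub(1) ab c D(3,4) apply blast
    using sub(2) ab c D(3,5) apply blast
    using sub(3) ab c D(4,5) by blast
  obtain a2 b2 where ab2: "a2 \<in> A2" "b2 \<in> B2" using D(11,12) by blast
  have v: "a \<in> verts T" "b \<in> verts T" "c \<in> verts T" "a2 \<in> verts T" "b2 \<in> verts T"
    using D(1) ab ab2 c by blast+
  have cX: "strongly_antiadj T c x" if "x \<in> A2 \<union> B2 \<union> C2" for x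
    using set_anticompleteD[OF D(17) c that] .
  have out: "a2 \<notin> {a, b, c}" "b2 \<notin> {a, b, c}" "a2 \<noteq> b2"
    using D(2,6) s ab2 by blast+
  \<comment> \<open>All neighbours of c are among p and r, so this strongly adjacent pair separates
    c from x.\<close>
  have cut: False if p: "p \<in> {a, b}" "strongly_adj T p r" "r \<in> verts T" "r \<notin> {p, c}"
    and x: "x \<in> verts T" "x \<notin> {c, p, r}"
    and n: "\<And>y. y \<in> {a, b} \<Longrightarrow> y \<notin> {p, r} \<Longrightarrow> strongly_antiadj T c y" for p r x
  proof -
    define R where "R = verts T - {c, p, r}"
    have "set_anticomplete T {c} R"
    proof (rule set_anticompleteI)
      fix x' y assume xy: "x' \<in> {c}" "y \<in> R"
      hence "y \<in> {a, b} - {p, r} \<or> y \<in> A2 \<union> B2 \<union> C2" using D(1) s unfolding R_def by blast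
      thus "strongly_antiadj T x' y" using xy n cX by blast
    qed
    moreover have "p \<in> verts T" "p \<noteq> c" using p(1) v ne by auto
    hence "verts T = {c} \<union> R \<union> {p, r}" "p \<notin> {c} \<union> R" "r \<notin> {c} \<union> R" "{c} \<inter> R = {}" "x \<in> R"
      using p(3,4) x v(3) unfolding R_def by auto
    ultimately have "balanced_skew_partition T ({c} \<union> R) ({p} \<union> {r})"
      using p(2) by (intro edge_cutset_balanced[OF B]) auto
    thus False using nb by blast
  qed
  have sa: "strongly_adj T a a2" "strongly_adj T b b2"
    using set_completeD[OF D(13) ab(1) ab2(1)] set_completeD[OF D(14) ab(2) ab2(2)] by blast+
  have ca: "adj T a c"
  proof (rule ccontr)
    assume "\<not> adj T a c"
    hence "strongly_antiadj T c a" using not_adj_iff[OF B(2) v(1,3) ne(2)] strongly_antiadj_sym by metis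
    moreover have "b2 \<notin> {b, c}" "a \<notin> {c, b, b2}" using out(2) ne by auto
    ultimately show False by (intro cut[of b b2 a]) (use sa v in auto)
  qed
  have cb: "adj T c b"
  proof (rule ccontr)
    assume "\<not> adj T c b"
    hence "strongly_antiadj T c b" using not_adj_iff[OF B(2) v(3,2)] ne by metis
    moreover have "a2 \<notin> {a, c}" "b \<notin> {c, a, a2}" using out(1) ne by auto
    ultimately show False by (intro cut[of a a2 b]) (use sa v in auto)
  qed
  have "strongly_antiadj T a b"
  proof (cases rule: pair_cases[OF B(2) v(1,2) ne(1)])
    case 1
    moreover have "b \<notin> {a, c}" "a2 \<notin> {c, a, b}" using out(1) ne by auto
    ultimately have False by (intro cut[of a b a2]) (use v in auto)
    thus ?thesis ..
  next
    case 2
    note sw = switchable_imp[OF 2]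
    \<comment> \<open>A switchable pair counts as adjacent on the first path and as antiadjacent on
      the second.\<close>
    have "join_path T A1 B1 C1 [a, b]" "join_path T A1 B1 C1 [a, c, b]"
      using path_pair[OF sw(1)] path_triple[OF ca cb sw(2)] ab c
      by (simp_all add: join_path_def path_interior_def)
    from this[THEN join_path_parity[OF B(1) J _ q]] show ?thesis by (simp add: path_length_def)
  qed
  thus thesis by (intro that[OF s ca cb])
qed

text \<open>The middle of a forbidden path of length two lies in neither of the singletons A1 and
  B1, hence in C1.\<close>

lemma prejoin_two_join_side:
  assumes J: "prejoin T A1 B1 C1 A2 B2 C2" and c: "card (A1 \<union> B1 \<union> C1) \<ge> 3"
    and c3: "card (A1 \<union> B1 \<union> C1) = 3 \<Longrightarrow> C1 = {}"
  shows "two_join_side T A1 B1 C1"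
proof -
  note D = prejoinD[OF J]
  have "\<not> realization_is_path2 (induced T (A1 \<union> B1 \<union> C1)) a b" if "A1 = {a}" "B1 = {b}" for a b
  proof
    assume "realization_is_path2 (induced T (A1 \<union> B1 \<union> C1)) a b"
    then obtain d where d: "a \<noteq> b" "d \<noteq> a" "d \<noteq> b" "A1 \<union> B1 \<union> C1 = {a, d, b}"
      unfolding realization_is_path2_def by auto
    hence "card (A1 \<union> B1 \<union> C1) = 3" by simp
    thus False using c3 d that by blast
  qed
  thus ?thesis using D(3,4,5,9,10) c unfolding two_join_side_def by simp
qed

text \<open>For connected T properness is a matter of counting: each side has at least three
  vertices and, if exactly three, none in C. The converse is \<open>proper_two_join_card\<close>, so
  a test by counting rejects no proper 2-join.\<close>

lemma prejoin_proper:
  assumes T: "T \<in> class_F" and nb: "\<nexists>X Y. balanced_skew_partition T X Y" and L: "linked T"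
    and J: "prejoin T A1 B1 C1 A2 B2 C2"
    and c: "card (A1 \<union> B1 \<union> C1) \<ge> 3" "card (A1 \<union> B1 \<union> C1) = 3 \<Longrightarrow> C1 = {}"
    and c': "card (A2 \<union> B2 \<union> C2) \<ge> 3" "card (A2 \<union> B2 \<union> C2) = 3 \<Longrightarrow> C2 = {}"
  shows "proper_two_join T A1 B1 C1 A2 B2 C2"
  using J prejoin_two_join_side[OF J c] prejoin_two_join_side[OF prejoin_flip[OF J] c']
    prejoin_components[OF class_FD(2,1,3)[OF T] nb L J c(1)]
    prejoin_components[OF class_FD(2,1,3)[OF T] nb L prejoin_flip[OF J] c'(1)]
  by (simp add: proper_two_join_def two_join_iff_prejoin)

lemma proper_two_join_card:
  assumes T: "T \<in> class_F" and nb: "\<nexists>X Y. balanced_skew_partition T X Y"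
    and J: "proper_two_join T A1 B1 C1 A2 B2 C2"
  shows "card (A1 \<union> B1 \<union> C1) \<ge> 3" "card (A1 \<union> B1 \<union> C1) = 3 \<Longrightarrow> C1 = {}"
proof -
  note P = proper_two_join_prejoin[OF J]
  note D = prejoinD[OF P(1)]
  show "card (A1 \<union> B1 \<union> C1) \<ge> 3" using P(2) by (simp add: two_join_side_def)
  assume c3: "card (A1 \<union> B1 \<union> C1) = 3"
  show "C1 = {}"
  proof (rule ccontr)
    assume "C1 \<noteq> {}"
    then obtain c where c: "c \<in> C1" by blast
    have X: "A2 \<union> B2 \<union> C2 \<subseteq> verts T" using D(1) by blast
    obtain q where q: "join_path T A2 B2 C2 q"
      by (rule least_walk_join_path[OF class_FD(1)[OF T] X D(11) refl P(5)])
    obtain a b where ab: "A1 = {a}" "B1 = {b}" "C1 = {c}" "adj T a c" "adj T c b" "strongly_antiadj T a b"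
      by (rule prejoin_three[OF class_FD(2,1)[OF T] nb P(1) c3 c q])
    have "realization_is_path2 (induced T (A1 \<union> B1 \<union> C1)) a b"
      unfolding realization_is_path2_def
    proof (intro conjI exI[of _ c])
      show "a \<noteq> b" "c \<noteq> a" "c \<noteq> b" using ab(4-6) by (auto simp: adj_def strongly_antiadj_def)
      show "verts (induced T (A1 \<union> B1 \<union> C1)) = {a, c, b}" unfolding ab(1-3) by auto
      have "a \<in> A1 \<union> B1 \<union> C1" "b \<in> A1 \<union> B1 \<union> C1" "c \<in> A1 \<union> B1 \<union> C1" unfolding ab(1-3) by auto
      thus "adj (induced T (A1 \<union> B1 \<union> C1)) a c" "adj (induced T (A1 \<union> B1 \<union> C1)) c b"
        using ab(4,5) by (simp_all add: adj_def induced_def)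
      show "\<not> adj (induced T (A1 \<union> B1 \<union> C1)) a b"
        using ab(6) by (simp add: strongly_antiadj_def)
    qed
    moreover have no: "\<forall>a b. A1 = {a} \<and> B1 = {b} \<longrightarrow> \<not> realization_is_path2 (induced T (A1 \<union> B1 \<union> C1)) a b"
      using P(2) unfolding two_join_side_def by (elim conjE)
    ultimately show False using no[rule_format, OF conjI[OF ab(1,2)]] by (elim notE)
  qed
qed

lemma proper_two_join_flip:
  "proper_two_join T A1 B1 C1 A2 B2 C2 \<Longrightarrow> proper_two_join T A2 B2 C2 A1 B1 C1"
  using prejoin_flip by (simp add: proper_two_join_def two_join_iff_prejoin) blast

text \<open>A tree edge may cross the join between B1 and B2; then the two ends of the join exchange
  names.\<close>

lemma proper_two_join_swap:
  assumes "proper_two_join T A1 B1 C1 A2 B2 C2"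
  shows "proper_two_join T B1 A1 C1 B2 A2 C2"
proof -
  have eq: "B1 \<union> A1 \<union> C1 = A1 \<union> B1 \<union> C1" "B2 \<union> A2 \<union> C2 = A2 \<union> B2 \<union> C2" by blast+
  have "two_join_side T B A C" if "two_join_side T A B C" for A B C
  proof -
    have e: "B \<union> A \<union> C = A \<union> B \<union> C" by blast
    have "realization_is_path2 S a b" if r: "realization_is_path2 S b a" for S :: "'a trigraph" and a b
    proof -
      obtain c where "a \<noteq> b" "c \<noteq> a" "c \<noteq> b" "verts S = {b, c, a}" "adj S b c" "adj S c a" "\<not> adj S b a"
        using r unfolding realization_is_path2_def by blast
      thus ?thesis unfolding realization_is_path2_def using adj_sym[of S]
        by (intro conjI exI[of _ c]) auto
    qed
    thus ?thesis using that unfolding two_join_side_def e by (simp add: Int_commute) metis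
  qed
  thus ?thesis using assms prejoin_swap[of T A1 B1 C1 A2 B2 C2]
    unfolding proper_two_join_def two_join_iff_prejoin eq by blast
qed

section \<open>Minimal 2-joins\<close>

text \<open>What a vertex v outside must satisfy to belong to the other side when the members of S
  keep their labels. Only members of S are consulted, so some label may still be missing in
  S.\<close>

definition join_closed :: "'a trigraph \<Rightarrow> 'a set \<Rightarrow> 'a set \<Rightarrow> 'a set \<Rightarrow> 'a set \<Rightarrow> bool" where
  "join_closed T A B C S \<longleftrightarrow> (\<forall>v\<in>verts T - S.
     (\<forall>x\<in>S. \<not> switchable T x v) \<and>
     (\<forall>x\<in>S \<inter> A. \<forall>y\<in>S \<inter> A. strongly_adj T x v = strongly_adj T y v) \<and>
     (\<forall>x\<in>S \<inter> B. \<forall>y\<in>S \<inter> B. strongly_adj T x v = strongly_adj T y v) \<and>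
     (\<forall>x\<in>S \<inter> C. \<not> strongly_adj T x v) \<and>
     (\<forall>x\<in>S \<inter> A. \<forall>y\<in>S \<inter> B. \<not> (strongly_adj T x v \<and> strongly_adj T y v)))"

lemma join_closedD:
  assumes "join_closed T A B C S" "v \<in> verts T" "v \<notin> S"
  shows "x \<in> S \<Longrightarrow> \<not> switchable T x v"
    "x \<in> S \<Longrightarrow> x \<in> A \<Longrightarrow> y \<in> S \<Longrightarrow> y \<in> A \<Longrightarrow> strongly_adj T x v = strongly_adj T y v"
    "x \<in> S \<Longrightarrow> x \<in> B \<Longrightarrow> y \<in> S \<Longrightarrow> y \<in> B \<Longrightarrow> strongly_adj T x v = strongly_adj T y v"
    "x \<in> S \<Longrightarrow> x \<in> C \<Longrightarrow> \<not> strongly_adj T x v"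
    "x \<in> S \<Longrightarrow> x \<in> A \<Longrightarrow> y \<in> S \<Longrightarrow> y \<in> B \<Longrightarrow> strongly_adj T x v \<Longrightarrow> \<not> strongly_adj T y v"
proof -
  have v: "v \<in> verts T - S" using assms by simp
  note J = bspec[OF assms(1)[unfolded join_closed_def] v]
  note J1 = J[THEN conjunct1] and J' = J[THEN conjunct2]
  note J2 = J'[THEN conjunct1] and J'' = J'[THEN conjunct2]
  note J3 = J''[THEN conjunct1] and J4 = J''[THEN conjunct2, THEN conjunct1] and J5 = J''[THEN conjunct2, THEN conjunct2]
  show "x \<in> S \<Longrightarrow> \<not> switchable T x v" by (rule bspec[OF J1])
  show "x \<in> S \<Longrightarrow> x \<in> A \<Longrightarrow> y \<in> S \<Longrightarrow> y \<in> A \<Longrightarrow> strongly_adj T x v = strongly_adj T y v"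
    by (rule J2[THEN bspec, THEN bspec]) (rule IntI; assumption)+
  show "x \<in> S \<Longrightarrow> x \<in> B \<Longrightarrow> y \<in> S \<Longrightarrow> y \<in> B \<Longrightarrow> strongly_adj T x v = strongly_adj T y v"
    by (rule J3[THEN bspec, THEN bspec]) (rule IntI; assumption)+
  show "x \<in> S \<Longrightarrow> x \<in> C \<Longrightarrow> \<not> strongly_adj T x v"
    by (rule J4[THEN bspec]) (rule IntI; assumption)
  have *: "x \<in> S \<Longrightarrow> x \<in> A \<Longrightarrow> y \<in> S \<Longrightarrow> y \<in> B \<Longrightarrow> \<not> (strongly_adj T x v \<and> strongly_adj T y v)"
    by (rule J5[THEN bspec, THEN bspec]) (rule IntI; assumption)+
  show "x \<in> S \<Longrightarrow> x \<in> A \<Longrightarrow> y \<in> S \<Longrightarrow> y \<in> B \<Longrightarrow> strongly_adj T x v \<Longrightarrow> \<not> strongly_adj T y v"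
    using * by simp
qed

lemma join_closed_strong:
  assumes "trigraph T" "join_closed T A B C S" "S \<subseteq> verts T" "v \<in> verts T" "v \<notin> S" "x \<in> S"
  shows "strongly_antiadj T x v \<longleftrightarrow> \<not> strongly_adj T x v"
proof -
  have "x \<noteq> v" "x \<in> verts T" using assms by auto
  thus ?thesis using pair_cases[OF assms(1) _ assms(4), of x] join_closedD(1)[OF assms(2,4,5,6)]
      strongly_adj_not(2) by metis
qed

text \<open>Members with label A agree on every outside vertex, and so do members with label B.
  Therefore the single vertices a and b determine the other side.\<close>

lemma join_closed_prejoin:
  assumes T: "trigraph T" and jc: "join_closed T A B C S"
    and S: "S \<subseteq> verts T" "S \<subseteq> A \<union> B \<union> C" and d: "A \<inter> B = {}" "A \<inter> C = {}" "B \<inter> C = {}"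
    and a: "a \<in> S" "a \<in> A" "a' \<in> verts T - S" "strongly_adj T a a'"
    and b: "b \<in> S" "b \<in> B" "b' \<in> verts T - S" "strongly_adj T b b'"
  shows "prejoin T (S \<inter> A) (S \<inter> B) (S \<inter> C) {v \<in> verts T - S. strongly_adj T a v}
    {v \<in> verts T - S. strongly_adj T b v} {v \<in> verts T - S. \<not> strongly_adj T a v \<and> \<not> strongly_adj T b v}"
    (is "prejoin T ?A ?B ?C ?A' ?B' ?C'")
proof -
  note J = join_closedD[OF jc]
  have anti: "strongly_antiadj T x v" if "x \<in> S" "v \<in> verts T" "v \<notin> S" "\<not> strongly_adj T x v" for x v
    using join_closed_strong[OF T jc S(1) that(2,3,1)] that(4) by simp
  have X: "?A \<union> ?B \<union> ?C = S" using S(2) by blast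
  have Y: "?A' \<union> ?B' \<union> ?C' = verts T - S" by blast
  have ab: "\<not> strongly_adj T b v" if "v \<in> verts T" "v \<notin> S" "strongly_adj T a v" for v
    using J(5)[OF that(1,2) a(1,2) b(1,2) that(3)] .
  have Aa: "strongly_adj T x v = strongly_adj T a v" if "x \<in> ?A" "v \<in> verts T - S" for x v
    using J(2)[of v x a] that a by simp
  have Bb: "strongly_adj T x v = strongly_adj T b v" if "x \<in> ?B" "v \<in> verts T - S" for x v
    using J(3)[of v x b] that b by simp
  show ?thesis
    unfolding prejoin_def X Y
  proof (intro conjI)
    show "verts T = S \<union> (verts T - S)" "S \<inter> (verts T - S) = {}" using S by blast+
    show "?A \<inter> ?B = {}" "?A \<inter> ?C = {}" "?B \<inter> ?C = {}" using d by blast+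
    show "?A' \<inter> ?B' = {}" using ab by blast
    show "?A' \<inter> ?C' = {}" "?B' \<inter> ?C' = {}" by blast+
    show "?A \<noteq> {}" "?B \<noteq> {}" "?A' \<noteq> {}" "?B' \<noteq> {}" using a b by blast+
    show "set_complete T ?A ?A'" using Aa by (intro set_completeI) simp
    show "set_complete T ?B ?B'" using Bb by (intro set_completeI) simp
    show "set_anticomplete T ?A (?B' \<union> ?C')"
    proof (rule set_anticompleteI)
      fix x v assume x: "x \<in> ?A" and v: "v \<in> ?B' \<union> ?C'"
      hence "v \<in> verts T - S" "\<not> strongly_adj T a v" using ab by blast+
      thus "strongly_antiadj T x v" using Aa[OF x, of v] anti[of x v] x by simp
    qed
    show "set_anticomplete T ?B (?A' \<union> ?C')"
    proof (rule set_anticompleteI)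
      fix x v assume x: "x \<in> ?B" and v: "v \<in> ?A' \<union> ?C'"
      hence "v \<in> verts T - S" "\<not> strongly_adj T b v" using ab by blast+
      thus "strongly_antiadj T x v" using Bb[OF x, of v] anti[of x v] x by simp
    qed
    show "set_anticomplete T ?C (verts T - S)"
    proof (rule set_anticompleteI)
      fix x v assume "x \<in> ?C" "v \<in> verts T - S"
      thus "strongly_antiadj T x v" using J(4)[of v x] anti[of x v] by simp
    qed
  qed
qed

text \<open>If no closure were all of the minimal side, \<open>A1\<close> would consist of \<open>a1\<close> only and every vertex of
  \<open>C1\<close> would be the middle of a path of length two from \<open>a1\<close> to \<open>B1\<close>; then either a twin cutset appears or
  removing \<open>a1\<close> leaves a smaller 2-join.\<close>

lemma minimal_two_join_generated:
  assumes T: "T \<in> class_F" and nb: "\<nexists>X Y. balanced_skew_partition T X Y"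
    and J: "proper_two_join T A1 B1 C1 A2 B2 C2"
    and min: "\<And>A B C A' B' C'. proper_two_join T A B C A' B' C' \<Longrightarrow> \<not> A \<union> B \<union> C \<subset> A1 \<union> B1 \<union> C1"
    and a1: "a1 \<in> A1" and a2: "a2 \<in> A2" and b2: "b2 \<in> B2"
    and S: "\<And>c. c \<in> A1 \<union> B1 \<union> C1 \<Longrightarrow> a1 \<in> S c \<and> c \<in> S c \<and> S c \<subseteq> A1 \<union> B1 \<union> C1 \<and> join_closed T A1 B1 C1 (S c)"
  shows "\<exists>c\<in>A1 \<union> B1 \<union> C1. S c = A1 \<union> B1 \<union> C1"
proof (rule ccontr)
  let ?X = "A1 \<union> B1 \<union> C1"
  assume "\<not> ?thesis"
  hence neq: "S c \<noteq> ?X" if "c \<in> ?X" for c using that by blast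
  note F = class_FD[OF T]
  note P = proper_two_join_prejoin[OF J]
  note D = prejoinD[OF P(1)]
  note L = proper_two_join_linked[OF J]
  have XV: "?X \<subseteq> verts T" and X2V: "A2 \<union> B2 \<union> C2 \<subseteq> verts T" using D(1) by blast+
  have finX: "finite ?X" using finite_subset[OF XV F(3)] .
  have aX: "a1 \<in> ?X" using a1 by blast
  have nX: "a2 \<notin> ?X" "b2 \<notin> ?X" using D(2) a2 b2 by blast+
  have v2: "a2 \<in> verts T" "b2 \<in> verts T" "a1 \<in> verts T" using X2V XV a1 a2 b2 by blast+
  have sa: "strongly_adj T a1 a2" using set_completeD[OF D(13) a1 a2] .
  have san: "strongly_antiadj T a1 b2" using set_anticompleteD[OF D(15) a1] b2 by blast
  have card2: "card (A2 \<union> B2 \<union> C2) \<ge> 3" using P(3) by (simp add: two_join_side_def)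
  have card1: "card ?X \<ge> 3" using P(2) by (simp add: two_join_side_def)
  have Ssub: "S c \<subseteq> ?X" "a1 \<in> S c" "c \<in> S c" "join_closed T A1 B1 C1 (S c)" "S c \<subseteq> verts T"
    "a2 \<notin> S c" "b2 \<notin> S c" if "c \<in> ?X" for c
    using S[OF that] XV nX by blast+
  have strong: "strongly_antiadj T x v \<longleftrightarrow> \<not> strongly_adj T x v"
    if "c \<in> ?X" "x \<in> S c" "v \<in> verts T" "v \<notin> S c" for c x v
    using join_closed_strong[OF F(1) Ssub(4,5)[OF that(1)] that(3,4,2)] .
  obtain q where q: "join_path T A2 B2 C2 q"
    by (rule least_walk_join_path[OF F(1) X2V D(11) refl P(5)])
  \<comment> \<open>A closure without vertices of B1 can be cut off, in whole or in part: with Q the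
    outside neighbours of a1, its vertices in C1 are separated by its vertices in A1 and Q; if there
    are none in C1, the rest is separated by a1 and Q.\<close>
  have meetB: "S c \<inter> B1 \<noteq> {}" if c: "c \<in> ?X" "c \<noteq> a1" for c
  proof
    assume SB: "S c \<inter> B1 = {}"
    note s = Ssub[OF c(1)]
    define Q where "Q = {v \<in> verts T - S c. strongly_adj T a1 v}"
    define R where "R = verts T - S c - Q"
    have Q2: "a2 \<in> Q" using sa v2 s unfolding Q_def by simp
    have R2: "b2 \<in> R" using san v2 s strongly_antiadj_not(2)[OF san] unfolding R_def Q_def by simp
    have A: "strongly_adj T x v \<longleftrightarrow> v \<in> Q" if "x \<in> S c \<inter> A1" "v \<in> verts T - S c" for x v
      using join_closedD(2)[OF s(4), of v x a1] that s(2) a1 unfolding Q_def by simp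
    have AQ: "set_complete T (S c \<inter> A1) Q" using A unfolding Q_def by (intro set_completeI) auto
    have AR: "set_anticomplete T (S c \<inter> A1) R"
    proof (rule set_anticompleteI)
      fix x v assume xv: "x \<in> S c \<inter> A1" "v \<in> R"
      hence "\<not> strongly_adj T x v" using A[OF xv(1), of v] unfolding R_def by simp
      thus "strongly_antiadj T x v" using strong[OF c(1), of x v] xv unfolding R_def by simp
    qed
    have CV: "set_anticomplete T (S c \<inter> C1) (verts T - S c)"
    proof (rule set_anticompleteI)
      fix x v assume xv: "x \<in> S c \<inter> C1" "v \<in> verts T - S c"
      hence "\<not> strongly_adj T x v" using join_closedD(4)[OF s(4), of v x] by simp
      thus "strongly_antiadj T x v" using strong[OF c(1), of x v] xv by simp
    qed
    have Sc: "S c = (S c \<inter> A1) \<union> (S c \<inter> C1)" using s(1) SB by blast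
    have QV: "Q \<subseteq> verts T - S c" "R \<subseteq> verts T - S c" unfolding Q_def R_def by blast+
    show False
    proof (cases "S c \<inter> C1 = {}")
      case False
      have "balanced_skew_partition T ((S c \<inter> C1) \<union> R) ((S c \<inter> A1) \<union> Q)"
      proof (rule cross_cutset_balanced[OF F(2,1)])
        have "verts T = S c \<union> Q \<union> R" using s(5) QV(1) unfolding R_def by blast
        thus "verts T = S c \<inter> C1 \<union> R \<union> (S c \<inter> A1 \<union> Q)" using Sc by blast
        show "(S c \<inter> C1 \<union> R) \<inter> (S c \<inter> A1 \<union> Q) = {}" using QV D(4) unfolding R_def by blast
        show "S c \<inter> C1 \<inter> R = {}" "S c \<inter> A1 \<inter> Q = {}" using QV by blast+
        show "S c \<inter> A1 \<noteq> {}" using s(2) a1 by blast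
        show "set_anticomplete T (S c \<inter> C1) R" "set_anticomplete T (S c \<inter> C1) Q"
          using set_anticomplete_subset[OF CV subset_refl] QV by blast+
      qed (use False R2 Q2 AQ AR in blast)+
      thus False using nb by blast
    next
      case True
      hence SA: "S c \<subseteq> A1" using Sc by blast
      hence SA': "S c \<inter> A1 = S c" by blast
      have "balanced_skew_partition T ((S c - {a1}) \<union> R) ({a1} \<union> Q)"
      proof (rule twin_cutset_balanced[OF F(2,1)])
        show "S c - {a1} \<subseteq> verts T" "Q \<subseteq> verts T" using s(5) QV by blast+
        show "a1 \<in> verts T" "a1 \<notin> S c - {a1}" "a1 \<notin> Q" using v2 QV s(2) by blast+
        show "(S c - {a1}) \<inter> Q = {}" using QV by blast
        show "R = verts T - (S c - {a1} \<union> Q \<union> {a1})" unfolding R_def using s(2) by blast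
        show "S c - {a1} \<noteq> {}" using s(3) c(2) by blast
        show "Q \<noteq> {}" "R \<noteq> {}" using Q2 R2 by blast+
        show "set_complete T (S c - {a1}) Q" "set_complete T {a1} Q"
          using set_complete_subset[OF AQ[unfolded SA']] s(2) by blast+
        show "set_anticomplete T (S c - {a1}) R" using set_anticomplete_subset[OF AR[unfolded SA']] by blast
      qed
      thus False using nb by blast
    qed
  qed
  have pj: "prejoin T (S c \<inter> A1) (S c \<inter> B1) (S c \<inter> C1) {v \<in> verts T - S c. strongly_adj T a1 v}
      {v \<in> verts T - S c. strongly_adj T b v} {v \<in> verts T - S c. \<not> strongly_adj T a1 v \<and> \<not> strongly_adj T b v}"
    if c: "c \<in> ?X" and b: "b \<in> S c" "b \<in> B1" for c b
    by (rule join_closed_prejoin[OF F(1) Ssub(4,5,1)[OF c] D(3-5) Ssub(2)[OF c] a1 _ sa b _ set_completeD[OF D(14) b(2) b2]])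
      (use v2 Ssub(6,7)[OF c] in blast)+
  have Sun: "S c \<inter> A1 \<union> S c \<inter> B1 \<union> S c \<inter> C1 = S c" if "c \<in> ?X" for c
    using Ssub(1)[OF that] by blast
  \<comment> \<open>Any other size would make the closure a proper 2-join below the minimal
    one.\<close>
  have small: "card (S c) < 3 \<or> card (S c) = 3 \<and> S c \<inter> C1 \<noteq> {}" if c: "c \<in> ?X" "c \<noteq> a1" for c
  proof (rule ccontr)
    assume n: "\<not> ?thesis"
    obtain b where b: "b \<in> S c" "b \<in> B1" using meetB[OF c] by blast
    let ?Y = "{v \<in> verts T - S c. strongly_adj T a1 v} \<union> {v \<in> verts T - S c. strongly_adj T b v} \<union>
      {v \<in> verts T - S c. \<not> strongly_adj T a1 v \<and> \<not> strongly_adj T b v}"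
    have Y: "?Y = verts T - S c" by blast
    \<comment> \<open>The other side had three vertices and gains at least one, so the exceptional
      size three cannot occur there.\<close>
    have "A2 \<union> B2 \<union> C2 \<subset> verts T - S c"
      using Ssub(1)[OF c(1)] neq[OF c(1)] D(1,2) by blast
    hence "card (A2 \<union> B2 \<union> C2) < card ?Y" unfolding Y using psubset_card_mono[of "verts T - S c"] F(3) by blast
    hence Y4: "card ?Y \<ge> 4" using card2 by linarith
    have "proper_two_join T (S c \<inter> A1) (S c \<inter> B1) (S c \<inter> C1) {v \<in> verts T - S c. strongly_adj T a1 v}
      {v \<in> verts T - S c. strongly_adj T b v} {v \<in> verts T - S c. \<not> strongly_adj T a1 v \<and> \<not> strongly_adj T b v}"
      by (rule prejoin_proper[OF T nb L pj[OF c(1) b]]) (use n Y4 in \<open>simp_all only: Sun[OF c(1)]\<close>, auto)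
    from min[OF this] show False using Sun[OF c(1)] Ssub(1)[OF c(1)] neq[OF c(1)] by blast
  qed
  have finS: "finite (S c)" if "c \<in> ?X" for c using finite_subset[OF Ssub(1)[OF that] finX] .
  \<comment> \<open>The closure of a1 and a second vertex of A1 also meets B1. So it would have
    exactly three vertices, none of them in C1, which \<open>small\<close> rules out.\<close>
  have A1: "A1 = {a1}"
  proof (rule ccontr)
    assume "A1 \<noteq> {a1}"
    then obtain c where c: "c \<in> A1" "c \<noteq> a1" using a1 by blast
    hence cX: "c \<in> ?X" by blast
    obtain b where b: "b \<in> S c" "b \<in> B1" using meetB[OF cX c(2)] by blast
    have ne: "b \<noteq> a1" "b \<noteq> c" using b c a1 D(3) by blast+
    have sub: "{a1, c, b} \<subseteq> S c" using Ssub(2,3)[OF cX] b by blast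
    have c3: "card {a1, c, b} = 3" using ne c by auto
    hence "card (S c) \<ge> 3" using card_mono[OF finS[OF cX] sub] by simp
    hence s: "card (S c) = 3" "S c \<inter> C1 \<noteq> {}" using small[OF cX c(2)] by auto
    have eq: "S c = {a1, c, b}" by (rule card_subset_eq[OF finS[OF cX] sub, symmetric]) (simp only: s(1) c3)
    have "a1 \<notin> C1" "c \<notin> C1" using a1 c(1) D(4) by blast+
    moreover have "b \<notin> C1" using b(2) D(5) by blast
    ultimately show False using s(2) unfolding eq by simp
  qed
  have aB: "x \<noteq> a1" if "x \<in> B1 \<union> C1" for x using that a1 D(3,4) by blast
  have AC: "set_anticomplete T B1 A2" "set_anticomplete T B1 C2" "set_anticomplete T C1 A2"
    "set_anticomplete T C1 B2" "set_anticomplete T C1 C2" using D(16,17) by simp_all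
  \<comment> \<open>If the rest of B1 has no neighbours in a1 and C1, then p together with B2 cuts
    it off.\<close>
  have twinB: False if p: "p \<in> B1" and K: "B1 - {p} \<noteq> {}" and n: "set_anticomplete T (B1 - {p}) ({a1} \<union> C1)" for p
  proof -
    define R where "R = verts T - ((B1 - {p}) \<union> B2 \<union> {p})"
    have R: "R \<subseteq> ({a1} \<union> C1) \<union> (A2 \<union> C2)" unfolding R_def using D(1) A1 by blast
    have "balanced_skew_partition T ((B1 - {p}) \<union> R) ({p} \<union> B2)"
    proof (rule twin_cutset_balanced[OF F(2,1) _ _ _ _ _ _ R_def K D(12)])
      show "B1 - {p} \<subseteq> verts T" "B2 \<subseteq> verts T" "p \<in> verts T" "p \<notin> B1 - {p}" "p \<notin> B2" "(B1 - {p}) \<inter> B2 = {}"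
        using D(1,2) p by blast+
      show "set_complete T (B1 - {p}) B2" "set_complete T {p} B2"
        using set_complete_subset[OF D(14)] p by blast+
      have "set_anticomplete T (B1 - {p}) (A2 \<union> C2)" using set_anticomplete_subset[OF D(16)] by blast
      hence "set_anticomplete T (B1 - {p}) (({a1} \<union> C1) \<union> (A2 \<union> C2))" using n by (simp only: set_anticomplete_Un)
      thus "set_anticomplete T (B1 - {p}) R" by (rule set_anticomplete_subset[OF _ subset_refl R])
      have "a1 \<notin> B1" "a1 \<notin> B2" using a1 D(3) D(2) by blast+
      hence "a1 \<in> R" unfolding R_def using v2(3) p by blast
      thus "R \<noteq> {}" by blast
    qed
    thus False using nb by blast
  qed
  show False
  proof (cases "C1 = {}")
    case True
    have X1: "?X = {a1} \<union> B1" using A1 True by blast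
    obtain K where K: "component (induced T ?X) K" "a1 \<in> K" "K \<subseteq> ?X" "graph_connected K (adj T)"
      by (rule component_containing[OF XV aX])
    obtain b0 where b0: "b0 \<in> K" "b0 \<in> B1" using P(4)[OF K(1)] by blast
    have "{a1} \<subseteq> K" "{a1} \<noteq> {}" "{a1} \<noteq> K" using K(2) b0 aB by blast+
    then obtain u b where ub: "u \<in> {a1}" "b \<in> K - {a1}" "adj T u b"
      by (rule graph_connected_cut[OF K(4)])
    hence b: "b \<in> B1" "adj T a1 b" using K(3) X1 by blast+
    have vb: "b \<in> verts T" "a1 \<noteq> b" using b XV aB by blast+
    have "B1 - {b} \<noteq> {}"
    proof
      assume "B1 - {b} = {}"
      hence "?X = {a1, b}" using X1 b by blast
      hence "card ?X \<le> 2" by (simp add: card_insert_if)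
      thus False using card1 by simp
    qed
    note KB = this
    \<comment> \<open>The side now consists of a1 and B1. A strong neighbour p of a1 in B1 gives the
      cutset of p against a1 and B2; otherwise a1 is joined to B1 by switchable pairs only.\<close>
    show False
    proof (cases "\<exists>p\<in>B1. strongly_adj T a1 p")
      case True
      then obtain p where p: "p \<in> B1" "strongly_adj T a1 p" by blast
      hence pa: "strongly_adj T p a1" by (simp only: strongly_adj_sym)
      have K': "B1 - {p} \<noteq> {}"
      proof
        assume "B1 - {p} = {}"
        hence "?X = {a1, p}" using X1 p by blast
        hence "card ?X \<le> 2" by (simp add: card_insert_if)
        thus False using card1 by simp
      qed
      have pv: "p \<in> verts T" using p XV by blast
      have "balanced_skew_partition T ((B1 - {p}) \<union> (A2 \<union> C2)) ({p} \<union> ({a1} \<union> B2))"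
      proof (rule balanced_skew_partitionI[OF F(2,1)])
        have "verts T = ({a1} \<union> B1) \<union> (A2 \<union> B2 \<union> C2)" using D(1) X1 by simp
        thus "verts T = B1 - {p} \<union> (A2 \<union> C2) \<union> ({p} \<union> ({a1} \<union> B2))" using p by blast
        have "a1 \<notin> A2 \<union> B2 \<union> C2" "B1 \<inter> (A2 \<union> B2 \<union> C2) = {}" using D(2) a1 by blast+
        thus "(B1 - {p} \<union> (A2 \<union> C2)) \<inter> ({p} \<union> ({a1} \<union> B2)) = {}" "(B1 - {p}) \<inter> (A2 \<union> C2) = {}"
          "{p} \<inter> ({a1} \<union> B2) = {}"
          using aB p D(6,8) by blast+
        show "B1 - {p} \<noteq> {}" by (rule K')
        show "A2 \<union> C2 \<noteq> {}" "{p} \<noteq> {}" "{a1} \<union> B2 \<noteq> {}" using a2 by blast+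
        have BA: "set_anticomplete T B1 (A2 \<union> C2)" using D(16) .
        show "set_anticomplete T (B1 - {p}) (A2 \<union> C2)" using set_anticomplete_subset[OF BA] by blast
        have "set_complete T {p} B2" using set_complete_subset[OF D(14)] p by blast
        thus pQ: "set_complete T {p} ({a1} \<union> B2)" using pa by (auto simp: set_complete_def)
        show "attach_ok T {p} (B1 - {p})" "attach_ok T {p} (A2 \<union> C2)" by (rule attach_ok_singleton)+
        show "attach_ok T ({a1} \<union> B2) (A2 \<union> C2)"
          by (rule attach_ok_vertex[OF pv pQ]) (use set_anticomplete_subset[OF BA] p in blast)
        \<comment> \<open>B2 is complete to B1 and anticomplete to a1, so a1 is the only vertex of
          this half with mixed adjacencies.\<close>
        show "attach_ok T ({a1} \<union> B2) (B1 - {p})"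
          unfolding attach_ok_def
        proof (intro exI[of _ "{a1}"] conjI ballI)
          show "{a1} \<subseteq> {a1} \<union> B2" by blast
          have "set_complete T B2 B1" using D(14) by (simp only: set_complete_sym)
          thus "set_complete T ({a1} \<union> B2 - {a1}) (B1 - {p})" by (rule set_complete_subset) blast+
          fix y assume "y \<in> {a1} \<union> B2 - {a1}"
          hence "strongly_antiadj T a1 y" using set_anticompleteD[OF D(15) a1] by blast
          hence "strongly_antiadj T y a1" by (simp only: strongly_antiadj_sym)
          thus "set_complete T {y} {a1} \<or> set_anticomplete T {y} {a1}" by (simp add: set_anticomplete_def)
        qed simp
      qed
      thus False using nb by blast
    next
      case False
      have nsa: "switchable T a1 x \<or> strongly_antiadj T a1 x" if "x \<in> B1" for x
      proof -
        have "x \<in> verts T" "a1 \<noteq> x" using that XV aB by blast+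
        thus ?thesis using pair_cases[OF F(1) v2(3)] False that by metis
      qed
      \<comment> \<open>Since a1 has the strong neighbour a2 and the strong antineighbour b2, it is
        in at most one switchable pair. Hence all of B1 except b is anticomplete to a1.\<close>
      have sb: "switchable T a1 b"
        using nsa[OF b(1)] b(2) strongly_antiadj_not(1) by metis
      have "strongly_antiadj T x a1" if "x \<in> B1 - {b}" for x
      proof -
        have "\<not> switchable T a1 x"
          using class_F_two_switchable[OF T sb _ _ sa, of x b2] san that by blast
        hence "strongly_antiadj T a1 x" using nsa that by blast
        thus ?thesis by (simp only: strongly_antiadj_sym)
      qed
      hence "set_anticomplete T (B1 - {b}) ({a1} \<union> C1)" using True by (simp add: set_anticomplete_def)
      thus False by (rule twinB[OF b(1) KB])
    qed
  next
    case False
    \<comment> \<open>The closure of c contains a1, c and a vertex of B1, and \<open>small\<close>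
      leaves no room for more. By \<open>prejoin_three\<close> these vertices form a path of length
      two.\<close>
    have tri: "\<exists>b\<in>B1. S c = {a1, c, b} \<and> adj T a1 c \<and> adj T c b \<and> strongly_antiadj T a1 b" if c: "c \<in> C1" for c
    proof -
      have cX: "c \<in> ?X" "c \<noteq> a1" using c aB by blast+
      obtain b where b: "b \<in> S c" "b \<in> B1" using meetB[OF cX] by blast
      have ne: "b \<noteq> a1" "b \<noteq> c" using b c aB D(5) by blast+
      have sub: "{a1, c, b} \<subseteq> S c" using Ssub(2,3)[OF cX(1)] b by blast
      have c3: "card {a1, c, b} = 3" using ne cX(2) by auto
      hence "card (S c) \<ge> 3" using card_mono[OF finS[OF cX(1)] sub] by simp
      hence s: "card (S c) = 3" using small[OF cX] by auto
      have Sc: "S c = {a1, c, b}" by (rule card_subset_eq[OF finS[OF cX(1)] sub, symmetric]) (simp only: s c3)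
      let ?Y = "{v \<in> verts T - S c. strongly_adj T a1 v} \<union> {v \<in> verts T - S c. strongly_adj T b v} \<union>
        {v \<in> verts T - S c. \<not> strongly_adj T a1 v \<and> \<not> strongly_adj T b v}"
      have Y: "?Y = verts T - S c" by blast
      have "A2 \<union> B2 \<union> C2 \<subseteq> verts T - S c" using Ssub(1)[OF cX(1)] D(1,2) by blast
      hence "card (A2 \<union> B2 \<union> C2) \<le> card ?Y" unfolding Y using card_mono[of "verts T - S c"] F(3) by blast
      hence Y3: "card ?Y \<ge> 3" using card2 by linarith
      note pjc = pj[OF cX(1) b]
      have YV: "?Y \<subseteq> verts T" by blast
      have ne': "{v \<in> verts T - S c. strongly_adj T a1 v} \<noteq> {}" using prejoinD(11)[OF pjc] .
      obtain q' where q': "join_path T {v \<in> verts T - S c. strongly_adj T a1 v} {v \<in> verts T - S c. strongly_adj T b v}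
        {v \<in> verts T - S c. \<not> strongly_adj T a1 v \<and> \<not> strongly_adj T b v} q'"
        by (rule least_walk_join_path[OF F(1) YV ne' refl prejoin_components[OF F(2,1,3) nb L prejoin_flip[OF pjc] Y3]])
      have c3': "card (S c \<inter> A1 \<union> S c \<inter> B1 \<union> S c \<inter> C1) = 3" using s Sun[OF cX(1)] by simp
      have cS: "c \<in> S c \<inter> C1" using c Sc by blast
      obtain x y where xy: "S c \<inter> A1 = {x}" "S c \<inter> B1 = {y}" "adj T x c" "adj T c y" "strongly_antiadj T x y"
        by (rule prejoin_three[OF F(2,1) nb pjc c3' cS q'])
      have "a1 \<in> S c \<inter> A1" "b \<in> S c \<inter> B1" using Ssub(2)[OF cX(1)] a1 b by simp_all
      hence "x = a1" "y = b" unfolding xy(1,2) by simp_all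
      thus ?thesis using xy Sc b(2) by blast
    qed
    obtain c where c: "c \<in> C1" using False by blast
    obtain b where b: "b \<in> B1" "S c = {a1, c, b}" "adj T a1 c" "adj T c b" "strongly_antiadj T a1 b"
      using tri[OF c] by blast
    have even: "join_path T A1 B1 C1 [a1, c, b]"
      using path_triple[OF b(3,4) strongly_antiadj_imp_antiadj[OF b(5)]] a1 b c
      by (simp add: join_path_def path_interior_def)
    \<comment> \<open>A neighbour of a1 in B1 would give a path of length one beside the path of
      length two.\<close>
    have Ba: "strongly_antiadj T x a1" if x: "x \<in> B1" for x
    proof (rule ccontr)
      assume "\<not> strongly_antiadj T x a1"
      hence "\<not> strongly_antiadj T a1 x" using strongly_antiadj_sym by metis
      moreover have "x \<in> verts T" "a1 \<noteq> x" using x XV aB by blast+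
      ultimately have "adj T a1 x" using not_adj_iff[OF F(1) v2(3)] by blast
      hence "join_path T A1 B1 C1 [a1, x]" using path_pair a1 x by (simp add: join_path_def path_interior_def)
      from join_path_parity[OF F(2) P(1) this q] join_path_parity[OF F(2) P(1) even q]
      show False by (simp add: path_length_def)
    qed
    have cV: "strongly_antiadj T d v" if d: "d \<in> C1" and v: "v \<in> verts T" "v \<notin> S d" for d v
    proof -
      have dX: "d \<in> ?X" using d by blast
      show ?thesis
        using join_closedD(4)[OF Ssub(4)[OF dX] v Ssub(3)[OF dX] d] strong[OF dX Ssub(3)[OF dX] v] by blast
    qed
    show False
    proof (cases "C1 = {c}")
      case C1: True
      \<comment> \<open>If C1 is the single vertex c, the vertices of B1 other than b lie outside
        the closure of c and hence do not see it; nor do they see a1. So \<open>twinB\<close>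
        applies as soon as there are any.\<close>
      have "B1 - {b} \<noteq> {}"
      proof
        assume "B1 - {b} = {}"
        hence "?X = S c" using A1 C1 b(1,2) by blast
        moreover have "c \<in> ?X" using c by blast
        ultimately show False using neq by metis
      qed
      moreover have "set_anticomplete T (B1 - {b}) ({a1} \<union> C1)"
      proof (rule set_anticompleteI)
        fix x y assume x: "x \<in> B1 - {b}" and y: "y \<in> {a1} \<union> C1"
        show "strongly_antiadj T x y"
        proof (cases "y = a1")
          case True thus ?thesis using Ba x by blast
        next
          case False
          hence y: "y = c" using y C1 by blast
          have "x \<in> verts T" "x \<notin> S c" using x XV b(2) aB c D(5) by blast+
          hence "strongly_antiadj T c x" by (rule cV[OF c])
          thus ?thesis unfolding y by (simp only: strongly_antiadj_sym)
        qed
      qed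
      ultimately show False by (rule twinB[OF b(1)])
    next
      case C1: False
      \<comment> \<open>x lies outside the closure of another vertex y of C1, which contains a1. So
        a1 and x are not switchable, and they are adjacent.\<close>
      have Ca: "strongly_adj T x a1" if x: "x \<in> C1" for x
      proof -
        obtain y where y: "y \<in> C1" "y \<noteq> x" using C1 c x by blast
        obtain b' where b': "b' \<in> B1" "S y = {a1, y, b'}" using tri[OF y(1)] by blast
        have xn: "x \<in> verts T" "x \<notin> S y" using x XV b' y aB D(5) by blast+
        have yX: "y \<in> ?X" using y by blast
        have "adj T a1 x" using tri[OF x] by blast
        hence "\<not> strongly_antiadj T a1 x" using strongly_antiadj_not(1) by metis
        hence "strongly_adj T a1 x" using strong[OF yX Ssub(2)[OF yX] xn] by blast
        thus ?thesis by (simp only: strongly_adj_sym)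
      qed
      obtain c' where c': "c' \<in> C1" "c' \<noteq> c" using C1 c by blast
      obtain b' where b': "b' \<in> B1" "S c' = {a1, c', b'}" "adj T c' b'" using tri[OF c'(1)] by blast
      have vv: "c \<in> verts T" "c' \<in> verts T" "b \<in> verts T" using c c' b XV by blast+
      have cn: "c \<notin> S c'" "c' \<notin> S c" using b b' c c' aB D(5) by blast+
      \<comment> \<open>Otherwise c and c' are twins: outside itself c sees only a1 and b, which c'
        sees strongly too, so c' with a1 and b cuts off c.\<close>
      have bb: "b \<noteq> b'"
      proof
        assume eq: "b = b'"
        have cX: "c \<in> ?X" "c' \<in> ?X" using c c' by blast+
        have "\<not> strongly_antiadj T b c" "\<not> strongly_antiadj T b c'"
          using b(4) b'(3) eq strongly_antiadj_adj_False(2) by metis+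
        moreover have "b \<in> S c'" "b \<in> S c" using b(2) b'(2) eq by blast+
        ultimately have "strongly_adj T b c" "strongly_adj T b c'"
          using strong[OF cX(2) _ vv(1) cn(1)] strong[OF cX(1) _ vv(2) cn(2)] by blast+
        hence cb: "strongly_adj T c b" "strongly_adj T c' b" by (simp_all only: strongly_adj_sym)
        define R where "R = verts T - ({c} \<union> {a1, b} \<union> {c'})"
        have "balanced_skew_partition T ({c} \<union> R) ({c'} \<union> {a1, b})"
        proof (rule twin_cutset_balanced[OF F(2,1) _ _ _ _ _ _ R_def])
          show "{c} \<subseteq> verts T" "{a1, b} \<subseteq> verts T" "c' \<in> verts T" "c' \<notin> {c}" using vv v2 c' by blast+
          show "c' \<notin> {a1, b}" "{c} \<inter> {a1, b} = {}" using aB c c' b D(5) by blast+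
          show "set_complete T {c} {a1, b}" "set_complete T {c'} {a1, b}"
            using Ca c c' cb by (simp_all add: set_complete_def)
          show "set_anticomplete T {c} R"
            using cV[OF c] b(2) unfolding R_def by (intro set_anticompleteI) blast
          have "a2 \<in> R" unfolding R_def using v2 nX c c' b aX by blast
          thus "R \<noteq> {}" by blast
        qed simp_all
        thus False using nb by blast
      qed
      \<comment> \<open>Since a1 is complete to C1 and anticomplete to B1, it can move to the other
        side while C1 takes the place of A1. The vertices c, c', b, b' are distinct, so the smaller
        side has the four vertices that make its properness unconditional.\<close>
      have Y: "C1 \<union> B1 \<union> {} = ?X - {a1}" using A1 aB by blast
      have Y2: "{a1} \<union> B2 \<union> (A2 \<union> C2) = insert a1 (A2 \<union> B2 \<union> C2)" by blast
      have a1n: "a1 \<notin> A2 \<union> B2 \<union> C2" using aX D(2) by blast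
      have "card {c, c', b, b'} = 4" using c c' b b' bb D(5) by (auto simp: card_insert_if)
      moreover have "{c, c', b, b'} \<subseteq> ?X - {a1}" using c c' b b' aB by blast
      ultimately have cY: "card (?X - {a1}) \<ge> 4" using card_mono[of "?X - {a1}" "{c, c', b, b'}"] finX by simp
      have cY2: "card (insert a1 (A2 \<union> B2 \<union> C2)) \<ge> 4"
        using card2 a1n finite_subset[OF X2V F(3)] by simp
      have "prejoin T C1 B1 {} {a1} B2 (A2 \<union> C2)"
        unfolding prejoin_def Y Y2
      proof (intro conjI)
        show "verts T = (?X - {a1}) \<union> insert a1 (A2 \<union> B2 \<union> C2)" using D(1) aX by blast
        show "(?X - {a1}) \<inter> insert a1 (A2 \<union> B2 \<union> C2) = {}" using D(2) by blast
        show "C1 \<inter> B1 = {}" "C1 \<inter> {} = {}" "B1 \<inter> {} = {}" using D(5) by blast+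
        show "{a1} \<inter> B2 = {}" "{a1} \<inter> (A2 \<union> C2) = {}" using a1n by blast+
        show "B2 \<inter> (A2 \<union> C2) = {}" using D(6,8) by blast
        show "C1 \<noteq> {}" "B1 \<noteq> {}" "{a1} \<noteq> {}" "B2 \<noteq> {}" using c b b2 by blast+
        show "set_complete T C1 {a1}" using Ca by (simp add: set_complete_def)
        show "set_complete T B1 B2" using D(14) .
        show "set_anticomplete T C1 (B2 \<union> (A2 \<union> C2))" using AC by (simp only: set_anticomplete_Un)
        have "set_anticomplete T B1 {a1}" using Ba by (simp add: set_anticomplete_def)
        thus "set_anticomplete T B1 ({a1} \<union> (A2 \<union> C2))" using AC by (simp only: set_anticomplete_Un)
      qed simp
      hence "proper_two_join T C1 B1 {} {a1} B2 (A2 \<union> C2)"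
      proof (rule prejoin_proper[OF T nb L])
        show "3 \<le> card (C1 \<union> B1 \<union> {})" unfolding Y using cY by linarith
        show "3 \<le> card ({a1} \<union> B2 \<union> (A2 \<union> C2))" unfolding Y2 using cY2 by linarith
        show "A2 \<union> C2 = {}" if "card ({a1} \<union> B2 \<union> (A2 \<union> C2)) = 3" using that cY2 unfolding Y2 by linarith
      qed simp
      from min[OF this] show False unfolding Y using aX by blast
    qed
  qed
qed

section \<open>A language of counted loops on the word RAM, with its running time\<close>

section \<open>Counting loops\<close>

definition upd :: "string \<Rightarrow> nat \<Rightarrow> nat \<Rightarrow> state \<Rightarrow> state" where
  "upd x i a s = s(x := (s x)(i := a))"

lemma upd_apply: "upd x i a s y j = (if y = x \<and> j = i then a else s y j)"
  by (simp add: upd_def)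

lemma upd_same [simp]: "upd x i a s x j = (if j = i then a else s x j)"
  by (simp add: upd_def)

lemma upd_other [simp]: "y \<noteq> x \<Longrightarrow> upd x i a s y = s y"
  by (simp add: upd_def)

text \<open>Loops are counted, so every program halts, its effect is a function of the state, and
  its running time has a bound that can be computed from the syntax.\<close>

datatype prog =
    PSkip
  | PAss string exp exp
  | PSeq prog prog
  | PIf exp prog prog
  | PFor string string prog

fun compile :: "prog \<Rightarrow> com" where
  "compile PSkip = Skip"
| "compile (PAss x i e) = Assign x i e"
| "compile (PSeq p q) = Seq (compile p) (compile q)"
| "compile (PIf b p q) = If b (compile p) (compile q)"
| "compile (PFor x b p) = Seq (Assign x (Const 0) (Const 0))
     (While (Minus (Cell b (Const 0)) (Cell x (Const 0)))
       (Seq (compile p) (Assign x (Const 0) (Plus (Cell x (Const 0)) (Const 1)))))"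

text \<open>This agrees with the compiled loop only if the body changes neither the counter nor the
  bound, whence \<open>wf_prog\<close> and the disjointness of \<open>bounds\<close> and
  \<open>writes\<close> in \<open>exec_compile\<close>.\<close>

fun run :: "nat \<Rightarrow> prog \<Rightarrow> state \<Rightarrow> state" where
  "run W PSkip s = s"
| "run W (PAss x i e) s = upd x (val W i s) (val W e s) s"
| "run W (PSeq p q) s = run W q (run W p s)"
| "run W (PIf b p q) s = (if val W b s \<noteq> 0 then run W p s else run W q s)"
| "run W (PFor x b p) s =
     ((\<lambda>s. upd x 0 (Suc (s x 0)) (run W p s)) ^^ s b 0) (upd x 0 0 s)"

fun writes :: "prog \<Rightarrow> string set" where
  "writes PSkip = {}"
| "writes (PAss x i e) = {x}"
| "writes (PSeq p q) = writes p \<union> writes q"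
| "writes (PIf b p q) = writes p \<union> writes q"
| "writes (PFor x b p) = insert x (writes p)"

fun bounds :: "prog \<Rightarrow> string set" where
  "bounds PSkip = {}"
| "bounds (PAss x i e) = {}"
| "bounds (PSeq p q) = bounds p \<union> bounds q"
| "bounds (PIf b p q) = bounds p \<union> bounds q"
| "bounds (PFor x b p) = insert b (bounds p)"

fun wf_prog :: "prog \<Rightarrow> bool" where
  "wf_prog PSkip = True"
| "wf_prog (PAss x i e) = True"
| "wf_prog (PSeq p q) = (wf_prog p \<and> wf_prog q)"
| "wf_prog (PIf b p q) = (wf_prog p \<and> wf_prog q)"
| "wf_prog (PFor x b p) = (wf_prog p \<and> x \<notin> writes p)"

text \<open>A round of a loop adds 5 for the guard, 6 for the increment and 2 for the sequence and
  the loop itself, in all 13. The first assignment costs 3, the failing guard 6 and their sequence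
  1, in all 10. Adding both branches of a conditional is coarse but does not affect the order of
  growth.\<close>

fun time_bound :: "(string \<Rightarrow> nat) \<Rightarrow> prog \<Rightarrow> nat" where
  "time_bound f PSkip = 1"
| "time_bound f (PAss x i e) = cost i + cost e + 1"
| "time_bound f (PSeq p q) = time_bound f p + time_bound f q + 1"
| "time_bound f (PIf b p q) = cost b + time_bound f p + time_bound f q + 1"
| "time_bound f (PFor x b p) = 10 + f b * (time_bound f p + 13)"

definition word :: "nat \<Rightarrow> state \<Rightarrow> bool" where
  "word W s \<longleftrightarrow> (\<forall>x i. s x i < W)"

lemma wordD: "word W s \<Longrightarrow> s x i < W"
  by (simp add: word_def)

lemma val_less: "word W s \<Longrightarrow> val W e s < W"
proof (induction e)
  case (Const c)
  have "0 < W" using wordD[OF Const, of undefined undefined] by simp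
  thus ?case by simp
next
  case (Div e f)
  hence "val W e s < W" by simp
  thus ?case by (auto intro: le_less_trans[OF div_le_dividend])
qed (auto simp: word_def intro: le_less_trans[OF diff_le_self])

lemma word_upd: "word W s \<Longrightarrow> a < W \<Longrightarrow> word W (upd x i a s)"
  by (auto simp: word_def upd_apply)

lemma run_frame: "x \<notin> writes p \<Longrightarrow> run W p s x = s x"
proof (induction p arbitrary: s)
  case (PFor y b p)
  have "((\<lambda>s. upd y 0 (Suc (s y 0)) (run W p s)) ^^ k) s' x = s' x" for k s'
    using PFor by (induction k) auto
  thus ?case using PFor.prems by simp
qed auto

lemma loop_counter:
  assumes "x \<notin> writes p"
  shows "((\<lambda>s. upd x 0 (Suc (s x 0)) (run W p s)) ^^ k) (upd x 0 0 s) x 0 = k"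
proof (induction k)
  case (Suc k) thus ?case by simp
qed simp

lemma loop_frame:
  assumes "y \<notin> writes p" "y \<noteq> x"
  shows "((\<lambda>s. upd x 0 (Suc (s x 0)) (run W p s)) ^^ k) s y = s y"
  by (induction k) (use assms run_frame in auto)

text \<open>Word states are closed under \<open>run\<close>: the counter of a loop never exceeds the bound, which is a word.\<close>

lemma exec_compile:
  assumes "word W s" "wf_prog p" "W > 1" "bounds p \<inter> writes p = {}" "\<And>b. b \<in> bounds p \<Longrightarrow> s b 0 \<le> f b"
  shows "word W (run W p s) \<and> (\<exists>t \<le> time_bound f p. exec W (compile p) s t (run W p s))"
  using assms
proof (induction p arbitrary: s)
  case PSkip
  thus ?case using exec.Skip by auto
next
  case (PAss x i e)
  have "word W (run W (PAss x i e) s)" using PAss val_less by (simp add: word_upd)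
  moreover have "exec W (Assign x i e) s (cost i + cost e + 1) (run W (PAss x i e) s)"
    using exec.Assign[of W x i e s] by (simp add: upd_def)
  ultimately show ?case by auto
next
  case (PSeq p q)
  have w: "word W (run W p s)" and "\<exists>t \<le> time_bound f p. exec W (compile p) s t (run W p s)"
    using PSeq.IH(1)[of s] PSeq.prems by auto
  then obtain t where t: "t \<le> time_bound f p" "exec W (compile p) s t (run W p s)" by blast
  have "run W p s b 0 \<le> f b" if "b \<in> bounds q" for b
  proof -
    have "b \<notin> writes p" using that PSeq.prems(4) by auto
    thus ?thesis using run_frame[of b p W s] PSeq.prems(5)[of b] that by simp
  qed
  hence w': "word W (run W q (run W p s))" and
    "\<exists>t \<le> time_bound f q. exec W (compile q) (run W p s) t (run W q (run W p s))"
    using PSeq.IH(2)[OF w] PSeq.prems by auto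
  then obtain t' where t': "t' \<le> time_bound f q" "exec W (compile q) (run W p s) t' (run W q (run W p s))" by blast
  have "exec W (compile (PSeq p q)) s (t + t' + 1) (run W (PSeq p q) s)"
    using exec.Seq[OF t(2) t'(2)] by simp
  moreover have "t + t' + 1 \<le> time_bound f (PSeq p q)" using t(1) t'(1) by simp
  moreover have "word W (run W (PSeq p q) s)" using w' by simp
  ultimately show ?case by blast
next
  case (PIf b p q)
  show ?case
  proof (cases "val W b s = 0")
    case True
    have w: "word W (run W q s)" and "\<exists>t \<le> time_bound f q. exec W (compile q) s t (run W q s)"
      using PIf.IH(2)[of s] PIf.prems by auto
    then obtain t where t: "t \<le> time_bound f q" "exec W (compile q) s t (run W q s)" by blast
    have "exec W (compile (PIf b p q)) s (cost b + t + 1) (run W (PIf b p q) s)"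
      using exec.IfFalse[OF True t(2)] True by simp
    moreover have "cost b + t + 1 \<le> time_bound f (PIf b p q)" using t(1) by simp
    moreover have "word W (run W (PIf b p q) s)" using w True by simp
    ultimately show ?thesis by blast
  next
    case False
    have w: "word W (run W p s)" and "\<exists>t \<le> time_bound f p. exec W (compile p) s t (run W p s)"
      using PIf.IH(1)[of s] PIf.prems by auto
    then obtain t where t: "t \<le> time_bound f p" "exec W (compile p) s t (run W p s)" by blast
    have "exec W (compile (PIf b p q)) s (cost b + t + 1) (run W (PIf b p q) s)"
      using exec.IfTrue[OF False t(2)] False by simp
    moreover have "cost b + t + 1 \<le> time_bound f (PIf b p q)" using t(1) by simp
    moreover have "word W (run W (PIf b p q) s)" using w False by simp
    ultimately show ?thesis by blast
  qed
next
  case (PFor x b p)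
  let ?g = "\<lambda>s. upd x 0 (Suc (s x 0)) (run W p s)"
  let ?c = "Minus (Cell b (Const 0)) (Cell x (Const 0))"
  let ?d = "Seq (compile p) (Assign x (Const 0) (Plus (Cell x (Const 0)) (Const 1)))"
  let ?T = "time_bound f p + 13"
  have bx: "b \<noteq> x" "b \<notin> writes p" "x \<notin> writes p" using PFor.prems by auto
  \<comment> \<open>Stated for a loop already under way with k rounds to go, as the induction needs
    it. The 6 is the cost of the failing guard.\<close>
  have main: "word W ((?g ^^ k) s') \<and> (\<exists>t \<le> 6 + k * ?T. exec W (While ?c ?d) s' t ((?g ^^ k) s'))"
    if "s' b 0 - s' x 0 = k" "word W s'" "\<And>b. b \<in> bounds p \<Longrightarrow> s' b 0 \<le> f b" for k s'
    using that
  proof (induction k arbitrary: s')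
    case 0
    have "val W ?c s' = 0" using 0 by simp
    hence "exec W (While ?c ?d) s' (cost ?c + 1) s'" by (rule exec.WhileFalse)
    thus ?case using 0 by (intro conjI exI[of _ "cost ?c + 1"]) auto
  next
    case (Suc k)
    let ?s1 = "run W p s'"
    have w1: "word W ?s1" and "\<exists>t \<le> time_bound f p. exec W (compile p) s' t ?s1"
      using PFor.IH[OF Suc.prems(2) _ PFor.prems(3) _ Suc.prems(3)] PFor.prems(2,4) by auto
    then obtain t where t: "t \<le> time_bound f p" "exec W (compile p) s' t ?s1" by blast
    have x1: "?s1 x = s' x" "?s1 b = s' b" using bx by (auto simp: run_frame)
    have lt: "Suc (s' x 0) < W" using Suc.prems(1) wordD[OF Suc.prems(2), of b 0] by linarith
    have val1: "val W (Plus (Cell x (Const 0)) (Const 1)) ?s1 = Suc (s' x 0)"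
      using lt x1 by simp
    have e2: "exec W (Assign x (Const 0) (Plus (Cell x (Const 0)) (Const 1))) ?s1 6 (?g s')"
      using exec.Assign[of W x "Const 0" "Plus (Cell x (Const 0)) (Const 1)" ?s1] val1 x1
      by (simp add: upd_def eval_nat_numeral)
    have e3: "exec W ?d s' (t + 6 + 1) (?g s')" by (rule exec.Seq[OF t(2) e2])
    have w2: "word W (?g s')" using word_upd[OF w1 lt] by simp
    have d: "?g s' b 0 - ?g s' x 0 = k" using Suc.prems(1) bx x1 by simp
    have f2: "?g s' b' 0 \<le> f b'" if "b' \<in> bounds p" for b'
    proof -
      have "b' \<noteq> x" "b' \<notin> writes p" using that PFor.prems(4) by auto
      thus ?thesis using run_frame[of b' p W s'] Suc.prems(3)[OF that] by simp
    qed
    from Suc.IH[OF d w2 f2] obtain t' where w3: "word W ((?g ^^ k) (?g s'))"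
      and t': "t' \<le> 6 + k * ?T" "exec W (While ?c ?d) (?g s') t' ((?g ^^ k) (?g s'))" by blast
    have nz: "val W ?c s' \<noteq> 0" using Suc.prems(1) by simp
    have eq: "(?g ^^ k) (?g s') = (?g ^^ Suc k) s'" by (simp only: funpow_Suc_right comp_apply)
    have "exec W (While ?c ?d) s' (cost ?c + (t + 6 + 1) + t' + 1) ((?g ^^ Suc k) s')"
      using exec.WhileTrue[OF nz e3 t'(2)] unfolding eq .
    moreover have "cost ?c + (t + 6 + 1) + t' + 1 \<le> 6 + Suc k * ?T" using t(1) t'(1) by simp
    ultimately show ?case using w3 unfolding eq by blast
  qed
  let ?s0 = "upd x 0 0 s"
  have w0: "word W ?s0" using PFor.prems by (simp add: word_upd)
  have e0: "exec W (Assign x (Const 0) (Const 0)) s 3 ?s0"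
    using exec.Assign[of W x "Const 0" "Const 0" s] by (simp add: upd_def eval_nat_numeral)
  have f0: "?s0 b' 0 \<le> f b'" if "b' \<in> bounds p" for b'
  proof -
    have "b' \<noteq> x" using that PFor.prems(4) by auto
    thus ?thesis using PFor.prems(5)[of b'] that by simp
  qed
  have "?s0 b 0 - ?s0 x 0 = s b 0" using bx by simp
  from main[OF this w0 f0] obtain t where w: "word W ((?g ^^ s b 0) ?s0)"
    and t: "t \<le> 6 + s b 0 * ?T" "exec W (While ?c ?d) ?s0 t ((?g ^^ s b 0) ?s0)" by blast
  have "exec W (compile (PFor x b p)) s (3 + t + 1) (run W (PFor x b p) s)"
    using exec.Seq[OF e0 t(2)] by simp
  moreover have "s b 0 * ?T \<le> f b * ?T" using PFor.prems(5)[of b] by (intro mult_right_mono) auto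
  hence "3 + t + 1 \<le> time_bound f (PFor x b p)" using t(1) unfolding time_bound.simps by linarith
  moreover have "word W (run W (PFor x b p) s)" using w by simp
  ultimately show ?case by blast
qed

lemma word_run:
  assumes "word W s" "wf_prog p" "W > 1" "bounds p \<inter> writes p = {}"
  shows "word W (run W p s)"
  using exec_compile[OF assms, of "\<lambda>b. s b 0"] by simp

text \<open>The invariant is indexed by the number of completed rounds. The step receives for free
  that the state consists of words and agrees with s off the written arrays, so invariants mention
  only what the loop changes.\<close>

lemma for_induct:
  assumes w: "word W s" and wf: "wf_prog (PFor x b p)" "bounds (PFor x b p) \<inter> writes (PFor x b p) = {}" and W: "W > 1"
    and N: "s b 0 = N"
    and init: "I 0 (upd x 0 0 s)"
    and step: "\<And>i s'. i < N \<Longrightarrow> I i s' \<Longrightarrow> s' x 0 = i \<Longrightarrow> word W s' \<Longrightarrow>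
      (\<And>y. y \<notin> writes (PFor x b p) \<Longrightarrow> s' y = s y) \<Longrightarrow> I (Suc i) (upd x 0 (Suc i) (run W p s'))"
  shows "I N (run W (PFor x b p) s)"
proof -
  let ?g = "\<lambda>s. upd x 0 (Suc (s x 0)) (run W p s)"
  let ?s = "\<lambda>k. (?g ^^ k) (upd x 0 0 s)"
  have wfp: "wf_prog p" "x \<notin> writes p" "bounds p \<inter> writes p = {}" "b \<noteq> x" using wf by auto
  have "k \<le> N \<Longrightarrow> I k (?s k) \<and> word W (?s k)" for k
  proof (induction k)
    case 0 thus ?case using init w W by (simp add: word_upd)
  next
    case (Suc k)
    hence IH: "I k (?s k)" "word W (?s k)" by auto
    have x: "?s k x 0 = k" by (rule loop_counter[OF wfp(2)])
    have fr: "?s k y = s y" if "y \<notin> writes (PFor x b p)" for y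
      using loop_frame[of y p x] that by simp
    have "I (Suc k) (upd x 0 (Suc k) (run W p (?s k)))"
      by (rule step) (use Suc.prems IH x fr in auto)
    moreover have "Suc k < W" using Suc.prems N wordD[OF w, of b 0] by linarith
    ultimately show ?case using x word_upd[OF word_run[OF IH(2) wfp(1) W wfp(3)]] by simp
  qed
  thus ?thesis using N by simp
qed

section \<open>Boolean expressions\<close>

abbreviation V :: "string \<Rightarrow> exp" where "V x \<equiv> Cell x (Const 0)"

text \<open>Zero is false, every other word is true. Truncated subtraction makes
  \<open>1 - e\<close> a negation, and a sum of two negations is at most 2, so nothing wraps around
  once W exceeds 2.\<close>

definition ENot :: "exp \<Rightarrow> exp" where "ENot e = Minus (Const 1) e"
definition EAnd :: "exp \<Rightarrow> exp \<Rightarrow> exp" where "EAnd e f = ENot (Plus (ENot e) (ENot f))"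
definition EOr :: "exp \<Rightarrow> exp \<Rightarrow> exp" where "EOr e f = ENot (EAnd (ENot e) (ENot f))"
definition EEq :: "exp \<Rightarrow> exp \<Rightarrow> exp" where "EEq e f = ENot (Plus (Minus e f) (Minus f e))"
definition EMod :: "exp \<Rightarrow> exp \<Rightarrow> exp" where "EMod e f = Minus e (Times (Div e f) f)"

lemma val_ENot: "W > 2 \<Longrightarrow> val W (ENot e) s = of_bool (val W e s = 0)"
  by (simp add: ENot_def)

lemma val_EAnd: "W > 2 \<Longrightarrow> val W (EAnd e f) s = of_bool (val W e s \<noteq> 0 \<and> val W f s \<noteq> 0)"
  by (auto simp: EAnd_def val_ENot)

lemma val_EOr: "W > 2 \<Longrightarrow> val W (EOr e f) s = of_bool (val W e s \<noteq> 0 \<or> val W f s \<noteq> 0)"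
  by (auto simp: EOr_def val_ENot val_EAnd)

text \<open>At most one of the two truncated differences is nonzero, so their sum is a word and
  vanishes only for equal values.\<close>

lemma val_EEq: "W > 2 \<Longrightarrow> word W s \<Longrightarrow> val W (EEq e f) s = of_bool (val W e s = val W f s)"
proof -
  assume W: "W > 2" "word W s"
  have "val W e s - val W f s + (val W f s - val W e s) < W"
    using val_less[OF W(2), of e] val_less[OF W(2), of f] by linarith
  thus ?thesis using W(1) by (simp add: EEq_def val_ENot)
qed

lemma val_EMod: "word W s \<Longrightarrow> val W (EMod e f) s = val W e s mod val W f s"
proof -
  assume W: "word W s"
  have "val W e s div val W f s * val W f s < W"
    using val_less[OF W, of e] by (rule le_less_trans[OF div_times_less_eq_dividend])
  thus ?thesis by (simp add: EMod_def minus_div_mult_eq_mod)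
qed

section \<open>Least closed sets and spanning trees by one worklist algorithm\<close>

section \<open>Closure by a worklist\<close>

text \<open>\<open>cl y\<close> is the part a member \<open>y\<close> plays: 0, 1, 2 for \<open>A\<close>, \<open>B\<close>, \<open>C\<close> and 3 for a vertex that must
  not be a member. \<open>J\<close> is 1 for 2-joins, 0 for homogeneous pairs, 2 for spanning trees.
  Entries of \<open>m\<close> are \<open>theta + 1\<close>.\<close>

definition conflict :: "nat \<Rightarrow> (nat \<Rightarrow> nat) \<Rightarrow> (nat \<Rightarrow> nat \<Rightarrow> nat) \<Rightarrow> nat \<Rightarrow> nat \<Rightarrow> nat \<Rightarrow> bool" where
  "conflict J cl m v y z \<longleftrightarrow> m y v = 1 \<or> (J = 2 \<and> m y v \<noteq> 0) \<or>
     (cl y = 0 \<and> cl z = 0 \<and> m y v \<noteq> m z v) \<or> (cl y = 1 \<and> cl z = 1 \<and> m y v \<noteq> m z v) \<or>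
     (J = 1 \<and> cl y = 2 \<and> m y v \<noteq> 0) \<or> (J = 1 \<and> cl y = 0 \<and> cl z = 1 \<and> m y v = 2 \<and> m z v = 2)"

definition closed_set :: "nat \<Rightarrow> nat \<Rightarrow> (nat \<Rightarrow> nat) \<Rightarrow> (nat \<Rightarrow> nat \<Rightarrow> nat) \<Rightarrow> nat set \<Rightarrow> bool" where
  "closed_set n J cl m U \<longleftrightarrow> (\<forall>v<n. v \<notin> U \<longrightarrow> (\<forall>y\<in>U. \<forall>z\<in>U. \<not> conflict J cl m v y z))"

text \<open>Conflicts are tested against one reference member \<open>ra\<close>, \<open>rb\<close> of each of the parts \<open>A\<close>, \<open>B\<close>;
  the value \<open>n\<close> means that there is none yet.\<close>

definition fires ::
  "nat \<Rightarrow> nat \<Rightarrow> (nat \<Rightarrow> nat) \<Rightarrow> (nat \<Rightarrow> nat \<Rightarrow> nat) \<Rightarrow> nat \<Rightarrow> nat \<Rightarrow> nat \<Rightarrow> nat \<Rightarrow> bool" where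
  "fires n J cl m ra rb y v \<longleftrightarrow> m y v = 1 \<or> (J = 2 \<and> m y v \<noteq> 0) \<or>
     (cl y = 0 \<and> m y v \<noteq> m ra v) \<or> (cl y = 1 \<and> m y v \<noteq> m rb v) \<or>
     (J = 1 \<and> cl y = 2 \<and> m y v \<noteq> 0) \<or> (J = 1 \<and> ra < n \<and> rb < n \<and> m ra v = 2 \<and> m rb v = 2)"

definition ref_ok :: "nat \<Rightarrow> (nat \<Rightarrow> nat) \<Rightarrow> nat set \<Rightarrow> nat \<Rightarrow> nat \<Rightarrow> bool" where
  "ref_ok n cl D k r \<longleftrightarrow> (if r = n then \<forall>y\<in>D. cl y \<noteq> k else r \<in> D \<and> cl r = k)"

text \<open>The third clause keeps S inside every closed set above S0, which makes a closed S the
  least one. The last clause says that the pointers \<open>par\<close> lead back to S0, as an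
  induction principle instead of by ranks; with J = 2 they are the edges of a tree.\<close>

definition grown ::
  "nat \<Rightarrow> nat \<Rightarrow> (nat \<Rightarrow> nat) \<Rightarrow> (nat \<Rightarrow> nat \<Rightarrow> nat) \<Rightarrow> nat set \<Rightarrow> nat set \<Rightarrow> (nat \<Rightarrow> nat) \<Rightarrow> bool" where
  "grown n J cl m S0 S par \<longleftrightarrow> S0 \<subseteq> S \<and> S \<subseteq> {..<n} \<and>
     (\<forall>U. S0 \<subseteq> U \<longrightarrow> closed_set n J cl m U \<longrightarrow> S \<subseteq> U) \<and>
     (\<forall>v\<in>S - S0. par v \<in> S \<and> (J = 2 \<longrightarrow> m (par v) v \<noteq> 0)) \<and>
     (\<forall>U. S0 \<subseteq> U \<longrightarrow> (\<forall>v\<in>S - S0. par v \<in> U \<longrightarrow> v \<in> U) \<longrightarrow> S \<subseteq> U)"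

text \<open>D holds the members already processed; an outside vertex is only known not to conflict
  with these.\<close>

definition worklist_inv ::
  "nat \<Rightarrow> nat \<Rightarrow> (nat \<Rightarrow> nat) \<Rightarrow> (nat \<Rightarrow> nat \<Rightarrow> nat) \<Rightarrow> nat set \<Rightarrow> nat set \<Rightarrow> nat set \<Rightarrow> nat \<Rightarrow> nat \<Rightarrow>
   (nat \<Rightarrow> nat) \<Rightarrow> bool" where
  "worklist_inv n J cl m S0 S D ra rb par \<longleftrightarrow> grown n J cl m S0 S par \<and> D \<subseteq> S \<and>
     (\<forall>v<n. v \<notin> S \<longrightarrow> (\<forall>y\<in>D. \<not> fires n J cl m ra rb y v)) \<and>
     ref_ok n cl D 0 ra \<and> ref_ok n cl D 1 rb"

text \<open>Vertices added because of y lie in every closed superset, since references are members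
  too. Earlier tests stay valid: a processed member already has its reference, which no longer
  changes, and the test of ra against rb does not mention the member, so the scan for y repeats it
  for all.\<close>

lemma worklist_step:
  assumes I: "worklist_inv n J cl m S0 S D ra rb par" and y: "y \<in> S" "y \<notin> D"
    and ra': "ra' = (if cl y = 0 \<and> ra = n then y else ra)" and rb': "rb' = (if cl y = 1 \<and> rb = n then y else rb)"
    and N: "N = {v. v < n \<and> v \<notin> S \<and> fires n J cl m ra' rb' y v}"
    and par': "\<And>v. v < n \<Longrightarrow> par' v = (if v \<in> N then y else par v)"
  shows "worklist_inv n J cl m S0 (S \<union> N) (insert y D) ra' rb' par'"
proof -
  have g: "S0 \<subseteq> S" "S \<subseteq> {..<n}" "\<And>U. S0 \<subseteq> U \<Longrightarrow> closed_set n J cl m U \<Longrightarrow> S \<subseteq> U"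
    "\<And>v. v \<in> S - S0 \<Longrightarrow> par v \<in> S \<and> (J = 2 \<longrightarrow> m (par v) v \<noteq> 0)"
    "\<And>U. S0 \<subseteq> U \<Longrightarrow> (\<And>v. v \<in> S - S0 \<Longrightarrow> par v \<in> U \<Longrightarrow> v \<in> U) \<Longrightarrow> S \<subseteq> U"
    and D: "D \<subseteq> S" and q: "\<And>v y. v < n \<Longrightarrow> v \<notin> S \<Longrightarrow> y \<in> D \<Longrightarrow> \<not> fires n J cl m ra rb y v"
    and r: "ref_ok n cl D 0 ra" "ref_ok n cl D 1 rb"
    using I unfolding worklist_inv_def grown_def by (fast, fast, metis, metis, metis, metis, metis, metis, metis)
  have yn: "y < n" using y g(2) by auto
  have Dn: "x < n" if "x \<in> D" for x using that D g(2) by auto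
  have r': "ref_ok n cl (insert y D) 0 ra'" "ref_ok n cl (insert y D) 1 rb'"
    using r yn unfolding ra' rb' ref_ok_def by (auto split: if_splits)
  have raS: "ra' < n \<Longrightarrow> ra' \<in> S \<and> cl ra' = 0" "rb' < n \<Longrightarrow> rb' \<in> S \<and> cl rb' = 1"
    "cl y = 0 \<Longrightarrow> ra' \<in> S \<and> cl ra' = 0" "cl y = 1 \<Longrightarrow> rb' \<in> S \<and> cl rb' = 1"
    using r' y D unfolding ref_ok_def by (auto split: if_splits)
  have NU: "N \<subseteq> U" if U: "S \<subseteq> U" "closed_set n J cl m U" for U
  proof
    fix v assume v: "v \<in> N"
    show "v \<in> U"
    proof (rule ccontr)
      assume "v \<notin> U"
      hence no: "\<not> conflict J cl m v x z" if "x \<in> U" "z \<in> U" for x z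
        using U(2) v that unfolding closed_set_def N by blast
      have "fires n J cl m ra' rb' y v" using v N by blast
      moreover have "y \<in> U" using y U by blast
      ultimately show False
        using no[of y y] no[of y ra'] no[of y rb'] no[of ra' rb'] raS U(1)
        unfolding fires_def conflict_def by (metis subsetD)
    qed
  qed
  have grow: "grown n J cl m S0 (S \<union> N) par'"
    unfolding grown_def
  proof (intro conjI allI impI ballI)
    show "S0 \<subseteq> S \<union> N" "S \<union> N \<subseteq> {..<n}" using g N by auto
    show "S \<union> N \<subseteq> U" if "S0 \<subseteq> U" "closed_set n J cl m U" for U using g(3)[OF that] NU that by blast
    show "par' v \<in> S \<union> N" if "v \<in> S \<union> N - S0" for v
      using that par'[of v] g(2) g(4)[of v] y N by auto
    show "m (par' v) v \<noteq> 0" if "v \<in> S \<union> N - S0" "J = 2" for v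
    proof (cases "v \<in> N")
      case True
      hence "fires n J cl m ra' rb' y v" using N by blast
      moreover have vn: "v < n" "v \<notin> S" using True N by blast+
      \<comment> \<open>With J = 2 an outside vertex sees no processed member, in particular no
        reference other than y. So even a mismatch with a reference shows that y sees it, and the
        pointer to y is an edge.\<close>
      have "m x v = 0" if "x \<in> D" for x using q[OF vn that] \<open>J = 2\<close> unfolding fires_def by metis
      moreover have "cl y = 0 \<Longrightarrow> ra' \<in> insert y D" "cl y = 1 \<Longrightarrow> rb' \<in> insert y D"
        using r' unfolding ref_ok_def by (metis insertI1)+
      ultimately have "m y v \<noteq> 0" using \<open>J = 2\<close> unfolding fires_def
        by (metis insertE one_neq_zero numeral_eq_one_iff semiring_norm(85))
      thus ?thesis using True par'[of v] N by simp
    next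
      case False
      thus ?thesis using that par'[of v] g(2) g(4)[of v] by auto
    qed
    fix U assume U: "S0 \<subseteq> U" "\<forall>v\<in>S \<union> N - S0. par' v \<in> U \<longrightarrow> v \<in> U"
    have SU: "S \<subseteq> U"
    proof (rule g(5)[OF U(1)])
      fix v assume v: "v \<in> S - S0" "par v \<in> U"
      hence "v \<notin> N" "v < n" using N g(2) by auto
      thus "v \<in> U" using U(2) v par'[of v] by auto
    qed
    moreover have "v \<in> U" if v: "v \<in> N" for v
    proof -
      have "v < n" "v \<notin> S0" using v N g(1) by auto
      thus ?thesis using U(2) v par'[of v] SU y by auto
    qed
    ultimately show "S \<union> N \<subseteq> U" by blast
  qed
  have "\<not> fires n J cl m ra' rb' x v" if v: "v < n" "v \<notin> S \<union> N" and x: "x \<in> insert y D" for v x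
  proof (cases "x = y")
    case True
    thus ?thesis using v N by blast
  next
    case False
    hence xD: "x \<in> D" using x by blast
    have 1: "\<not> fires n J cl m ra rb x v" using q xD v by blast
    have 2: "\<not> fires n J cl m ra' rb' y v" using v N by blast
    have "cl x = 0 \<Longrightarrow> ra' = ra" "cl x = 1 \<Longrightarrow> rb' = rb"
      using r xD unfolding ref_ok_def ra' rb' by (auto split: if_splits)
    thus ?thesis using 1 2 unfolding fires_def by metis
  qed
  thus ?thesis using grow D y r' unfolding worklist_inv_def by blast
qed

text \<open>Members with the same label agree with their common reference on each outside vertex and
  hence with each other, so one test per member covers all pairs of members.\<close>

lemma worklist_final:
  assumes I: "worklist_inv n J cl m S0 S S ra rb par"
  shows "closed_set n J cl m S"
  unfolding closed_set_def
proof (intro allI impI ballI notI)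
  fix v y z assume v: "v < n" "v \<notin> S" and yz: "y \<in> S" "z \<in> S" and c: "conflict J cl m v y z"
  have q: "\<not> fires n J cl m ra rb x v" if "x \<in> S" for x
    using I v that unfolding worklist_inv_def by blast
  have r: "ref_ok n cl S 0 ra" "ref_ok n cl S 1 rb" and Sn: "S \<subseteq> {..<n}"
    using I unfolding worklist_inv_def grown_def by blast+
  have "cl x = 0 \<Longrightarrow> ra < n" "cl x = 1 \<Longrightarrow> rb < n" if "x \<in> S" for x
    using r that Sn unfolding ref_ok_def by (auto split: if_splits)
  thus False using q[OF yz(1)] q[OF yz(2)] c yz unfolding fires_def conflict_def by metis
qed

lemma worklist_init:
  assumes "S0 \<subseteq> {..<n}"
  shows "worklist_inv n J cl m S0 S0 {} n n par"
  using assms unfolding worklist_inv_def grown_def ref_ok_def by simp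

section \<open>The worklist program\<close>

text \<open>Entries are \<open>theta + 1\<close>, so complementation sends e to
  \<open>2 - e\<close>; the cell \<open>co\<close> selects one of the two summands.\<close>

definition ECo :: "exp \<Rightarrow> exp" where
  "ECo e = Plus (Times (V ''co'') (Minus (Const 2) e)) (Times (Minus (Const 1) (V ''co'')) e)"

definition ETh :: "exp \<Rightarrow> exp \<Rightarrow> exp" where
  "ETh e f = ECo (Cell ''theta'' (Plus (Times e (V ''n'')) f))"

definition fires_exp :: exp where
  "fires_exp = (let t = ETh (V ''y'') (V ''v''); a = ETh (V ''ra'') (V ''v''); b = ETh (V ''rb'') (V ''v'');
       k = Cell ''cl'' (V ''y''); J = V ''J''; two = Const 2
     in EOr (EEq t (Const 1)) (EOr (EAnd (EEq J two) t)
       (EOr (EAnd (EEq k (Const 0)) (ENot (EEq t a))) (EOr (EAnd (EEq k (Const 1)) (ENot (EEq t b)))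
       (EOr (EAnd (EEq J (Const 1)) (EAnd (EEq k two) t))
         (EAnd (EEq J (Const 1)) (EAnd (Minus (V ''n'') (V ''ra'')) (EAnd (Minus (V ''n'') (V ''rb''))
           (EAnd (EEq a two) (EEq b two))))))))))"

text \<open>In the array \<open>st\<close>, 0 is an outside vertex, 1 a member waiting in the
  worklist and 2 a processed member.\<close>

definition scan_prog :: prog where
  "scan_prog = PFor ''v'' ''n'' (PIf (EAnd (EEq (Cell ''st'' (V ''v'')) (Const 0)) fires_exp)
     (PSeq (PAss ''st'' (V ''v'') (Const 1)) (PAss ''par'' (V ''v'') (V ''y''))) PSkip)"

definition process_prog :: prog where
  "process_prog = PSeq (PAss ''st'' (V ''y'') (Const 2))
     (PSeq (PIf (EAnd (EEq (Cell ''cl'' (V ''y'')) (Const 0)) (EEq (V ''ra'') (V ''n''))) (PAss ''ra'' (Const 0) (V ''y'')) PSkip)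
     (PSeq (PIf (EAnd (EEq (Cell ''cl'' (V ''y'')) (Const 1)) (EEq (V ''rb'') (V ''n''))) (PAss ''rb'' (Const 0) (V ''y'')) PSkip)
     scan_prog))"

text \<open>The value n remains in \<open>y\<close> if no member is waiting.\<close>

definition pick_prog :: prog where
  "pick_prog = PSeq (PAss ''y'' (Const 0) (V ''n''))
     (PFor ''u'' ''n'' (PIf (EEq (Cell ''st'' (V ''u'')) (Const 1)) (PAss ''y'' (Const 0) (V ''u'')) PSkip))"

text \<open>Each round processes a member or finds none waiting, so n rounds suffice. A round is
  linear, which gives quadratic time per closure.\<close>

definition worklist_prog :: prog where
  "worklist_prog = PFor ''it'' ''n'' (PSeq pick_prog (PIf (Minus (V ''n'') (V ''y'')) process_prog PSkip))"

lemmas prog_defs1 = scan_prog_def process_prog_def pick_prog_def worklist_prog_def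

locale ram =
  fixes n W :: nat and m0 :: "nat \<Rightarrow> nat \<Rightarrow> nat"
  assumes W_eq: "W = (n + 2) ^ 8" and m0_le: "m0 i j \<le> 2"
begin

text \<open>A word has to hold indices of an (n + 3) by (n + 3) matrix, the number of seeds and,
  even for n = 0, the small constants of the programs; the eighth power is at least 256 and leaves
  room for all of them.\<close>

lemma W_ge: "256 \<le> W" "(n + 3) * (n + 3) < W" "5 * (n * n * n) + 5 < W"
proof -
  have "(2::nat) ^ 8 \<le> (n + 2) ^ 8" by (rule power_mono) auto
  thus "256 \<le> W" unfolding W_eq by simp
  have e: "(n + 2) ^ 8 = (n + 2) ^ 3 * (n + 2) ^ 5" "(n + 2) ^ 8 = (n + 2) ^ 2 * (n + 2) ^ 6"
    unfolding power_add[symmetric] by simp_all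
  have 5: "(2::nat) ^ 5 \<le> (n + 2) ^ 5" and 6: "(2::nat) ^ 6 \<le> (n + 2) ^ 6" by (rule power_mono; simp)+
  have "(n + 2) ^ 3 * 32 \<le> W" unfolding W_eq e(1) using 5 by (intro mult_mono) auto
  moreover have "n * n * n + 8 \<le> (n + 2) ^ 3" by (simp add: power3_eq_cube algebra_simps)
  ultimately show "5 * (n * n * n) + 5 < W" by linarith
  have "(n + 2) ^ 2 * 64 \<le> W" unfolding W_eq e(2) using 6 by (intro mult_mono) auto
  moreover have "(n + 3) * (n + 3) < (n + 2) ^ 2 * 4" by (simp add: power2_eq_square algebra_simps)
  ultimately show "(n + 3) * (n + 3) < W" by linarith
qed

lemma W_small [simp]: "2 < W" "Suc 0 < W" "0 < W" "W \<noteq> Suc 0" "2 mod W = 2" "3 mod W = 3"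
  using W_ge(1) by auto

lemma n_less [simp]: "n < W" "Suc n < W" "n + 2 < W" "n + 3 < W"
proof -
  have "n + 3 \<le> (n + 3) * (n + 3)" by simp
  thus "n + 3 < W" using W_ge(2) by linarith
  thus "n < W" "Suc n < W" "n + 2 < W" by simp_all
qed

lemma index_less:
  assumes "i \<le> n + 2" "j < n + 3"
  shows "i * (n + 3) + j < W" "i * n + j < W"
proof -
  have "i * (n + 3) + j < i * (n + 3) + (n + 3)" using assms by simp
  also have "\<dots> = (i + 1) * (n + 3)" by simp
  also have "\<dots> \<le> (n + 3) * (n + 3)" using assms by (intro mult_right_mono) auto
  finally show 1: "i * (n + 3) + j < W" using W_ge(2) by linarith
  have "i * n + j \<le> i * (n + 3) + j" by simp
  thus "i * n + j < W" using 1 by linarith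
qed

definition inp :: "state \<Rightarrow> bool" where
  "inp s \<longleftrightarrow> word W s \<and> s ''n'' 0 = n \<and> (\<forall>i<n. \<forall>j<n. s ''theta'' (i * n + j) = m0 i j)"

text \<open>Complementation turns the zeros on the diagonal of the input into 2, so diagonal entries
  mean nothing. This is why \<open>part\<close> and \<open>layer\<close> test explicitly for equal
  vertices.\<close>

definition m :: "nat \<Rightarrow> nat \<Rightarrow> nat \<Rightarrow> nat" where
  "m c i j = (if c = 0 then m0 i j else 2 - m0 i j)"

lemma m_le: "m c i j \<le> 2"
  using m0_le by (simp add: m_def)

lemma inp_frame: "inp s \<Longrightarrow> word W s' \<Longrightarrow> s' ''n'' = s ''n'' \<Longrightarrow> s' ''theta'' = s ''theta'' \<Longrightarrow> inp s'"
  by (simp add: inp_def)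

lemma inpD: "inp s \<Longrightarrow> word W s" "inp s \<Longrightarrow> s ''n'' 0 = n"
  by (simp_all add: inp_def)

lemmas bval = val_ENot[OF W_small(1)] val_EAnd[OF W_small(1)] val_EOr[OF W_small(1)] val_EEq[OF W_small(1)]

lemma val_ECo:
  assumes "word W s" "s ''co'' 0 = c" "c \<le> 1" "val W e s \<le> 2"
  shows "val W (ECo e) s = (if c = 0 then val W e s else 2 - val W e s)"
proof -
  have "c = 0 \<or> c = 1" "val W e s < W" "2 - val W e s < W"
    using assms val_less W_small(1) by (auto simp del: W_small)
  thus ?thesis using assms by (auto simp: ECo_def)
qed

lemma val_ETh:
  assumes "inp s" "s ''co'' 0 = c" "c \<le> 1" "val W e s = i" "val W f s = j" "i < n" "j < n"
  shows "val W (ETh e f) s = m c i j"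
proof -
  have *: "i * n < W" "i * n + j < W" using index_less(2)[of i j] index_less(2)[of i 0] assms by auto
  have "val W (Cell ''theta'' (Plus (Times e (V ''n'')) f)) s = m0 i j"
    using assms * by (simp add: inp_def)
  thus ?thesis unfolding ETh_def using assms m0_le inpD(1)[OF assms(1)] by (simp add: val_ECo m_def)
qed

text \<open>A missing reference has the value n, and the entry read for it is meaningless; the label
  test or the factor \<open>n - ra\<close> or \<open>n - rb\<close> masks it.\<close>

lemma val_fires:
  assumes s: "inp s" "s ''co'' 0 = c" "c \<le> 1" "s ''y'' 0 = y" "y < n" "s ''v'' 0 = v" "v < n"
    and r: "s ''ra'' 0 = ra" "s ''rb'' 0 = rb" "ra \<le> n" "rb \<le> n"
    and rc: "s ''cl'' y = 0 \<Longrightarrow> ra < n" "s ''cl'' y = 1 \<Longrightarrow> rb < n"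
  shows "val W fires_exp s = of_bool (fires n (s ''J'' 0) (s ''cl'') (m c) ra rb y v)"
proof -
  note w = inpD[OF s(1)]
  have t: "val W (ETh (V ''y'') (V ''v'')) s = m c y v"
    using s by (intro val_ETh) auto
  have a: "val W (ETh (V ''ra'') (V ''v'')) s = m c ra v" if "ra < n"
    using s r that by (intro val_ETh) auto
  have b: "val W (ETh (V ''rb'') (V ''v'')) s = m c rb v" if "rb < n"
    using s r that by (intro val_ETh) auto
  let ?a = "val W (ETh (V ''ra'') (V ''v'')) s" and ?b = "val W (ETh (V ''rb'') (V ''v'')) s"
  have ob: "(of_bool P = (0::nat)) = (\<not> P)" for P by simp
  have num: "val W (Const 0) s = 0" "val W (Const 1) s = 1" "val W (Const 2) s = 2" by simp_all
  have cell: "val W (V x) s = s x 0" for x by simp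
  have "val W fires_exp s = of_bool (m c y v = 1 \<or> (s ''J'' 0 = 2 \<and> m c y v \<noteq> 0) \<or>
     (s ''cl'' y = 0 \<and> m c y v \<noteq> ?a) \<or> (s ''cl'' y = 1 \<and> m c y v \<noteq> ?b) \<or>
     (s ''J'' 0 = 1 \<and> s ''cl'' y = 2 \<and> m c y v \<noteq> 0) \<or>
     (s ''J'' 0 = 1 \<and> n - ra \<noteq> 0 \<and> n - rb \<noteq> 0 \<and> ?a = 2 \<and> ?b = 2))"
    unfolding fires_exp_def Let_def
    by (simp only: bval(1-3) val_EEq[OF W_small(1) w(1)] t num cell val.simps(2,4) ob not_not s(4) r(1,2) w(2) simp_thms)
  also have "\<dots> = of_bool (fires n (s ''J'' 0) (s ''cl'') (m c) ra rb y v)"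
  proof -
    have "s ''cl'' y = 0 \<Longrightarrow> ?a = m c ra v" "s ''cl'' y = 1 \<Longrightarrow> ?b = m c rb v" using a b rc by blast+
    moreover have "n - ra \<noteq> 0 \<longleftrightarrow> ra < n" "n - rb \<noteq> 0 \<longleftrightarrow> rb < n" by auto
    ultimately show ?thesis unfolding fires_def using a b by (intro arg_cong[where f = of_bool]) metis
  qed
  finally show ?thesis .
qed

definition vset :: "state \<Rightarrow> nat set" where "vset s = {v. v < n \<and> s ''st'' v \<noteq> 0}"
definition dset :: "state \<Rightarrow> nat set" where "dset s = {v. v < n \<and> s ''st'' v = 2}"

lemma scan:
  assumes s: "inp s" "s ''co'' 0 = c" "c \<le> 1" "s ''y'' 0 = y" "y < n" "s ''ra'' 0 = ra" "s ''rb'' 0 = rb"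
    and r: "ra \<le> n" "rb \<le> n" "s ''cl'' y = 0 \<Longrightarrow> ra < n" "s ''cl'' y = 1 \<Longrightarrow> rb < n"
  defines "F v \<equiv> s ''st'' v = 0 \<and> fires n (s ''J'' 0) (s ''cl'') (m c) ra rb y v"
  shows "\<forall>v<n. run W scan_prog s ''st'' v = (if F v then 1 else s ''st'' v) \<and>
    run W scan_prog s ''par'' v = (if F v then y else s ''par'' v)"
proof -
  let ?I = "\<lambda>i s'. \<forall>v<n. s' ''st'' v = (if v < i \<and> F v then 1 else s ''st'' v) \<and>
    s' ''par'' v = (if v < i \<and> F v then y else s ''par'' v)"
  have "?I n (run W scan_prog s)"
    unfolding scan_prog_def
  proof (rule for_induct[where I = ?I])
    show "word W s" "s ''n'' 0 = n" using inpD[OF s(1)] by simp_all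
    fix i s' assume i: "i < n" and I: "?I i s'" and v: "s' ''v'' 0 = i" and w: "word W s'"
      and fr: "\<And>y. y \<notin> writes (PFor ''v'' ''n'' (PIf (EAnd (EEq (Cell ''st'' (V ''v'')) (Const 0)) fires_exp)
         (PSeq (PAss ''st'' (V ''v'') (Const 1)) (PAss ''par'' (V ''v'') (V ''y''))) PSkip)) \<Longrightarrow> s' y = s y"
    have eq: "s' ''n'' = s ''n''" "s' ''theta'' = s ''theta''" "s' ''co'' = s ''co''" "s' ''y'' = s ''y''"
      "s' ''ra'' = s ''ra''" "s' ''rb'' = s ''rb''" "s' ''cl'' = s ''cl''" "s' ''J'' = s ''J''"
      by (rule fr; simp)+
    have in': "inp s'" using inp_frame[OF s(1) w] eq by simp
    have "val W fires_exp s' = of_bool (fires n (s' ''J'' 0) (s' ''cl'') (m c) ra rb y i)"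
      by (rule val_fires) (use in' eq s r v i in auto)
    thus "?I (Suc i) (upd ''v'' 0 (Suc i) (run W (PIf (EAnd (EEq (Cell ''st'' (V ''v'')) (Const 0)) fires_exp)
         (PSeq (PAss ''st'' (V ''v'') (Const 1)) (PAss ''par'' (V ''v'') (V ''y''))) PSkip) s'))"
      using I i v w eq s by (auto simp: bval F_def less_Suc_eq)
  qed auto
  thus ?thesis by simp
qed

lemma pick:
  assumes s: "inp s"
  shows "(run W pick_prog s ''y'' 0 = n \<and> (\<forall>v<n. s ''st'' v \<noteq> 1)) \<or>
    (run W pick_prog s ''y'' 0 < n \<and> s ''st'' (run W pick_prog s ''y'' 0) = 1)"
proof -
  let ?I = "\<lambda>i s'. (s' ''y'' 0 = n \<and> (\<forall>v<i. s ''st'' v \<noteq> 1)) \<or> (s' ''y'' 0 < n \<and> s ''st'' (s' ''y'' 0) = 1)"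
  let ?s = "run W (PAss ''y'' (Const 0) (V ''n'')) s"
  have w: "word W ?s" using inpD(1)[OF s] val_less by (simp add: word_upd wordD)
  have "?I n (run W (PFor ''u'' ''n'' (PIf (EEq (Cell ''st'' (V ''u'')) (Const 1)) (PAss ''y'' (Const 0) (V ''u'')) PSkip)) ?s)"
  proof (rule for_induct[where I = ?I, OF w])
    show "?s ''n'' 0 = n" using inpD[OF s] by simp
    show "?I 0 (upd ''u'' 0 0 ?s)" using inpD[OF s] by simp
    fix i s' assume i: "i < n" and I: "?I i s'" and u: "s' ''u'' 0 = i" and w': "word W s'"
      and fr: "\<And>y. y \<notin> writes (PFor ''u'' ''n'' (PIf (EEq (Cell ''st'' (V ''u'')) (Const 1)) (PAss ''y'' (Const 0) (V ''u'')) PSkip)) \<Longrightarrow> s' y = ?s y"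
    have eq: "s' ''st'' = s ''st''" using fr[of "''st''"] by simp
    show "?I (Suc i) (upd ''u'' 0 (Suc i) (run W (PIf (EEq (Cell ''st'' (V ''u'')) (Const 1)) (PAss ''y'' (Const 0) (V ''u'')) PSkip) s'))"
      using I i u w' eq by (auto simp: bval less_Suc_eq)
  qed auto
  thus ?thesis unfolding pick_prog_def by simp
qed

text \<open>Progress is measured by the number of processed members: after i rounds it is at least
  i, unless nothing is waiting any more.\<close>

lemma worklist:
  assumes s: "inp s" "s ''co'' 0 = c" "c \<le> 1" "s ''ra'' 0 = n" "s ''rb'' 0 = n" "\<forall>v<n. s ''st'' v \<le> 1"
  defines "S0 \<equiv> vset s" and "J \<equiv> s ''J'' 0" and "cl \<equiv> s ''cl''"
  obtains s' where "s' = run W worklist_prog s"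
    "grown n J cl (m c) S0 (vset s') (s' ''par'')" "closed_set n J cl (m c) (vset s')"
    "ref_ok n cl (vset s') 0 (s' ''ra'' 0)" "ref_ok n cl (vset s') 1 (s' ''rb'' 0)"
proof -
  let ?body = "PSeq pick_prog (PIf (Minus (V ''n'') (V ''y'')) process_prog PSkip)"
  let ?I = "\<lambda>i s'. worklist_inv n J cl (m c) S0 (vset s') (dset s') (s' ''ra'' 0) (s' ''rb'' 0) (s' ''par'') \<and>
    (\<forall>v<n. s' ''st'' v \<le> 2) \<and> (i \<le> card (dset s') \<or> vset s' = dset s')"
  have fin: "finite (dset t)" for t by (simp add: dset_def)
  have "?I n (run W worklist_prog s)"
    unfolding worklist_prog_def
  proof (rule for_induct[where I = ?I])
    show "word W s" "s ''n'' 0 = n" using inpD[OF s(1)] by simp_all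
    show "wf_prog (PFor ''it'' ''n'' ?body)" "bounds (PFor ''it'' ''n'' ?body) \<inter> writes (PFor ''it'' ''n'' ?body) = {}"
      by (auto simp: prog_defs1)
    have "vset (upd ''it'' 0 0 s) = S0" "dset (upd ''it'' 0 0 s) = {}"
      using s(6) by (fastforce simp: vset_def dset_def S0_def)+
    moreover have "S0 \<subseteq> {..<n}" by (auto simp: S0_def vset_def)
    ultimately show "?I 0 (upd ''it'' 0 0 s)"
      using worklist_init[of S0 n J cl "m c" "s ''par''"] s by (simp add: le_Suc_eq) fastforce
    fix i s1 assume i: "i < n" and I: "?I i s1" and it: "s1 ''it'' 0 = i" and w1: "word W s1"
      and fr: "\<And>y. y \<notin> writes (PFor ''it'' ''n'' ?body) \<Longrightarrow> s1 y = s y"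
    have eq1: "s1 ''n'' = s ''n''" "s1 ''theta'' = s ''theta''" "s1 ''co'' = s ''co''" "s1 ''cl'' = s ''cl''" "s1 ''J'' = s ''J''"
      by (rule fr; simp add: prog_defs1)+
    have in1: "inp s1" using inp_frame[OF s(1) w1] eq1 by simp
    define s2 where "s2 = run W pick_prog s1"
    have w2: "word W s2" unfolding s2_def by (rule word_run[OF w1]) (auto simp: prog_defs1)
    have eq2: "s2 x = s1 x" if "x \<notin> {''y'', ''u''}" for x
      unfolding s2_def by (rule run_frame) (use that in \<open>auto simp: prog_defs1\<close>)
    have in2: "inp s2" using inp_frame[OF in1 w2] eq2 by simp
    note pk = pick[OF in1, folded s2_def]
    have vd2: "vset s2 = vset s1" "dset s2 = dset s1" by (simp_all add: vset_def dset_def eq2)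
    show "?I (Suc i) (upd ''it'' 0 (Suc i) (run W ?body s1))"
    proof (cases "s2 ''y'' 0 = n")
      case True
      hence r: "run W ?body s1 = s2" using inpD[OF in2] by (simp add: s2_def[symmetric])
      have "vset s1 = dset s1"
      proof -
        have "s1 ''st'' v \<noteq> 0 \<longleftrightarrow> s1 ''st'' v = 2" if v: "v < n" for v
        proof -
          have "s1 ''st'' v \<noteq> 1" "s1 ''st'' v \<le> 2" using pk True I v by auto
          thus ?thesis by linarith
        qed
        thus ?thesis unfolding vset_def dset_def by blast
      qed
      thus ?thesis unfolding r using I vd2 eq2 by (simp add: vset_def dset_def)
    next
      case False
      define y where "y = s2 ''y'' 0"
      have y: "y < n" "s1 ''st'' y = 1" using pk False unfolding y_def by auto
      have yS: "y \<in> vset s1" "y \<notin> dset s1" using y by (auto simp: vset_def dset_def)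
      define ra where "ra = (if cl y = 0 \<and> s1 ''ra'' 0 = n then y else s1 ''ra'' 0)"
      define rb where "rb = (if cl y = 1 \<and> s1 ''rb'' 0 = n then y else s1 ''rb'' 0)"
      define s3 where "s3 = run W (PAss ''st'' (V ''y'') (Const 2)) s2"
      define s4 where "s4 = run W (PIf (EAnd (EEq (Cell ''cl'' (V ''y'')) (Const 0)) (EEq (V ''ra'') (V ''n''))) (PAss ''ra'' (Const 0) (V ''y'')) PSkip) s3"
      define s5 where "s5 = run W (PIf (EAnd (EEq (Cell ''cl'' (V ''y'')) (Const 1)) (EEq (V ''rb'') (V ''n''))) (PAss ''rb'' (Const 0) (V ''y'')) PSkip) s4"
      have w3: "word W s3" unfolding s3_def by (rule word_run[OF w2]) auto
      have w4: "word W s4" unfolding s4_def by (rule word_run[OF w3]) auto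
      have w5: "word W s5" unfolding s5_def by (rule word_run[OF w4]) auto
      have st3: "s3 ''st'' = (s1 ''st'')(y := 2)" using eq2[of "''st''"] by (simp add: s3_def y_def upd_def)
      have eq3: "s3 x = s2 x" if "x \<noteq> ''st''" for x unfolding s3_def by (rule run_frame) (use that in auto)
      have eq4: "s4 x = s3 x" if "x \<noteq> ''ra''" for x unfolding s4_def by (rule run_frame) (use that in auto)
      have eq5: "s5 x = s4 x" if "x \<noteq> ''rb''" for x unfolding s5_def by (rule run_frame) (use that in auto)
      have ra4: "s4 ''ra'' 0 = ra"
        unfolding s4_def ra_def using w3 eq3 eq2 eq1 inpD[OF in1] by (auto simp: bval cl_def y_def[symmetric])
      have rb5: "s5 ''rb'' 0 = rb"
        unfolding s5_def rb_def using w4 eq4 eq3 eq2 eq1 inpD[OF in1] by (auto simp: bval cl_def y_def[symmetric])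
      have st5: "s5 ''st'' = (s1 ''st'')(y := 2)" "s5 ''par'' = s1 ''par''" "s5 ''J'' 0 = J" "s5 ''cl'' = cl" "s5 ''y'' 0 = y"
        "s5 ''ra'' 0 = ra" "s5 ''co'' 0 = c"
        using eq5 eq4 eq3 eq2 eq1 st3 ra4 s by (simp_all add: J_def cl_def y_def)
      have in5: "inp s5" by (rule inp_frame[OF in2 w5]) (simp_all add: eq5 eq4 eq3)
      have rr: "ref_ok n cl (dset s1) 0 (s1 ''ra'' 0)" "ref_ok n cl (dset s1) 1 (s1 ''rb'' 0)"
        using I unfolding worklist_inv_def by blast+
      have rle: "ra \<le> n" "rb \<le> n" "cl y = 0 \<Longrightarrow> ra < n" "cl y = 1 \<Longrightarrow> rb < n"
        using rr y unfolding ra_def rb_def ref_ok_def dset_def by (auto split: if_splits)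
      define s6 where "s6 = run W scan_prog s5"
      define N where "N = {v. v < n \<and> v \<notin> vset s1 \<and> fires n J cl (m c) ra rb y v}"
      have sc: "\<forall>v<n. s6 ''st'' v = (if s5 ''st'' v = 0 \<and> fires n (s5 ''J'' 0) (s5 ''cl'') (m c) ra rb y v then 1 else s5 ''st'' v) \<and>
          s6 ''par'' v = (if s5 ''st'' v = 0 \<and> fires n (s5 ''J'' 0) (s5 ''cl'') (m c) ra rb y v then y else s5 ''par'' v)"
        unfolding s6_def by (rule scan) (use in5 st5 rb5 s(3) y rle in auto)
      have N': "v \<in> N \<longleftrightarrow> s5 ''st'' v = 0 \<and> fires n J cl (m c) ra rb y v" if "v < n" for v
        using that y by (auto simp: N_def vset_def st5)
      have sc': "s6 ''st'' v = (if v \<in> N then 1 else s5 ''st'' v)" "s6 ''par'' v = (if v \<in> N then y else s1 ''par'' v)" if "v < n" for v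
        using sc that N'[OF that] by (simp_all add: st5)
      have eq6: "s6 x = s5 x" if "x \<notin> {''v'', ''st'', ''par''}" for x
        unfolding s6_def by (rule run_frame) (use that in \<open>auto simp: prog_defs1\<close>)
      have vs6: "vset s6 = vset s1 \<union> N"
        using sc'(1) y by (auto simp: vset_def st5 N_def split: if_splits)
      have ds6: "dset s6 = insert y (dset s1)"
        using sc'(1) y yS N' by (auto simp: dset_def st5 N_def split: if_splits)
      have "worklist_inv n J cl (m c) S0 (vset s6) (dset s6) ra rb (s6 ''par'')"
        unfolding vs6 ds6
        by (rule worklist_step[OF conjunct1[OF I] yS ra_def rb_def N_def]) (use sc'(2) in auto)
      moreover have "s6 ''st'' v \<le> 2" if "v < n" for v
        using sc'(1)[OF that] I that by (auto simp: st5)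
      moreover have "Suc i \<le> card (dset s6) \<or> vset s6 = dset s6"
      proof -
        have "vset s1 \<noteq> dset s1" using yS by blast
        hence "i \<le> card (dset s1)" using I by blast
        thus ?thesis unfolding ds6 using yS fin by simp
      qed
      moreover have "run W ?body s1 = s6"
      proof -
        have "n - y \<noteq> 0" using y by simp
        thus ?thesis using inpD[OF in2] unfolding s6_def s5_def s4_def s3_def y_def s2_def process_prog_def by simp
      qed
      moreover have "s6 ''ra'' 0 = ra" "s6 ''rb'' 0 = rb" using eq6 st5 rb5 by simp_all
      ultimately show ?thesis by (simp add: vset_def dset_def)
    qed
  qed auto
  \<comment> \<open>Once n vertices are processed, these are all vertices.\<close>
  moreover have "vset t = dset t" if "n \<le> card (dset t) \<or> vset t = dset t" for t
  proof -
    have "dset t \<subseteq> {..<n}" "vset t \<subseteq> {..<n}" "dset t \<subseteq> vset t" by (auto simp: dset_def vset_def)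
    moreover have "dset t = {..<n}" if "n \<le> card (dset t)"
      using card_seteq[of "{..<n}" "dset t"] that calculation by simp
    ultimately show ?thesis using that by blast
  qed
  ultimately have f: "worklist_inv n J cl (m c) S0 (vset (run W worklist_prog s)) (vset (run W worklist_prog s))
    (run W worklist_prog s ''ra'' 0) (run W worklist_prog s ''rb'' 0) (run W worklist_prog s ''par'')"
    by metis
  show thesis
    by (rule that[OF refl _ worklist_final[OF f]]) (use f in \<open>auto simp: worklist_inv_def\<close>)
qed

end

lemma grownD:
  assumes "grown n J cl m S0 S par"
  shows "S0 \<subseteq> S" "S \<subseteq> {..<n}" "S0 \<subseteq> U \<Longrightarrow> closed_set n J cl m U \<Longrightarrow> S \<subseteq> U"
  using assms unfolding grown_def by (elim conjE; simp)+

section \<open>Spanning trees\<close>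

fun pseq :: "prog list \<Rightarrow> prog" where
  "pseq [] = PSkip"
| "pseq (p # ps) = PSeq p (pseq ps)"

abbreviation PSet :: "string \<Rightarrow> exp \<Rightarrow> prog" where "PSet x e \<equiv> PAss x (Const 0) e"

text \<open>With label 3 everywhere no label test applies, and J = 2 makes every adjacency a
  conflict. The closure of vertex 0 is then its component, and \<open>par\<close> is a search
  tree.\<close>

definition tree_init :: prog where
  "tree_init = PFor ''v'' ''n'' (PSeq (PAss ''st'' (V ''v'') (Const 0)) (PAss ''cl'' (V ''v'') (Const 3)))"

text \<open>The trees of T and of its complement share the array \<open>tp\<close>, the second one
  shifted by n; \<open>cn\<close> records whether the search reached every vertex.\<close>

definition tree_store :: "nat \<Rightarrow> prog" where
  "tree_store c = PFor ''v'' ''n'' (PSeq (PAss ''tp'' (Plus (Times (Const c) (V ''n'')) (V ''v'')) (Cell ''par'' (V ''v'')))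
     (PIf (Cell ''st'' (V ''v'')) PSkip (PAss ''cn'' (Const c) (Const 0))))"

definition tree_prog :: "nat \<Rightarrow> prog" where
  "tree_prog c = pseq [PSet ''co'' (Const c), PSet ''J'' (Const 2), PSet ''ra'' (V ''n''), PSet ''rb'' (V ''n''),
     tree_init, PAss ''st'' (Const 0) (Const 1), worklist_prog, PAss ''cn'' (Const c) (Const 1), tree_store c]"

text \<open>A tree rooted at 0, given by parents. The first clause is induction from the root;
  applied to a set that contains 0 but not every vertex, it gives a tree edge leaving that
  set.\<close>

definition spanning :: "nat \<Rightarrow> (nat \<Rightarrow> nat \<Rightarrow> nat) \<Rightarrow> (nat \<Rightarrow> nat) \<Rightarrow> bool" where
  "spanning n mm par \<longleftrightarrow> (\<forall>U. 0 \<in> U \<longrightarrow> (\<forall>v<n. v \<noteq> 0 \<longrightarrow> par v \<in> U \<longrightarrow> v \<in> U) \<longrightarrow> {..<n} \<subseteq> U) \<and>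
     (\<forall>v<n. v \<noteq> 0 \<longrightarrow> par v < n \<and> mm (par v) v \<noteq> 0)"

definition split_set :: "nat \<Rightarrow> (nat \<Rightarrow> nat \<Rightarrow> nat) \<Rightarrow> bool" where
  "split_set n mm \<longleftrightarrow> (\<exists>S. S \<subset> {..<n} \<and> S \<noteq> {} \<and> (\<forall>y\<in>S. \<forall>v<n. v \<notin> S \<longrightarrow> mm y v = 0))"

context ram
begin

lemma tree:
  assumes s: "inp s" "c \<le> 1" and n: "0 < n"
  defines "s' \<equiv> run W (tree_prog c) s"
  shows "inp s'" "s' ''cn'' c \<noteq> 0 \<Longrightarrow> spanning n (m c) (\<lambda>v. s' ''tp'' (c * n + v))"
    "s' ''cn'' c = 0 \<Longrightarrow> split_set n (m c)"
    "d \<noteq> c \<Longrightarrow> s' ''cn'' d = s ''cn'' d" "i \<notin> {c * n..<c * n + n} \<Longrightarrow> s' ''tp'' i = s ''tp'' i"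
proof -
  define s1 where "s1 = run W (pseq [PSet ''co'' (Const c), PSet ''J'' (Const 2), PSet ''ra'' (V ''n''), PSet ''rb'' (V ''n'')]) s"
  define s2 where "s2 = run W tree_init s1"
  define s3 where "s3 = run W (PAss ''st'' (Const 0) (Const 1)) s2"
  define s4 where "s4 = run W worklist_prog s3"
  define s5 where "s5 = run W (PAss ''cn'' (Const c) (Const 1)) s4"
  have s': "s' = run W (tree_store c) s5"
    unfolding s'_def s5_def s4_def s3_def s2_def s1_def tree_prog_def by simp
  have cW: "c mod W = c" using s(2) W_small(2) by (simp del: W_small)
  have w1: "word W s1" unfolding s1_def by (rule word_run) (use inpD[OF s(1)] in auto)
  have w2: "word W s2" unfolding s2_def by (rule word_run[OF w1]) (auto simp: tree_init_def)
  have w3: "word W s3" unfolding s3_def by (rule word_run[OF w2]) auto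
  have w4: "word W s4" unfolding s4_def by (rule word_run[OF w3]) (auto simp: prog_defs1)
  have w5: "word W s5" unfolding s5_def by (rule word_run[OF w4]) auto
  have w': "word W s'" unfolding s' by (rule word_run[OF w5]) (auto simp: tree_store_def)
  have v1: "s1 ''co'' 0 = c" "s1 ''J'' 0 = 2" "s1 ''ra'' 0 = n" "s1 ''rb'' 0 = n" "s1 ''n'' 0 = n"
    unfolding s1_def using inpD[OF s(1)] cW by simp_all
  have f1: "s1 x = s x" if "x \<notin> {''co'', ''J'', ''ra'', ''rb''}" for x
    unfolding s1_def by (rule run_frame) (use that in auto)
  have f2: "s2 x = s1 x" if "x \<notin> {''v'', ''st'', ''cl''}" for x
    unfolding s2_def by (rule run_frame) (use that in \<open>auto simp: tree_init_def\<close>)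
  have f3: "s3 x = s2 x" if "x \<noteq> ''st''" for x
    unfolding s3_def by (rule run_frame) (use that in auto)
  have f4: "s4 x = s3 x" if "x \<notin> {''it'', ''y'', ''u'', ''v'', ''st'', ''par'', ''ra'', ''rb''}" for x
    unfolding s4_def by (rule run_frame) (use that in \<open>auto simp: prog_defs1\<close>)
  have f5: "s5 x = s4 x" if "x \<noteq> ''cn''" for x
    unfolding s5_def by (rule run_frame) (use that in auto)
  have f': "s' x = s5 x" if "x \<notin> {''v'', ''tp'', ''cn''}" for x
    unfolding s' by (rule run_frame) (use that in \<open>auto simp: tree_store_def\<close>)
  show in': "inp s'" by (rule inp_frame[OF s(1) w']) (simp_all add: f' f5 f4 f3 f2 f1)
  have in3: "inp s3" by (rule inp_frame[OF s(1) w3]) (simp_all add: f3 f2 f1)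
  have st2: "\<forall>v<n. s2 ''st'' v = 0"
  proof -
    let ?I = "\<lambda>i t. \<forall>v<i. t ''st'' v = 0"
    have "?I n s2" unfolding s2_def tree_init_def
      by (rule for_induct[where I = ?I, OF w1]) (auto simp: v1 less_Suc_eq)
    thus ?thesis .
  qed
  have st3: "s3 ''st'' v = of_bool (v = 0)" if "v < n" for v
    unfolding s3_def using st2 that by simp
  hence vs3: "vset s3 = {0}" using n by (auto simp: vset_def)
  have le3: "\<forall>v<n. s3 ''st'' v \<le> 1" using st3 by simp
  have co3: "s3 ''co'' 0 = c" "s3 ''ra'' 0 = n" "s3 ''rb'' 0 = n" "s3 ''J'' 0 = 2" using v1 f2 f3 by simp_all
  obtain t where t: "t = run W worklist_prog s3"
    "grown n (s3 ''J'' 0) (s3 ''cl'') (m c) (vset s3) (vset t) (t ''par'')"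
    "closed_set n (s3 ''J'' 0) (s3 ''cl'') (m c) (vset t)"
    by (rule worklist[OF in3 co3(1) s(2) co3(2,3) le3])
  have t4: "t = s4" using t(1) s4_def by simp
  have g: "grown n 2 (s3 ''cl'') (m c) {0} (vset s4) (s4 ''par'')" and cs: "closed_set n 2 (s3 ''cl'') (m c) (vset s4)"
    using t(2,3) t4 co3 vs3 by simp_all
  let ?I = "\<lambda>i t. (\<forall>v<n. t ''tp'' (c * n + v) = (if v < i then s5 ''par'' v else s ''tp'' (c * n + v))) \<and>
    (\<forall>k. k \<notin> {c * n..<c * n + n} \<longrightarrow> t ''tp'' k = s ''tp'' k) \<and> (\<forall>d. d \<noteq> c \<longrightarrow> t ''cn'' d = s ''cn'' d) \<and>
    t ''cn'' c = of_bool (\<forall>v<i. s5 ''st'' v \<noteq> 0)"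
  have "?I n s'"
    unfolding s' tree_store_def
  proof (rule for_induct[where I = ?I, OF w5])
    show "s5 ''n'' 0 = n" using f5 f4 f3 f2 v1 by simp
    have "s5 ''tp'' = s ''tp''" using f5 f4 f3 f2 f1 by simp
    moreover have "s5 ''cn'' = (s ''cn'')(c := 1)" using f4 f3 f2 f1 cW by (simp add: s5_def upd_def)
    ultimately show "?I 0 (upd ''v'' 0 0 s5)" by simp
    fix i u assume i: "i < n" and I: "?I i u" and v: "u ''v'' 0 = i" and w: "word W u"
      and fr: "\<And>y. y \<notin> writes (PFor ''v'' ''n'' (PSeq (PAss ''tp'' (Plus (Times (Const c) (V ''n'')) (V ''v'')) (Cell ''par'' (V ''v'')))
     (PIf (Cell ''st'' (V ''v'')) PSkip (PAss ''cn'' (Const c) (Const 0))))) \<Longrightarrow> u y = s5 y"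
    have e: "u ''n'' = s5 ''n''" "u ''par'' = s5 ''par''" "u ''st'' = s5 ''st''" by (rule fr; simp)+
    have n5: "s5 ''n'' 0 = n" using f5 f4 f3 f2 v1 by simp
    have "c * n + i < W" "c * n < W" using index_less(2)[of c i] index_less(2)[of c 0] s(2) i by auto
    hence idx: "val W (Plus (Times (Const c) (V ''n'')) (V ''v'')) u = c * n + i"
      using cW v e n5 by simp
    show "?I (Suc i) (upd ''v'' 0 (Suc i) (run W (PSeq (PAss ''tp'' (Plus (Times (Const c) (V ''n'')) (V ''v'')) (Cell ''par'' (V ''v'')))
     (PIf (Cell ''st'' (V ''v'')) PSkip (PAss ''cn'' (Const c) (Const 0)))) u))"
      using I i v e cW unfolding run.simps idx by (auto simp: less_Suc_eq)
  qed (use s(2) in auto)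
  hence tp: "\<And>v. v < n \<Longrightarrow> s' ''tp'' (c * n + v) = s4 ''par'' v"
    and o: "\<forall>k. k \<notin> {c * n..<c * n + n} \<longrightarrow> s' ''tp'' k = s ''tp'' k" "\<forall>d. d \<noteq> c \<longrightarrow> s' ''cn'' d = s ''cn'' d"
    and cn: "s' ''cn'' c = of_bool (\<forall>v<n. s4 ''st'' v \<noteq> 0)"
    using f5 by auto
  show "d \<noteq> c \<Longrightarrow> s' ''cn'' d = s ''cn'' d" "i \<notin> {c * n..<c * n + n} \<Longrightarrow> s' ''tp'' i = s ''tp'' i" using o by blast+
  show "spanning n (m c) (\<lambda>v. s' ''tp'' (c * n + v))" if "s' ''cn'' c \<noteq> 0"
  proof -
    have "\<forall>v<n. s4 ''st'' v \<noteq> 0" using that cn by simp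
    hence vs: "vset s4 = {..<n}" by (auto simp: vset_def)
    have ball: "\<forall>v<n. v \<noteq> 0 \<longrightarrow> s4 ''par'' v < n \<and> m c (s4 ''par'' v) v \<noteq> 0"
      using g unfolding grown_def vs by auto
    have all: "{..<n} \<subseteq> U" if "0 \<in> U" "\<forall>v<n. v \<noteq> 0 \<longrightarrow> s4 ''par'' v \<in> U \<longrightarrow> v \<in> U" for U
    proof -
      have "{0} \<subseteq> U" "\<forall>v\<in>{..<n} - {0}. s4 ''par'' v \<in> U \<longrightarrow> v \<in> U" using that by auto
      thus ?thesis using g unfolding grown_def vs by meson
    qed
    show ?thesis unfolding spanning_def using ball all tp by simp
  qed
  show "split_set n (m c)" if "s' ''cn'' c = 0"
  proof -
    have "\<not> (\<forall>v<n. s4 ''st'' v \<noteq> 0)" using that cn by simp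
    then obtain v where "v < n" "s4 ''st'' v = 0" by blast
    hence "v \<in> {..<n}" "v \<notin> vset s4" by (simp_all add: vset_def)
    moreover have "vset s4 \<subseteq> {..<n}" by (auto simp: vset_def)
    ultimately have "vset s4 \<subset> {..<n}" by blast
    moreover have "vset s4 \<noteq> {}" using grownD(1)[OF g] by blast
    moreover have "m c y v = 0" if "y \<in> vset s4" "v < n" "v \<notin> vset s4" for y v
      using cs that unfolding closed_set_def conflict_def by metis
    ultimately show ?thesis unfolding split_set_def by blast
  qed
qed

end

section \<open>Seeds, the test that accepts their closures, and the search for the smallest
  one\<close>

section \<open>Candidates\<close>

definition closure :: "nat \<Rightarrow> nat \<Rightarrow> (nat \<Rightarrow> nat) \<Rightarrow> (nat \<Rightarrow> nat \<Rightarrow> nat) \<Rightarrow> nat set \<Rightarrow> nat set" where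
  "closure n J cl mm S0 = \<Inter>{U. U \<subseteq> {..<n} \<and> S0 \<subseteq> U \<and> closed_set n J cl mm U}"

lemma closed_set_cong:
  assumes "U \<subseteq> {..<n}" "\<And>v. v < n \<Longrightarrow> cl v = cl' v"
  shows "closed_set n J cl mm U = closed_set n J cl' mm U"
proof -
  have "conflict J cl mm v y z = conflict J cl' mm v y z" if "y \<in> U" "z \<in> U" for v y z
    using assms that unfolding conflict_def by (metis lessThan_iff subsetD)
  thus ?thesis unfolding closed_set_def by metis
qed

lemma grown_closure:
  assumes "grown n J cl mm S0 S par" "closed_set n J cl mm S" "\<And>v. v < n \<Longrightarrow> cl v = cl' v"
  shows "S = closure n J cl' mm S0"
proof -
  have g: "S0 \<subseteq> S" "S \<subseteq> {..<n}" "\<And>U. S0 \<subseteq> U \<Longrightarrow> closed_set n J cl mm U \<Longrightarrow> S \<subseteq> U"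
    using grownD(1,2)[OF assms(1)] grownD(3)[OF assms(1)] by simp_all
  have "closed_set n J cl' mm S" using closed_set_cong[of S n cl cl', OF g(2) assms(3)] assms(2) by blast
  hence "closure n J cl' mm S0 \<subseteq> S" unfolding closure_def using g by blast
  moreover have "S \<subseteq> U" if "U \<subseteq> {..<n}" "S0 \<subseteq> U" "closed_set n J cl' mm U" for U
    using g(3)[OF that(2)] closed_set_cong[of U n cl cl', OF that(1) assms(3)] that(3) by blast
  hence "S \<subseteq> closure n J cl' mm S0" unfolding closure_def by blast
  ultimately show ?thesis by blast
qed

text \<open>The role of a vertex inside is visible from outside: A1 sees only a2, B1 sees only b2,
  C1 sees neither. For homogeneous pairs one outside vertex complete to A and anticomplete to B
  suffices. The label 3 marks vertices that can have no role, among them a2 and b2.\<close>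

definition part :: "nat \<Rightarrow> (nat \<Rightarrow> nat \<Rightarrow> nat) \<Rightarrow> nat \<Rightarrow> nat \<Rightarrow> nat \<Rightarrow> nat" where
  "part J mm a2 b2 v = (if v = a2 \<or> v = b2 then 3
     else if J = 0 then (if mm a2 v = 2 then 0 else if mm a2 v = 0 then 1 else 3)
     else if mm a2 v = 2 \<and> mm b2 v = 0 then 0 else if mm a2 v = 0 \<and> mm b2 v = 2 then 1
     else if mm a2 v = 0 \<and> mm b2 v = 0 then 2 else 3)"

text \<open>For a 2-join, x = y = 0 asks whether C2 is nonempty; for a homogeneous pair the values 0
  and 2 select the four outer classes.\<close>

definition outer :: "nat \<Rightarrow> (nat \<Rightarrow> nat) \<Rightarrow> (nat \<Rightarrow> nat \<Rightarrow> nat) \<Rightarrow> nat set \<Rightarrow> nat \<Rightarrow> nat \<Rightarrow> bool" where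
  "outer n cl mm S x y \<longleftrightarrow> (\<exists>v<n. v \<notin> S \<and> (\<forall>u\<in>S. (cl u = 0 \<longrightarrow> mm u v = x) \<and> (cl u = 1 \<longrightarrow> mm u v = y)))"

text \<open>Adding \<open>of_bool\<close> to 3 encodes the requirement of at least three vertices,
  and of more than three if the C part is nonempty, once for each side of a 2-join.\<close>

definition accept :: "nat \<Rightarrow> nat \<Rightarrow> (nat \<Rightarrow> nat) \<Rightarrow> (nat \<Rightarrow> nat \<Rightarrow> nat) \<Rightarrow> nat set \<Rightarrow> nat \<Rightarrow> bool \<Rightarrow> bool" where
  "accept n J cl mm S a1 conn \<longleftrightarrow> (\<exists>v\<in>S. cl v = 0) \<and> (\<exists>v\<in>S. cl v = 1) \<and> (\<forall>v\<in>S. cl v \<noteq> 3) \<and>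
     (if J = 1 then conn \<and> cl a1 = 0 \<and> card S \<ge> 3 + of_bool (\<exists>v\<in>S. cl v = 2) \<and>
        n - card S \<ge> 3 + of_bool (outer n cl mm S 0 0)
      else card S \<ge> 3 \<and> outer n cl mm S 0 0 \<and> outer n cl mm S 0 2 \<and> outer n cl mm S 2 0 \<and> outer n cl mm S 2 2)"

text \<open>A seed number is \<open>((md * n + p) * n + q) * n + r\<close>. The mode
  \<open>md\<close> is 0 or 1 for T, 2 or 3 for the complement and 4 for homogeneous pairs; its
  parity tells which end of the tree edge at p is a1. The parent is reduced modulo n because only
  away from the root of a spanning tree is it known to be a vertex.\<close>

definition decode_prog :: prog where
  "decode_prog = pseq [
     PSet ''md'' (Div (V ''sg'') (Times (V ''n'') (Times (V ''n'') (V ''n'')))),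
     PSet ''p'' (EMod (Div (V ''sg'') (Times (V ''n'') (V ''n''))) (V ''n'')),
     PSet ''q'' (EMod (Div (V ''sg'') (V ''n'')) (V ''n'')),
     PSet ''r'' (EMod (V ''sg'') (V ''n'')),
     PSet ''co'' (EEq (Div (V ''md'') (Const 2)) (Const 1)),
     PSet ''J'' (ENot (EEq (V ''md'') (Const 4))),
     PSet ''tq'' (EMod (Cell ''tp'' (Plus (Times (V ''co'') (V ''n'')) (V ''p''))) (V ''n'')),
     PSet ''fl'' (EMod (V ''md'') (Const 2))]"

definition seed_prog :: prog where
  "seed_prog = pseq [
     PSet ''ra'' (V ''n''), PSet ''rb'' (V ''n''),
     PIf (V ''J'')
       (PIf (V ''fl'') (pseq [PSet ''a1'' (V ''tq''), PSet ''a2'' (V ''p''), PSet ''b2'' (V ''q'')])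
         (pseq [PSet ''a1'' (V ''p''), PSet ''a2'' (V ''tq''), PSet ''b2'' (V ''q'')]))
       (pseq [PSet ''a1'' (V ''q''), PSet ''a2'' (V ''p''), PSet ''b2'' (V ''p'')])]"

text \<open>Subtracting the weights 3, 2, 1 of the mutually exclusive cases A, B, C from 3 gives the
  labels 0, 1, 2, and 3 if no case applies.\<close>

definition part_exp :: exp where
  "part_exp = (let v = V ''v''; a = V ''a2''; b = V ''b2''; J = V ''J''; ta = ETh a v; tb = ETh b v; z = Const 0; two = Const 2
     in Minus (Const 3) (Times (ENot (EOr (EEq v a) (EEq v b)))
       (Plus (Times (Const 3) (EAnd (EEq ta two) (EOr (ENot J) (EEq tb z))))
         (Plus (Times two (EAnd (EEq ta z) (EOr (ENot J) (EEq tb two))))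
           (EAnd J (EAnd (EEq ta z) (EEq tb z)))))))"

definition part_prog :: prog where
  "part_prog = PFor ''v'' ''n'' (PSeq (PAss ''st'' (V ''v'') (Const 0)) (PAss ''cl'' (V ''v'') part_exp))"

text \<open>The cell \<open>3 * x + y\<close> of the array \<open>e\<close> records that some
  outside vertex has entry x towards ra and y towards rb. The four outer classes are the cells 0, 2,
  6 and 8.\<close>

definition stat_prog :: prog where
  "stat_prog = PFor ''v'' ''n'' (PIf (Cell ''st'' (V ''v''))
     (pseq [PSet ''sz'' (Plus (V ''sz'') (Const 1)),
        PIf (EEq (Cell ''cl'' (V ''v'')) (Const 3)) (PSet ''bad'' (Const 1)) PSkip,
        PIf (EEq (Cell ''cl'' (V ''v'')) (Const 2)) (PSet ''c1'' (Const 1)) PSkip])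
     (PAss ''e'' (Plus (Times (Const 3) (ETh (V ''ra'') (V ''v''))) (ETh (V ''rb'') (V ''v''))) (Const 1)))"

definition accept_exp :: exp where
  "accept_exp = EAnd (Minus (V ''n'') (V ''ra'')) (EAnd (Minus (V ''n'') (V ''rb'')) (EAnd (ENot (V ''bad''))
     (EOr
       (EAnd (V ''J'') (EAnd (Cell ''cn'' (V ''co'')) (EAnd (EEq (Cell ''cl'' (V ''a1'')) (Const 0))
         (EAnd (Minus (V ''sz'') (Plus (Const 2) (V ''c1'')))
           (Minus (Minus (V ''n'') (V ''sz'')) (Plus (Const 2) (V ''e'')))))))
       (EAnd (ENot (V ''J'')) (EAnd (Minus (V ''sz'') (Const 2)) (EAnd (V ''e'') (EAnd (Cell ''e'' (Const 2))
         (EAnd (Cell ''e'' (Const 6)) (Cell ''e'' (Const 8))))))))))"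

definition cand_prog :: prog where
  "cand_prog = pseq [decode_prog, seed_prog, part_prog, PAss ''st'' (V ''a1'') (Const 1), PAss ''st'' (V ''r'') (Const 1),
     worklist_prog, PSet ''sz'' (Const 0), PSet ''bad'' (Const 0), PSet ''c1'' (Const 0), PAss ''e'' (Const 0) (Const 0),
     PAss ''e'' (Const 2) (Const 0), PAss ''e'' (Const 6) (Const 0), PAss ''e'' (Const 8) (Const 0),
     stat_prog, PSet ''ok'' accept_exp]"

lemmas prog_defs2 = decode_prog_def seed_prog_def part_prog_def stat_prog_def cand_prog_def prog_defs1

record seed =
  sd_co :: nat
  sd_J :: nat
  sd_a1 :: nat
  sd_a2 :: nat
  sd_b2 :: nat
  sd_c :: nat

definition decode :: "nat \<Rightarrow> (nat \<Rightarrow> nat) \<Rightarrow> nat \<Rightarrow> seed" where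
  "decode n tp k = (let md = k div (n * (n * n)); p = k div (n * n) mod n; q = k div n mod n; r = k mod n;
       co = of_bool (md div 2 = 1); J = of_bool (md \<noteq> 4); t = tp (co * n + p) mod n; f = odd md
     in \<lparr>sd_co = co, sd_J = J, sd_a1 = (if J = 0 then q else if f then t else p),
         sd_a2 = (if J = 0 then p else if f then p else t), sd_b2 = (if J = 0 then p else q), sd_c = r\<rparr>)"

context ram
begin

definition seed_part :: "seed \<Rightarrow> nat \<Rightarrow> nat" where
  "seed_part d = part (sd_J d) (m (sd_co d)) (sd_a2 d) (sd_b2 d)"

definition seed_set :: "seed \<Rightarrow> nat set" where
  "seed_set d = closure n (sd_J d) (seed_part d) (m (sd_co d)) {sd_a1 d, sd_c d}"

definition seed_ok :: "(nat \<Rightarrow> nat) \<Rightarrow> seed \<Rightarrow> bool" where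
  "seed_ok cn d \<longleftrightarrow> accept n (sd_J d) (seed_part d) (m (sd_co d)) (seed_set d) (sd_a1 d) (cn (sd_co d) \<noteq> 0)"

lemma decode_bounds:
  assumes "0 < n"
  shows "sd_co (decode n tp k) \<le> 1" "sd_J (decode n tp k) \<le> 1" "sd_a1 (decode n tp k) < n"
    "sd_a2 (decode n tp k) < n" "sd_b2 (decode n tp k) < n" "sd_c (decode n tp k) < n"
  using assms by (auto simp: decode_def Let_def)

lemma val_part:
  assumes s: "inp s" "s ''co'' 0 = c" "c \<le> 1" "s ''a2'' 0 = a2" "s ''b2'' 0 = b2" "s ''v'' 0 = v" "s ''J'' 0 = J" "J \<le> 1"
    and b: "a2 < n" "b2 < n" "v < n"
  shows "val W part_exp s = part J (m c) a2 b2 v"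
proof -
  note w = inpD[OF s(1)]
  have ta: "val W (ETh (V ''a2'') (V ''v'')) s = m c a2 v" and tb: "val W (ETh (V ''b2'') (V ''v'')) s = m c b2 v"
    using s b by (auto intro!: val_ETh)
  have num: "val W (Const 0) s = 0" "val W (Const 1) s = 1" "val W (Const 2) s = 2" "val W (Const 3) s = 3" by simp_all
  have ob: "(of_bool P = (0::nat)) = (\<not> P)" for P by simp
  have le: "2 < W" "3 < W" "4 < W" "5 < W" "6 < W" using W_ge(1) by simp_all
  have J: "J = 0 \<or> J = 1" using s(8) by auto
  show ?thesis
    unfolding part_exp_def Let_def part_def
    using J le s b
    by (auto simp: bval(1-3) val_EEq[OF W_small(1) w(1)] ta tb num ob)
qed

lemma of_bool_W [simp]: "of_bool P < W"
  by (cases P) auto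

lemma decode_run:
  assumes s: "inp s" "s ''sg'' 0 = k" and n: "0 < n"
  defines "s' \<equiv> run W decode_prog s" and "md \<equiv> k div (n * (n * n))"
  defines "cc \<equiv> of_bool (md div 2 = 1) :: nat" and "p \<equiv> k div (n * n) mod n"
  shows "s' ''p'' 0 = p" "s' ''q'' 0 = k div n mod n" "s' ''r'' 0 = k mod n"
    "s' ''co'' 0 = cc" "s' ''J'' 0 = of_bool (md \<noteq> 4)" "s' ''tq'' 0 = s ''tp'' (cc * n + p) mod n" "s' ''fl'' 0 = md mod 2"
proof -
  note w = inpD[OF s(1)]
  have k: "k < W" using wordD[OF w(1), of "''sg''" 0] s(2) by simp
  have md: "md < W" unfolding md_def using k by (rule le_less_trans[OF div_le_dividend])
  have pn: "p < n" unfolding p_def using n by simp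
  have lt: "n * n < W" "n * (n * n) < W" using W_ge(2,3) by (auto simp: algebra_simps)
  have cc: "cc \<le> 1" unfolding cc_def by simp
  have idx: "cc * n < W" "cc * n + p < W"
    using index_less(2)[of cc p] index_less(2)[of cc 0] cc pn n by auto
  have mods: "x mod n < W" for x using mod_less_divisor[OF n, of x] n_less(1) by linarith
  have md2: "md mod 2 < W" using W_small(1) mod_less_divisor[of 2 md] by linarith
  have four: "4 mod W = 4" using W_ge(1) by simp
  define s1 where "s1 = upd ''md'' 0 md s"
  define s2 where "s2 = upd ''p'' 0 p s1"
  define s3 where "s3 = upd ''q'' 0 (k div n mod n) s2"
  define s4 where "s4 = upd ''r'' 0 (k mod n) s3"
  define s5 where "s5 = upd ''co'' 0 cc s4"
  define s6 where "s6 = upd ''J'' 0 (of_bool (md \<noteq> 4)) s5"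
  define s7 where "s7 = upd ''tq'' 0 (s ''tp'' (cc * n + p) mod n) s6"
  define s8 where "s8 = upd ''fl'' 0 (md mod 2) s7"
  have w1: "word W s1" unfolding s1_def by (rule word_upd[OF w(1) md])
  have w2: "word W s2" unfolding s2_def by (rule word_upd[OF w1]) (use pn n_less(1) in linarith)
  have w3: "word W s3" unfolding s3_def by (rule word_upd[OF w2 mods])
  have w4: "word W s4" unfolding s4_def by (rule word_upd[OF w3 mods])
  have w5: "word W s5" unfolding s5_def by (rule word_upd[OF w4]) (simp add: cc_def)
  have w6: "word W s6" unfolding s6_def by (rule word_upd[OF w5]) simp
  have w7: "word W s7" unfolding s7_def by (rule word_upd[OF w6 mods])
  have e1: "run W (PSet ''md'' (Div (V ''sg'') (Times (V ''n'') (Times (V ''n'') (V ''n''))))) s = s1"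
    using w lt s by (simp add: s1_def md_def)
  have e2: "run W (PSet ''p'' (EMod (Div (V ''sg'') (Times (V ''n'') (V ''n''))) (V ''n''))) s1 = s2"
    using w lt s by (simp add: s2_def p_def val_EMod[OF w1]) (simp add: s1_def)
  have e3: "run W (PSet ''q'' (EMod (Div (V ''sg'') (V ''n'')) (V ''n''))) s2 = s3"
    using w s by (simp add: s3_def val_EMod[OF w2]) (simp add: s1_def s2_def)
  have e4: "run W (PSet ''r'' (EMod (V ''sg'') (V ''n''))) s3 = s4"
    using w s by (simp add: s4_def val_EMod[OF w3]) (simp add: s1_def s2_def s3_def)
  have e5: "run W (PSet ''co'' (EEq (Div (V ''md'') (Const 2)) (Const 1))) s4 = s5"
    by (simp add: s5_def val_EEq[OF W_small(1) w4]) (simp add: s1_def s2_def s3_def s4_def cc_def)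
  have e6: "run W (PSet ''J'' (ENot (EEq (V ''md'') (Const 4)))) s5 = s6"
    by (simp add: s6_def bval(1) val_EEq[OF W_small(1) w5] four) (simp add: s1_def s2_def s3_def s4_def s5_def)
  have e7: "run W (PSet ''tq'' (EMod (Cell ''tp'' (Plus (Times (V ''co'') (V ''n'')) (V ''p''))) (V ''n''))) s6 = s7"
    using w idx by (simp add: s7_def val_EMod[OF w6]) (simp add: s1_def s2_def s3_def s4_def s5_def s6_def)
  have e8: "run W (PSet ''fl'' (EMod (V ''md'') (Const 2))) s7 = s8"
    by (simp add: s8_def val_EMod[OF w7]) (simp add: s1_def s2_def s3_def s4_def s5_def s6_def s7_def)
  have s': "s' = s8" unfolding s'_def decode_prog_def pseq.simps run.simps(1,3) e1 e2 e3 e4 e5 e6 e7 e8 ..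
  show "s' ''p'' 0 = p" "s' ''q'' 0 = k div n mod n" "s' ''r'' 0 = k mod n"
    "s' ''co'' 0 = cc" "s' ''J'' 0 = of_bool (md \<noteq> 4)" "s' ''tq'' 0 = s ''tp'' (cc * n + p) mod n" "s' ''fl'' 0 = md mod 2"
    unfolding s' by (simp_all add: s1_def s2_def s3_def s4_def s5_def s6_def s7_def s8_def)
qed

lemma stat_run:
  assumes s: "inp s" "s ''co'' 0 = c" "c \<le> 1" "s ''sz'' 0 = 0" "s ''bad'' 0 = 0" "s ''c1'' 0 = 0"
    and e: "s ''e'' 0 = 0" "s ''e'' 2 = 0" "s ''e'' 6 = 0" "s ''e'' 8 = 0"
    and r: "s ''ra'' 0 = ra" "s ''rb'' 0 = rb"
  defines "s' \<equiv> run W stat_prog s" and "S \<equiv> vset s"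
  shows "s' ''sz'' 0 = card S" "s' ''bad'' 0 = of_bool (\<exists>v\<in>S. s ''cl'' v = 3)"
    "s' ''c1'' 0 = of_bool (\<exists>v\<in>S. s ''cl'' v = 2)"
    "ra < n \<Longrightarrow> rb < n \<Longrightarrow> k \<in> {0, 2, 6, 8} \<Longrightarrow>
      s' ''e'' k = of_bool (\<exists>v<n. v \<notin> S \<and> 3 * m c ra v + m c rb v = k)"
proof -
  let ?I = "\<lambda>i t. t ''sz'' 0 = card {v\<in>S. v < i} \<and> t ''bad'' 0 = of_bool (\<exists>v\<in>S. v < i \<and> s ''cl'' v = 3) \<and>
    t ''c1'' 0 = of_bool (\<exists>v\<in>S. v < i \<and> s ''cl'' v = 2) \<and>
    (ra < n \<and> rb < n \<longrightarrow> (\<forall>k\<in>{0, 2, 6, 8}. t ''e'' k = of_bool (\<exists>v<i. v \<notin> S \<and> 3 * m c ra v + m c rb v = k)))"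
  let ?body = "PIf (Cell ''st'' (V ''v''))
     (pseq [PSet ''sz'' (Plus (V ''sz'') (Const 1)),
        PIf (EEq (Cell ''cl'' (V ''v'')) (Const 3)) (PSet ''bad'' (Const 1)) PSkip,
        PIf (EEq (Cell ''cl'' (V ''v'')) (Const 2)) (PSet ''c1'' (Const 1)) PSkip])
     (PAss ''e'' (Plus (Times (Const 3) (ETh (V ''ra'') (V ''v''))) (ETh (V ''rb'') (V ''v''))) (Const 1))"
  have Sn: "S \<subseteq> {..<n}" "finite S" by (auto simp: S_def vset_def)
  have "?I n s'"
    unfolding s'_def stat_prog_def
  proof (rule for_induct[where I = ?I])
    show "word W s" "s ''n'' 0 = n" using inpD[OF s(1)] by simp_all
    show "?I 0 (upd ''v'' 0 0 s)" using s e by auto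
    fix i t assume i: "i < n" and I: "?I i t" and v: "t ''v'' 0 = i" and w: "word W t"
      and fr: "\<And>y. y \<notin> writes (PFor ''v'' ''n'' ?body) \<Longrightarrow> t y = s y"
    have eq: "t ''n'' = s ''n''" "t ''theta'' = s ''theta''" "t ''co'' = s ''co''" "t ''ra'' = s ''ra''" "t ''rb'' = s ''rb''"
      "t ''cl'' = s ''cl''" "t ''st'' = s ''st''"
      by (rule fr; simp)+
    have in': "inp t" using inp_frame[OF s(1) w] eq by simp
    show "?I (Suc i) (upd ''v'' 0 (Suc i) (run W ?body t))"
    proof (cases "i \<in> S")
      case True
      have st: "t ''st'' i \<noteq> 0" using True eq by (simp add: S_def vset_def)
      have set: "{v\<in>S. v < Suc i} = insert i {v\<in>S. v < i}" using True by (auto simp: less_Suc_eq)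
      have cs: "card {v\<in>S. v < Suc i} = Suc (card {v\<in>S. v < i})" unfolding set using Sn by simp
      have "card {v\<in>S. v < i} \<le> card {..<i}" by (rule card_mono) auto
      hence "card {v\<in>S. v < i} \<le> i" by simp
      hence lt: "Suc (card {v\<in>S. v < i}) < W" using i n_less(1) by linarith
      define t1 where "t1 = upd ''sz'' 0 (card {v\<in>S. v < Suc i}) t"
      have e1: "run W (PSet ''sz'' (Plus (V ''sz'') (Const 1))) t = t1"
        unfolding t1_def using I lt cs by simp
      have w1: "word W t1" unfolding t1_def by (rule word_upd[OF w]) (use lt cs in simp)
      define t2 where "t2 = run W (PIf (EEq (Cell ''cl'' (V ''v'')) (Const 3)) (PSet ''bad'' (Const 1)) PSkip) t1"
      have w2: "word W t2" unfolding t2_def by (rule word_run[OF w1]) auto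
      have t2: "t2 = (if s ''cl'' i = 3 then upd ''bad'' 0 1 t1 else t1)"
        unfolding t2_def by (simp add: val_EEq[OF W_small(1) w1]) (simp add: t1_def v eq)
      have t3: "run W (PIf (EEq (Cell ''cl'' (V ''v'')) (Const 2)) (PSet ''c1'' (Const 1)) PSkip) t2
        = (if s ''cl'' i = 2 then upd ''c1'' 0 1 t2 else t2)"
        by (simp add: val_EEq[OF W_small(1) w2]) (simp add: t2 t1_def v eq)
      have g: "val W (Cell ''st'' (V ''v'')) t \<noteq> 0" using st v by simp
      have "run W ?body t = run W (pseq [PSet ''sz'' (Plus (V ''sz'') (Const 1)),
        PIf (EEq (Cell ''cl'' (V ''v'')) (Const 3)) (PSet ''bad'' (Const 1)) PSkip,
        PIf (EEq (Cell ''cl'' (V ''v'')) (Const 2)) (PSet ''c1'' (Const 1)) PSkip]) t"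
        by (simp only: run.simps(4) g if_True simp_thms not_False_eq_True)
      also have "\<dots> = (if s ''cl'' i = 2 then upd ''c1'' 0 1 t2 else t2)"
        unfolding pseq.simps run.simps(1,3) e1 t2_def[symmetric] t3 ..
      finally have "run W ?body t = (if s ''cl'' i = 2 then upd ''c1'' 0 1 t2 else t2)" .
      hence r: "run W ?body t = (if s ''cl'' i = 2 then upd ''c1'' 0 1 t1 else if s ''cl'' i = 3 then upd ''bad'' 0 1 t1 else t1)"
        unfolding t2 by auto
      have ex: "(\<exists>v\<in>S. v < Suc i \<and> s ''cl'' v = x) \<longleftrightarrow> (\<exists>v\<in>S. v < i \<and> s ''cl'' v = x) \<or> s ''cl'' i = x" for x
        using True by (auto simp: less_Suc_eq)
      have ex2: "(\<exists>v<Suc i. v \<notin> S \<and> Q v) \<longleftrightarrow> (\<exists>v<i. v \<notin> S \<and> Q v)" for Q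
        using True by (auto simp: less_Suc_eq)
      show ?thesis unfolding r ex ex2 using I by (auto simp: t1_def)
    next
      case False
      have st: "t ''st'' i = 0" using False i eq by (simp add: S_def vset_def)
      have set: "{v\<in>S. v < Suc i} = {v\<in>S. v < i}" using False by (auto simp: less_Suc_eq)
      \<comment> \<open>Without both references this index is arbitrary, but then
        \<open>accept_exp\<close> rejects before reading \<open>e\<close>'s meaning into the
        result.\<close>
      define k where "k = val W (Plus (Times (Const 3) (ETh (V ''ra'') (V ''v''))) (ETh (V ''rb'') (V ''v''))) t"
      have rr: "run W ?body t = upd ''e'' k 1 t" using st v by (simp add: k_def)
      have kk: "k = 3 * m c ra i + m c rb i" if "ra < n" "rb < n"
      proof -
        have a: "val W (ETh (V ''ra'') (V ''v'')) t = m c ra i" "val W (ETh (V ''rb'') (V ''v'')) t = m c rb i"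
          using in' eq s r v i that by (auto intro!: val_ETh)
        have "3 * m c ra i \<le> 6" "3 * m c ra i + m c rb i \<le> 8" using m_le[of c ra i] m_le[of c rb i] by linarith+
        hence "3 * m c ra i < W" "3 * m c ra i + m c rb i < W" using W_ge(1) by linarith+
        thus ?thesis unfolding k_def using a by simp
      qed
      have ex: "(\<exists>v\<in>S. v < Suc i \<and> s ''cl'' v = x) \<longleftrightarrow> (\<exists>v\<in>S. v < i \<and> s ''cl'' v = x)" for x
        using False by (auto simp: less_Suc_eq)
      have ex2: "(\<exists>v<Suc i. v \<notin> S \<and> Q v) \<longleftrightarrow> (\<exists>v<i. v \<notin> S \<and> Q v) \<or> Q i" for Q
        using False by (auto simp: less_Suc_eq)
      show ?thesis unfolding rr set ex ex2 using I kk by auto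
    qed
  qed auto
  moreover have "{v\<in>S. v < n} = S" "\<And>P. (\<exists>v\<in>S. v < n \<and> P v) \<longleftrightarrow> (\<exists>v\<in>S. P v)" using Sn by auto
  ultimately have f: "s' ''sz'' 0 = card S" "s' ''bad'' 0 = of_bool (\<exists>v\<in>S. s ''cl'' v = 3)"
    "s' ''c1'' 0 = of_bool (\<exists>v\<in>S. s ''cl'' v = 2)"
    "ra < n \<and> rb < n \<longrightarrow> (\<forall>k\<in>{0, 2, 6, 8}. s' ''e'' k = of_bool (\<exists>v<n. v \<notin> S \<and> 3 * m c ra v + m c rb v = k))"
    by simp_all
  show "s' ''sz'' 0 = card S" "s' ''bad'' 0 = of_bool (\<exists>v\<in>S. s ''cl'' v = 3)"
    "s' ''c1'' 0 = of_bool (\<exists>v\<in>S. s ''cl'' v = 2)" by (fact f(1-3))+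
  show "ra < n \<Longrightarrow> rb < n \<Longrightarrow> k \<in> {0, 2, 6, 8} \<Longrightarrow>
      s' ''e'' k = of_bool (\<exists>v<n. v \<notin> S \<and> 3 * m c ra v + m c rb v = k)" using f(4) by blast
qed

text \<open>In a closed set all members of a class see an outside vertex as their reference does, so
  two entries decide; \<open>3 * x + y\<close> determines x and y as long as both are at most
  2.\<close>

lemma outer_ref:
  assumes cs: "closed_set n J cl (m c) S" and ra: "ra \<in> S" "cl ra = 0" and rb: "rb \<in> S" "cl rb = 1"
    and xy: "x \<le> 2" "y \<le> 2"
  shows "outer n cl (m c) S x y \<longleftrightarrow> (\<exists>v<n. v \<notin> S \<and> 3 * m c ra v + m c rb v = 3 * x + y)"
proof -
  have "(\<forall>u\<in>S. (cl u = 0 \<longrightarrow> m c u v = x) \<and> (cl u = 1 \<longrightarrow> m c u v = y)) \<longleftrightarrow> 3 * m c ra v + m c rb v = 3 * x + y"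
    if v: "v < n" "v \<notin> S" for v
  proof -
    have no: "\<not> conflict J cl (m c) v u w" if "u \<in> S" "w \<in> S" for u w
      using cs v that unfolding closed_set_def by blast
    have 0: "m c u v = m c ra v" if "u \<in> S" "cl u = 0" for u
      using no[OF that(1) ra(1)] that ra unfolding conflict_def by metis
    have 1: "m c u v = m c rb v" if "u \<in> S" "cl u = 1" for u
      using no[OF that(1) rb(1)] that rb unfolding conflict_def by metis
    have "(\<forall>u\<in>S. (cl u = 0 \<longrightarrow> m c u v = x) \<and> (cl u = 1 \<longrightarrow> m c u v = y)) \<longleftrightarrow> m c ra v = x \<and> m c rb v = y"
      using 0 1 ra rb by metis
    also have "\<dots> \<longleftrightarrow> 3 * m c ra v + m c rb v = 3 * x + y"
      using m_le[of c ra v] m_le[of c rb v] xy by presburger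
    finally show ?thesis .
  qed
  thus ?thesis unfolding outer_def by blast
qed

lemma cand:
  assumes s: "inp s" "s ''sg'' 0 = k" and n: "0 < n"
  defines "s' \<equiv> run W cand_prog s" and "d \<equiv> decode n (s ''tp'') k"
  shows "inp s'" "vset s' = seed_set d" "\<And>v. v < n \<Longrightarrow> s' ''cl'' v = seed_part d v"
    "s' ''ok'' 0 = of_bool (seed_ok (s ''cn'') d)" "s' ''sz'' 0 = card (seed_set d)" "s' ''co'' 0 = sd_co d" "s' ''J'' 0 = sd_J d"
proof -
  let ?z = "[PSet ''sz'' (Const 0), PSet ''bad'' (Const 0), PSet ''c1'' (Const 0), PAss ''e'' (Const 0) (Const 0),
     PAss ''e'' (Const 2) (Const 0), PAss ''e'' (Const 6) (Const 0), PAss ''e'' (Const 8) (Const 0)]"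
  define s1 where "s1 = run W decode_prog s"
  define s2 where "s2 = run W seed_prog s1"
  define s3 where "s3 = run W part_prog s2"
  define s4 where "s4 = run W (PSeq (PAss ''st'' (V ''a1'') (Const 1)) (PAss ''st'' (V ''r'') (Const 1))) s3"
  define s5 where "s5 = run W worklist_prog s4"
  define s6 where "s6 = run W (pseq ?z) s5"
  define s7 where "s7 = run W stat_prog s6"
  have s': "s' = run W (PSet ''ok'' accept_exp) s7"
    unfolding s'_def s7_def s6_def s5_def s4_def s3_def s2_def s1_def cand_prog_def by simp
  have w0: "word W s" using inpD[OF s(1)] by simp
  have w1: "word W s1" unfolding s1_def by (rule word_run[OF w0]) (auto simp: prog_defs2)
  have w2: "word W s2" unfolding s2_def by (rule word_run[OF w1]) (auto simp: prog_defs2)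
  have w3: "word W s3" unfolding s3_def by (rule word_run[OF w2]) (auto simp: prog_defs2)
  have w4: "word W s4" unfolding s4_def by (rule word_run[OF w3]) auto
  have w5: "word W s5" unfolding s5_def by (rule word_run[OF w4]) (auto simp: prog_defs2)
  have w6: "word W s6" unfolding s6_def by (rule word_run[OF w5]) auto
  have w7: "word W s7" unfolding s7_def by (rule word_run[OF w6]) (auto simp: prog_defs2)
  have w': "word W s'" unfolding s' by (rule word_run[OF w7]) auto
  have f1: "s1 x = s x" if "x \<notin> {''md'', ''p'', ''q'', ''r'', ''co'', ''J'', ''tq'', ''fl''}" for x
    unfolding s1_def by (rule run_frame) (use that in \<open>auto simp: prog_defs2\<close>)
  have f2: "s2 x = s1 x" if "x \<notin> {''ra'', ''rb'', ''a1'', ''a2'', ''b2''}" for x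
    unfolding s2_def by (rule run_frame) (use that in \<open>auto simp: prog_defs2\<close>)
  have f3: "s3 x = s2 x" if "x \<notin> {''v'', ''st'', ''cl''}" for x
    unfolding s3_def by (rule run_frame) (use that in \<open>auto simp: prog_defs2\<close>)
  have f4: "s4 x = s3 x" if "x \<noteq> ''st''" for x
    unfolding s4_def by (rule run_frame) (use that in auto)
  have f5: "s5 x = s4 x" if "x \<notin> {''it'', ''y'', ''u'', ''v'', ''st'', ''par'', ''ra'', ''rb''}" for x
    unfolding s5_def by (rule run_frame) (use that in \<open>auto simp: prog_defs2\<close>)
  have f6: "s6 x = s5 x" if "x \<notin> {''sz'', ''bad'', ''c1'', ''e''}" for x
    unfolding s6_def by (rule run_frame) (use that in auto)
  have f7: "s7 x = s6 x" if "x \<notin> {''v'', ''sz'', ''bad'', ''c1'', ''e''}" for x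
    unfolding s7_def by (rule run_frame) (use that in \<open>auto simp: prog_defs2\<close>)
  have f8: "s' x = s7 x" if "x \<noteq> ''ok''" for x
    unfolding s' by (rule run_frame) (use that in auto)
  have n1: "s1 ''n'' 0 = n" using f1 inpD[OF s(1)] by simp
  note dec = decode_run[OF s n, folded s1_def]
  note db = decode_bounds[OF n, of "s ''tp''" k, folded d_def]
  have nt: "s2 ''n'' = s ''n''" "s2 ''theta'' = s ''theta''" using f2 f1 by simp_all
  have in2: "inp s2" by (rule inp_frame[OF s(1) w2 nt])
  have d1: "s1 ''co'' 0 = sd_co d" "s1 ''J'' 0 = sd_J d" "s1 ''r'' 0 = sd_c d"
    unfolding d_def decode_def Let_def using dec by simp_all
  have d2: "s2 ''ra'' 0 = n" "s2 ''rb'' 0 = n" "s2 ''a1'' 0 = sd_a1 d" "s2 ''a2'' 0 = sd_a2 d" "s2 ''b2'' 0 = sd_b2 d"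
    unfolding s2_def seed_prog_def d_def decode_def Let_def using dec n1 by (auto simp: odd_iff_mod_2_eq_one)
  have d2': "s2 ''co'' 0 = sd_co d" "s2 ''J'' 0 = sd_J d" "s2 ''r'' 0 = sd_c d" using d1 f2 by simp_all
  have part: "\<forall>v<n. s3 ''st'' v = 0 \<and> s3 ''cl'' v = seed_part d v"
  proof -
    let ?I = "\<lambda>i t. \<forall>v<i. t ''st'' v = 0 \<and> t ''cl'' v = seed_part d v"
    let ?body = "PSeq (PAss ''st'' (V ''v'') (Const 0)) (PAss ''cl'' (V ''v'') part_exp)"
    have "?I n s3" unfolding s3_def part_prog_def
    proof (rule for_induct[where I = ?I, OF w2])
      show "s2 ''n'' 0 = n" using inpD[OF in2] by simp
      fix i t assume i: "i < n" and I: "?I i t" and v: "t ''v'' 0 = i" and w: "word W t"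
        and fr: "\<And>y. y \<notin> writes (PFor ''v'' ''n'' ?body) \<Longrightarrow> t y = s2 y"
      define t1 where "t1 = run W (PAss ''st'' (V ''v'') (Const 0)) t"
      have w1: "word W t1" unfolding t1_def by (rule word_run[OF w]) auto
      have eq: "t1 x = s2 x" if "x \<notin> {''v'', ''st'', ''cl''}" for x
        using fr[of x] that by (simp add: t1_def)
      have "inp t1" by (rule inp_frame[OF in2 w1]) (simp_all add: eq)
      moreover have "t1 ''v'' 0 = i" using v by (simp add: t1_def)
      ultimately have vp: "val W part_exp t1 = seed_part d i"
        unfolding seed_part_def by (intro val_part) (use eq d2 d2' db i in simp_all)
      have "run W ?body t = upd ''cl'' i (seed_part d i) t1"
        using vp v by (simp add: t1_def)
      thus "?I (Suc i) (upd ''v'' 0 (Suc i) (run W ?body t))"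
        using I v by (auto simp: t1_def less_Suc_eq)
    qed auto
    thus ?thesis .
  qed
  have r34: "s3 ''a1'' 0 = sd_a1 d" "s3 ''r'' 0 = sd_c d" using f3 d2 d2' by simp_all
  have st4: "s4 ''st'' v = of_bool (v = sd_a1 d \<or> v = sd_c d)" if "v < n" for v
    using part that r34 unfolding s4_def by simp
  have vs4: "vset s4 = {sd_a1 d, sd_c d}" using st4 db by (auto simp: vset_def)
  have cl4: "s4 ''cl'' v = seed_part d v" if "v < n" for v using part that f4 by simp
  have d4: "s4 ''co'' 0 = sd_co d" "s4 ''J'' 0 = sd_J d" "s4 ''ra'' 0 = n" "s4 ''rb'' 0 = n" using f4 f3 d2 d2' by simp_all
  have le4: "\<forall>v<n. s4 ''st'' v \<le> 1" using st4 by simp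
  have in4: "inp s4" by (rule inp_frame[OF in2 w4]) (simp_all add: f4 f3)
  obtain t where t: "t = run W worklist_prog s4"
    "grown n (s4 ''J'' 0) (s4 ''cl'') (m (sd_co d)) (vset s4) (vset t) (t ''par'')"
    "closed_set n (s4 ''J'' 0) (s4 ''cl'') (m (sd_co d)) (vset t)"
    "ref_ok n (s4 ''cl'') (vset t) 0 (t ''ra'' 0)" "ref_ok n (s4 ''cl'') (vset t) 1 (t ''rb'' 0)"
    by (rule worklist[OF in4 d4(1) db(1) d4(3,4) le4])
  have t5: "t = s5" using t(1) s5_def by simp
  define S where "S = seed_set d"
  have S5: "vset s5 = S"
    unfolding S_def seed_set_def using grown_closure[OF t(2,3) cl4] t5 vs4 d4 by simp
  have Sn: "S \<subseteq> {..<n}" using S5 by (auto simp: vset_def)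
  have cS: "closed_set n (sd_J d) (seed_part d) (m (sd_co d)) S"
    using t(3) closed_set_cong[of S n "s4 ''cl''" "seed_part d", OF Sn cl4] S5 t5 d4 by simp
  define ra rb where rab: "ra = s5 ''ra'' 0" "rb = s5 ''rb'' 0"
  have clS: "s4 ''cl'' v = seed_part d v" if "v \<in> S" for v using cl4 Sn that by auto
  have r5: "ref_ok n (seed_part d) S 0 ra" "ref_ok n (seed_part d) S 1 rb"
    using t(4,5) clS unfolding t5 S5 rab ref_ok_def by (auto split: if_splits)
  have in5: "inp s5" by (rule inp_frame[OF in4 w5]) (simp_all add: f5)
  have z6: "s6 ''sz'' 0 = 0" "s6 ''bad'' 0 = 0" "s6 ''c1'' 0 = 0" "s6 ''e'' 0 = 0" "s6 ''e'' 2 = 0" "s6 ''e'' 6 = 0" "s6 ''e'' 8 = 0"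
    using W_ge(1) unfolding s6_def by simp_all
  have in6: "inp s6" by (rule inp_frame[OF in5 w6]) (simp_all add: f6)
  have d6: "s6 ''co'' 0 = sd_co d" "s6 ''ra'' 0 = ra" "s6 ''rb'' 0 = rb" using f6 f5 d4 by (simp_all add: rab)
  have S6: "vset s6 = S" using S5 f6 by (simp add: vset_def)
  have cl6: "s6 ''cl'' v = seed_part d v" if "v < n" for v using cl4[OF that] f6 f5 by simp
  note st = stat_run[OF in6 d6(1) db(1) z6 d6(2,3), folded s7_def, unfolded S6]
  have S7: "vset s7 = S" using S6 f7 by (simp add: vset_def)
  have in7: "inp s7" by (rule inp_frame[OF in6 w7]) (simp_all add: f7)
  show "inp s'" by (rule inp_frame[OF in7 w']) (simp_all add: f8)
  show "vset s' = seed_set d" using S7 f8 by (simp add: vset_def S_def)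
  show "\<And>v. v < n \<Longrightarrow> s' ''cl'' v = seed_part d v" using cl6 f7 f8 by simp
  show "s' ''sz'' 0 = card (seed_set d)" using st(1) f8 by (simp add: S_def)
  show "s' ''co'' 0 = sd_co d" "s' ''J'' 0 = sd_J d" using f8 f7 f6 f5 d4 by simp_all
  have v7: "s7 ''n'' 0 = n" "s7 ''ra'' 0 = ra" "s7 ''rb'' 0 = rb" "s7 ''J'' 0 = sd_J d" "s7 ''cn'' = s ''cn''"
    "s7 ''co'' 0 = sd_co d" "s7 ''a1'' 0 = sd_a1 d" "s7 ''cl'' (sd_a1 d) = seed_part d (sd_a1 d)"
    using inpD[OF in7] d6 f7 f6 f5 f4 f3 f2 f1 d4 d2 cl6[OF db(3)] by simp_all
  have cl6S: "s6 ''cl'' v = seed_part d v" if "v \<in> S" for v using cl6 Sn that by auto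
  have bad: "s7 ''bad'' 0 = of_bool (\<exists>v\<in>S. seed_part d v = 3)" and c1: "s7 ''c1'' 0 = of_bool (\<exists>v\<in>S. seed_part d v = 2)"
    using st(2,3) cl6S by simp_all
  have num: "val W (Const 0) t = 0" "val W (Const 2) t = 2" "val W (Const 6) t = 6" "val W (Const 8) t = 8" for t
    using W_ge(1) by simp_all
  have ob: "(of_bool P = (0::nat)) = (\<not> P)" for P by simp
  have pl: "val W (Plus (Const 2) (V ''c1'')) s7 = 2 + of_bool (\<exists>v\<in>S. seed_part d v = 2)"
    using c1 W_ge(1) by simp
  have "val W accept_exp s7 = of_bool (seed_ok (s ''cn'') d)"
  proof (cases "ra < n \<and> rb < n")
    case False
    \<comment> \<open>A missing reference means that label 0 or label 1 does not occur at all, so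
      the program and the specification both reject.\<close>
    hence "ra = n \<or> rb = n" using r5 Sn unfolding ref_ok_def by (auto split: if_splits)
    hence "\<not> ((\<exists>v\<in>S. seed_part d v = 0) \<and> (\<exists>v\<in>S. seed_part d v = 1))" using r5 unfolding ref_ok_def by metis
    hence "\<not> seed_ok (s ''cn'') d" unfolding seed_ok_def accept_def S_def by blast
    moreover have "val W accept_exp s7 = 0" unfolding accept_exp_def using False v7 by (auto simp: bval(2))
    ultimately show ?thesis by simp
  next
    case True
    hence ra: "ra \<in> S" "seed_part d ra = 0" and rb: "rb \<in> S" "seed_part d rb = 1"
      using r5 unfolding ref_ok_def by (auto split: if_splits)
    have o: "s7 ''e'' (3 * x + y) = of_bool (outer n (seed_part d) (m (sd_co d)) S x y)"
      if "x \<in> {0, 2}" "y \<in> {0, 2}" for x y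
      using st(4)[of "3 * x + y"] True that outer_ref[OF cS ra rb, of x y] by auto
    have e: "s7 ''e'' 0 = of_bool (outer n (seed_part d) (m (sd_co d)) S 0 0)"
      "s7 ''e'' 2 = of_bool (outer n (seed_part d) (m (sd_co d)) S 0 2)"
      "s7 ''e'' 6 = of_bool (outer n (seed_part d) (m (sd_co d)) S 2 0)"
      "s7 ''e'' 8 = of_bool (outer n (seed_part d) (m (sd_co d)) S 2 2)"
      using o[of 0 0] o[of 2 0] o[of 2 2] o[of 0 2, unfolded mult_0_right add_0] by simp_all
    have pe: "val W (Plus (Const 2) (V ''e'')) s7 = 2 + of_bool (outer n (seed_part d) (m (sd_co d)) S 0 0)"
      using e W_ge(1) by simp
    have ex: "\<exists>v\<in>S. seed_part d v = 0" "\<exists>v\<in>S. seed_part d v = 1" using ra rb by blast+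
    have J: "sd_J d = 0 \<or> sd_J d = 1" using db(2) by auto
    have "val W accept_exp s7 = of_bool ((\<forall>v\<in>S. seed_part d v \<noteq> 3) \<and>
      (sd_J d \<noteq> 0 \<and> s ''cn'' (sd_co d) \<noteq> 0 \<and> seed_part d (sd_a1 d) = 0 \<and>
         card S - (2 + of_bool (\<exists>v\<in>S. seed_part d v = 2)) \<noteq> 0 \<and>
         n - card S - (2 + of_bool (outer n (seed_part d) (m (sd_co d)) S 0 0)) \<noteq> 0 \<or>
       sd_J d = 0 \<and> card S - 2 \<noteq> 0 \<and> outer n (seed_part d) (m (sd_co d)) S 0 0 \<and> outer n (seed_part d) (m (sd_co d)) S 0 2 \<and>
         outer n (seed_part d) (m (sd_co d)) S 2 0 \<and> outer n (seed_part d) (m (sd_co d)) S 2 2))"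
    proof -
      have nz: "n - ra \<noteq> 0" "n - rb \<noteq> 0" using True by auto
      have val2: "val W (Cell x i) s7 = s7 x (val W i s7)" "val W (Minus a b) s7 = val W a s7 - val W b s7" for x i a b
        by simp_all
      have bx: "(\<not> (\<exists>v\<in>S. seed_part d v = 3)) = (\<forall>v\<in>S. seed_part d v \<noteq> 3)" by blast
      show ?thesis
        unfolding accept_exp_def
        by (simp only: bval(1-3) val_EEq[OF W_small(1) w7] pl pe val2 num v7 e bad st(1) ob nz not_not bx simp_thms)
    qed
    also have "\<dots> = of_bool (seed_ok (s ''cn'') d)"
      unfolding seed_ok_def accept_def S_def[symmetric] using ex J
      by (intro arg_cong[where f = of_bool]) (auto simp: not_le)
    finally show ?thesis .
  qed
  thus "s' ''ok'' 0 = of_bool (seed_ok (s ''cn'') d)" unfolding s' by simp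
qed

end

section \<open>Search\<close>

definition copy_prog :: prog where
  "copy_prog = PFor ''v'' ''n'' (PSeq (PAss ''bst'' (V ''v'') (Cell ''st'' (V ''v''))) (PAss ''bcl'' (V ''v'') (Cell ''cl'' (V ''v''))))"

definition save_prog :: prog where
  "save_prog = PSeq (pseq [PSet ''best'' (V ''sz''), PSet ''bco'' (V ''co''), PSet ''bJ'' (V ''J'')]) copy_prog"

text \<open>The cell \<open>best\<close> starts at n + 1, above every possible size, so the
  comparison also accepts the first admissible candidate and later tells whether there was
  one.\<close>

definition search_prog :: prog where
  "search_prog = PFor ''sg'' ''N3'' (PSeq cand_prog (PIf (EAnd (V ''ok'') (Minus (V ''best'') (V ''sz''))) save_prog PSkip))"

lemmas prog_defs3 = copy_prog_def save_prog_def search_prog_def prog_defs2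

context ram
begin

definition stored :: "state \<Rightarrow> seed \<Rightarrow> bool" where
  "stored s d \<longleftrightarrow> s ''best'' 0 = card (seed_set d) \<and> s ''bco'' 0 = sd_co d \<and> s ''bJ'' 0 = sd_J d \<and>
     (\<forall>v<n. (s ''bst'' v \<noteq> 0 \<longleftrightarrow> v \<in> seed_set d) \<and> s ''bcl'' v = seed_part d v)"

lemma save:
  assumes s: "inp s" "vset s = seed_set d" "\<And>v. v < n \<Longrightarrow> s ''cl'' v = seed_part d v"
    "s ''sz'' 0 = card (seed_set d)" "s ''co'' 0 = sd_co d" "s ''J'' 0 = sd_J d"
  shows "stored (run W save_prog s) d"
proof -
  define s1 where "s1 = run W (pseq [PSet ''best'' (V ''sz''), PSet ''bco'' (V ''co''), PSet ''bJ'' (V ''J'')]) s"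
  have w1: "word W s1" unfolding s1_def by (rule word_run) (use inpD[OF s(1)] in auto)
  have f1: "s1 x = s x" if "x \<notin> {''best'', ''bco'', ''bJ''}" for x
    unfolding s1_def by (rule run_frame) (use that in auto)
  have v1: "s1 ''best'' 0 = card (seed_set d)" "s1 ''bco'' 0 = sd_co d" "s1 ''bJ'' 0 = sd_J d" "s1 ''n'' 0 = n"
    using s inpD[OF s(1)] unfolding s1_def by simp_all
  let ?I = "\<lambda>i t. \<forall>v<i. t ''bst'' v = s ''st'' v \<and> t ''bcl'' v = s ''cl'' v"
  let ?body = "PSeq (PAss ''bst'' (V ''v'') (Cell ''st'' (V ''v''))) (PAss ''bcl'' (V ''v'') (Cell ''cl'' (V ''v'')))"
  have I: "?I n (run W copy_prog s1)"
    unfolding copy_prog_def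
  proof (rule for_induct[where I = ?I, OF w1])
    show "s1 ''n'' 0 = n" by (rule v1)
    fix i t assume I: "?I i t" and v: "t ''v'' 0 = i"
      and fr: "\<And>y. y \<notin> writes (PFor ''v'' ''n'' ?body) \<Longrightarrow> t y = s1 y"
    have "t ''st'' = s ''st''" "t ''cl'' = s ''cl''" using fr[of "''st''"] fr[of "''cl''"] f1 by simp_all
    thus "?I (Suc i) (upd ''v'' 0 (Suc i) (run W ?body t))" using I v by (auto simp: less_Suc_eq)
  qed auto
  have fr: "run W copy_prog s1 x = s1 x" if "x \<notin> {''v'', ''bst'', ''bcl''}" for x
    by (rule run_frame) (use that in \<open>auto simp: copy_prog_def\<close>)
  have "s ''st'' v \<noteq> 0 \<longleftrightarrow> v \<in> seed_set d" if "v < n" for v using s(2) that by (auto simp: vset_def)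
  thus ?thesis unfolding stored_def save_prog_def run.simps(3) s1_def[symmetric]
    using I fr v1 s(3) by simp
qed

lemma seed_set_subset: "0 < n \<Longrightarrow> seed_set (decode n tp k) \<subseteq> {..<n}"
proof -
  assume n: "0 < n"
  let ?d = "decode n tp k"
  have "{..<n} \<in> {U. U \<subseteq> {..<n} \<and> {sd_a1 ?d, sd_c ?d} \<subseteq> U \<and> closed_set n (sd_J ?d) (seed_part ?d) (m (sd_co ?d)) U}"
    using decode_bounds[OF n, of tp k] by (auto simp: closed_set_def)
  thus ?thesis unfolding seed_set_def closure_def by blast
qed

lemma stored_cong:
  assumes "\<And>x. x \<in> {''best'', ''bco'', ''bJ'', ''bst'', ''bcl''} \<Longrightarrow> t x = s x"
  shows "stored t d = stored s d"
  using assms by (simp add: stored_def)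

lemma search:
  assumes s: "inp s" "s ''N3'' 0 = N" "s ''best'' 0 = n + 1" and n: "0 < n"
  defines "s' \<equiv> run W search_prog s" and "D \<equiv> decode n (s ''tp'')"
  shows "inp s'" "(s' ''best'' 0 = n + 1 \<and> (\<forall>k<N. \<not> seed_ok (s ''cn'') (D k))) \<or>
    (\<exists>k<N. seed_ok (s ''cn'') (D k) \<and> stored s' (D k) \<and>
       (\<forall>k'<N. seed_ok (s ''cn'') (D k') \<longrightarrow> card (seed_set (D k)) \<le> card (seed_set (D k'))))"
proof -
  let ?body = "PSeq cand_prog (PIf (EAnd (V ''ok'') (Minus (V ''best'') (V ''sz''))) save_prog PSkip)"
  let ?I = "\<lambda>i t. (t ''best'' 0 = n + 1 \<and> (\<forall>k<i. \<not> seed_ok (s ''cn'') (D k))) \<or>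
    (\<exists>k<i. seed_ok (s ''cn'') (D k) \<and> stored t (D k) \<and>
       (\<forall>k'<i. seed_ok (s ''cn'') (D k') \<longrightarrow> card (seed_set (D k)) \<le> card (seed_set (D k'))))"
  have w0: "word W s" using inpD[OF s(1)] by simp
  have wf: "wf_prog (PFor ''sg'' ''N3'' ?body)" "bounds (PFor ''sg'' ''N3'' ?body) \<inter> writes (PFor ''sg'' ''N3'' ?body) = {}"
    by (auto simp: prog_defs3)
  have w': "word W s'" unfolding s'_def search_prog_def by (rule word_run[OF w0 wf(1) _ wf(2)]) simp
  have fr': "s' x = s x" if "x \<notin> writes search_prog" for x unfolding s'_def by (rule run_frame[OF that])
  show "inp s'" by (rule inp_frame[OF s(1) w']) (rule fr', simp add: prog_defs3)+
  have "?I N s'"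
    unfolding s'_def search_prog_def
  proof (rule for_induct[where I = ?I, OF w0 wf])
    show "?I 0 (upd ''sg'' 0 0 s)" using s(3) by simp
    fix i t assume i: "i < N" and I: "?I i t" and sg: "t ''sg'' 0 = i" and w: "word W t"
      and fr: "\<And>y. y \<notin> writes (PFor ''sg'' ''N3'' ?body) \<Longrightarrow> t y = s y"
    have eq: "t ''n'' = s ''n''" "t ''theta'' = s ''theta''" "t ''tp'' = s ''tp''" "t ''cn'' = s ''cn''"
      by (rule fr; simp add: prog_defs3)+
    have in': "inp t" by (rule inp_frame[OF s(1) w eq(1,2)])
    define t1 where "t1 = run W cand_prog t"
    note c = cand[OF in' sg n, folded t1_def, unfolded eq, folded D_def]
    have f1: "t1 x = t x" if "x \<in> {''best'', ''bco'', ''bJ'', ''bst'', ''bcl''}" for x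
      unfolding t1_def by (rule run_frame) (use that in \<open>auto simp: prog_defs2\<close>)
    have sub: "card (seed_set (D k)) \<le> n" for k
      using card_mono[of "{..<n}"] seed_set_subset[OF n, of "s ''tp''" k] unfolding D_def by fastforce
    have b1: "t1 ''best'' 0 = t ''best'' 0" using f1 by simp
    define g where "g \<longleftrightarrow> seed_ok (s ''cn'') (D i) \<and> card (seed_set (D i)) < t ''best'' 0"
    have guard: "val W (EAnd (V ''ok'') (Minus (V ''best'') (V ''sz''))) t1 = of_bool g"
      using c(4,5) b1 by (auto simp: bval(2) g_def)
    have bt: "t ''best'' 0 = card (seed_set (D k))" if "stored t (D k)" for k using that by (simp add: stored_def)
    have "?I (Suc i) (run W ?body t)"
    proof (cases g)
      case True
      have r: "run W ?body t = run W save_prog t1" using guard True by (simp add: t1_def)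
      have st: "stored (run W save_prog t1) (D i)" by (rule save) (use c in auto)
      have "card (seed_set (D i)) \<le> card (seed_set (D k'))" if kk: "k' < Suc i" "seed_ok (s ''cn'') (D k')" for k'
      proof (cases "k' = i")
        case False
        hence "k' < i" using kk by simp
        then obtain k where "stored t (D k)" "card (seed_set (D k)) \<le> card (seed_set (D k'))"
          using I kk(2) by blast
        thus ?thesis using True bt[of k] unfolding g_def by linarith
      qed simp
      thus ?thesis unfolding r using st True unfolding g_def by blast
    next
      case False
      have r: "run W ?body t = t1" using guard False by (simp add: t1_def)
      have stt: "stored t1 (D k) = stored t (D k)" for k by (rule stored_cong) (rule f1)
      show ?thesis
      proof (cases "t ''best'' 0 = n + 1 \<and> (\<forall>k<i. \<not> seed_ok (s ''cn'') (D k))")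
        case True
        hence "\<not> seed_ok (s ''cn'') (D i)" using False sub[of i] unfolding g_def by simp
        thus ?thesis unfolding r using True b1 less_Suc_eq by auto
      next
        case f: False
        then obtain k where k: "k < i" "seed_ok (s ''cn'') (D k)" "stored t (D k)"
          "\<forall>k'<i. seed_ok (s ''cn'') (D k') \<longrightarrow> card (seed_set (D k)) \<le> card (seed_set (D k'))" using I by blast
        have "card (seed_set (D k)) \<le> card (seed_set (D k'))" if "k' < Suc i" "seed_ok (s ''cn'') (D k')" for k'
          using that k(4) False bt[OF k(3)] unfolding g_def by (cases "k' = i") auto
        thus ?thesis unfolding r using k(1-3) stt less_Suc_eq by blast
      qed
    qed
    moreover have "stored (upd ''sg'' 0 j u) d = stored u d" for j u d by (rule stored_cong) auto
    ultimately show "?I (Suc i) (upd ''sg'' 0 (Suc i) (run W ?body t))" by simp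
  qed (use s in auto)
  thus "(s' ''best'' 0 = n + 1 \<and> (\<forall>k<N. \<not> seed_ok (s ''cn'') (D k))) \<or>
    (\<exists>k<N. seed_ok (s ''cn'') (D k) \<and> stored s' (D k) \<and>
       (\<forall>k'<N. seed_ok (s ''cn'') (D k') \<longrightarrow> card (seed_set (D k)) \<le> card (seed_set (D k'))))" .
qed

end

section \<open>Parity of a 2-join by layered walks, and the writing of the block\<close>

section \<open>Parity\<close>

text \<open>\<open>w\<close> holds in row \<open>k\<close> the ends of the walks of length \<open>k\<close> that start in \<open>A\<close>; a shortest walk from \<open>A\<close> to
  \<open>B\<close> is an induced path.\<close>

definition step_prog :: prog where
  "step_prog = PFor ''u'' ''n'' (PIf (EAnd (Cell ''w'' (Plus (Times (V ''k'') (V ''n'')) (V ''u'')))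
     (EAnd (Cell ''bst'' (V ''v'')) (EAnd (ENot (EEq (V ''u'') (V ''v''))) (ETh (V ''u'') (V ''v'')))))
     (PAss ''w'' (Plus (Times (Plus (V ''k'') (Const 1)) (V ''n'')) (V ''v'')) (Const 1)) PSkip)"

definition layer_prog :: prog where "layer_prog = PFor ''v'' ''n'' step_prog"

definition start_prog :: prog where
  "start_prog = PFor ''v'' ''n'' (PAss ''w'' (V ''v'') (EAnd (Cell ''bst'' (V ''v'')) (EEq (Cell ''bcl'' (V ''v'')) (Const 0))))"

text \<open>The flag \<open>fin\<close> lets only the first row that contains a vertex of B
  determine the parity.\<close>

definition hit_prog :: prog where
  "hit_prog = PFor ''v'' ''n'' (PIf (EAnd (ENot (V ''fin'')) (EAnd (Cell ''w'' (Plus (Times (V ''k'') (V ''n'')) (V ''v'')))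
       (EEq (Cell ''bcl'' (V ''v'')) (Const 1))))
     (PSeq (PSet ''fin'' (Const 1)) (PSet ''ev'' (ENot (EMod (V ''k'') (Const 2))))) PSkip)"

definition walk_prog :: prog where
  "walk_prog = pseq [start_prog, PFor ''k'' ''n'' layer_prog, PSet ''fin'' (Const 0), PFor ''k'' ''n'' hit_prog]"

lemmas prog_defs4 = step_prog_def layer_prog_def start_prog_def hit_prog_def walk_prog_def

text \<open>Walks of exact length k, so a vertex may recur in later layers; this does not affect the
  first layer that meets B.\<close>

fun layer :: "nat set \<Rightarrow> (nat \<Rightarrow> nat) \<Rightarrow> (nat \<Rightarrow> nat \<Rightarrow> nat) \<Rightarrow> nat \<Rightarrow> nat set" where
  "layer S cl mm 0 = {v\<in>S. cl v = 0}"
| "layer S cl mm (Suc k) = {v\<in>S. \<exists>u\<in>layer S cl mm k. u \<noteq> v \<and> mm u v \<noteq> 0}"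

lemma layer_subset: "layer S cl mm k \<subseteq> S"
  by (cases k) auto

context ram
begin

text \<open>The program only ever sets cells, so the target has to be zero beforehand. No earlier
  stage writes to the array \<open>w\<close>, which is zero in the initial state.\<close>

lemma step_run:
  assumes s: "inp s" "s ''co'' 0 = c" "c \<le> 1" "s ''k'' 0 = k" "k < n" "s ''v'' 0 = v" "v < n"
    and z: "s ''w'' (Suc k * n + v) = 0"
  shows "run W step_prog s ''w'' = (s ''w'')(Suc k * n + v :=
    of_bool (s ''bst'' v \<noteq> 0 \<and> (\<exists>u<n. s ''w'' (k * n + u) \<noteq> 0 \<and> u \<noteq> v \<and> m c u v \<noteq> 0)))"
proof -
  let ?P = "\<lambda>u. s ''bst'' v \<noteq> 0 \<and> s ''w'' (k * n + u) \<noteq> 0 \<and> u \<noteq> v \<and> m c u v \<noteq> 0"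
  let ?I = "\<lambda>i t. t ''w'' = (s ''w'')(Suc k * n + v := of_bool (\<exists>u<i. ?P u))"
  let ?body = "PIf (EAnd (Cell ''w'' (Plus (Times (V ''k'') (V ''n'')) (V ''u'')))
     (EAnd (Cell ''bst'' (V ''v'')) (EAnd (ENot (EEq (V ''u'') (V ''v''))) (ETh (V ''u'') (V ''v'')))))
     (PAss ''w'' (Plus (Times (Plus (V ''k'') (Const 1)) (V ''n'')) (V ''v'')) (Const 1)) PSkip"
  have "?I n (run W step_prog s)"
    unfolding step_prog_def
  proof (rule for_induct[where I = ?I])
    show "word W s" "s ''n'' 0 = n" using inpD[OF s(1)] by simp_all
    show "?I 0 (upd ''u'' 0 0 s)" using z by (simp add: fun_upd_idem)
    fix i t assume i: "i < n" and I: "?I i t" and u: "t ''u'' 0 = i" and w: "word W t"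
      and fr: "\<And>y. y \<notin> writes (PFor ''u'' ''n'' ?body) \<Longrightarrow> t y = s y"
    have eq: "t ''n'' = s ''n''" "t ''theta'' = s ''theta''" "t ''co'' = s ''co''" "t ''k'' = s ''k''" "t ''v'' = s ''v''" "t ''bst'' = s ''bst''"
      by (rule fr; simp)+
    have in': "inp t" by (rule inp_frame[OF s(1) w eq(1,2)])
    have lt: "k * n + i < W" "k * n < W" "Suc k * n + v < W" "Suc k * n < W" "Suc k < W"
      using index_less(2)[of k i] index_less(2)[of k 0] index_less(2)[of "Suc k" v] index_less(2)[of "Suc k" 0] s i n_less(1)
      by (auto simp del: n_less)
    have ix: "val W (Plus (Times (V ''k'') (V ''n'')) (V ''u'')) t = k * n + i"
      using eq s u lt inpD[OF in'] by simp
    have ix2: "val W (Plus (Times (Plus (V ''k'') (Const 1)) (V ''n'')) (V ''v'')) t = Suc k * n + v"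
      using eq s lt inpD[OF in'] by simp
    have th: "val W (ETh (V ''u'') (V ''v'')) t = m c i v"
      using in' eq s u i by (intro val_ETh) auto
    have ne: "k * n + i \<noteq> Suc k * n + v" using i by simp
    have ti: "t ''w'' (k * n + i) = s ''w'' (k * n + i)" using I ne by simp
    have cells: "val W (V ''u'') t = i" "val W (V ''v'') t = v" "val W (Cell ''bst'' (V ''v'')) t = s ''bst'' v"
      "val W (Cell ''w'' (Plus (Times (V ''k'') (V ''n'')) (V ''u''))) t = s ''w'' (k * n + i)"
      using u s eq ti ix by simp_all
    have g: "val W (EAnd (Cell ''w'' (Plus (Times (V ''k'') (V ''n'')) (V ''u'')))
     (EAnd (Cell ''bst'' (V ''v'')) (EAnd (ENot (EEq (V ''u'') (V ''v''))) (ETh (V ''u'') (V ''v''))))) t = of_bool (?P i)"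
      unfolding bval(1-2) val_EEq[OF W_small(1) w] th cells by auto
    have "run W ?body t = (if ?P i then upd ''w'' (Suc k * n + v) 1 t else t)"
      unfolding run.simps(1,2,4) g ix2 by simp
    moreover have "(\<exists>u<Suc i. ?P u) \<longleftrightarrow> (\<exists>u<i. ?P u) \<or> ?P i" by (auto simp: less_Suc_eq)
    ultimately show "?I (Suc i) (upd ''u'' 0 (Suc i) (run W ?body t))"
      using I by (cases "?P i") (simp_all add: fun_eq_iff)
  qed auto
  moreover have "(\<exists>u<n. ?P u) \<longleftrightarrow> s ''bst'' v \<noteq> 0 \<and> (\<exists>u<n. s ''w'' (k * n + u) \<noteq> 0 \<and> u \<noteq> v \<and> m c u v \<noteq> 0)" by blast
  ultimately show ?thesis by simp
qed

lemma layer_run: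
  assumes s: "inp s" "s ''co'' 0 = c" "c \<le> 1" "s ''k'' 0 = k" "k < n"
    and z: "\<And>i. i \<ge> Suc k * n \<Longrightarrow> s ''w'' i = 0"
  defines "s' \<equiv> run W layer_prog s"
  shows "\<forall>i<Suc k * n. s' ''w'' i = s ''w'' i"
    "\<forall>v<n. s' ''w'' (Suc k * n + v) = of_bool (s ''bst'' v \<noteq> 0 \<and> (\<exists>u<n. s ''w'' (k * n + u) \<noteq> 0 \<and> u \<noteq> v \<and> m c u v \<noteq> 0))"
    "\<forall>i\<ge>Suc k * n + n. s' ''w'' i = 0"
proof -
  let ?F = "\<lambda>v. s ''bst'' v \<noteq> 0 \<and> (\<exists>u<n. s ''w'' (k * n + u) \<noteq> 0 \<and> u \<noteq> v \<and> m c u v \<noteq> 0)"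
  let ?I = "\<lambda>i t. (\<forall>j<Suc k * n. t ''w'' j = s ''w'' j) \<and> (\<forall>v<i. t ''w'' (Suc k * n + v) = of_bool (?F v)) \<and>
    (\<forall>j\<ge>Suc k * n + i. t ''w'' j = 0)"
  have "?I n s'"
    unfolding s'_def layer_prog_def
  proof (rule for_induct[where I = ?I])
    show "word W s" "s ''n'' 0 = n" using inpD[OF s(1)] by simp_all
    show "wf_prog (PFor ''v'' ''n'' step_prog)" "bounds (PFor ''v'' ''n'' step_prog) \<inter> writes (PFor ''v'' ''n'' step_prog) = {}"
      by (auto simp: prog_defs4)
    show "?I 0 (upd ''v'' 0 0 s)" using z by simp
    fix i t assume i: "i < n" and I: "?I i t" and v: "t ''v'' 0 = i" and w: "word W t"
      and fr: "\<And>y. y \<notin> writes (PFor ''v'' ''n'' step_prog) \<Longrightarrow> t y = s y"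
    have eq: "t ''n'' = s ''n''" "t ''theta'' = s ''theta''" "t ''co'' = s ''co''" "t ''k'' = s ''k''" "t ''bst'' = s ''bst''"
      by (rule fr; simp add: prog_defs4)+
    have in': "inp t" by (rule inp_frame[OF s(1) w eq(1,2)])
    have z': "t ''w'' (Suc k * n + i) = 0" using I by blast
    have r: "run W step_prog t ''w'' = (t ''w'')(Suc k * n + i :=
      of_bool (t ''bst'' i \<noteq> 0 \<and> (\<exists>u<n. t ''w'' (k * n + u) \<noteq> 0 \<and> u \<noteq> i \<and> m c u i \<noteq> 0)))"
      by (rule step_run[OF in' _ s(3) _ s(5) v i z']) (use eq s in simp_all)
    have old: "t ''w'' (k * n + u) = s ''w'' (k * n + u)" if "u < n" for u using I that by simp
    have "(\<exists>u<n. t ''w'' (k * n + u) \<noteq> 0 \<and> u \<noteq> i \<and> m c u i \<noteq> 0) \<longleftrightarrow> (\<exists>u<n. s ''w'' (k * n + u) \<noteq> 0 \<and> u \<noteq> i \<and> m c u i \<noteq> 0)"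
      using old by auto
    hence "run W step_prog t ''w'' = (t ''w'')(Suc k * n + i := of_bool (?F i))"
      unfolding r eq by simp
    thus "?I (Suc i) (upd ''v'' 0 (Suc i) (run W step_prog t))"
      using I by (auto simp: less_Suc_eq)
  qed auto
  thus "\<forall>i<Suc k * n. s' ''w'' i = s ''w'' i" "\<forall>v<n. s' ''w'' (Suc k * n + v) = of_bool (?F v)" "\<forall>i\<ge>Suc k * n + n. s' ''w'' i = 0"
    by blast+
qed

lemma walk_run:
  assumes s: "inp s" "s ''co'' 0 = c" "c \<le> 1" "\<And>i. s ''w'' i = 0" and S: "S \<subseteq> {..<n}"
    and st: "\<And>v. v < n \<Longrightarrow> (s ''bst'' v \<noteq> 0) = (v \<in> S)" and cl: "\<And>v. v < n \<Longrightarrow> s ''bcl'' v = cl v"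
    and K: "K < n" "v0 \<in> layer S cl (m c) K" "cl v0 = 1" "\<And>j v. j < K \<Longrightarrow> v \<in> layer S cl (m c) j \<Longrightarrow> cl v \<noteq> 1"
  shows "run W walk_prog s ''ev'' 0 = of_bool (even K)"
proof -
  let ?L = "layer S cl (m c)"
  define s1 where "s1 = run W start_prog s"
  define s2 where "s2 = run W (PFor ''k'' ''n'' layer_prog) s1"
  define s3 where "s3 = run W (PSet ''fin'' (Const 0)) s2"
  define s4 where "s4 = run W (PFor ''k'' ''n'' hit_prog) s3"
  have s4: "run W walk_prog s = s4" unfolding s4_def s3_def s2_def s1_def walk_prog_def by simp
  have w0: "word W s" using inpD[OF s(1)] by simp
  have w1: "word W s1" unfolding s1_def by (rule word_run[OF w0]) (auto simp: prog_defs4)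
  have w2: "word W s2" unfolding s2_def by (rule word_run[OF w1]) (auto simp: prog_defs4)
  have w3: "word W s3" unfolding s3_def by (rule word_run[OF w2]) auto
  have f1: "s1 x = s x" if "x \<notin> {''v'', ''w''}" for x
    unfolding s1_def by (rule run_frame) (use that in \<open>auto simp: prog_defs4\<close>)
  have f2: "s2 x = s1 x" if "x \<notin> {''k'', ''v'', ''u'', ''w''}" for x
    unfolding s2_def by (rule run_frame) (use that in \<open>auto simp: prog_defs4\<close>)
  have f3: "s3 x = s2 x" if "x \<noteq> ''fin''" for x
    unfolding s3_def by (rule run_frame) (use that in auto)
  have n1: "s1 ''n'' 0 = n" "s3 ''n'' 0 = n" using f1 f2 f3 inpD[OF s(1)] by simp_all
  have in1: "inp s1" by (rule inp_frame[OF s(1) w1]) (simp_all add: f1)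
  have init: "(\<forall>v<n. s1 ''w'' v = of_bool (v \<in> ?L 0)) \<and> (\<forall>i\<ge>n. s1 ''w'' i = 0)"
  proof -
    let ?I = "\<lambda>i t. (\<forall>v<i. t ''w'' v = of_bool (v \<in> ?L 0)) \<and> (\<forall>j\<ge>i. t ''w'' j = 0)"
    let ?body = "PAss ''w'' (V ''v'') (EAnd (Cell ''bst'' (V ''v'')) (EEq (Cell ''bcl'' (V ''v'')) (Const 0)))"
    show ?thesis unfolding s1_def start_prog_def
    proof (rule for_induct[where I = ?I, OF w0])
      show "s ''n'' 0 = n" using inpD[OF s(1)] by simp
      fix i t assume i: "i < n" and I: "?I i t" and v: "t ''v'' 0 = i" and w: "word W t"
        and fr: "\<And>y. y \<notin> writes (PFor ''v'' ''n'' ?body) \<Longrightarrow> t y = s y"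
      have eq: "t ''bst'' = s ''bst''" "t ''bcl'' = s ''bcl''" by (rule fr; simp)+
      have "val W (EAnd (Cell ''bst'' (V ''v'')) (EEq (Cell ''bcl'' (V ''v'')) (Const 0))) t = of_bool (i \<in> ?L 0)"
        using eq v st[OF i] cl[OF i] by (simp add: bval(2) val_EEq[OF W_small(1) w])
      thus "?I (Suc i) (upd ''v'' 0 (Suc i) (run W ?body t))" using I v by (auto simp: less_Suc_eq)
    qed (use s(4) in auto)
  qed
  have Ln: "u < n" if "u \<in> ?L k" for u k using that layer_subset[of S cl "m c" k] S by blast
  have rows: "\<forall>k\<le>n. \<forall>v<n. s2 ''w'' (k * n + v) = of_bool (v \<in> ?L k)"
  proof -
    let ?I = "\<lambda>i t. (\<forall>k\<le>i. \<forall>v<n. t ''w'' (k * n + v) = of_bool (v \<in> ?L k)) \<and> (\<forall>j\<ge>Suc i * n. t ''w'' j = 0)"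
    have "?I n s2" unfolding s2_def
    proof (rule for_induct[where I = ?I, OF w1])
      show "wf_prog (PFor ''k'' ''n'' layer_prog)" "bounds (PFor ''k'' ''n'' layer_prog) \<inter> writes (PFor ''k'' ''n'' layer_prog) = {}"
        by (auto simp: prog_defs4)
      show "s1 ''n'' 0 = n" by (rule n1)
      show "?I 0 (upd ''k'' 0 0 s1)" using init by simp
      fix i t assume i: "i < n" and I: "?I i t" and k: "t ''k'' 0 = i" and w: "word W t"
        and fr: "\<And>y. y \<notin> writes (PFor ''k'' ''n'' layer_prog) \<Longrightarrow> t y = s1 y"
      have eq: "t ''n'' = s1 ''n''" "t ''theta'' = s1 ''theta''" "t ''co'' = s1 ''co''" "t ''bst'' = s1 ''bst''"
        by (rule fr; simp add: prog_defs4)+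
      have in': "inp t" by (rule inp_frame[OF in1 w eq(1,2)])
      have co: "t ''co'' 0 = c" using eq f1 s by simp
      have z: "\<And>j. j \<ge> Suc i * n \<Longrightarrow> t ''w'' j = 0" using I by blast
      note lr = layer_run[OF in' co s(3) k i z]
      define t' where "t' = run W layer_prog t"
      have bst: "(t ''bst'' v \<noteq> 0) = (v \<in> S)" if "v < n" for v using eq f1 st[OF that] by simp
      have new: "t' ''w'' (Suc i * n + v) = of_bool (v \<in> ?L (Suc i))" if v: "v < n" for v
      proof -
        have "(\<exists>u<n. t ''w'' (i * n + u) \<noteq> 0 \<and> u \<noteq> v \<and> m c u v \<noteq> 0) \<longleftrightarrow> (\<exists>u\<in>?L i. u \<noteq> v \<and> m c u v \<noteq> 0)"
          using I Ln by (metis (no_types, lifting) of_bool_eq_0_iff order_refl)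
        thus ?thesis using lr(2) v bst[OF v] unfolding t'_def by simp
      qed
      have old: "t' ''w'' (k * n + v) = of_bool (v \<in> ?L k)" if "k \<le> i" "v < n" for k v
      proof -
        have "k * n + v < Suc k * n" using that by simp
        also have "\<dots> \<le> Suc i * n" using that by (intro mult_right_mono) auto
        finally have "k * n + v < Suc i * n" .
        thus ?thesis using lr(1) I that unfolding t'_def by simp
      qed
      have "\<forall>k\<le>Suc i. \<forall>v<n. t' ''w'' (k * n + v) = of_bool (v \<in> ?L k)"
        using new old le_Suc_eq by metis
      moreover have "\<forall>j\<ge>Suc (Suc i) * n. t' ''w'' j = 0" using lr(3) unfolding t'_def by (simp add: algebra_simps)
      ultimately show "?I (Suc i) (upd ''k'' 0 (Suc i) (run W layer_prog t))"
        unfolding t'_def by simp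
    qed auto
    thus ?thesis by blast
  qed
  have wl: "s3 ''w'' (k * n + v) = of_bool (v \<in> ?L k)" if "k < n" "v < n" for k v using rows that f3 by simp
  have bcl: "s3 ''bcl'' v = cl v" if "v < n" for v using cl[OF that] f3 f2 f1 by simp
  have v0n: "v0 < n" using Ln[OF K(2)] .
  let ?Q = "\<lambda>i t. (i \<le> K \<longrightarrow> t ''fin'' 0 = 0) \<and> (K < i \<longrightarrow> t ''fin'' 0 = 1 \<and> t ''ev'' 0 = of_bool (even K))"
  have "?Q n s4"
    unfolding s4_def
  proof (rule for_induct[where I = ?Q, OF w3])
    show "wf_prog (PFor ''k'' ''n'' hit_prog)" "bounds (PFor ''k'' ''n'' hit_prog) \<inter> writes (PFor ''k'' ''n'' hit_prog) = {}"
      by (auto simp: prog_defs4)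
    show "s3 ''n'' 0 = n" by (rule n1)
    show "?Q 0 (upd ''k'' 0 0 s3)" by (simp add: s3_def)
    fix i t assume i: "i < n" and I: "?Q i t" and k: "t ''k'' 0 = i" and w: "word W t"
      and fr: "\<And>y. y \<notin> writes (PFor ''k'' ''n'' hit_prog) \<Longrightarrow> t y = s3 y"
    have eq: "t ''n'' = s3 ''n''" "t ''w'' = s3 ''w''" "t ''bcl'' = s3 ''bcl''" by (rule fr; simp add: prog_defs4)+
    let ?body = "PIf (EAnd (ENot (V ''fin'')) (EAnd (Cell ''w'' (Plus (Times (V ''k'') (V ''n'')) (V ''v'')))
       (EEq (Cell ''bcl'' (V ''v'')) (Const 1))))
     (PSeq (PSet ''fin'' (Const 1)) (PSet ''ev'' (ENot (EMod (V ''k'') (Const 2))))) PSkip"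
    let ?H = "\<lambda>j. t ''fin'' 0 = 0 \<and> (\<exists>v<j. v \<in> ?L i \<and> cl v = 1)"
    let ?R = "\<lambda>j r. r ''fin'' 0 = (if ?H j then 1 else t ''fin'' 0) \<and> r ''ev'' 0 = (if ?H j then of_bool (even i) else t ''ev'' 0)"
    have R: "?R n (run W hit_prog t)"
      unfolding hit_prog_def
    proof (rule for_induct[where I = ?R, OF w])
      show "t ''n'' 0 = n" using eq n1 by simp
      fix j r assume j: "j < n" and R: "?R j r" and v: "r ''v'' 0 = j" and wr: "word W r"
        and fr': "\<And>y. y \<notin> writes (PFor ''v'' ''n'' ?body) \<Longrightarrow> r y = t y"
      have e: "r ''n'' = t ''n''" "r ''w'' = t ''w''" "r ''bcl'' = t ''bcl''" "r ''k'' = t ''k''" by (rule fr'; simp)+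
      have lt: "i * n + j < W" "i * n < W" using index_less(2)[of i j] index_less(2)[of i 0] i j by auto
      have ix: "val W (Plus (Times (V ''k'') (V ''n'')) (V ''v'')) r = i * n + j" using e eq n1 k v lt by simp
      have g: "val W (EAnd (ENot (V ''fin'')) (EAnd (Cell ''w'' (Plus (Times (V ''k'') (V ''n'')) (V ''v'')))
         (EEq (Cell ''bcl'' (V ''v'')) (Const 1)))) r = of_bool (r ''fin'' 0 = 0 \<and> j \<in> ?L i \<and> cl j = 1)"
        unfolding bval(1,2) val_EEq[OF W_small(1) wr] val.simps(2) ix using e eq v wl[OF i j] bcl[OF j] by auto
      define r1 where "r1 = run W (PSet ''fin'' (Const 1)) r"
      have w1: "word W r1" unfolding r1_def by (rule word_run[OF wr]) auto
      have em: "val W (ENot (EMod (V ''k'') (Const 2))) r1 = of_bool (even i)"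
        using e k by (simp add: bval(1) val_EMod[OF w1] even_iff_mod_2_eq_zero) (simp add: r1_def)
      have pe: "run W (PSet ''ev'' (ENot (EMod (V ''k'') (Const 2)))) r1 = upd ''ev'' 0 (of_bool (even i)) r1"
        unfolding run.simps(2) em by simp
      have ob: "(of_bool P \<noteq> (0::nat)) = P" for P by simp
      have rb: "run W ?body r = (if r ''fin'' 0 = 0 \<and> j \<in> ?L i \<and> cl j = 1 then upd ''ev'' 0 (of_bool (even i)) r1 else r)"
        unfolding run.simps(1,3,4) r1_def[symmetric] g pe ob ..
      have HS: "?H (Suc j) \<longleftrightarrow> ?H j \<or> (t ''fin'' 0 = 0 \<and> j \<in> ?L i \<and> cl j = 1)"
        by (auto simp: less_Suc_eq)
      have r1v: "r1 ''fin'' 0 = 1" "r1 ''ev'' = r ''ev''" by (simp_all add: r1_def)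
      show "?R (Suc j) (upd ''v'' 0 (Suc j) (run W ?body r))"
      proof (cases "?H j")
        case True
        hence "r ''fin'' 0 = 1" using R by simp
        hence rr: "run W ?body r = r" unfolding rb by simp
        have "?H (Suc j)" using True HS by blast
        thus ?thesis using R True unfolding rr by simp
      next
        case False
        hence re: "r ''fin'' 0 = t ''fin'' 0" "r ''ev'' 0 = t ''ev'' 0" using R by (simp_all only: if_False)
        have H2: "?H (Suc j) \<longleftrightarrow> t ''fin'' 0 = 0 \<and> j \<in> ?L i \<and> cl j = 1" using HS False by blast
        show ?thesis unfolding H2 rb using re r1v by simp
      qed
    qed auto
    have ex: "(\<exists>v<n. v \<in> ?L i \<and> cl v = 1) \<Longrightarrow> K \<le> i" using K(4) not_le by metis
    \<comment> \<open>Rows before K contain no vertex of B by minimality of K, and after row K the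
      flag blocks a second hit.\<close>
    have "?H n \<longleftrightarrow> i = K"
    proof
      assume H: "?H n"
      hence "K \<le> i" using ex by blast
      moreover have "\<not> K < i" using I H by auto
      ultimately show "i = K" by simp
    next
      assume "i = K"
      thus "?H n" using I K(2,3) v0n by auto
    qed
    thus "?Q (Suc i) (upd ''k'' 0 (Suc i) (run W hit_prog t))"
      using R I by (auto simp: less_Suc_eq)
  qed auto
  thus ?thesis unfolding s4 using K(1) by simp
qed

end

section \<open>Output\<close>

definition cell_exp :: "exp \<Rightarrow> exp \<Rightarrow> exp" where
  "cell_exp i j = Plus (Times i (Plus (V ''n'') (Const 3))) j"

definition row_prog :: prog where
  "row_prog = PFor ''j'' ''n'' (PAss ''block_theta'' (cell_exp (V ''i'') (V ''j'')) (Cell ''theta'' (Plus (Times (V ''i'') (V ''n'')) (V ''j''))))"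

text \<open>The block of a complement 2-join is the complement of the block that the 2-join of the
  complement would receive. So the markers n, n + 1, n + 2 are written as for a 2-join, complete to
  A, complete to B and anticomplete, and \<open>ECo\<close> translates back.\<close>

definition marks_prog :: prog where
  "marks_prog = pseq [
     PAss ''X'' (V ''i'') (Cell ''bst'' (V ''i'')), PAss ''block_verts'' (V ''i'') (Cell ''bst'' (V ''i'')),
     PAss ''block_theta'' (cell_exp (V ''i'') (V ''n'')) (ECo (Times (Const 2) (EEq (Cell ''bcl'' (V ''i'')) (Const 0)))),
     PAss ''block_theta'' (cell_exp (V ''i'') (Plus (V ''n'') (Const 1))) (ECo (Times (Const 2) (EEq (Cell ''bcl'' (V ''i'')) (Const 1)))),
     PAss ''block_theta'' (cell_exp (V ''i'') (Plus (V ''n'') (Const 2))) (ECo (Const 0))]"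

definition rows_prog :: prog where
  "rows_prog = PFor ''i'' ''n'' (PSeq row_prog marks_prog)"

text \<open>Marker n + 2 is a vertex only in the even case. Its switchable pairs are written in any
  case, since without that vertex they are not read.\<close>

definition markers_prog :: prog where
  "markers_prog = pseq [
     PAss ''block_verts'' (V ''n'') (Const 1), PAss ''block_verts'' (Plus (V ''n'') (Const 1)) (Const 1),
     PAss ''block_verts'' (Plus (V ''n'') (Const 2)) (V ''ev''),
     PIf (V ''ev'') (PAss ''block_theta'' (cell_exp (V ''n'') (Plus (V ''n'') (Const 1))) (ECo (Const 0)))
       (PAss ''block_theta'' (cell_exp (V ''n'') (Plus (V ''n'') (Const 1))) (Const 1)),
     PAss ''block_theta'' (cell_exp (V ''n'') (Plus (V ''n'') (Const 2))) (Const 1),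
     PAss ''block_theta'' (cell_exp (Plus (V ''n'') (Const 1)) (Plus (V ''n'') (Const 2))) (Const 1)]"

text \<open>A homogeneous pair leaves \<open>ev\<close> at 0, because its two markers are attached
  to A and B exactly as those of an odd 2-join.\<close>

definition final_prog :: prog where
  "final_prog = pseq [PSet ''co'' (V ''bco''), PSet ''ev'' (Const 0), PIf (V ''bJ'') walk_prog PSkip, rows_prog, markers_prog]"

text \<open>Kept apart from \<open>rest_prog\<close> because \<open>exec_compile\<close> requires
  that a program does not write the bounds of its own loops, and \<open>N3\<close> bounds the
  search.\<close>

definition init_prog :: prog where
  "init_prog = PSeq (PSet ''N3'' (Times (Const 5) (Times (V ''n'') (Times (V ''n'') (V ''n'')))))
     (PSet ''best'' (Plus (V ''n'') (Const 1)))"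

definition rest_prog :: prog where
  "rest_prog = pseq [tree_prog 0, tree_prog 1, search_prog, PIf (Minus (Plus (V ''n'') (Const 1)) (V ''best'')) final_prog PSkip]"

lemmas prog_defs5 = row_prog_def marks_prog_def rows_prog_def markers_prog_def final_prog_def

definition flip :: "nat \<Rightarrow> nat \<Rightarrow> nat" where "flip c x = (if c = 0 then x else 2 - x)"

lemma cell_inj:
  fixes N :: nat
  assumes "j < N" "j' < N"
  shows "i * N + j = i' * N + j' \<longleftrightarrow> i = i' \<and> j = j'"
proof
  assume e: "i * N + j = i' * N + j'"
  have "(i * N + j) div N = i" "(i' * N + j') div N = i'" using assms by simp_all
  thus "i = i' \<and> j = j'" using e by auto
qed simp

context ram
begin

lemma n_less2 [simp]: "Suc (Suc n) < W"
  using n_less(3) by linarith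

definition row_val :: "nat \<Rightarrow> (nat \<Rightarrow> nat) \<Rightarrow> nat \<Rightarrow> nat \<Rightarrow> nat" where
  "row_val c cl i j = (if j < n then m0 i j else if j = n then flip c (2 * of_bool (cl i = 0))
     else if j = n + 1 then flip c (2 * of_bool (cl i = 1)) else flip c 0)"

lemma val_cell:
  assumes "s ''n'' 0 = n" "val W a s = i" "val W b s = j" "i \<le> n + 2" "j < n + 3"
  shows "val W (cell_exp a b) s = i * (n + 3) + j"
proof -
  have "i * (n + 3) + j < W" "i * (n + 3) < W" using index_less(1)[OF assms(4,5)] index_less(1)[OF assms(4), of 0] by simp_all
  thus ?thesis using assms by (simp add: cell_exp_def)
qed

lemma row_run:
  assumes s: "inp s" "s ''i'' 0 = i" "i < n"
  shows "run W row_prog s ''block_theta'' k = (if \<exists>j<n. k = i * (n + 3) + j then m0 i (k - i * (n + 3)) else s ''block_theta'' k)"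
proof -
  let ?I = "\<lambda>l t. \<forall>k. t ''block_theta'' k = (if \<exists>j<l. k = i * (n + 3) + j then m0 i (k - i * (n + 3)) else s ''block_theta'' k)"
  let ?body = "PAss ''block_theta'' (cell_exp (V ''i'') (V ''j'')) (Cell ''theta'' (Plus (Times (V ''i'') (V ''n'')) (V ''j'')))"
  have "?I n (run W row_prog s)" unfolding row_prog_def
  proof (rule for_induct[where I = ?I])
    show "word W s" "s ''n'' 0 = n" using inpD[OF s(1)] by simp_all
    fix l t assume l: "l < n" and I: "?I l t" and j: "t ''j'' 0 = l" and w: "word W t"
      and fr: "\<And>y. y \<notin> writes (PFor ''j'' ''n'' ?body) \<Longrightarrow> t y = s y"
    have eq: "t ''n'' = s ''n''" "t ''theta'' = s ''theta''" "t ''i'' = s ''i''" by (rule fr; simp)+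
    have in': "inp t" by (rule inp_frame[OF s(1) w eq(1,2)])
    have lt: "i * n + l < W" "i * n < W" using index_less(2)[of i l] index_less(2)[of i 0] s(3) l by auto
    have a: "val W (cell_exp (V ''i'') (V ''j'')) t = i * (n + 3) + l"
      by (rule val_cell) (use inpD[OF in'] eq s j l in auto)
    have b: "val W (Cell ''theta'' (Plus (Times (V ''i'') (V ''n'')) (V ''j''))) t = m0 i l"
      using in' eq s j l lt unfolding inp_def by simp
    have r: "run W ?body t = upd ''block_theta'' (i * (n + 3) + l) (m0 i l) t" unfolding run.simps(2) a b ..
    have ex: "(\<exists>j<Suc l. k = i * (n + 3) + j) \<longleftrightarrow> (\<exists>j<l. k = i * (n + 3) + j) \<or> k = i * (n + 3) + l" for k
      by (auto simp: less_Suc_eq)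
    show "?I (Suc l) (upd ''j'' 0 (Suc l) (run W ?body t))"
      unfolding r ex using I by auto
  qed auto
  thus ?thesis by blast
qed

lemma rows_run:
  assumes s: "inp s" "s ''co'' 0 = c" "c \<le> 1"
  defines "s' \<equiv> run W rows_prog s"
  shows "\<forall>i<n. s' ''X'' i = s ''bst'' i \<and> s' ''block_verts'' i = s ''bst'' i \<and>
    (\<forall>j<n + 3. s' ''block_theta'' (i * (n + 3) + j) = row_val c (s ''bcl'') i j)"
proof -
  let ?I = "\<lambda>i t. \<forall>i'<i. t ''X'' i' = s ''bst'' i' \<and> t ''block_verts'' i' = s ''bst'' i' \<and>
    (\<forall>j<n + 3. t ''block_theta'' (i' * (n + 3) + j) = row_val c (s ''bcl'') i' j)"
  let ?body = "PSeq row_prog marks_prog"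
  have "?I n s'" unfolding s'_def rows_prog_def
  proof (rule for_induct[where I = ?I])
    show "word W s" "s ''n'' 0 = n" using inpD[OF s(1)] by simp_all
    show "wf_prog (PFor ''i'' ''n'' ?body)" "bounds (PFor ''i'' ''n'' ?body) \<inter> writes (PFor ''i'' ''n'' ?body) = {}"
      by (auto simp: prog_defs5)
    fix i t assume i: "i < n" and I: "?I i t" and vi: "t ''i'' 0 = i" and w: "word W t"
      and fr: "\<And>y. y \<notin> writes (PFor ''i'' ''n'' ?body) \<Longrightarrow> t y = s y"
    have eq: "t ''n'' = s ''n''" "t ''theta'' = s ''theta''" "t ''co'' = s ''co''" "t ''bst'' = s ''bst''" "t ''bcl'' = s ''bcl''"
      by (rule fr; simp add: prog_defs5)+
    have in': "inp t" by (rule inp_frame[OF s(1) w eq(1,2)])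
    define t1 where "t1 = run W row_prog t"
    have w1: "word W t1" unfolding t1_def by (rule word_run[OF w]) (auto simp: prog_defs5)
    have f1: "t1 x = t x" if "x \<notin> {''j'', ''block_theta''}" for x
      unfolding t1_def by (rule run_frame) (use that in \<open>auto simp: prog_defs5\<close>)
    note row = row_run[OF in' vi i, folded t1_def]
    let ?a = "ECo (Times (Const 2) (EEq (Cell ''bcl'' (V ''i'')) (Const 0)))"
    let ?b = "ECo (Times (Const 2) (EEq (Cell ''bcl'' (V ''i'')) (Const 1)))"
    define t2 where "t2 = run W (PSeq (PAss ''X'' (V ''i'') (Cell ''bst'' (V ''i''))) (PAss ''block_verts'' (V ''i'') (Cell ''bst'' (V ''i'')))) t1"
    define t3 where "t3 = run W (PAss ''block_theta'' (cell_exp (V ''i'') (V ''n'')) ?a) t2"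
    define t4 where "t4 = run W (PAss ''block_theta'' (cell_exp (V ''i'') (Plus (V ''n'') (Const 1))) ?b) t3"
    define t5 where "t5 = run W (PAss ''block_theta'' (cell_exp (V ''i'') (Plus (V ''n'') (Const 2))) (ECo (Const 0))) t4"
    have w2: "word W t2" unfolding t2_def by (rule word_run[OF w1]) auto
    have w3: "word W t3" unfolding t3_def by (rule word_run[OF w2]) auto
    have w4: "word W t4" unfolding t4_def by (rule word_run[OF w3]) auto
    have f2: "t2 x = t1 x" if "x \<notin> {''X'', ''block_verts''}" for x unfolding t2_def by (rule run_frame) (use that in auto)
    have f3: "t3 x = t2 x" if "x \<noteq> ''block_theta''" for x unfolding t3_def by (rule run_frame) (use that in auto)
    have f4: "t4 x = t3 x" if "x \<noteq> ''block_theta''" for x unfolding t4_def by (rule run_frame) (use that in auto)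
    have f5: "t5 x = t4 x" if "x \<noteq> ''block_theta''" for x unfolding t5_def by (rule run_frame) (use that in auto)
    have b: "run W ?body t = t5" unfolding t5_def t4_def t3_def t2_def t1_def marks_prog_def by (simp only: run.simps(1,3) pseq.simps)
    have n0: "s ''n'' 0 = n" using inpD[OF s(1)] by simp
    have vals: "x ''n'' 0 = n" "x ''i'' 0 = i" "x ''co'' 0 = c" "x ''bcl'' = s ''bcl''" if "x \<in> {t1, t2, t3, t4}" for x
      using that f4 f3 f2 f1 eq n0 vi s(2) by auto
    have le: "2 * of_bool P \<le> (2::nat)" "2 * of_bool P < W" for P using W_small(1) by (cases P; simp)+
    have va: "val W ?a t2 = flip c (2 * of_bool (s ''bcl'' i = 0))"
    proof -
      have "val W (Times (Const 2) (EEq (Cell ''bcl'' (V ''i'')) (Const 0))) t2 = 2 * of_bool (s ''bcl'' i = 0)"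
        using vals[of t2] le(2)[of "s ''bcl'' i = 0"] by (simp add: val_EEq[OF W_small(1) w2])
      thus ?thesis using val_ECo[OF w2 vals(3)[of t2] s(3)] le(1) unfolding flip_def by simp
    qed
    have vb: "val W ?b t3 = flip c (2 * of_bool (s ''bcl'' i = 1))"
    proof -
      have "val W (Times (Const 2) (EEq (Cell ''bcl'' (V ''i'')) (Const 1))) t3 = 2 * of_bool (s ''bcl'' i = 1)"
        using vals[of t3] le(2)[of "s ''bcl'' i = 1"] by (simp add: val_EEq[OF W_small(1) w3])
      thus ?thesis using val_ECo[OF w3 vals(3)[of t3] s(3)] le(1) unfolding flip_def by simp
    qed
    have vc: "val W (ECo (Const 0)) t4 = flip c 0" using val_ECo[OF w4 vals(3)[of t4] s(3)] unfolding flip_def by simp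
    have ia: "val W (cell_exp (V ''i'') (V ''n'')) t2 = i * (n + 3) + n"
      by (rule val_cell) (use vals[of t2] i in auto)
    have ib: "val W (cell_exp (V ''i'') (Plus (V ''n'') (Const 1))) t3 = i * (n + 3) + (n + 1)"
      by (rule val_cell) (use vals[of t3] i in auto)
    have ic: "val W (cell_exp (V ''i'') (Plus (V ''n'') (Const 2))) t4 = i * (n + 3) + (n + 2)"
      by (rule val_cell) (use vals[of t4] i n_less(3) in \<open>auto simp del: n_less\<close>)
    have bt: "t5 ''block_theta'' = ((t1 ''block_theta'')(i * (n + 3) + n := flip c (2 * of_bool (s ''bcl'' i = 0)),
      i * (n + 3) + (n + 1) := flip c (2 * of_bool (s ''bcl'' i = 1)), i * (n + 3) + (n + 2) := flip c 0))"
      unfolding t5_def t4_def[symmetric] run.simps(2) ic vc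
      unfolding t4_def run.simps(2) ib vb
      unfolding t3_def run.simps(2) ia va
      by (simp add: upd_def f2)
    have new: "t5 ''block_theta'' (i * (n + 3) + j) = row_val c (s ''bcl'') i j" if j: "j < n + 3" for j
    proof -
      have inj: "i * (n + 3) + j = i * (n + 3) + j' \<longleftrightarrow> j = j'" for j' by simp
      have "j < n \<or> j = n \<or> j = n + 1 \<or> j = n + 2" using j by linarith
      moreover have "t1 ''block_theta'' (i * (n + 3) + j) = m0 i j" if "j < n" using row that by auto
      ultimately show ?thesis unfolding bt row_val_def by auto
    qed
    have old: "t5 ''block_theta'' (i' * (n + 3) + j) = t ''block_theta'' (i' * (n + 3) + j)" if "i' < i" "j < n + 3" for i' j
    proof -
      have ne: "i' * (n + 3) + j \<noteq> i * (n + 3) + j'" if "j' < n + 3" for j'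
        using cell_inj[of j "n + 3" j' i' i] that \<open>i' < i\<close> \<open>j < n + 3\<close> by simp
      hence no: "\<not> (\<exists>j'<n. i' * (n + 3) + j = i * (n + 3) + j')" by auto
      have "t1 ''block_theta'' (i' * (n + 3) + j) = t ''block_theta'' (i' * (n + 3) + j)"
        unfolding row by (simp only: no if_False)
      moreover have "i' * (n + 3) + j \<noteq> i * (n + 3) + n" "i' * (n + 3) + j \<noteq> i * (n + 3) + (n + 1)"
        "i' * (n + 3) + j \<noteq> i * (n + 3) + (n + 2)" by (rule ne; simp)+
      ultimately show ?thesis unfolding bt fun_upd_apply by (simp only: if_False)
    qed
    have xv: "t5 ''X'' = (t ''X'')(i := s ''bst'' i)" "t5 ''block_verts'' = (t ''block_verts'')(i := s ''bst'' i)"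
      using f5 f4 f3 vi eq f1 by (simp_all add: t2_def upd_def)
    show "?I (Suc i) (upd ''i'' 0 (Suc i) (run W ?body t))"
      unfolding b using I xv new old by (auto simp: less_Suc_eq)
  qed auto
  thus ?thesis .
qed

lemma markers_run:
  assumes s: "inp s" "s ''co'' 0 = c" "c \<le> 1" "s ''ev'' 0 = ev"
  defines "s' \<equiv> run W markers_prog s"
  shows "s' ''X'' = s ''X''" "\<And>i. i < n \<Longrightarrow> s' ''block_verts'' i = s ''block_verts'' i"
    "s' ''block_verts'' n = 1" "s' ''block_verts'' (n + 1) = 1" "s' ''block_verts'' (n + 2) = ev"
    "\<And>i j. i < n \<Longrightarrow> j < n + 3 \<Longrightarrow> s' ''block_theta'' (i * (n + 3) + j) = s ''block_theta'' (i * (n + 3) + j)"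
    "s' ''block_theta'' (n * (n + 3) + (n + 1)) = (if ev = 0 then 1 else flip c 0)"
    "s' ''block_theta'' (n * (n + 3) + (n + 2)) = 1" "s' ''block_theta'' ((n + 1) * (n + 3) + (n + 2)) = 1"
proof -
  define t1 where "t1 = run W (pseq [PAss ''block_verts'' (V ''n'') (Const 1), PAss ''block_verts'' (Plus (V ''n'') (Const 1)) (Const 1),
     PAss ''block_verts'' (Plus (V ''n'') (Const 2)) (V ''ev'')]) s"
  define t2 where "t2 = run W (PIf (V ''ev'') (PAss ''block_theta'' (cell_exp (V ''n'') (Plus (V ''n'') (Const 1))) (ECo (Const 0)))
       (PAss ''block_theta'' (cell_exp (V ''n'') (Plus (V ''n'') (Const 1))) (Const 1))) t1"
  define t3 where "t3 = run W (PAss ''block_theta'' (cell_exp (V ''n'') (Plus (V ''n'') (Const 2))) (Const 1)) t2"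
  have s': "s' = run W (PAss ''block_theta'' (cell_exp (Plus (V ''n'') (Const 1)) (Plus (V ''n'') (Const 2))) (Const 1)) t3"
    unfolding s'_def t3_def t2_def t1_def markers_prog_def by (simp only: run.simps(1,3) pseq.simps)
  have n0: "s ''n'' 0 = n" "word W s" using inpD[OF s(1)] by simp_all
  have w1: "word W t1" unfolding t1_def by (rule word_run[OF n0(2)]) auto
  have w2: "word W t2" unfolding t2_def by (rule word_run[OF w1]) auto
  have f1: "t1 x = s x" if "x \<noteq> ''block_verts''" for x unfolding t1_def by (rule run_frame) (use that in auto)
  have f2: "t2 x = t1 x" if "x \<noteq> ''block_theta''" for x unfolding t2_def by (rule run_frame) (use that in auto)
  have f3: "t3 x = t2 x" if "x \<noteq> ''block_theta''" for x unfolding t3_def by (rule run_frame) (use that in auto)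
  have f4: "s' x = t3 x" if "x \<noteq> ''block_theta''" for x unfolding s' by (rule run_frame) (use that in auto)
  have nn: "(n + 1) mod W = n + 1" "(n + 2) mod W = n + 2" using n_less by simp_all
  have bv: "t1 ''block_verts'' = (s ''block_verts'')(n := 1, n + 1 := 1, n + 2 := ev)"
    unfolding t1_def using n0 s(4) nn by (simp add: upd_def)
  show "s' ''X'' = s ''X''" using f4 f3 f2 f1 by simp
  show "\<And>i. i < n \<Longrightarrow> s' ''block_verts'' i = s ''block_verts'' i"
    "s' ''block_verts'' n = 1" "s' ''block_verts'' (n + 1) = 1" "s' ''block_verts'' (n + 2) = ev"
    using f4 f3 f2 bv by simp_all
  have vals: "x ''n'' 0 = n" "x ''co'' 0 = c" "x ''ev'' 0 = ev" if "x \<in> {t1, t2, t3}" for x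
    using that f3 f2 f1 n0 s by auto
  have v1: "val W (Plus (V ''n'') (Const 1)) x = n + 1" "val W (Plus (V ''n'') (Const 2)) x = n + 2" if "x \<in> {t1, t2, t3}" for x
    using vals[OF that] n_less by simp_all
  have ia: "val W (cell_exp (V ''n'') (Plus (V ''n'') (Const 1))) t1 = n * (n + 3) + (n + 1)"
    by (rule val_cell) (use vals[of t1] v1[of t1] in auto)
  have ib: "val W (cell_exp (V ''n'') (Plus (V ''n'') (Const 2))) t2 = n * (n + 3) + (n + 2)"
    by (rule val_cell) (use vals[of t2] v1[of t2] in auto)
  have ic: "val W (cell_exp (Plus (V ''n'') (Const 1)) (Plus (V ''n'') (Const 2))) t3 = (n + 1) * (n + 3) + (n + 2)"
    by (rule val_cell) (use vals[of t3] v1[of t3] in auto)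
  have vc: "val W (ECo (Const 0)) t1 = flip c 0" using val_ECo[OF w1 vals(2)[of t1] s(3)] unfolding flip_def by simp
  have ve: "val W (V ''ev'') t1 = ev" using vals[of t1] by simp
  have one: "val W (Const 1) x = 1" for x by simp
  have t2': "t2 = upd ''block_theta'' (n * (n + 3) + (n + 1)) (if ev = 0 then 1 else flip c 0) t1"
    unfolding t2_def run.simps(2,4) ia vc ve one by simp
  have t3': "t3 = upd ''block_theta'' (n * (n + 3) + (n + 2)) 1 t2" unfolding t3_def run.simps(2) ib one ..
  have bt: "s' ''block_theta'' = (s ''block_theta'')(n * (n + 3) + (n + 1) := (if ev = 0 then 1 else flip c 0),
    n * (n + 3) + (n + 2) := 1, (n + 1) * (n + 3) + (n + 2) := 1)"
    unfolding s' run.simps(2) ic one using f1[of "''block_theta''"] by (simp add: t3' t2' upd_def)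
  have ne: "i * (n + 3) + j \<noteq> i' * (n + 3) + j'" if "i \<noteq> i' \<or> j \<noteq> j'" "j < n + 3" "j' < n + 3" for i j i' j'
    using cell_inj[OF that(2,3), of i i'] that(1) by blast
  show "s' ''block_theta'' (i * (n + 3) + j) = s ''block_theta'' (i * (n + 3) + j)" if "i < n" "j < n + 3" for i j
  proof -
    have "i * (n + 3) + j \<noteq> n * (n + 3) + (n + 1)" "i * (n + 3) + j \<noteq> n * (n + 3) + (n + 2)"
      "i * (n + 3) + j \<noteq> (n + 1) * (n + 3) + (n + 2)"
      by (rule ne; use that in simp)+
    thus ?thesis unfolding bt fun_upd_apply by (simp only: if_False)
  qed
  have d: "n * (n + 3) + (n + 1) \<noteq> n * (n + 3) + (n + 2)" "n * (n + 3) + (n + 1) \<noteq> (n + 1) * (n + 3) + (n + 2)"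
    "n * (n + 3) + (n + 2) \<noteq> (n + 1) * (n + 3) + (n + 2)"
    by (rule ne; simp)+
  show "s' ''block_theta'' ((n + 1) * (n + 3) + (n + 2)) = 1" unfolding bt fun_upd_apply by (simp only: if_True simp_thms)
  show "s' ''block_theta'' (n * (n + 3) + (n + 2)) = 1" unfolding bt fun_upd_apply by (simp only: d if_True if_False simp_thms)
  show "s' ''block_theta'' (n * (n + 3) + (n + 1)) = (if ev = 0 then 1 else flip c 0)"
    unfolding bt fun_upd_apply by (simp only: d if_True if_False simp_thms)
qed

text \<open>The clause on parity is conditional on a first layer K that meets B. That such a layer
  exists is known only after the accepted seed has been recognized as a proper 2-join, in
  \<open>output_ev\<close>.\<close>

definition output_ok :: "state \<Rightarrow> seed \<Rightarrow> nat \<Rightarrow> bool" where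
  "output_ok s d ev \<longleftrightarrow> ev \<le> 1 \<and> (sd_J d = 0 \<longrightarrow> ev = 0) \<and>
     (sd_J d = 1 \<longrightarrow> (\<forall>K v. K < n \<longrightarrow> v \<in> layer (seed_set d) (seed_part d) (m (sd_co d)) K \<longrightarrow> seed_part d v = 1 \<longrightarrow>
        (\<forall>j<K. \<forall>v\<in>layer (seed_set d) (seed_part d) (m (sd_co d)) j. seed_part d v \<noteq> 1) \<longrightarrow> ev = of_bool (even K))) \<and>
     (\<forall>i<n. (s ''X'' i \<noteq> 0 \<longleftrightarrow> i \<in> seed_set d) \<and> (s ''block_verts'' i \<noteq> 0 \<longleftrightarrow> i \<in> seed_set d) \<and>
        (\<forall>j<n + 3. s ''block_theta'' (i * (n + 3) + j) = row_val (sd_co d) (seed_part d) i j)) \<and>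
     s ''block_verts'' n = 1 \<and> s ''block_verts'' (n + 1) = 1 \<and> s ''block_verts'' (n + 2) = ev \<and>
     s ''block_theta'' (n * (n + 3) + (n + 1)) = (if ev = 0 then 1 else flip (sd_co d) 0) \<and>
     s ''block_theta'' (n * (n + 3) + (n + 2)) = 1 \<and> s ''block_theta'' ((n + 1) * (n + 3) + (n + 2)) = 1"

text \<open>This holds without knowing that any walk from A to B exists, as needed before the seed
  is interpreted.\<close>

lemma walk_ev_le:
  assumes "word W s" "s ''ev'' 0 \<le> 1"
  shows "run W walk_prog s ''ev'' 0 \<le> 1"
proof -
  let ?E = "\<lambda>t :: state. t ''ev'' 0 \<le> 1"
  let ?body = "PIf (EAnd (ENot (V ''fin'')) (EAnd (Cell ''w'' (Plus (Times (V ''k'') (V ''n'')) (V ''v'')))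
       (EEq (Cell ''bcl'' (V ''v'')) (Const 1))))
     (PSeq (PSet ''fin'' (Const 1)) (PSet ''ev'' (ENot (EMod (V ''k'') (Const 2))))) PSkip"
  have hit: "?E (run W hit_prog t)" if t: "word W t" "?E t" for t
    unfolding hit_prog_def
  proof (rule for_induct[where I = "\<lambda>_. ?E", OF t(1) _ _ _ refl])
    fix i r assume "?E r"
    thus "?E (upd ''v'' 0 (Suc i) (run W ?body r))" by (auto simp: bval(1))
  qed (use t in auto)
  define s1 where "s1 = run W (pseq [start_prog, PFor ''k'' ''n'' layer_prog, PSet ''fin'' (Const 0)]) s"
  have w1: "word W s1" unfolding s1_def by (rule word_run[OF assms(1)]) (auto simp: prog_defs4)
  have e1: "?E s1" using assms(2) unfolding s1_def by (subst run_frame) (auto simp: prog_defs4)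
  have "?E (run W (PFor ''k'' ''n'' hit_prog) s1)"
  proof (rule for_induct[where I = "\<lambda>_. ?E", OF w1 _ _ _ refl])
    show "wf_prog (PFor ''k'' ''n'' hit_prog)" "bounds (PFor ''k'' ''n'' hit_prog) \<inter> writes (PFor ''k'' ''n'' hit_prog) = {}"
      by (auto simp: prog_defs4)
    show "?E (upd ''k'' 0 (Suc i) (run W hit_prog r))" if "word W r" "?E r" for i r using hit[OF that] by simp
  qed (use e1 in auto)
  thus ?thesis unfolding walk_prog_def s1_def by simp
qed

lemma final:
  assumes s: "inp s" "stored s d" "\<And>i. s ''w'' i = 0" and d: "sd_co d \<le> 1" "sd_J d \<le> 1" "seed_set d \<subseteq> {..<n}"
  shows "\<exists>ev. output_ok (run W final_prog s) d ev"
proof -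
  define s1 where "s1 = run W (PSeq (PSet ''co'' (V ''bco'')) (PSet ''ev'' (Const 0))) s"
  define s2 where "s2 = run W (PIf (V ''bJ'') walk_prog PSkip) s1"
  define s3 where "s3 = run W rows_prog s2"
  define s4 where "s4 = run W markers_prog s3"
  have s4: "run W final_prog s = s4" unfolding s4_def s3_def s2_def s1_def final_prog_def by (simp only: run.simps(1,3) pseq.simps)
  have w0: "word W s" using inpD[OF s(1)] by simp
  have w1: "word W s1" unfolding s1_def by (rule word_run[OF w0]) auto
  have w2: "word W s2" unfolding s2_def by (rule word_run[OF w1]) (auto simp: prog_defs4)
  have w3: "word W s3" unfolding s3_def by (rule word_run[OF w2]) (auto simp: prog_defs5)
  have f1: "s1 x = s x" if "x \<notin> {''co'', ''ev''}" for x unfolding s1_def by (rule run_frame) (use that in auto)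
  have f2: "s2 x = s1 x" if "x \<notin> {''v'', ''w'', ''k'', ''u'', ''fin'', ''ev''}" for x
    unfolding s2_def by (rule run_frame) (use that in \<open>auto simp: prog_defs4\<close>)
  have f3: "s3 x = s2 x" if "x \<notin> {''i'', ''j'', ''X'', ''block_verts'', ''block_theta''}" for x
    unfolding s3_def by (rule run_frame) (use that in \<open>auto simp: prog_defs5\<close>)
  have st: "s ''bco'' 0 = sd_co d" "s ''bJ'' 0 = sd_J d" "\<And>v. v < n \<Longrightarrow> (s ''bst'' v \<noteq> 0) = (v \<in> seed_set d)"
    "\<And>v. v < n \<Longrightarrow> s ''bcl'' v = seed_part d v" using s(2) unfolding stored_def by simp_all
  have v1: "s1 ''co'' 0 = sd_co d" "s1 ''ev'' 0 = 0" using st unfolding s1_def by simp_all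
  have in1: "inp s1" by (rule inp_frame[OF s(1) w1]) (simp_all add: f1)
  have in2: "inp s2" by (rule inp_frame[OF in1 w2]) (simp_all add: f2)
  have in3: "inp s3" by (rule inp_frame[OF in2 w3]) (simp_all add: f3)
  have co2: "s2 ''co'' 0 = sd_co d" "s3 ''co'' 0 = sd_co d" using f2 f3 v1 by simp_all
  define ev where "ev = s2 ''ev'' 0"
  have ev3: "s3 ''ev'' 0 = ev" using f3 by (simp add: ev_def)
  have bJ: "s1 ''bJ'' 0 = sd_J d" using f1 st by simp
  have ev0: "sd_J d = 0 \<Longrightarrow> ev = 0" unfolding ev_def s2_def using bJ v1 by simp
  have evw: "ev = run W walk_prog s1 ''ev'' 0" if "sd_J d = 1" unfolding ev_def s2_def using bJ that by simp
  have ev1: "ev \<le> 1"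
  proof (cases "sd_J d = 0")
    case True thus ?thesis using ev0 by simp
  next
    case False
    hence "sd_J d = 1" using d(2) by simp
    thus ?thesis using evw walk_ev_le[OF w1] v1 by simp
  qed
  have evK: "ev = of_bool (even K)" if "sd_J d = 1" "K < n" "v \<in> layer (seed_set d) (seed_part d) (m (sd_co d)) K" "seed_part d v = 1"
    "\<forall>j<K. \<forall>v\<in>layer (seed_set d) (seed_part d) (m (sd_co d)) j. seed_part d v \<noteq> 1" for K v
    unfolding evw[OF that(1)]
    by (rule walk_run[OF in1 v1(1) d(1) _ d(3) _ _ that(2,3,4)]) (use s(3) f1 st that(5) in auto)
  note rows = rows_run[OF in2 co2(1) d(1), folded s3_def]
  note mk = markers_run[OF in3 co2(2) d(1) ev3, folded s4_def]
  have bst: "(s2 ''bst'' i \<noteq> 0) = (i \<in> seed_set d)" and bcl: "s2 ''bcl'' i = seed_part d i" if "i < n" for i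
    using f2 f1 st that by simp_all
  have rv: "row_val (sd_co d) (s2 ''bcl'') i j = row_val (sd_co d) (seed_part d) i j" if "i < n" for i j
    unfolding row_val_def using bcl[OF that] by simp
  have "output_ok s4 d ev"
    unfolding output_ok_def
  proof (intro conjI allI impI)
    fix i assume i: "i < n"
    show "(s4 ''X'' i \<noteq> 0) = (i \<in> seed_set d)" "(s4 ''block_verts'' i \<noteq> 0) = (i \<in> seed_set d)"
      using rows i mk(1) mk(2)[OF i] bst[OF i] by simp_all
    show "s4 ''block_theta'' (i * (n + 3) + j) = row_val (sd_co d) (seed_part d) i j" if "j < n + 3" for j
      using rows i that mk(6)[OF i that] rv[OF i] by simp
  qed (use ev1 ev0 evK mk in blast)+
  thus ?thesis unfolding s4 by blast
qed

lemma main_run: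
  assumes s: "inp s" "s ''N3'' 0 = N" "s ''best'' 0 = n + 1" "\<And>i. s ''w'' i = 0" and n: "0 < n"
  defines "s' \<equiv> run W rest_prog s"
  obtains tp cn where
    "\<And>c. c \<le> 1 \<Longrightarrow> cn c \<noteq> 0 \<Longrightarrow> spanning n (m c) (\<lambda>v. tp (c * n + v))"
    "\<And>c. c \<le> 1 \<Longrightarrow> cn c = 0 \<Longrightarrow> split_set n (m c)"
    "(\<forall>k<N. \<not> seed_ok cn (decode n tp k)) \<or>
     (\<exists>k<N. seed_ok cn (decode n tp k) \<and> (\<exists>ev. output_ok s' (decode n tp k) ev) \<and>
       (\<forall>k'<N. seed_ok cn (decode n tp k') \<longrightarrow> card (seed_set (decode n tp k)) \<le> card (seed_set (decode n tp k'))))"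
proof -
  define s1 where "s1 = run W (tree_prog 0) s"
  define s2 where "s2 = run W (tree_prog 1) s1"
  define s3 where "s3 = run W search_prog s2"
  have s': "s' = run W (PIf (Minus (Plus (V ''n'') (Const 1)) (V ''best'')) final_prog PSkip) s3"
    unfolding s'_def s3_def s2_def s1_def rest_prog_def by (simp only: run.simps(1,3) pseq.simps)
  have c01: "(0::nat) \<le> 1" "(1::nat) \<le> 1" by simp_all
  note t0 = tree[OF s(1) c01(1) n, folded s1_def]
  note t1 = tree[OF t0(1) c01(2) n, folded s2_def]
  have ft: "run W (tree_prog c) t x = t x" if "x \<in> {''N3'', ''best'', ''w''}" for c t x
    by (rule run_frame) (use that in \<open>auto simp: tree_prog_def tree_init_def tree_store_def prog_defs1\<close>)
  have e2: "s2 ''N3'' 0 = N" "s2 ''best'' 0 = n + 1" "s2 ''w'' = s ''w''"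
    unfolding s2_def s1_def using ft s(2,3) by simp_all
  note se = search[OF t1(1) e2(1,2) n, folded s3_def]
  define tp cn where tc: "tp = s2 ''tp''" "cn = s2 ''cn''"
  have cn: "cn 0 = s1 ''cn'' 0" "\<And>v. v < n \<Longrightarrow> tp (0 * n + v) = s1 ''tp'' (0 * n + v)"
    unfolding tc using t1(4)[of 0] t1(5) by simp_all
  have sp0: "spanning n (m 0) (\<lambda>v. tp (0 * n + v))" if "cn 0 \<noteq> 0"
  proof -
    have "spanning n (m 0) (\<lambda>v. s1 ''tp'' (0 * n + v))" using t0(2) that cn(1) by simp
    thus ?thesis unfolding spanning_def using cn(2) by simp
  qed
  have sp1: "spanning n (m 1) (\<lambda>v. tp (1 * n + v))" if "cn 1 \<noteq> 0" using t1(2) that unfolding tc by blast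
  have w3: "s3 ''w'' = s ''w''" unfolding s3_def using e2(3) by (subst run_frame) (auto simp: prog_defs3)
  have n3: "s3 ''n'' 0 = n" using inpD[OF se(1)] by simp
  have val: "val W (Minus (Plus (V ''n'') (Const 1)) (V ''best'')) s3 = n + 1 - s3 ''best'' 0" using n3 by simp
  show thesis
  proof (rule that[of cn tp])
    show "spanning n (m c) (\<lambda>v. tp (c * n + v))" if "c \<le> 1" "cn c \<noteq> 0" for c
      using sp0 sp1 that by (cases "c = 0") (auto simp: le_Suc_eq)
    show "split_set n (m c)" if "c \<le> 1" "cn c = 0" for c
    proof (cases "c = 0")
      case True thus ?thesis using t0(3) that cn(1) by simp
    next
      case False
      hence "c = 1" using that by simp
      thus ?thesis using t1(3) that unfolding tc by simp
    qed
    show "(\<forall>k<N. \<not> seed_ok cn (decode n tp k)) \<or>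
     (\<exists>k<N. seed_ok cn (decode n tp k) \<and> (\<exists>ev. output_ok s' (decode n tp k) ev) \<and>
       (\<forall>k'<N. seed_ok cn (decode n tp k') \<longrightarrow> card (seed_set (decode n tp k)) \<le> card (seed_set (decode n tp k'))))"
    proof (cases "\<forall>k<N. \<not> seed_ok cn (decode n tp k)")
      case False
      then obtain k where k: "k < N" "seed_ok cn (decode n tp k)" "stored s3 (decode n tp k)"
        "\<forall>k'<N. seed_ok cn (decode n tp k') \<longrightarrow> card (seed_set (decode n tp k)) \<le> card (seed_set (decode n tp k'))"
        using se(2) unfolding tc by blast
      let ?d = "decode n tp k"
      have sub: "seed_set ?d \<subseteq> {..<n}" by (rule seed_set_subset[OF n])
      hence "card (seed_set ?d) \<le> n" using card_mono[of "{..<n}"] by fastforce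
      hence "n + 1 - s3 ''best'' 0 \<noteq> 0" using k(3) unfolding stored_def by simp
      hence "s' = run W final_prog s3" unfolding s' run.simps(4) val by simp
      moreover have "\<exists>ev. output_ok (run W final_prog s3) ?d ev"
        by (rule final[OF se(1) k(3) _ decode_bounds(1,2)[OF n] sub]) (use w3 s(4) in simp)
      ultimately show ?thesis using k by metis
    qed blast
  qed
qed

end

lemma init_run:
  assumes "(n + 2) ^ 8 = W" "word W s" "s ''n'' 0 = n" "5 * (n * n * n) + 5 < W"
  shows "run W init_prog s = upd ''best'' 0 (n + 1) (upd ''N3'' 0 (5 * (n * (n * n))) s)"
proof -
  have le: "n * n \<le> n * (n * n)" "n \<le> n * n" by (cases n; simp)+
  have a: "5 * (n * (n * n)) + 5 < W" using assms(4) by (simp only: mult.assoc)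
  have "n * n < W" "n * (n * n) < W" "5 * (n * (n * n)) < W" "n + 1 < W" "5 < W" using le a by linarith+
  thus ?thesis using assms(3) by (simp add: init_prog_def)
qed

section \<open>Accepted closures are fragments, and minimal fragments are accepted closures\<close>

section \<open>Candidates and fragments\<close>

definition tri_matrix :: "nat \<Rightarrow> nat trigraph \<Rightarrow> nat \<Rightarrow> nat \<Rightarrow> nat" where
  "tri_matrix n T i j = (if i < n \<and> j < n \<and> i \<noteq> j then nat (theta T {i, j} + 1) else 0)"

text \<open>Closedness passes to intersections: if v is missing from the intersection it is missing
  from one of the closed sets, and a conflict of v with members of the intersection is a conflict
  there.\<close>

lemma closure_props:
  assumes "S0 \<subseteq> {..<n}"
  shows "closure n J cl mm S0 \<subseteq> {..<n}" "S0 \<subseteq> closure n J cl mm S0" "closed_set n J cl mm (closure n J cl mm S0)"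
    "U \<subseteq> {..<n} \<Longrightarrow> S0 \<subseteq> U \<Longrightarrow> closed_set n J cl mm U \<Longrightarrow> closure n J cl mm S0 \<subseteq> U"
proof -
  have "{..<n} \<in> {U. U \<subseteq> {..<n} \<and> S0 \<subseteq> U \<and> closed_set n J cl mm U}" using assms by (auto simp: closed_set_def)
  thus "closure n J cl mm S0 \<subseteq> {..<n}" unfolding closure_def by blast
  show "S0 \<subseteq> closure n J cl mm S0" unfolding closure_def by blast
  show "U \<subseteq> {..<n} \<Longrightarrow> S0 \<subseteq> U \<Longrightarrow> closed_set n J cl mm U \<Longrightarrow> closure n J cl mm S0 \<subseteq> U"
    unfolding closure_def by blast
  show "closed_set n J cl mm (closure n J cl mm S0)"
    unfolding closed_set_def
  proof (intro allI impI ballI)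
    fix v y z assume v: "v < n" "v \<notin> closure n J cl mm S0" and yz: "y \<in> closure n J cl mm S0" "z \<in> closure n J cl mm S0"
    obtain U where U: "U \<subseteq> {..<n}" "S0 \<subseteq> U" "closed_set n J cl mm U" "v \<notin> U" using v(2) unfolding closure_def by blast
    have "y \<in> U" "z \<in> U" using yz U unfolding closure_def by blast+
    thus "\<not> conflict J cl mm v y z" using U(3,4) v(1) unfolding closed_set_def by blast
  qed
qed

lemma partD:
  assumes "part J mm a2 b2 v = k"
  shows "k \<noteq> 3 \<Longrightarrow> v \<noteq> a2 \<and> v \<noteq> b2" "k = 0 \<Longrightarrow> mm a2 v = 2" "k = 0 \<Longrightarrow> J \<noteq> 0 \<Longrightarrow> mm b2 v = 0"
    "k = 1 \<Longrightarrow> mm a2 v = 0" "k = 1 \<Longrightarrow> J \<noteq> 0 \<Longrightarrow> mm b2 v = 2" "k \<in> {0, 1, 2, 3}" "J = 0 \<Longrightarrow> k \<noteq> 2"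
  unfolding assms[symmetric] part_def by (simp_all split: if_split_asm if_split)

locale tri_ram =
  fixes n :: nat and T :: "nat trigraph"
  assumes V: "verts T = {..<n}" and TF: "T \<in> class_F" and nbal: "\<nexists>A B. balanced_skew_partition T A B"
begin

lemma matrix_le: "tri_matrix n T i j \<le> 2"
proof (cases "i < n \<and> j < n \<and> i \<noteq> j")
  case True
  hence "theta T {i, j} \<in> {-1, 0, 1}" using theta_cases[OF class_FD(1)[OF TF], of i j] V by simp
  thus ?thesis unfolding tri_matrix_def by auto
qed (auto simp: tri_matrix_def)

sublocale ram n "(n + 2) ^ 8" "tri_matrix n T"
  by unfold_locales (simp_all add: matrix_le)

text \<open>The class F and the absence of balanced skew-partitions are invariant under
  complementation, so one argument with the index c covers 2-joins and complement 2-joins.\<close>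

definition Tc :: "nat \<Rightarrow> nat trigraph" where "Tc c = (if c = 0 then T else co T)"

lemma Tc: "verts (Tc c) = {..<n}" "Tc c \<in> class_F" "\<nexists>A B. balanced_skew_partition (Tc c) A B"
proof -
  show "verts (Tc c) = {..<n}" "Tc c \<in> class_F" using V TF class_F_co[OF TF] by (simp_all add: Tc_def)
  show "\<nexists>A B. balanced_skew_partition (Tc c) A B"
    using nbal balanced_skew_partition_co[OF _ class_FD(1)[OF TF]] by (cases "c = 0") (simp add: Tc_def, simp add: Tc_def, blast)
qed

lemma m_iff:
  assumes "i < n" "j < n" "i \<noteq> j"
  shows "m c i j = 2 \<longleftrightarrow> strongly_adj (Tc c) i j" "m c i j = 1 \<longleftrightarrow> switchable (Tc c) i j"
    "m c i j = 0 \<longleftrightarrow> strongly_antiadj (Tc c) i j" "m c i j \<noteq> 0 \<longleftrightarrow> adj (Tc c) i j"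
proof -
  have "theta T {i, j} \<in> {-1, 0, 1}" using theta_cases[OF class_FD(1)[OF TF], of i j] V assms by simp
  then consider "theta T {i, j} = -1" | "theta T {i, j} = 0" | "theta T {i, j} = 1" by blast
  hence "(m c i j = 2 \<longleftrightarrow> strongly_adj (Tc c) i j) \<and> (m c i j = 1 \<longleftrightarrow> switchable (Tc c) i j) \<and>
    (m c i j = 0 \<longleftrightarrow> strongly_antiadj (Tc c) i j) \<and> (m c i j \<noteq> 0 \<longleftrightarrow> adj (Tc c) i j)"
    by cases (cases "c = 0";
      use assms V in \<open>simp add: m_def tri_matrix_def Tc_def strongly_adj_def switchable_def strongly_antiadj_def adj_def antiadj_def co_def\<close>)+
  thus "m c i j = 2 \<longleftrightarrow> strongly_adj (Tc c) i j" "m c i j = 1 \<longleftrightarrow> switchable (Tc c) i j"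
    "m c i j = 0 \<longleftrightarrow> strongly_antiadj (Tc c) i j" "m c i j \<noteq> 0 \<longleftrightarrow> adj (Tc c) i j" by blast+
qed

text \<open>The tree yields an edge leaving any proper vertex set that contains the root; for other
  sets, take the edge leaving the complementary set and reverse it.\<close>

lemma spanning_linked:
  assumes sp: "spanning n (m c) par"
  shows "linked (Tc c)"
  unfolding linked_def Tc(1)
proof (intro allI impI)
  have key: "\<exists>v<n. v \<noteq> 0 \<and> par v < n \<and> par v \<in> U \<and> v \<notin> U \<and> adj (Tc c) (par v) v" if U: "0 \<in> U" "\<not> {..<n} \<subseteq> U" for U
  proof -
    obtain v where v: "v < n" "v \<noteq> 0" "par v \<in> U" "v \<notin> U" using sp U unfolding spanning_def by blast
    hence "par v < n" "m c (par v) v \<noteq> 0" "par v \<noteq> v" using sp unfolding spanning_def by auto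
    thus ?thesis using v m_iff(4)[of "par v" v c] by blast
  qed
  fix U assume U: "U \<subseteq> {..<n} \<and> U \<noteq> {} \<and> U \<noteq> {..<n}"
  show "\<exists>u\<in>U. \<exists>v\<in>{..<n} - U. adj (Tc c) u v"
  proof (cases "0 \<in> U")
    case True
    thus ?thesis using key[of U] U by blast
  next
    case False
    have "0 \<in> {..<n} - U" using False U by auto
    moreover have "\<not> {..<n} \<subseteq> {..<n} - U" using U by blast
    ultimately obtain v where v: "v < n" "par v \<in> {..<n} - U" "v \<notin> {..<n} - U" "adj (Tc c) (par v) v" using key[of "{..<n} - U"] by blast
    have "v \<in> U" using v(1,3) by auto
    moreover have "adj (Tc c) v (par v)" using v(4) adj_sym by metis
    ultimately show ?thesis using v(2) by blast
  qed
qed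

lemma split_not_linked:
  assumes "split_set n (m c)"
  shows "\<not> linked (Tc c)"
proof
  assume L: "linked (Tc c)"
  obtain S where S: "S \<subset> {..<n}" "S \<noteq> {}" "\<forall>y\<in>S. \<forall>v<n. v \<notin> S \<longrightarrow> m c y v = 0"
    using assms unfolding split_set_def by blast
  obtain u v where uv: "u \<in> S" "v \<in> {..<n} - S" "adj (Tc c) u v"
    using L[unfolded linked_def Tc(1), rule_format, of S] S(1,2) by blast
  have "u < n" "v < n" "u \<noteq> v" using uv(1,2) S(1) by auto
  hence "m c u v \<noteq> 0" using m_iff(4)[of u v c] uv(3) by blast
  thus False using S(3) uv by auto
qed

lemma closed_set_join_closed:
  assumes cs: "closed_set n 1 cl (m c) S" and S: "S \<subseteq> {..<n}"
    and cl: "\<And>x. x \<in> S \<Longrightarrow> (x \<in> A \<longleftrightarrow> cl x = 0) \<and> (x \<in> B \<longleftrightarrow> cl x = 1) \<and> (x \<in> C \<longleftrightarrow> cl x = 2)"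
  shows "join_closed (Tc c) A B C S"
  unfolding join_closed_def Tc(1)
proof (intro ballI conjI notI)
  fix v assume v: "v \<in> {..<n} - S"
  have no: "\<not> conflict 1 cl (m c) v y z" if "y \<in> S" "z \<in> S" for y z
    using cs v that unfolding closed_set_def by blast
  have i: "m c x v = 2 \<longleftrightarrow> strongly_adj (Tc c) x v" "m c x v = 1 \<longleftrightarrow> switchable (Tc c) x v"
    "m c x v = 0 \<longleftrightarrow> strongly_antiadj (Tc c) x v" if "x \<in> S" for x
    using m_iff[of x v c] that v S by auto
  show False if "x \<in> S" "switchable (Tc c) x v" for x
    using no[OF that(1) that(1)] i(2)[OF that(1)] that(2) unfolding conflict_def by metis
  show "strongly_adj (Tc c) x v = strongly_adj (Tc c) y v" if "x \<in> S \<inter> A" "y \<in> S \<inter> A" for x y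
    using no[of x y] i(1)[of x] i(1)[of y] that cl unfolding conflict_def by (metis IntE)
  show "strongly_adj (Tc c) x v = strongly_adj (Tc c) y v" if "x \<in> S \<inter> B" "y \<in> S \<inter> B" for x y
    using no[of x y] i(1)[of x] i(1)[of y] that cl unfolding conflict_def by (metis IntE)
  show False if "x \<in> S \<inter> C" "strongly_adj (Tc c) x v" for x
    using no[of x x] i(1)[of x] that cl unfolding conflict_def by (metis IntE zero_neq_numeral)
  show False if "x \<in> S \<inter> A" "y \<in> S \<inter> B" "strongly_adj (Tc c) x v \<and> strongly_adj (Tc c) y v" for x y
    using no[of x y] i(1)[of x] i(1)[of y] that cl unfolding conflict_def by (metis IntE)
qed

text \<open>A side of an actual 2-join is closed for its own labels, so closures of vertices inside
  never leave it.\<close>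

lemma prejoin_closed_set:
  assumes J: "prejoin (Tc c) A B C A' B' C'"
    and cl: "\<And>x. x \<in> A \<union> B \<union> C \<Longrightarrow> (x \<in> A \<longleftrightarrow> cl x = 0) \<and> (x \<in> B \<longleftrightarrow> cl x = 1) \<and> (x \<in> C \<longleftrightarrow> cl x = 2)"
  shows "closed_set n 1 cl (m c) (A \<union> B \<union> C)"
  unfolding closed_set_def
proof (intro allI impI ballI notI)
  note D = prejoinD[OF J]
  fix v y z assume v: "v < n" "v \<notin> A \<union> B \<union> C" and yz: "y \<in> A \<union> B \<union> C" "z \<in> A \<union> B \<union> C"
    and cf: "conflict 1 cl (m c) v y z"
  have XV: "A \<union> B \<union> C \<subseteq> {..<n}" and VY: "v \<in> A' \<union> B' \<union> C'" using D(1) v unfolding Tc(1) by auto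
  have i: "m c x v = 2 \<longleftrightarrow> strongly_adj (Tc c) x v" "m c x v = 0 \<longleftrightarrow> strongly_antiadj (Tc c) x v" if "x \<in> A \<union> B \<union> C" for x
  proof -
    have "x < n" "x \<noteq> v" using that v XV by auto
    thus "m c x v = 2 \<longleftrightarrow> strongly_adj (Tc c) x v" "m c x v = 0 \<longleftrightarrow> strongly_antiadj (Tc c) x v"
      using m_iff[of x v c] v(1) by blast+
  qed
  have a: "m c x v = (if v \<in> A' then 2 else 0)" if "x \<in> A" for x
    using that i[of x] VY set_completeD[OF D(13) that, of v] set_anticompleteD[OF D(15) that, of v] by auto
  have b: "m c x v = (if v \<in> B' then 2 else 0)" if "x \<in> B" for x
    using that i[of x] VY set_completeD[OF D(14) that, of v] set_anticompleteD[OF D(16) that, of v] by auto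
  have c0: "m c x v = 0" if "x \<in> C" for x
    using that i[of x] set_anticompleteD[OF D(17) that VY] by auto
  have d: "\<not> (v \<in> A' \<and> v \<in> B')" using D(6) by blast
  have "m c y v \<in> {0, 2}" using yz(1) a b c0 by (auto split: if_splits)
  hence n1: "m c y v \<noteq> 1" by auto
  have y: "cl y = 0 \<longleftrightarrow> y \<in> A" "cl y = 1 \<longleftrightarrow> y \<in> B" "cl y = 2 \<longleftrightarrow> y \<in> C" "cl z = 0 \<longleftrightarrow> z \<in> A" "cl z = 1 \<longleftrightarrow> z \<in> B"
    using cl[OF yz(1)] cl[OF yz(2)] by blast+
  show False using cf n1 a[of y] a[of z] b[of y] b[of z] c0[of y] d unfolding conflict_def y
    by (auto split: if_splits)
qed

text \<open>The vertices a2 and b2 have label 3 and thus stay outside an accepted closure. The label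
  0 of a1 and the label 1 of some b then mean strong adjacencies to a2 and b2 across the boundary,
  which is what \<open>join_closed_prejoin\<close> needs; the counts are those of
  \<open>prejoin_proper\<close>.\<close>

lemma sound_join:
  assumes d: "sd_J d = 1" "sd_co d \<le> 1" "sd_a1 d < n" "sd_a2 d < n" "sd_b2 d < n" "sd_c d < n"
    and ok: "seed_ok cn d" and sp: "cn (sd_co d) \<noteq> 0 \<Longrightarrow> linked (Tc (sd_co d))"
  shows "\<exists>A' B' C'. proper_two_join (Tc (sd_co d)) {v \<in> seed_set d. seed_part d v = 0} {v \<in> seed_set d. seed_part d v = 1}
    {v \<in> seed_set d. seed_part d v = 2} A' B' C'"
    "{v \<in> seed_set d. seed_part d v = 0} \<union> {v \<in> seed_set d. seed_part d v = 1} \<union> {v \<in> seed_set d. seed_part d v = 2} = seed_set d"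
proof -
  define S cl c where Sc: "S = seed_set d" "cl = seed_part d" "c = sd_co d"
  have S0: "{sd_a1 d, sd_c d} \<subseteq> {..<n}" using d by auto
  note cp = closure_props[OF S0, where J = 1 and cl = cl and mm = "m c"]
  have Se: "S = closure n 1 cl (m c) {sd_a1 d, sd_c d}" unfolding Sc seed_set_def d(1) ..
  have Sn: "S \<subseteq> {..<n}" and aS: "sd_a1 d \<in> S" and cs: "closed_set n 1 cl (m c) S" using cp(1-3) unfolding Se by auto
  have acc: "accept n 1 cl (m c) S (sd_a1 d) (cn c \<noteq> 0)" using ok unfolding seed_ok_def d(1) Sc .
  hence B: "\<exists>v\<in>S. cl v = 1" and no3: "\<forall>v\<in>S. cl v \<noteq> 3" and cn: "cn c \<noteq> 0" and a0: "cl (sd_a1 d) = 0"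
    and card1: "card S \<ge> 3 + of_bool (\<exists>v\<in>S. cl v = 2)" and card2: "n - card S \<ge> 3 + of_bool (outer n cl (m c) S 0 0)"
    unfolding accept_def by simp_all
  obtain b where b: "b \<in> S" "cl b = 1" using B by blast
  have cl: "cl v = part 1 (m c) (sd_a2 d) (sd_b2 d) v" for v unfolding Sc seed_part_def d(1) ..
  have k: "cl v \<in> {0, 1, 2}" if "v \<in> S" for v using partD(6)[OF cl[symmetric], of v] no3 that by auto
  have out: "sd_a2 d \<notin> S" "sd_b2 d \<notin> S" using no3 cl unfolding part_def by auto
  have nn: "sd_a2 d \<noteq> sd_a1 d" "sd_b2 d \<noteq> b" using out aS b by auto
  have bn: "b < n" using b Sn by auto
  have "m c (sd_a2 d) (sd_a1 d) = 2" using partD(2)[OF cl[symmetric]] a0 by blast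
  hence sa: "strongly_adj (Tc c) (sd_a1 d) (sd_a2 d)" using m_iff(1)[OF d(4,3) nn(1)] strongly_adj_sym by metis
  have "m c (sd_b2 d) b = 2" using partD(5)[OF cl[symmetric], of b] b by simp
  hence sb: "strongly_adj (Tc c) b (sd_b2 d)" using m_iff(1)[OF d(5) bn nn(2)] strongly_adj_sym by metis
  let ?A = "{v. cl v = 0}" and ?B = "{v. cl v = 1}" and ?C = "{v. cl v = 2}"
  have jc: "join_closed (Tc c) ?A ?B ?C S" by (rule closed_set_join_closed[OF cs Sn]) auto
  let ?A' = "{v \<in> verts (Tc c) - S. strongly_adj (Tc c) (sd_a1 d) v}" and ?B' = "{v \<in> verts (Tc c) - S. strongly_adj (Tc c) b v}"
  let ?C' = "{v \<in> verts (Tc c) - S. \<not> strongly_adj (Tc c) (sd_a1 d) v \<and> \<not> strongly_adj (Tc c) b v}"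
  have pj: "prejoin (Tc c) (S \<inter> ?A) (S \<inter> ?B) (S \<inter> ?C) ?A' ?B' ?C'"
    by (rule join_closed_prejoin[OF class_FD(1)[OF Tc(2)] jc _ _ _ _ _ aS _ _ sa b(1) _ _ sb])
      (use Sn k a0 b out d in \<open>auto simp: Tc(1)\<close>)
  have X: "S \<inter> ?A \<union> S \<inter> ?B \<union> S \<inter> ?C = S" using k by auto
  have Y: "?A' \<union> ?B' \<union> ?C' = {..<n} - S" unfolding Tc(1) by blast
  have cY: "card ({..<n} - S) = n - card S" using Sn by (simp add: card_Diff_subset finite_subset)
  \<comment> \<open>Not being strongly adjacent to a1 and b is enough: no switchable pair leaves S,
    and all members with the same label agree.\<close>
  have oC: "outer n cl (m c) S 0 0" if ne: "?C' \<noteq> {}"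
  proof -
    obtain v where v: "v < n" "v \<notin> S" "\<not> strongly_adj (Tc c) (sd_a1 d) v" "\<not> strongly_adj (Tc c) b v" using ne unfolding Tc(1) by auto
    have nc: "\<not> conflict 1 cl (m c) v y z" if "y \<in> S" "z \<in> S" for y z using cs v that unfolding closed_set_def by blast
    have vn: "sd_a1 d \<noteq> v" "b \<noteq> v" using aS b v by auto
    have "m c (sd_a1 d) v \<noteq> 2" "m c b v \<noteq> 2" using v(3,4) m_iff(1)[OF d(3) v(1) vn(1)] m_iff(1)[OF bn v(1) vn(2)] by blast+
    moreover have "m c (sd_a1 d) v \<noteq> 1" "m c b v \<noteq> 1" using nc[OF aS aS] nc[OF b(1) b(1)] unfolding conflict_def by blast+
    ultimately have z: "m c (sd_a1 d) v = 0" "m c b v = 0" using m_le[of c "sd_a1 d" v] m_le[of c b v] by linarith+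
    have "(cl u = 0 \<longrightarrow> m c u v = 0) \<and> (cl u = 1 \<longrightarrow> m c u v = 0)" if "u \<in> S" for u
      using nc[OF that aS] nc[OF that b(1)] z a0 b(2) unfolding conflict_def by metis
    thus ?thesis unfolding outer_def using v by blast
  qed
  have pr: "proper_two_join (Tc c) (S \<inter> ?A) (S \<inter> ?B) (S \<inter> ?C) ?A' ?B' ?C'"
  proof (rule prejoin_proper[OF Tc(2,3) sp[folded Sc, OF cn] pj])
    show "3 \<le> card (S \<inter> ?A \<union> S \<inter> ?B \<union> S \<inter> ?C)" unfolding X using card1 by linarith
    show "S \<inter> ?C = {}" if "card (S \<inter> ?A \<union> S \<inter> ?B \<union> S \<inter> ?C) = 3"
      using card1 that unfolding X by (auto split: if_splits)
    show "3 \<le> card (?A' \<union> ?B' \<union> ?C')" unfolding Y cY using card2 by linarith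
    show "?C' = {}" if "card (?A' \<union> ?B' \<union> ?C') = 3"
    proof (rule ccontr)
      assume "?C' \<noteq> {}"
      thus False using card2 oC that unfolding Y cY by simp
    qed
  qed
  have e: "S \<inter> ?A = {v \<in> S. cl v = 0}" "S \<inter> ?B = {v \<in> S. cl v = 1}" "S \<inter> ?C = {v \<in> S. cl v = 2}" by auto
  show "\<exists>A' B' C'. proper_two_join (Tc (sd_co d)) {v \<in> seed_set d. seed_part d v = 0} {v \<in> seed_set d. seed_part d v = 1}
    {v \<in> seed_set d. seed_part d v = 2} A' B' C'" using pr[unfolded e] unfolding Sc by (intro exI)
  show "{v \<in> seed_set d. seed_part d v = 0} \<union> {v \<in> seed_set d. seed_part d v = 1} \<union> {v \<in> seed_set d. seed_part d v = 2} = seed_set d"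
    using X[unfolded e] unfolding Sc .
qed

text \<open>With J = 0 closedness means that no switchable pair leaves S and that each outside
  vertex sees each of the two labels uniformly, so it falls into one of the four classes.\<close>

lemma closed_set_pair:
  assumes cs: "closed_set n 0 cl (m 0) S" and S: "S \<subseteq> {..<n}" and cl: "\<And>v. v \<in> S \<Longrightarrow> cl v = 0 \<or> cl v = 1"
    and o: "outer n cl (m 0) S 0 0" "outer n cl (m 0) S 0 2" "outer n cl (m 0) S 2 0" "outer n cl (m 0) S 2 2"
  shows "closed_pair T {v \<in> S. cl v = 0} {v \<in> S. cl v = 1}" (is "closed_pair T ?A ?B")
proof (rule closed_pairI)
  have AB: "?A \<union> ?B = S" using cl by blast
  show "?A \<subseteq> verts T" "?B \<subseteq> verts T" "?A \<inter> ?B = {}" using S V by auto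
  have T0: "Tc 0 = T" by (simp add: Tc_def)
  have oc: "v \<in> outer_class T ?A ?B x y" if v: "v < n" "v \<notin> S"
    and a: "\<forall>u\<in>S. (cl u = 0 \<longrightarrow> m 0 u v = (if x then 2 else 0)) \<and> (cl u = 1 \<longrightarrow> m 0 u v = (if y then 2 else 0))" for v x y
  proof -
    have i: "m 0 u v = 2 \<longleftrightarrow> strongly_adj T v u" "m 0 u v = 0 \<longleftrightarrow> strongly_antiadj T v u" if "u \<in> S" for u
    proof -
      have "u < n" "u \<noteq> v" using that S v by auto
      thus "m 0 u v = 2 \<longleftrightarrow> strongly_adj T v u" "m 0 u v = 0 \<longleftrightarrow> strongly_antiadj T v u"
        using m_iff(1,3)[of u v 0] v(1) strongly_adj_sym[of T u v] strongly_antiadj_sym[of T u v] unfolding T0 by blast+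
    qed
    show ?thesis unfolding outer_class_def AB using v a V i by (auto simp: set_complete_def set_anticomplete_def)
  qed
  show "outer_class T ?A ?B x y \<noteq> {}" for x y
  proof -
    have "outer n cl (m 0) S (if x then 2 else 0) (if y then 2 else 0)" using o by (cases x; cases y) simp_all
    then obtain v where "v < n" "v \<notin> S" "\<forall>u\<in>S. (cl u = 0 \<longrightarrow> m 0 u v = (if x then 2 else 0)) \<and> (cl u = 1 \<longrightarrow> m 0 u v = (if y then 2 else 0))"
      unfolding outer_def by blast
    from oc[OF this] show ?thesis by blast
  qed
  fix v assume "v \<in> verts T - (?A \<union> ?B)"
  hence "v \<in> verts T - S" unfolding AB .
  hence v: "v < n" "v \<notin> S" using V by auto
  have nc: "\<not> conflict 0 cl (m 0) v y z" if "y \<in> S" "z \<in> S" for y z using cs v that unfolding closed_set_def by blast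
  have val: "m 0 u v = 0 \<or> m 0 u v = 2" if "u \<in> S" for u
  proof -
    have "m 0 u v \<noteq> 1" using nc[OF that that] unfolding conflict_def by blast
    thus ?thesis using m_le[of 0 u v] by linarith
  qed
  have same: "m 0 u v = m 0 w v" if "u \<in> S" "w \<in> S" "cl u = cl w" for u w
    using nc[OF that(1,2)] that(3) cl[OF that(1)] unfolding conflict_def by metis
  define x y where xy: "x \<longleftrightarrow> (\<exists>u\<in>S. cl u = 0 \<and> m 0 u v = 2)" "y \<longleftrightarrow> (\<exists>u\<in>S. cl u = 1 \<and> m 0 u v = 2)"
  have "m 0 u v = (if x then 2 else 0)" if "u \<in> S" "cl u = 0" for u
    using val[OF that(1)] same[OF that(1)] that unfolding xy by (metis zero_neq_numeral)
  moreover have "m 0 u v = (if y then 2 else 0)" if "u \<in> S" "cl u = 1" for u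
    using val[OF that(1)] same[OF that(1)] that unfolding xy by (metis zero_neq_numeral)
  ultimately have "v \<in> outer_class T ?A ?B x y" by (intro oc[OF v]) blast
  thus "\<exists>x y. v \<in> outer_class T ?A ?B x y" by blast
qed

lemma sound_pair:
  assumes d: "sd_J d = 0" "sd_co d = 0" "sd_a1 d < n" "sd_c d < n" and ok: "seed_ok cn d"
  shows "proper_homogeneous_pair T {v \<in> seed_set d. seed_part d v = 0} {v \<in> seed_set d. seed_part d v = 1}"
    "\<forall>v\<in>seed_set d. seed_part d v = 0 \<or> seed_part d v = 1"
proof -
  define S cl where Sc: "S = seed_set d" "cl = seed_part d"
  have S0: "{sd_a1 d, sd_c d} \<subseteq> {..<n}" using d by auto
  note cp = closure_props[OF S0, where J = 0 and cl = cl and mm = "m 0"]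
  have Se: "S = closure n 0 cl (m 0) {sd_a1 d, sd_c d}" unfolding Sc seed_set_def d(1,2) ..
  have Sn: "S \<subseteq> {..<n}" and cs: "closed_set n 0 cl (m 0) S" using cp(1-3) unfolding Se by auto
  have acc: "accept n 0 cl (m 0) S (sd_a1 d) (cn 0 \<noteq> 0)" using ok unfolding seed_ok_def d(1,2) Sc .
  have k: "cl v = 0 \<or> cl v = 1" if "v \<in> S" for v
  proof -
    have p: "part 0 (m 0) (sd_a2 d) (sd_b2 d) v = cl v" unfolding Sc seed_part_def d(1,2) ..
    have "cl v \<noteq> 3" using acc that unfolding accept_def by blast
    thus ?thesis using partD(6,7)[OF p] by auto
  qed
  have cp: "closed_pair T {v \<in> S. cl v = 0} {v \<in> S. cl v = 1}"
    by (rule closed_set_pair[OF cs Sn k]) (use acc in \<open>simp_all add: accept_def\<close>)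
  have "{v \<in> S. cl v = 0} \<union> {v \<in> S. cl v = 1} = S" using k by blast
  hence "card ({v \<in> S. cl v = 0} \<union> {v \<in> S. cl v = 1}) \<ge> 3" using acc unfolding accept_def by simp
  from closed_pair_proper[OF TF nbal cp this] k
  show "proper_homogeneous_pair T {v \<in> seed_set d. seed_part d v = 0} {v \<in> seed_set d. seed_part d v = 1}"
    "\<forall>v\<in>seed_set d. seed_part d v = 0 \<or> seed_part d v = 1" unfolding Sc by blast+
qed

end

lemma decode_code:
  fixes p q r n md :: nat
  assumes b: "p < n" "q < n" "r < n" "md \<le> 4"
  defines "k \<equiv> ((md * n + p) * n + q) * n + r"
  shows "k < 5 * (n * (n * n))" "k div (n * (n * n)) = md" "k div (n * n) mod n = p" "k div n mod n = q" "k mod n = r"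
proof -
  have 1: "k div n = (md * n + p) * n + q" using b unfolding k_def by simp
  hence 2: "k div (n * n) = md * n + p" using b by (simp add: div_mult2_eq)
  hence 3: "k div (n * (n * n)) = md" using b by (simp add: div_mult2_eq mult.assoc[symmetric])
  show "k div (n * (n * n)) = md" by (rule 3)
  show "k div (n * n) mod n = p" "k div n mod n = q" "k mod n = r" using b unfolding 1 2 by (simp_all add: k_def)
  have "0 < n * (n * n)" using b by auto
  thus "k < 5 * (n * (n * n))" using 3 b(4) div_less_iff_less_mult[of "n * (n * n)" k 5] by simp
qed

lemma decode_join:
  assumes "p < n" "q < n" "r < n" "c \<le> 1"
  shows "\<exists>k < 5 * (n * (n * n)). decode n tp k = \<lparr>sd_co = c, sd_J = 1, sd_a1 = (if f then tp (c * n + p) mod n else p),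
    sd_a2 = (if f then p else tp (c * n + p) mod n), sd_b2 = q, sd_c = r\<rparr>"
proof -
  define md where "md = 2 * c + of_bool f"
  have m4: "md \<le> 4" "md \<noteq> 4" "of_bool (md div 2 = 1) = c" "odd md = f" using assms(4) by (cases f; auto simp: md_def le_Suc_eq)+
  note d = decode_code[OF assms(1-3) m4(1)]
  show ?thesis by (rule exI, rule conjI, rule d(1)) (simp only: decode_def Let_def d m4, simp)
qed

lemma decode_pair:
  assumes "p < n" "q < n" "r < n"
  shows "\<exists>k < 5 * (n * (n * n)). decode n tp k = \<lparr>sd_co = 0, sd_J = 0, sd_a1 = q, sd_a2 = p, sd_b2 = p, sd_c = r\<rparr>"
proof -
  have m4: "(4::nat) \<le> 4" by simp
  note d = decode_code[OF assms m4]
  show ?thesis by (rule exI, rule conjI, rule d(1)) (simp only: decode_def Let_def d, simp)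
qed

lemma decode_co: "sd_J (decode n tp k) = 0 \<Longrightarrow> sd_co (decode n tp k) = 0"
  by (auto simp: decode_def Let_def split: if_splits)

lemma proper_homogeneous_pair_closed_pair:
  assumes "proper_homogeneous_pair T A B"
  shows "closed_pair T A B" "card A > 1" "card B > 1"
proof -
  have sc: "strongly_complete T v S = set_complete T {v} S"
    "strongly_anticomplete T v S = set_anticomplete T {v} S" for v S
    by (auto simp: strongly_complete_def strongly_anticomplete_def set_complete_def set_anticomplete_def)
  let ?R = "verts T - (A \<union> B)"
  let ?A1 = "{v \<in> ?R. set_complete T {v} A}" and ?A2 = "{v \<in> ?R. set_anticomplete T {v} A}"
  let ?B1 = "{v \<in> ?R. set_complete T {v} B}" and ?B2 = "{v \<in> ?R. set_anticomplete T {v} B}"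
  have h: "A \<subseteq> verts T" "B \<subseteq> verts T" "A \<inter> B = {}" "?A1 \<union> ?A2 = ?R" "?B1 \<union> ?B2 = ?R"
    "?A1 \<inter> ?B1 \<noteq> {}" "?A1 \<inter> ?B2 \<noteq> {}" "?A2 \<inter> ?B1 \<noteq> {}" "?A2 \<inter> ?B2 \<noteq> {}"
    using assms unfolding proper_homogeneous_pair_def Let_def sc by simp_all
  show "card A > 1" "card B > 1" using assms unfolding proper_homogeneous_pair_def Let_def by simp_all
  have o: "outer_class T A B True True = ?A1 \<inter> ?B1" "outer_class T A B True False = ?A1 \<inter> ?B2"
    "outer_class T A B False True = ?A2 \<inter> ?B1" "outer_class T A B False False = ?A2 \<inter> ?B2"
    by (auto simp: outer_class_def)
  show "closed_pair T A B"
  proof (rule closed_pairI[OF h(1-3)])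
    show "outer_class T A B x y \<noteq> {}" for x y by (cases x; cases y) (use h(6-9) in \<open>simp_all only: o not_False_eq_True\<close>)
    show "\<exists>x y. v \<in> outer_class T A B x y" if v: "v \<in> ?R" for v
    proof -
      have "v \<in> ?A1 \<or> v \<in> ?A2" "v \<in> ?B1 \<or> v \<in> ?B2" using h(4,5) v by blast+
      thus ?thesis using o by blast
    qed
  qed
qed

context tri_ram
begin

text \<open>On the side X1 the labels computed from a2 and b2 are the true parts, and X1 is closed
  for them. So the closures of a1 with another vertex stay in X1, and
  \<open>minimal_two_join_generated\<close> finds one that is all of X1.\<close>

lemma complete_join_seed:
  assumes J: "proper_two_join (Tc c) A1 B1 C1 A2 B2 C2"
    and min: "\<forall>A B C A' B' C'. proper_two_join (Tc c) A B C A' B' C' \<longrightarrow> \<not> A \<union> B \<union> C \<subset> A1 \<union> B1 \<union> C1"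
    and a: "a1 \<in> A1" "a2 \<in> A2" "b2 \<in> B2" and cn: "cn c \<noteq> 0"
  shows "\<exists>x\<in>A1 \<union> B1 \<union> C1. seed_ok cn \<lparr>sd_co = c, sd_J = 1, sd_a1 = a1, sd_a2 = a2, sd_b2 = b2, sd_c = x\<rparr> \<and>
    seed_set \<lparr>sd_co = c, sd_J = 1, sd_a1 = a1, sd_a2 = a2, sd_b2 = b2, sd_c = x\<rparr> = A1 \<union> B1 \<union> C1"
proof -
  let ?X = "A1 \<union> B1 \<union> C1" and ?Y = "A2 \<union> B2 \<union> C2"
  note P = proper_two_join_prejoin(1)[OF J]
  note D = prejoinD[OF P]
  have XY: "?X \<subseteq> {..<n}" "?Y = {..<n} - ?X" using D(1,2) unfolding Tc(1) by blast+
  define cl where "cl = part 1 (m c) a2 b2"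
  have i: "m c y v = 2 \<longleftrightarrow> strongly_adj (Tc c) v y" "m c y v = 0 \<longleftrightarrow> strongly_antiadj (Tc c) v y"
    "m c v y = 2 \<longleftrightarrow> strongly_adj (Tc c) v y" "m c v y = 0 \<longleftrightarrow> strongly_antiadj (Tc c) v y"
    if "v \<in> ?X" "y \<in> ?Y" for v y
  proof -
    have "v < n" "y < n" "y \<noteq> v" using that XY by auto
    thus "m c y v = 2 \<longleftrightarrow> strongly_adj (Tc c) v y" "m c y v = 0 \<longleftrightarrow> strongly_antiadj (Tc c) v y"
      "m c v y = 2 \<longleftrightarrow> strongly_adj (Tc c) v y" "m c v y = 0 \<longleftrightarrow> strongly_antiadj (Tc c) v y"
      using m_iff(1,3)[of y v c] m_iff(1,3)[of v y c] strongly_adj_sym[of "Tc c" y v] strongly_antiadj_sym[of "Tc c" y v] by auto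
  qed
  have a2: "a2 \<in> ?Y" "b2 \<in> ?Y" using a by auto
  have cA: "cl v = 0" if "v \<in> A1" for v
  proof -
    have "strongly_adj (Tc c) v a2" "strongly_antiadj (Tc c) v b2"
      using set_completeD[OF D(13) that a(2)] set_anticompleteD[OF D(15) that, of b2] a(3) by auto
    thus ?thesis using i[of v a2] i[of v b2] that a2 XY unfolding cl_def part_def by auto
  qed
  have cB: "cl v = 1" if "v \<in> B1" for v
  proof -
    have "strongly_adj (Tc c) v b2" "strongly_antiadj (Tc c) v a2"
      using set_completeD[OF D(14) that a(3)] set_anticompleteD[OF D(16) that, of a2] a(2) by auto
    thus ?thesis using i[of v a2] i[of v b2] that a2 XY unfolding cl_def part_def by auto
  qed
  have cC: "cl v = 2" if "v \<in> C1" for v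
  proof -
    have "strongly_antiadj (Tc c) v b2" "strongly_antiadj (Tc c) v a2"
      using set_anticompleteD[OF D(17) that] a2 by auto
    thus ?thesis using i[of v a2] i[of v b2] that a2 XY unfolding cl_def part_def by auto
  qed
  have cl: "(x \<in> A1 \<longleftrightarrow> cl x = 0) \<and> (x \<in> B1 \<longleftrightarrow> cl x = 1) \<and> (x \<in> C1 \<longleftrightarrow> cl x = 2)" if "x \<in> ?X" for x
    using that cA[of x] cB[of x] cC[of x] by auto
  define S where "S x = closure n 1 cl (m c) {a1, x}" for x
  have XC: "closed_set n 1 cl (m c) ?X" by (rule prejoin_closed_set[OF P cl])
  have S: "a1 \<in> S x \<and> x \<in> S x \<and> S x \<subseteq> ?X \<and> join_closed (Tc c) A1 B1 C1 (S x)" if "x \<in> ?X" for x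
  proof -
    have s0: "{a1, x} \<subseteq> {..<n}" and s1: "{a1, x} \<subseteq> ?X" using that a XY by auto
    note cp = closure_props[OF s0, where J = 1 and cl = cl and mm = "m c", folded S_def]
    have sub: "S x \<subseteq> ?X" by (rule cp(4)[OF XY(1) s1 XC])
    moreover have "join_closed (Tc c) A1 B1 C1 (S x)"
      by (rule closed_set_join_closed[OF cp(3,1)]) (use cl sub in blast)
    ultimately show ?thesis using cp(2) by blast
  qed
  have "\<exists>x\<in>?X. S x = ?X"
    by (rule minimal_two_join_generated[OF Tc(2,3) J _ a]) (use min S in blast)+
  then obtain x where x: "x \<in> ?X" "S x = ?X" by blast
  let ?d = "\<lparr>sd_co = c, sd_J = 1, sd_a1 = a1, sd_a2 = a2, sd_b2 = b2, sd_c = x\<rparr>"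
  have sp: "seed_part ?d = cl" by (simp add: seed_part_def cl_def)
  hence ss: "seed_set ?d = ?X" using x(2) by (simp add: seed_set_def S_def)
  note c1 = proper_two_join_card[OF Tc(2,3) J] and c2 = proper_two_join_card[OF Tc(2,3) proper_two_join_flip[OF J]]
  have k1: "card ?X \<ge> 3 + of_bool (\<exists>v\<in>?X. cl v = 2)"
  proof (cases "\<exists>v\<in>?X. cl v = 2")
    case True
    hence "C1 \<noteq> {}" using cl by blast
    hence "card ?X \<noteq> 3" using c1(2) by blast
    thus ?thesis using c1(1) by simp
  next
    case False
    thus ?thesis using c1(1) by simp
  qed
  have cY: "card ?Y = n - card ?X" unfolding XY(2) using card_Diff_subset[OF finite_subset[OF XY(1)] XY(1)] by simp
  have k2: "n - card ?X \<ge> 3 + of_bool (outer n cl (m c) ?X 0 0)"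
  proof (cases "outer n cl (m c) ?X 0 0")
    case True
    then obtain v where v: "v < n" "v \<notin> ?X" "\<forall>u\<in>?X. (cl u = 0 \<longrightarrow> m c u v = 0) \<and> (cl u = 1 \<longrightarrow> m c u v = 0)" unfolding outer_def by blast
    obtain b1 where b1: "b1 \<in> B1" using D(10) by blast
    have vY: "v \<in> ?Y" using v XY by auto
    have z: "m c a1 v = 0" "m c b1 v = 0" using v(3) a b1 cA[OF a(1)] cB[OF b1] by blast+
    have "v \<notin> A2" using set_completeD[OF D(13) a(1), of v] i(3)[of a1 v] vY a z by auto
    moreover have "v \<notin> B2" using set_completeD[OF D(14) b1, of v] i(3)[of b1 v] vY b1 z by auto
    ultimately have "C2 \<noteq> {}" using vY by blast
    hence "card ?Y \<noteq> 3" using c2(2) by blast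
    thus ?thesis using c2(1) True unfolding cY by simp
  next
    case False
    thus ?thesis using c2(1) unfolding cY by simp
  qed
  have "accept n 1 cl (m c) ?X a1 (cn c \<noteq> 0)"
    unfolding accept_def
  proof (intro conjI)
    show "\<exists>v\<in>?X. cl v = 0" using a(1) cA by blast
    obtain b1 where "b1 \<in> B1" using D(10) by blast
    thus "\<exists>v\<in>?X. cl v = 1" using cB by blast
    show "\<forall>v\<in>?X. cl v \<noteq> 3" using cA cB cC by auto
  qed (use cn cA[OF a(1)] k1 k2 in simp)
  hence "seed_ok cn ?d" unfolding seed_ok_def sp ss by simp
  thus ?thesis using ss x(1) by blast
qed

text \<open>Some tree edge crosses the join, and its ends are in A1 and A2 or, after a swap, in B1
  and B2. Its inner end is the parent if the root lies in the side and the child otherwise, which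
  accounts for the two directions among the seeds.\<close>

lemma complete_join:
  assumes J: "proper_two_join (Tc c) A1 B1 C1 A2 B2 C2" and c: "c \<le> 1"
    and min: "\<forall>A B C A' B' C'. proper_two_join (Tc c) A B C A' B' C' \<longrightarrow> \<not> A \<union> B \<union> C \<subset> A1 \<union> B1 \<union> C1"
    and tree: "cn c \<noteq> 0 \<Longrightarrow> spanning n (m c) (\<lambda>v. tp (c * n + v))" "cn c = 0 \<Longrightarrow> split_set n (m c)"
  shows "\<exists>k < 5 * (n * (n * n)). seed_ok cn (decode n tp k) \<and> seed_set (decode n tp k) = A1 \<union> B1 \<union> C1"
proof -
  let ?X = "A1 \<union> B1 \<union> C1" and ?Y = "A2 \<union> B2 \<union> C2"
  note P = proper_two_join_prejoin(1)[OF J]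
  note D = prejoinD[OF P]
  have XY: "?X \<subseteq> {..<n}" "?Y = {..<n} - ?X" using D(1,2) unfolding Tc(1) by blast+
  have cn: "cn c \<noteq> 0" using tree(2) split_not_linked proper_two_join_linked[OF J] by blast
  let ?t = "\<lambda>v. tp (c * n + v)"
  note sp = tree(1)[OF cn]
  have t: "?t v < n \<and> m c (?t v) v \<noteq> 0" if "v < n" "v \<noteq> 0" for v using sp that unfolding spanning_def by blast
  have cross: "\<exists>v<n. v \<noteq> 0 \<and> ?t v \<in> U \<and> v \<notin> U" if "0 \<in> U" "\<not> {..<n} \<subseteq> U" for U
    using sp that unfolding spanning_def by blast
  have edge: "x \<in> A1 \<and> y \<in> A2 \<or> x \<in> B1 \<and> y \<in> B2" if x: "x \<in> ?X" and y: "y \<in> ?Y" and xy: "adj (Tc c) x y" for x y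
  proof -
    have na: "\<not> strongly_antiadj (Tc c) x y" using xy strongly_antiadj_not(1) by metis
    have "x \<notin> C1" using set_anticompleteD[OF D(17) _ y, of x] na by blast
    moreover have "y \<in> A2" if "x \<in> A1" using set_anticompleteD[OF D(15) that, of y] na y by blast
    moreover have "y \<in> B2" if "x \<in> B1" using set_anticompleteD[OF D(16) that, of y] na y by blast
    ultimately show ?thesis using x by blast
  qed
  have main: "\<exists>b2 r. b2 < n \<and> r < n \<and> seed_ok cn \<lparr>sd_co = c, sd_J = 1, sd_a1 = x, sd_a2 = y, sd_b2 = b2, sd_c = r\<rparr> \<and>
    seed_set \<lparr>sd_co = c, sd_J = 1, sd_a1 = x, sd_a2 = y, sd_b2 = b2, sd_c = r\<rparr> = ?X"
    if "x \<in> ?X" "y \<in> ?Y" "adj (Tc c) x y" for x y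
    using edge[OF that]
  proof
    assume h: "x \<in> A1 \<and> y \<in> A2"
    obtain b2 where b2: "b2 \<in> B2" using D(12) by blast
    obtain r where "r \<in> ?X" "seed_ok cn \<lparr>sd_co = c, sd_J = 1, sd_a1 = x, sd_a2 = y, sd_b2 = b2, sd_c = r\<rparr>"
      "seed_set \<lparr>sd_co = c, sd_J = 1, sd_a1 = x, sd_a2 = y, sd_b2 = b2, sd_c = r\<rparr> = ?X"
      using complete_join_seed[where cn = cn, OF J min _ _ b2 cn, of x y] h by blast
    moreover have "b2 < n" using b2 XY by blast
    ultimately show ?thesis using XY(1) by blast
  next
    assume h: "x \<in> B1 \<and> y \<in> B2"
    obtain b2 where b2: "b2 \<in> A2" using D(11) by blast
    have e: "B1 \<union> A1 \<union> C1 = ?X" by blast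
    note cj = complete_join_seed[where cn = cn, OF proper_two_join_swap[OF J], unfolded e, OF min _ _ b2 cn, of x y]
    obtain r where "r \<in> ?X" "seed_ok cn \<lparr>sd_co = c, sd_J = 1, sd_a1 = x, sd_a2 = y, sd_b2 = b2, sd_c = r\<rparr>"
      "seed_set \<lparr>sd_co = c, sd_J = 1, sd_a1 = x, sd_a2 = y, sd_b2 = b2, sd_c = r\<rparr> = ?X"
      using cj h by blast
    moreover have "b2 < n" using b2 XY by blast
    ultimately show ?thesis using XY(1) by blast
  qed
  show ?thesis
  proof (cases "0 \<in> ?X")
    case True
    have "\<not> {..<n} \<subseteq> ?X" using XY(2) D(11) by blast
    from cross[OF True this] obtain v where v: "v < n" "v \<noteq> 0" "?t v \<in> ?X" "v \<notin> ?X" by blast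
    have tv: "?t v < n" "m c (?t v) v \<noteq> 0" "?t v \<noteq> v" using t[OF v(1,2)] v by auto
    have "adj (Tc c) (?t v) v" using m_iff(4)[OF tv(1) v(1) tv(3)] tv(2) by blast
    from main[OF v(3) _ this] obtain b2 r where br: "b2 < n" "r < n"
      "seed_ok cn \<lparr>sd_co = c, sd_J = 1, sd_a1 = ?t v, sd_a2 = v, sd_b2 = b2, sd_c = r\<rparr>"
      "seed_set \<lparr>sd_co = c, sd_J = 1, sd_a1 = ?t v, sd_a2 = v, sd_b2 = b2, sd_c = r\<rparr> = ?X" using v XY(2) by blast
    from decode_join[OF v(1) br(1,2) c, of tp True] tv(1) br(3,4) show ?thesis by auto
  next
    case False
    have n0: "0 < n" using XY(1) D(9) by (cases n) auto
    have "\<not> {..<n} \<subseteq> - ?X" using XY(1) D(9) by blast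
    from cross[OF _ this] False obtain v where v: "v < n" "v \<noteq> 0" "?t v \<notin> ?X" "v \<in> ?X" by blast
    have tv: "?t v < n" "m c (?t v) v \<noteq> 0" "?t v \<noteq> v" using t[OF v(1,2)] v by auto
    have "adj (Tc c) v (?t v)" using m_iff(4)[OF tv(1) v(1) tv(3)] tv(2) adj_sym by metis
    from main[OF v(4) _ this] obtain b2 r where br: "b2 < n" "r < n"
      "seed_ok cn \<lparr>sd_co = c, sd_J = 1, sd_a1 = v, sd_a2 = ?t v, sd_b2 = b2, sd_c = r\<rparr>"
      "seed_set \<lparr>sd_co = c, sd_J = 1, sd_a1 = v, sd_a2 = ?t v, sd_b2 = b2, sd_c = r\<rparr> = ?X" using v(3) tv(1) XY(2) by blast
    from decode_join[OF v(1) br(1,2) c, of tp False] tv(1) br(3,4) show ?thesis by auto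
  qed
qed

text \<open>A vertex p complete to A and anticomplete to B tells the labels. The closure of two
  vertices of B stays inside the pair and is itself proper, so minimality makes it the whole
  pair.\<close>

lemma complete_pair:
  assumes H: "proper_homogeneous_pair T A B"
    and min: "\<And>A' B'. proper_homogeneous_pair T A' B' \<Longrightarrow> \<not> A' \<union> B' \<subset> A \<union> B"
  shows "\<exists>k < 5 * (n * (n * n)). seed_ok cn (decode n tp k) \<and> seed_set (decode n tp k) = A \<union> B"
proof -
  let ?X = "A \<union> B"
  note H' = proper_homogeneous_pair_closed_pair[OF H]
  note D = closed_pairD[OF H'(1)]
  have XV: "?X \<subseteq> {..<n}" using D(1,2) V by blast
  have T0: "Tc 0 = T" by (simp add: Tc_def)
  have oc: "v < n \<and> v \<notin> ?X \<and> (\<forall>u\<in>A. m 0 u v = (if x then 2 else 0) \<and> m 0 v u = (if x then 2 else 0)) \<and>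
      (\<forall>u\<in>B. m 0 u v = (if y then 2 else 0) \<and> m 0 v u = (if y then 2 else 0))"
    if "v \<in> outer_class T A B x y" for v x y
  proof -
    have v: "v < n" "v \<notin> ?X" "if x then set_complete T {v} A else set_anticomplete T {v} A"
      "if y then set_complete T {v} B else set_anticomplete T {v} B" using that V by (auto simp: outer_class_def)
    have i: "(m 0 u v = 2 \<longleftrightarrow> strongly_adj T v u) \<and> (m 0 u v = 0 \<longleftrightarrow> strongly_antiadj T v u) \<and>
      (m 0 v u = 2 \<longleftrightarrow> strongly_adj T v u) \<and> (m 0 v u = 0 \<longleftrightarrow> strongly_antiadj T v u)" if "u \<in> ?X" for u
    proof -
      have "u < n" "u \<noteq> v" using that XV v by auto
      thus ?thesis using m_iff(1,3)[of u v 0] m_iff(1,3)[of v u 0] v(1) strongly_adj_sym[of T u v] strongly_antiadj_sym[of T u v] unfolding T0 by auto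
    qed
    have "m 0 u v = (if x then 2 else 0) \<and> m 0 v u = (if x then 2 else 0)" if "u \<in> A" for u
      using v(3) i[of u] that by (cases x) (auto simp: set_complete_def set_anticomplete_def)
    moreover have "m 0 u v = (if y then 2 else 0) \<and> m 0 v u = (if y then 2 else 0)" if "u \<in> B" for u
      using v(4) i[of u] that by (cases y) (auto simp: set_complete_def set_anticomplete_def)
    ultimately show ?thesis using v(1,2) by blast
  qed
  obtain p where p: "p \<in> outer_class T A B True False" using D(4)[of True False] by blast
  have p': "p < n" "p \<notin> ?X" "\<And>u. u \<in> A \<Longrightarrow> m 0 p u = 2" "\<And>u. u \<in> B \<Longrightarrow> m 0 p u = 0" using oc[OF p] by auto
  obtain q r where qr: "q \<in> B" "r \<in> B" "q \<noteq> r" using H'(3) card_le_Suc0_iff_eq[of B] finite_subset[OF D(2) class_FD(3)[OF TF]] by auto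
  have qrn: "q < n" "r < n" using qr XV by auto
  define cl where "cl = part 0 (m 0) p p"
  have cl: "u \<in> A \<Longrightarrow> cl u = 0" "u \<in> B \<Longrightarrow> cl u = 1" for u using p' unfolding cl_def part_def by auto
  define S where "S = closure n 0 cl (m 0) {q, r}"
  have XC: "closed_set n 0 cl (m 0) ?X"
    unfolding closed_set_def
  proof (intro allI impI ballI)
    fix v y z assume v: "v < n" "v \<notin> ?X" and yz: "y \<in> ?X" "z \<in> ?X"
    then obtain a b where "v \<in> outer_class T A B a b" using D(5)[of v] V by auto
    from oc[OF this] have "\<And>u. u \<in> A \<Longrightarrow> m 0 u v = (if a then 2 else 0)" "\<And>u. u \<in> B \<Longrightarrow> m 0 u v = (if b then 2 else 0)" by auto
    thus "\<not> conflict 0 cl (m 0) v y z" using yz cl[of y] cl[of z] unfolding conflict_def by (auto split: if_splits)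
  qed
  have s0: "{q, r} \<subseteq> {..<n}" and s1: "{q, r} \<subseteq> ?X" using qr XV by auto
  note cp = closure_props[OF s0, where J = 0 and cl = cl and mm = "m 0", folded S_def]
  have SX: "S \<subseteq> ?X" by (rule cp(4)[OF XV s1 XC])
  have clS: "cl v = 0 \<or> cl v = 1" if "v \<in> S" for v using SX that cl by blast
  have out: "outer n cl (m 0) S (if x then 2 else 0) (if y then 2 else 0)" for x y
  proof -
    obtain v where "v \<in> outer_class T A B x y" using D(4)[of x y] by blast
    note v = oc[OF this]
    have "(cl u = 0 \<longrightarrow> m 0 u v = (if x then 2 else 0)) \<and> (cl u = 1 \<longrightarrow> m 0 u v = (if y then 2 else 0))" if "u \<in> S" for u
      using SX that cl[of u] v by auto
    thus ?thesis unfolding outer_def using v SX by blast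
  qed
  note o = out[of False False, simplified] out[of False True, simplified] out[of True False, simplified] out[of True True, simplified]
  let ?A = "{v \<in> S. cl v = 0}" and ?B = "{v \<in> S. cl v = 1}"
  have pair: "closed_pair T ?A ?B" by (rule closed_set_pair[OF cp(3,1) clS o])
  have AB: "?A \<union> ?B = S" using clS by blast
  have qS: "q \<in> S" "r \<in> S" using cp(2) by auto
  have qB: "q \<in> ?B" "r \<in> ?B" using qS qr cl by auto
  \<comment> \<open>If no member had label 0, then q would be vacuously complete to that class. As q
    is not the only member with label 1, this would yield a balanced skew-partition.\<close>
  have Ane: "?A \<noteq> {}"
  proof
    assume e: "?A = {}"
    have "set_complete T {q} ?A" unfolding e by (simp add: set_complete_def)
    moreover have "?B \<noteq> {q}" using qB(2) qr(3) by (metis singletonD)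
    ultimately show False
      using closed_pair_complete_balanced[OF class_FD(2,1)[OF TF] closed_pair_swap[OF pair] qB(1)] nbal by blast
  qed
  then obtain a where a: "a \<in> S" "cl a = 0" by blast
  have finS: "finite S" using cp(1) finite_subset by blast
  have "card {a, q, r} \<le> card S" using a qS by (intro card_mono finS) auto
  moreover have "a \<noteq> q" "a \<noteq> r" using a(2) qB by auto
  hence "card {a, q, r} = 3" using qr(3) by simp
  ultimately have c3: "card S \<ge> 3" by simp
  have "proper_homogeneous_pair T ?A ?B" by (rule closed_pair_proper[OF TF nbal pair]) (use c3 AB in simp)
  hence SeX: "S = ?X" using min[of ?A ?B] AB SX by blast
  obtain k where k: "k < 5 * (n * (n * n))" "decode n tp k = \<lparr>sd_co = 0, sd_J = 0, sd_a1 = q, sd_a2 = p, sd_b2 = p, sd_c = r\<rparr>"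
    using decode_pair[OF p'(1) qrn] by blast
  have sp: "seed_part (decode n tp k) = cl" by (simp add: seed_part_def cl_def k(2))
  hence ss: "seed_set (decode n tp k) = S" by (simp add: seed_set_def S_def k(2))
  have n3: "cl v \<noteq> 3" if "v \<in> S" for v using clS[OF that] by auto
  have "accept n 0 cl (m 0) S q (cn 0 \<noteq> 0)" unfolding accept_def
    using a qB(1) n3 c3 o by auto
  hence "seed_ok cn (decode n tp k)" unfolding seed_ok_def sp ss by (simp add: k(2))
  thus ?thesis using k(1) ss SeX by blast
qed

end

lemma doubleton_in_star: "{i, j} \<in> star v S \<longleftrightarrow> i = v \<and> j \<in> S \<or> j = v \<and> i \<in> S"
  by (auto simp: star_def doubleton_eq_iff image_iff)

lemma same_trigraphI:
  fixes T T' :: "nat trigraph"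
  assumes "verts T = verts T'" "\<And>i j. i < j \<Longrightarrow> i \<in> verts T \<Longrightarrow> j \<in> verts T \<Longrightarrow> theta T {i, j} = theta T' {i, j}"
  shows "same_trigraph T T'"
  unfolding same_trigraph_def
proof (intro conjI allI impI)
  fix e assume e: "e \<subseteq> verts T \<and> card e = 2"
  then obtain x y where xy: "e = {x, y}" "x \<noteq> y" by (auto simp: card_2_iff)
  show "theta T e = theta T' e"
  proof (cases "x < y")
    case True
    thus ?thesis using assms(2)[of x y] e xy by simp
  next
    case False
    hence "theta T {y, x} = theta T' {y, x}" using assms(2)[of y x] e xy by simp
    thus ?thesis using xy by (simp add: insert_commute)
  qed
qed (fact assms(1))

context tri_ram
begin

lemma layer_relpow:
  assumes S: "S \<subseteq> {..<n}"
  shows "layer S cl (m c) k = {v. \<exists>a\<in>{v \<in> S. cl v = 0}. (a, v) \<in> {(x, y). x \<in> S \<and> y \<in> S \<and> adj (Tc c) x y} ^^ k}"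
proof (induction k)
  case (Suc k)
  have "(u \<noteq> v \<and> m c u v \<noteq> 0) = adj (Tc c) u v" if "u \<in> S" "v \<in> S" for u v
  proof (cases "u = v")
    case False
    thus ?thesis using m_iff(4)[of u v c] that S by auto
  qed (simp add: adj_def)
  hence "layer S cl (m c) (Suc k) = {v\<in>S. \<exists>u\<in>layer S cl (m c) k. adj (Tc c) u v}"
    using layer_subset[of S cl "m c" k] by auto
  also have "\<dots> = {v. \<exists>u\<in>layer S cl (m c) k. (u, v) \<in> {(x, y). x \<in> S \<and> y \<in> S \<and> adj (Tc c) x y}}"
    using layer_subset[of S cl "m c" k] by blast
  finally show ?case unfolding Suc.IH by auto
qed auto

text \<open>The first layer that meets B is the length of a shortest walk, which is a path from A to
  B with interior in C; its parity is that of the 2-join.\<close>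

lemma output_ev:
  assumes o: "output_ok s d ev" and d: "sd_J d = 1"
    and J: "proper_two_join (Tc (sd_co d)) {v \<in> seed_set d. seed_part d v = 0} {v \<in> seed_set d. seed_part d v = 1}
      {v \<in> seed_set d. seed_part d v = 2} A' B' C'" (is "proper_two_join ?T ?A ?B ?C _ _ _")
    and X: "{v \<in> seed_set d. seed_part d v = 0} \<union> {v \<in> seed_set d. seed_part d v = 1} \<union> {v \<in> seed_set d. seed_part d v = 2} = seed_set d"
  shows "ev = 0 \<Longrightarrow> odd_two_join ?T ?A ?B ?C A' B' C'" "ev \<noteq> 0 \<Longrightarrow> even_two_join ?T ?A ?B ?C A' B' C'"
proof -
  let ?S = "seed_set d" and ?c = "sd_co d" and ?cl = "seed_part d"
  let ?E = "{(x, y). x \<in> ?S \<and> y \<in> ?S \<and> adj ?T x y}"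
  note P = proper_two_join_prejoin[OF J]
  note D = prejoinD[OF P(1)]
  have XV: "?S \<subseteq> verts ?T" using D(1) X by blast
  hence Sn: "?S \<subseteq> {..<n}" unfolding Tc(1) .
  obtain p k where k: "join_path ?T ?A ?B ?C p" "path_length p = k" "length p = Suc k"
    "\<And>j a b. j < k \<Longrightarrow> a \<in> ?A \<Longrightarrow> b \<in> ?B \<Longrightarrow> (a, b) \<notin> ?E ^^ j" "\<exists>a\<in>?A. \<exists>b\<in>?B. (a, b) \<in> ?E ^^ k"
  proof -
    show thesis by (rule least_walk_join_path[OF class_FD(1)[OF Tc(2)[of ?c]], of ?A ?B ?C ?E, unfolded X, OF XV D(9) refl P(4)[unfolded X]]) (assumption, rule that)
  qed
  have "path ?T p" using k(1) by (simp add: join_path_def)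
  \<comment> \<open>A path has distinct vertices, so its length is below n and the n rows that are
    inspected reach it.\<close>
  hence "card (set p) = Suc k" "set p \<subseteq> {..<n}" using k(3) distinct_card[of p] unfolding path_def Tc(1) by auto
  hence kn: "k < n" using card_mono[of "{..<n}" "set p"] by simp
  obtain a b where ab: "a \<in> ?A" "b \<in> ?B" "(a, b) \<in> ?E ^^ k" using k(5) by blast
  have bk: "b \<in> layer ?S ?cl (m ?c) k" unfolding layer_relpow[OF Sn] using ab by blast
  have no: "\<forall>j<k. \<forall>v\<in>layer ?S ?cl (m ?c) j. ?cl v \<noteq> 1"
  proof (intro allI impI ballI notI)
    fix j v assume j: "j < k" and v: "v \<in> layer ?S ?cl (m ?c) j" and "?cl v = 1"
    hence vB: "v \<in> ?B" using layer_subset[of ?S ?cl "m ?c" j] by blast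
    obtain a where "a \<in> ?A" "(a, v) \<in> ?E ^^ j" using v unfolding layer_relpow[OF Sn] by blast
    thus False using k(4)[OF j _ vB] by blast
  qed
  have bc: "?cl b = 1" using ab(2) by blast
  have ev: "ev = of_bool (even k)" using o d kn bk bc no unfolding output_ok_def by blast
  note par = two_join_parity[OF class_FD(2,1)[OF Tc(2)] J k(1), unfolded k(2)]
  show "ev = 0 \<Longrightarrow> odd_two_join ?T ?A ?B ?C A' B' C'" using par(2) ev by (cases "even k") auto
  show "ev \<noteq> 0 \<Longrightarrow> even_two_join ?T ?A ?B ?C A' B' C'" using par(1) ev by (cases "even k") auto
qed

text \<open>One comparison serves all five kinds of block: SS and W' are the strong and the
  switchable pairs of the kind at hand, and only their values on pairs with a marker matter.\<close>

lemma output_same: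
  assumes o: "output_ok s d ev" and S: "seed_set d \<subseteq> {..<n}" and c: "sd_co d \<le> 1"
    and M: "M = {n, n + 1} \<union> (if ev = 0 then {} else {n + 2})"
    and st: "\<And>i. i \<in> seed_set d \<Longrightarrow> ({i, n} \<in> SS \<longleftrightarrow> (seed_part d i = 0) = (sd_co d = 0)) \<and>
      ({i, n + 1} \<in> SS \<longleftrightarrow> (seed_part d i = 1) = (sd_co d = 0)) \<and> (ev \<noteq> 0 \<longrightarrow> ({i, n + 2} \<in> SS \<longleftrightarrow> sd_co d \<noteq> 0)) \<and>
      {i, n} \<notin> W' \<and> {i, n + 1} \<notin> W' \<and> {i, n + 2} \<notin> W'"
    and mk: "ev = 0 \<Longrightarrow> {n, n + 1} \<notin> SS \<and> {n, n + 1} \<in> W'"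
      "ev \<noteq> 0 \<Longrightarrow> ({n, n + 1} \<in> SS \<longleftrightarrow> sd_co d \<noteq> 0) \<and> {n, n + 1} \<notin> W' \<and> {n, n + 2} \<notin> SS \<and> {n, n + 2} \<in> W' \<and>
        {n + 1, n + 2} \<notin> SS \<and> {n + 1, n + 2} \<in> W'"
  shows "same_trigraph (output_trigraph n s) (add_markers T (seed_set d) M SS W')"
proof (rule same_trigraphI)
  let ?S = "seed_set d"
  have o': "\<And>i. i < n \<Longrightarrow> s ''block_verts'' i \<noteq> 0 \<longleftrightarrow> i \<in> ?S"
    "\<And>i j. i < n \<Longrightarrow> j < n + 3 \<Longrightarrow> s ''block_theta'' (i * (n + 3) + j) = row_val (sd_co d) (seed_part d) i j"
    "s ''block_verts'' n = 1" "s ''block_verts'' (n + 1) = 1" "s ''block_verts'' (n + 2) = ev"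
    "s ''block_theta'' (n * (n + 3) + (n + 1)) = (if ev = 0 then 1 else flip (sd_co d) 0)"
    "s ''block_theta'' (n * (n + 3) + (n + 2)) = 1" "s ''block_theta'' ((n + 1) * (n + 3) + (n + 2)) = 1"
    using o unfolding output_ok_def by blast+
  have vo: "i \<in> verts (output_trigraph n s) \<longleftrightarrow> i \<in> ?S \<union> M" for i
  proof -
    consider "i < n" | "i = n" | "i = n + 1" | "i = n + 2" | "i \<ge> n + 3" by linarith
    thus ?thesis
    proof cases
      case 1
      thus ?thesis using o'(1)[of i] M by (auto simp: output_trigraph_def)
    next
      case 2
      thus ?thesis using o'(3) M by (auto simp: output_trigraph_def)
    next
      case 3
      thus ?thesis using o'(4) M by (auto simp: output_trigraph_def)
    next
      case 4
      thus ?thesis using o'(5) M S by (auto simp: output_trigraph_def)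
    next
      case 5
      thus ?thesis using M S by (auto simp: output_trigraph_def split: if_splits)
    qed
  qed
  thus "verts (output_trigraph n s) = verts (add_markers T ?S M SS W')" by (auto simp: add_markers_def)
  fix i j assume ij: "i < j" "i \<in> verts (output_trigraph n s)" "j \<in> verts (output_trigraph n s)"
  hence mem: "i \<in> ?S \<union> M" "j \<in> ?S \<union> M" unfolding vo by blast+
  have th: "theta (output_trigraph n s) {i, j} = int (s ''block_theta'' (i * (n + 3) + j)) - 1"
    using ij(1) by (simp add: output_trigraph_def min_def max_def)
  have ad: "theta (add_markers T ?S M SS W') {i, j} = (if i \<in> ?S \<and> j \<in> ?S then theta T {i, j} else if {i, j} \<in> SS then 1
    else if {i, j} \<in> W' then 0 else - 1)" by (simp add: add_markers_def)
  have nS: "n \<notin> ?S" "n + 1 \<notin> ?S" "n + 2 \<notin> ?S" using S by auto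
  have c01: "sd_co d = 0 \<or> sd_co d = 1" using c by linarith
  have Mj: "k = n \<or> k = n + 1 \<or> k = n + 2 \<and> ev \<noteq> 0" if "k \<in> M" for k using that M by (auto split: if_splits)
  show "theta (output_trigraph n s) {i, j} = theta (add_markers T ?S M SS W') {i, j}"
  proof (cases "i \<in> ?S")
    case True
    hence i: "i < n" using S by auto
    show ?thesis
    proof (cases "j \<in> ?S")
      case j: True
      hence jn: "j < n" using S by auto
      have "theta T {i, j} \<in> {-1, 0, 1}" using theta_cases[OF class_FD(1)[OF TF], of i j] V i jn ij(1) by simp
      thus ?thesis unfolding th ad using True j jn i ij(1) by (subst o'(2)[OF i]) (auto simp: row_val_def tri_matrix_def)
    next
      case False
      hence "j = n \<or> j = n + 1 \<or> j = n + 2 \<and> ev \<noteq> 0" using mem(2) Mj by blast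
      moreover have j3: "j < n + 3" using calculation by auto
      ultimately show ?thesis unfolding th ad o'(2)[OF i j3] using st[OF True] False c01
        by (auto simp: row_val_def flip_def)
    qed
  next
    case False
    have "i = n \<or> i = n + 1 \<or> i = n + 2 \<and> ev \<noteq> 0" using mem(1) Mj False by blast
    moreover have "j \<notin> ?S" using calculation ij(1) S by auto
    moreover have "j = n \<or> j = n + 1 \<or> j = n + 2 \<and> ev \<noteq> 0" using mem(2) Mj calculation(2) by blast
    ultimately consider "i = n" "j = n + 1" | "i = n" "j = n + 2" "ev \<noteq> 0" | "i = n + 1" "j = n + 2" "ev \<noteq> 0"
      using ij(1) by linarith
    thus ?thesis
    proof cases
      case 1
      show ?thesis unfolding th ad using nS mk c01 unfolding 1 o'(6) by (cases "ev = 0") (auto simp: flip_def)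
    next
      case 2
      show ?thesis unfolding th ad using nS mk(2)[OF 2(3)] unfolding 2(1,2) o'(7) by simp
    next
      case 3
      show ?thesis unfolding th ad using nS mk(2)[OF 3(3)] unfolding 3(1,2) o'(8) by simp
    qed
  qed
qed

end

context tri_ram
begin

lemma output_block:
  assumes d: "d = decode n tp k" and n: "0 < n" and ok: "seed_ok cn d" and o: "output_ok s d ev"
    and tree: "\<And>c. c \<le> 1 \<Longrightarrow> cn c \<noteq> 0 \<Longrightarrow> spanning n (m c) (\<lambda>v. tp (c * n + v))"
  shows "proper_fragment T (seed_set d) \<and> block T (seed_set d) (output_trigraph n s)"
proof -
  note b = decode_bounds[OF n, of tp k, folded d]
  have S: "seed_set d \<subseteq> {..<n}" unfolding d by (rule seed_set_subset[OF n])
  let ?S = "seed_set d" and ?cl = "seed_part d"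
  let ?A = "{v \<in> ?S. ?cl v = 0}" and ?B = "{v \<in> ?S. ?cl v = 1}" and ?C = "{v \<in> ?S. ?cl v = 2}"
  have nS: "i \<noteq> n \<and> i \<noteq> n + 1 \<and> i \<noteq> n + 2" if "i \<in> ?S" for i using S that by auto
  have dist: "{n, n + 1} \<inter> verts T = {}" "{n, n + 1, n + 2} \<inter> verts T = {}" using V by auto
  have dn: "distinct [n, n + 1]" "distinct [n, n + 1, n + 2]" by simp_all
  note same = output_same[OF o S b(1)]
  have SV: "?S \<subseteq> verts T" using S V by simp
  have mem: "i \<in> ?S \<Longrightarrow> i \<noteq> n \<and> i \<noteq> Suc n \<and> i \<noteq> Suc (Suc n)" for i using nS[of i] by simp
  show ?thesis
  proof (cases "sd_J d = 1")
    case J: True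
    have sp: "linked (Tc (sd_co d))" if "cn (sd_co d) \<noteq> 0" using spanning_linked[OF tree[OF b(1) that]] .
    have X: "?A \<union> ?B \<union> ?C = ?S" by (rule sound_join(2)[OF J b(1,3-6) ok]) (rule sp)
    have "\<exists>A' B' C'. proper_two_join (Tc (sd_co d)) ?A ?B ?C A' B' C'" by (rule sound_join(1)[OF J b(1,3-6) ok]) (rule sp)
    then obtain A' B' C' where pj: "proper_two_join (Tc (sd_co d)) ?A ?B ?C A' B' C'" by blast
    note ev = output_ev[OF o J pj X]
    have "\<exists>A1 B1 C1 A2 B2 C2. ?S = A1 \<union> B1 \<union> C1 \<and> (proper_two_join T A1 B1 C1 A2 B2 C2 \<or> proper_two_join (co T) A1 B1 C1 A2 B2 C2)"
      using X[symmetric] pj unfolding Tc_def by (cases "sd_co d = 0") (simp_all, blast+)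
    hence frag: "proper_fragment T ?S" unfolding proper_fragment_def using SV by blast
    have cl3: "?cl i = 0 \<or> ?cl i = 1 \<or> ?cl i = 2" if "i \<in> ?S" for i using X that by blast
    \<comment> \<open>The block of a complement 2-join attaches its markers to unions of two parts;
      as negated label tests they have the form that \<open>output_same\<close> expects.\<close>
    have eq: "?B \<union> ?C = {v \<in> ?S. ?cl v \<noteq> 0}" "?A \<union> ?C = {v \<in> ?S. ?cl v \<noteq> 1}" using cl3 by fastforce+
    have "block T ?S (output_trigraph n s)"
    proof (cases "sd_co d = 0")
      case c: True
      hence TT: "Tc (sd_co d) = T" by (simp add: Tc_def)
      show ?thesis
      proof (cases "ev = 0")
        case True
        show ?thesis
          by (rule odd_join[OF ev(1)[OF True, unfolded TT] X[symmetric] dn(1) dist(1)], rule same)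
            (use True c mem in \<open>auto simp: doubleton_in_star doubleton_eq_iff\<close>)
      next
        case False
        show ?thesis
          by (rule even_join[OF ev(2)[OF False, unfolded TT] X[symmetric] dn(2) dist(2)], rule same)
            (use False c mem in \<open>auto simp: doubleton_in_star doubleton_eq_iff\<close>)
      qed
    next
      case c: False
      hence TT: "Tc (sd_co d) = co T" by (simp add: Tc_def)
      show ?thesis
      proof (cases "ev = 0")
        case True
        show ?thesis
          by (rule odd_co_join[OF ev(1)[OF True, unfolded TT] X[symmetric] dn(1) dist(1)], unfold eq, rule same)
            (use True c mem in \<open>auto simp: doubleton_in_star doubleton_eq_iff\<close>)
      next
        case False
        show ?thesis
          by (rule even_co_join[OF ev(2)[OF False, unfolded TT] X[symmetric] dn(2) dist(2)], unfold eq, rule same)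
            (use False c mem in \<open>auto simp: doubleton_in_star doubleton_eq_iff\<close>)
      qed
    qed
    thus ?thesis using frag by blast
  next
    case False
    hence J: "sd_J d = 0" using b(2) by simp
    have c0: "sd_co d = 0" using decode_co J unfolding d by blast
    note h = sound_pair[OF J c0 b(3,6) ok]
    have X: "?S = ?A \<union> ?B" using h(2) by blast
    have frag: "proper_fragment T ?S" unfolding proper_fragment_def using h(1) X SV by blast
    have ev: "ev = 0" using o J unfolding output_ok_def by blast
    have "block T ?S (output_trigraph n s)"
      by (rule homogeneous_pair[OF h(1) X dn(1) dist(1)], rule same)
        (use ev c0 mem in \<open>auto simp: doubleton_in_star doubleton_eq_iff\<close>)
    thus ?thesis using frag by blast
  qed
qed

text \<open>A fragment minimal among all fragments is minimal among those of its own kind, as the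
  generation lemmas require.\<close>

lemma minimal_fragment_generated:
  assumes X: "proper_fragment T X" and min: "\<And>Y. proper_fragment T Y \<Longrightarrow> \<not> Y \<subset> X"
    and tree: "\<And>c. c \<le> 1 \<Longrightarrow> cn c \<noteq> 0 \<Longrightarrow> spanning n (m c) (\<lambda>v. tp (c * n + v))"
    "\<And>c. c \<le> 1 \<Longrightarrow> cn c = 0 \<Longrightarrow> split_set n (m c)"
  shows "\<exists>k < 5 * (n * (n * n)). seed_ok cn (decode n tp k) \<and> seed_set (decode n tp k) = X"
proof -
  have join: ?thesis if X': "X = A1 \<union> B1 \<union> C1" and J: "proper_two_join (Tc c) A1 B1 C1 A2 B2 C2" and c: "c \<le> 1" for c A1 B1 C1 A2 B2 C2
  proof -
    have "\<forall>A B C A' B' C'. proper_two_join (Tc c) A B C A' B' C' \<longrightarrow> \<not> A \<union> B \<union> C \<subset> A1 \<union> B1 \<union> C1"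
    proof (intro allI impI)
      fix A B C A' B' C' assume p: "proper_two_join (Tc c) A B C A' B' C'"
      have "A \<union> B \<union> C \<subseteq> verts T" using prejoinD(1)[OF proper_two_join_prejoin(1)[OF p]] V unfolding Tc(1) by blast
      moreover have "proper_two_join T A B C A' B' C' \<or> proper_two_join (co T) A B C A' B' C'"
        using p unfolding Tc_def by (cases "c = 0") simp_all
      ultimately have "proper_fragment T (A \<union> B \<union> C)" unfolding proper_fragment_def by blast
      thus "\<not> A \<union> B \<union> C \<subset> A1 \<union> B1 \<union> C1" using min X' by blast
    qed
    from complete_join[OF J c this tree(1)[OF c] tree(2)[OF c]] show ?thesis unfolding X' .
  qed
  have T01: "Tc 0 = T" "Tc 1 = co T" by (simp_all add: Tc_def)
  have pair: ?thesis if X': "X = A \<union> B" and H: "proper_homogeneous_pair T A B" for A B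
  proof -
    have "\<not> A' \<union> B' \<subset> A \<union> B" if "proper_homogeneous_pair T A' B'" for A' B'
    proof -
      have "A' \<union> B' \<subseteq> verts T" using closed_pairD(1,2)[OF proper_homogeneous_pair_closed_pair(1)[OF that]] by blast
      hence "proper_fragment T (A' \<union> B')" unfolding proper_fragment_def using that by blast
      thus ?thesis using min X' by blast
    qed
    from complete_pair[OF H this] show ?thesis unfolding X' .
  qed
  have "(\<exists>A1 B1 C1 A2 B2 C2. X = A1 \<union> B1 \<union> C1 \<and> (proper_two_join (Tc 0) A1 B1 C1 A2 B2 C2 \<or> proper_two_join (Tc 1) A1 B1 C1 A2 B2 C2)) \<or>
      (\<exists>A B. X = A \<union> B \<and> proper_homogeneous_pair T A B)"
    using X unfolding proper_fragment_def T01 by (rule conjunct2)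
  thus ?thesis
  proof (elim disjE exE conjE)
    fix A1 B1 C1 A2 B2 C2 assume "X = A1 \<union> B1 \<union> C1" "proper_two_join (Tc 0) A1 B1 C1 A2 B2 C2"
    thus ?thesis by (rule join) simp
  next
    fix A1 B1 C1 A2 B2 C2 assume "X = A1 \<union> B1 \<union> C1" "proper_two_join (Tc 1) A1 B1 C1 A2 B2 C2"
    thus ?thesis by (rule join) simp
  qed (rule pair)
qed

text \<open>The given end guarantees that fragments exist. A fragment X of minimum size is
  inclusion-minimal and hence an accepted candidate. The output is an accepted candidate no larger
  than X, so it is a fragment of minimum size and therefore an end.\<close>

lemma rest_correct:
  assumes s: "inp s" "s ''N3'' 0 = 5 * (n * (n * n))" "s ''best'' 0 = n + 1" "\<And>i. s ''w'' i = 0"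
    and e: "is_end T X0"
  defines "s' \<equiv> run ((n + 2) ^ 8) rest_prog s"
  shows "is_end T (output_set n s') \<and> block T (output_set n s') (output_trigraph n s')"
proof -
  let ?N = "5 * (n * (n * n))"
  have fin: "finite (verts T)" by (rule class_FD(3)[OF TF])
  have ne: "X \<noteq> {}" if "proper_fragment T X" for X
    using that unfolding proper_fragment_def proper_two_join_def two_join_def two_join_side_def proper_homogeneous_pair_def Let_def by auto
  have f0: "proper_fragment T X0" using e by (simp add: is_end_def)
  have "X0 \<noteq> {}" "X0 \<subseteq> {..<n}" using ne[OF f0] f0 V unfolding proper_fragment_def by blast+
  hence n: "0 < n" by auto
  obtain X where X: "proper_fragment T X" "\<And>Y. proper_fragment T Y \<Longrightarrow> card X \<le> card Y"
    using exists_least_iff[of "\<lambda>k. \<exists>X. proper_fragment T X \<and> card X = k"] f0 by (metis not_le)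
  have min: "\<not> Y \<subset> Z" if "proper_fragment T Y" "proper_fragment T Z" "card Z \<le> card X" for Y Z
  proof
    assume "Y \<subset> Z"
    moreover have "finite Z" using that(2) fin finite_subset unfolding proper_fragment_def by blast
    ultimately have "card Y < card Z" by (rule psubset_card_mono[rotated])
    thus False using X(2)[OF that(1)] that(3) by linarith
  qed
  obtain tp cn where tree: "\<And>c. c \<le> 1 \<Longrightarrow> cn c \<noteq> 0 \<Longrightarrow> spanning n (m c) (\<lambda>v. tp (c * n + v))"
    "\<And>c. c \<le> 1 \<Longrightarrow> cn c = 0 \<Longrightarrow> split_set n (m c)"
    and out: "(\<forall>k<?N. \<not> seed_ok cn (decode n tp k)) \<or>
     (\<exists>k<?N. seed_ok cn (decode n tp k) \<and> (\<exists>ev. output_ok s' (decode n tp k) ev) \<and>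
       (\<forall>k'<?N. seed_ok cn (decode n tp k') \<longrightarrow> card (seed_set (decode n tp k)) \<le> card (seed_set (decode n tp k'))))"
  proof -
    show thesis by (rule main_run[OF s n, folded s'_def]) (rule that)
  qed
  obtain k0 where k0: "k0 < ?N" "seed_ok cn (decode n tp k0)" "seed_set (decode n tp k0) = X"
    using minimal_fragment_generated[where cn = cn and tp = tp, OF X(1) min[OF _ X(1) order_refl] tree] by blast
  then obtain k ev where k: "k < ?N" "seed_ok cn (decode n tp k)" "output_ok s' (decode n tp k) ev"
    "\<forall>k'<?N. seed_ok cn (decode n tp k') \<longrightarrow> card (seed_set (decode n tp k)) \<le> card (seed_set (decode n tp k'))"
    using out by blast
  let ?S = "seed_set (decode n tp k)"
  have c: "card ?S \<le> card X" using k(4) k0 by blast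
  have ob: "proper_fragment T ?S \<and> block T ?S (output_trigraph n s')"
    by (rule output_block[OF refl n k(2,3) tree(1)])
  have "\<forall>i<n. s' ''X'' i \<noteq> 0 \<longleftrightarrow> i \<in> ?S" using k(3) unfolding output_ok_def by blast
  moreover have "?S \<subseteq> {..<n}" by (rule seed_set_subset[OF n])
  ultimately have os: "output_set n s' = ?S" unfolding output_set_def by blast
  have "is_end T ?S" unfolding is_end_def using ob min[OF _ conjunct1[OF ob] c] by blast
  thus ?thesis unfolding os using ob by blast
qed

end

section \<open>Running time and the final assembly\<close>

definition loop_bounds :: "nat \<Rightarrow> string \<Rightarrow> nat" where
  "loop_bounds n x = (if x = ''N3'' then 5 * (n * (n * n)) else n)"

lemma time_bigo:
  "(\<lambda>n. real (time_bound (loop_bounds n) init_prog + time_bound (loop_bounds n) rest_prog + 1)) \<in> O(\<lambda>n. real n ^ 5)"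
proof (rule bigoI[where c = 20000])
  have "real (time_bound (loop_bounds n) init_prog + time_bound (loop_bounds n) rest_prog + 1) \<le> 20000 * real n ^ 5"
    if "n \<ge> 1" for n
  proof -
    define x where "x = real n"
    have x: "x \<ge> 1" using that by (simp add: x_def)
    have p: "x ^ i \<le> x ^ 5" if "i \<le> 5" for i using power_increasing[OF that x] .
    note pw = p[of 0, simplified] p[of 1, simplified] p[of 2, simplified] p[of 3, simplified] p[of 4, simplified]
    \<comment> \<open>The summand with the factor \<open>5 * (x * (x * x))\<close> is the search.
      The worklist inside it contributes \<open>786 * x\<close> per round and x rounds per seed,
      which makes the leading coefficient 3930.\<close>
    have "real (time_bound (loop_bounds n) init_prog + time_bound (loop_bounds n) rest_prog + 1) =
      real (time_bound (loop_bounds n) init_prog) + (306 + (149 * x + (2 * (x * (131 + 786 * x)) + (5 * (x * (x * x)) *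
        (511 + (677 * x + x * (131 + 786 * x))) + (x * (23 + x * (23 + x * 104)) + (x * (23 + x * 72) + x * (174 + x * 33))))))) + 1"
      by (simp add: loop_bounds_def rest_prog_def tree_prog_def tree_init_def tree_store_def prog_defs1 prog_defs2 prog_defs3
        prog_defs4 prog_defs5 cell_exp_def ECo_def ETh_def fires_exp_def part_exp_def accept_exp_def ENot_def EAnd_def EOr_def
        EEq_def EMod_def Let_def x_def)
    also have "\<dots> = real (time_bound (loop_bounds n) init_prog) + 307 + 631 * x + 1700 * x ^ 2 + 2659 * x ^ 3 + 4040 * x ^ 4 + 3930 * x ^ 5"
      by (simp add: algebra_simps power_numeral_reduce)
    \<comment> \<open>For x at least 1 each power is at most \<open>x ^ 5\<close>, and the
      coefficients together with 100 for the initial program add up to 13367.\<close>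
    also have "\<dots> \<le> 20000 * x ^ 5"
    proof -
      have "real (time_bound (loop_bounds n) init_prog) \<le> 100" by (simp add: init_prog_def)
      thus ?thesis using pw by linarith
    qed
    finally show ?thesis unfolding x_def .
  qed
  thus "\<forall>\<^sub>F n in sequentially. norm (real (time_bound (loop_bounds n) init_prog + time_bound (loop_bounds n) rest_prog + 1))
      \<le> 20000 * norm (real n ^ 5)"
    by (intro eventually_sequentiallyI[of 1]) simp
qed

theorem theorem10p3:
  shows "\<exists>(P :: com) (k :: nat) (time :: nat \<Rightarrow> nat).
    (\<lambda>n. real (time n)) \<in> O(\<lambda>n. real n ^ 5) \<and>
    (\<forall>(n :: nat) (T :: nat trigraph).
       verts T = {..<n} \<and> T \<in> class_F \<and> \<not> (\<exists>A B. balanced_skew_partition T A B) \<longrightarrow>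
       (\<exists>t s. exec ((n + 2) ^ k) P (input_state n T) t s \<and> t \<le> time n \<and>
          ((\<exists>X. is_end T X) \<longrightarrow>
             is_end T (output_set n s) \<and> block T (output_set n s) (output_trigraph n s))))"
proof (rule exI[of _ "Seq (compile init_prog) (compile rest_prog)"], rule exI[of _ 8],
    rule exI[of _ "\<lambda>n. time_bound (loop_bounds n) init_prog + time_bound (loop_bounds n) rest_prog + 1"],
    intro conjI allI impI, rule time_bigo)
  fix n :: nat and T :: "nat trigraph"
  assume h: "verts T = {..<n} \<and> T \<in> class_F \<and> \<not> (\<exists>A B. balanced_skew_partition T A B)"
  let ?W = "(n + 2) ^ 8" and ?f = "loop_bounds n"
  interpret tri_ram n T by unfold_locales (use h in blast)+
  define s0 s1 where s: "s0 = input_state n T" "s1 = upd ''best'' 0 (n + 1) (upd ''N3'' 0 (5 * (n * (n * n))) s0)"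
  have th: "s0 ''theta'' k = (if k < n * n then tri_matrix n T (k div n) (k mod n) else 0)" for k
  proof -
    have "k div n < n \<and> k mod n < n" if "k < n * n" using that by (cases "n = 0") (auto simp: less_mult_imp_div_less)
    thus ?thesis unfolding s input_state_def tri_matrix_def by auto
  qed
  have s0: "s0 ''n'' 0 = n" "\<And>i. s0 ''w'' i = 0" unfolding s input_state_def by simp_all
  have w0: "word ?W s0"
    unfolding word_def
  proof (intro allI)
    fix x i
    show "s0 x i < ?W"
    proof (cases "x = ''theta''")
      case True
      thus ?thesis using th[of i] matrix_le[of "i div n" "i mod n"] W_small(1,3) by (auto intro: le_less_trans)
    next
      case False
      hence "s0 x i = (if x = ''n'' \<and> i = 0 then n else 0)" unfolding s input_state_def by simp
      thus ?thesis using n_less(1) W_small(3) by simp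
    qed
  qed
  have "s0 ''theta'' (i * n + j) = tri_matrix n T i j" if "i < n" "j < n" for i j
  proof -
    have "i * n + j < Suc i * n" using that by simp
    also have "\<dots> \<le> n * n" using that by (intro mult_right_mono) auto
    finally show ?thesis using th[of "i * n + j"] that by simp
  qed
  hence in0: "inp s0" unfolding inp_def using w0 s0 by blast
  have r0: "run ?W init_prog s0 = s1" unfolding s(2) by (rule init_run[OF refl w0 s0(1) W_ge(3)])
  have W1: "1 < ?W" using W_small(2) by simp
  have e0: "word ?W s1 \<and> (\<exists>t \<le> time_bound ?f init_prog. exec ?W (compile init_prog) s0 t s1)"
    using exec_compile[OF w0 _ W1, of init_prog ?f] unfolding r0 by (simp add: init_prog_def)
  have in1: "inp s1" by (rule inp_frame[OF in0]) (use e0 in \<open>simp_all add: s(2)\<close>)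
  have v1: "s1 ''N3'' 0 = 5 * (n * (n * n))" "s1 ''best'' 0 = n + 1" "\<And>i. s1 ''w'' i = 0" "s1 ''n'' 0 = n"
    using s0 by (simp_all add: s(2))
  have wf: "wf_prog rest_prog" "bounds rest_prog \<inter> writes rest_prog = {}" "bounds rest_prog \<subseteq> {''n'', ''N3''}"
    by (auto simp: rest_prog_def tree_prog_def tree_init_def tree_store_def prog_defs3 prog_defs4 prog_defs5)
  have "s1 b 0 \<le> ?f b" if "b \<in> bounds rest_prog" for b
    using that wf(3) v1 by (auto simp: loop_bounds_def)
  from exec_compile[where s = s1 and f = ?f, OF _ wf(1) W1 wf(2) this] e0
  obtain t where t: "t \<le> time_bound ?f rest_prog" "exec ?W (compile rest_prog) s1 t (run ?W rest_prog s1)" by blast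
  obtain t0 where t0: "t0 \<le> time_bound ?f init_prog" "exec ?W (compile init_prog) s0 t0 s1" using e0 by blast
  show "\<exists>t s. exec ?W (Seq (compile init_prog) (compile rest_prog)) (input_state n T) t s \<and>
      t \<le> time_bound ?f init_prog + time_bound ?f rest_prog + 1 \<and>
      ((\<exists>X. is_end T X) \<longrightarrow> is_end T (output_set n s) \<and> block T (output_set n s) (output_trigraph n s))"
  proof (intro exI conjI impI)
    show "exec ?W (Seq (compile init_prog) (compile rest_prog)) (input_state n T) (t0 + t + 1) (run ?W rest_prog s1)"
      using exec.Seq[OF t0(2) t(2)] unfolding s .
    show "t0 + t + 1 \<le> time_bound ?f init_prog + time_bound ?f rest_prog + 1" using t t0 by simp
    assume "\<exists>X. is_end T X"
    then obtain X where "is_end T X" by blast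
    note rc = rest_correct[OF in1 v1(1-3) this]
    show "is_end T (output_set n (run ?W rest_prog s1))"
      "block T (output_set n (run ?W rest_prog s1)) (output_trigraph n (run ?W rest_prog s1))" using rc by blast+
  qed
qed

end
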